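(* Let $\mathfrak g$ be a complex simple Lie algebra, and let $R=\left(S^\bullet(\Lambda^n_0\mathfrak g_{-1})^*/I\right)^{G_0^{\mathrm{ss}}}$ be the graded ring of $G_0^{\mathrm{ss}}$-invariants in the homogeneous coordinate ring of the Plücker-embedded Lagrangian Grassmannian $\mathrm{LGr}(\mathfrak g_{-1})\subset\mathbb P\Lambda^n_0\mathfrak g_{-1}$. (1) If $\mathfrak g$ is of type $\mathsf A$ (i.e. $\mathfrak g=\mathfrak{sl}_{n+2}$, $n\ge 1$), the ring $R$ is generated by a pair of elements of degree $1$ with distinct $T$-weights. (2) If $\mathfrak g$ is of type $\mathsf G_2$, the ring $R$ is generated by a single element of degree $3$.
   Context: Let $G$ be the identity component of $\mathrm{Aut}\,\mathfrak g$ and $X\subset\mathbb P\mathfrak g$ its unique closed orbit. Fix $o\in X$ with stabiliser $P\subset G$ (a parabolic subgroup), and a Levi decomposition $P=G_0\ltimes P_+$ with $P_+$ the unipotent radical and $G_0$ connected reductive. Choosing a Cartan subalgebra in $\mathrm{Lie}(G_0)$ and positive roots such that $o$ is the root line of the highest root $\gamma$, the contact grading $\mathfrak g=\bigoplus_{i=-2}^2\mathfrak g_i$ is the eigenspace decomposition of $\mathrm{ad}$ of the coroot $\gamma^\vee$, with $\mathfrak g_0=\mathrm{Lie}(G_0)$. One has $\dim\mathfrak g_{-2}=1$, $\dim\mathfrak g_{-1}=2n$, and the bracket $\omega:\Lambda^2\mathfrak g_{-1}\to\mathfrak g_{-2}$ is a non-degenerate $\mathfrak g_{-2}$-valued symplectic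 form. $G_0$ acts on $\mathfrak g_{-1}$ preserving $\omega$ up to scale. $\mathrm{LGr}(\mathfrak g_{-1})$ is the variety of Lagrangian subspaces of $\mathfrak g_{-1}$; $\Lambda^n_0\mathfrak g_{-1}$ is the kernel of the contraction $\Lambda^n\mathfrak g_{-1}\to\Lambda^{n-2}\mathfrak g_{-1}\otimes\mathfrak g_{-2}$ with $\omega$ (zero map if $n=1$); the Plücker embedding is $L\mapsto\Lambda^nL$; and $I\subset S^\bullet(\Lambda^n_0\mathfrak g_{-1})^*$ is the homogeneous ideal of its image. $G_0^{\mathrm{ss}}=[G_0,G_0]$ is the semisimple part of $G_0$ and $T=G_0/G_0^{\mathrm{ss}}$ is a torus, which acts on $R$; "$T$-weight" refers to this action. Degree refers to the standard grading inherited from the symmetric algebra, and "generated" means generated as a $\mathbb C$-algebra. *)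

theory Defs
  imports
    "HOL-Analysis.Analysis"
    "HOL-Library.Function_Algebras"
    "HOL-Algebra.Generated_Groups"
    "HOL-Algebra.Generated_Rings"
    "HOL-Algebra.QuotRing"
begin

section \<open>Lie algebras\<close>

text \<open>
  A finite-dimensional complex Lie algebra is given by a bracket on \<open>complex^'d\<close>. Linear algebra
  over the complex numbers uses the library's interpretation \<open>vec\<close> (scalar action \<open>*s\<close>).
\<close>

definition lie_algebra :: "(complex^'d \<Rightarrow> complex^'d \<Rightarrow> complex^'d) \<Rightarrow> bool" where
  "lie_algebra br \<longleftrightarrow>
     (\<forall>x. Vector_Spaces.linear (*s) (*s) (br x)) \<and>
     (\<forall>y. Vector_Spaces.linear (*s) (*s) (\<lambda>x. br x y)) \<and>
     (\<forall>x. br x x = 0) \<and>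
     (\<forall>x y z. br x (br y z) + br y (br z x) + br z (br x y) = 0)"

definition lie_ideal :: "(complex^'d \<Rightarrow> complex^'d \<Rightarrow> complex^'d) \<Rightarrow> (complex^'d) set \<Rightarrow> bool" where
  "lie_ideal br J \<longleftrightarrow> vec.subspace J \<and> (\<forall>x. \<forall>y\<in>J. br x y \<in> J)"

definition simple_lie_algebra :: "(complex^'d \<Rightarrow> complex^'d \<Rightarrow> complex^'d) \<Rightarrow> bool" where
  "simple_lie_algebra br \<longleftrightarrow>
     lie_algebra br \<and> (\<exists>x y. br x y \<noteq> 0) \<and> (\<forall>J. lie_ideal br J \<longrightarrow> J = {0} \<or> J = UNIV)"

definition mscale :: "complex \<Rightarrow> complex^'n^'m \<Rightarrow> complex^'n^'m" where
  "mscale c A = (\<chi> i. c *s A $ i)"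

definition lie_iso_sl ::
    "(complex^'d \<Rightarrow> complex^'d \<Rightarrow> complex^'d) \<Rightarrow> (complex^'d \<Rightarrow> complex^'m^'m) \<Rightarrow> bool" where
  "lie_iso_sl br \<phi> \<longleftrightarrow>
     (\<forall>x y. \<phi> (x + y) = \<phi> x + \<phi> y) \<and>
     (\<forall>c x. \<phi> (c *s x) = mscale c (\<phi> x)) \<and>
     bij_betw \<phi> UNIV {A. trace A = 0} \<and>
     (\<forall>x y. \<phi> (br x y) = \<phi> x ** \<phi> y - \<phi> y ** \<phi> x)"

subsection \<open>Roots\<close>

text \<open>
  A linear form on a subspace \<open>W\<close> is an extensional function (\<open>undefined\<close> outside \<open>W\<close>); \<open>s\<close> is the
  scalar action on the ambient space.
\<close>

definition linear_forms :: "(complex \<Rightarrow> 'v \<Rightarrow> 'v) \<Rightarrow> 'v set \<Rightarrow> ('v::ab_group_add \<Rightarrow> complex) set" where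
  "linear_forms s W = {f \<in> extensional W.
     (\<forall>x\<in>W. \<forall>y\<in>W. f (x + y) = f x + f y) \<and> (\<forall>c. \<forall>x\<in>W. f (s c x) = c * f x)}"

text \<open>
  Cartan subalgebras of a semisimple complex Lie algebra: self-centralizing commutative subalgebras
  all of whose elements are \<open>ad\<close>-diagonalizable.
\<close>

definition cartan_subalgebra ::
    "(complex^'d \<Rightarrow> complex^'d \<Rightarrow> complex^'d) \<Rightarrow> (complex^'d) set \<Rightarrow> bool" where
  "cartan_subalgebra br H \<longleftrightarrow>
     vec.subspace H \<and>
     (\<forall>h\<in>H. \<forall>k\<in>H. br h k = 0) \<and>
     (\<forall>x. (\<forall>h\<in>H. br h x = 0) \<longrightarrow> x \<in> H) \<and>
     (\<forall>h\<in>H. vec.span {x. \<exists>c. br h x = c *s x} = UNIV)"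

definition root_space ::
    "(complex^'d \<Rightarrow> complex^'d \<Rightarrow> complex^'d) \<Rightarrow> (complex^'d) set \<Rightarrow>
     (complex^'d \<Rightarrow> complex) \<Rightarrow> (complex^'d) set" where
  "root_space br H \<alpha> = {x. \<forall>h\<in>H. br h x = \<alpha> h *s x}"

definition roots ::
    "(complex^'d \<Rightarrow> complex^'d \<Rightarrow> complex^'d) \<Rightarrow> (complex^'d) set \<Rightarrow> (complex^'d \<Rightarrow> complex) set" where
  "roots br H =
     {\<alpha> \<in> linear_forms (*s) H. (\<exists>h\<in>H. \<alpha> h \<noteq> 0) \<and> root_space br H \<alpha> \<noteq> {0}}"

text \<open>
  The choice of a base is the choice of positive roots, namely the roots with nonnegative
  coefficients.
\<close>

definition root_base ::
    "(complex^'d \<Rightarrow> complex^'d \<Rightarrow> complex^'d) \<Rightarrow> (complex^'d) set \<Rightarrow>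
     (complex^'d \<Rightarrow> complex) set \<Rightarrow> bool" where
  "root_base br H \<Delta> \<longleftrightarrow>
     finite \<Delta> \<and> \<Delta> \<subseteq> roots br H \<and>
     (\<forall>c. (\<forall>h\<in>H. (\<Sum>\<beta>\<in>\<Delta>. c \<beta> * \<beta> h) = 0) \<longrightarrow> (\<forall>\<beta>\<in>\<Delta>. c \<beta> = 0)) \<and>
     (\<forall>\<alpha>\<in>roots br H. \<exists>m::(complex^'d \<Rightarrow> complex) \<Rightarrow> nat.
        (\<forall>h\<in>H. \<alpha> h = (\<Sum>\<beta>\<in>\<Delta>. of_nat (m \<beta>) * \<beta> h)) \<or>
        (\<forall>h\<in>H. \<alpha> h = - (\<Sum>\<beta>\<in>\<Delta>. of_nat (m \<beta>) * \<beta> h)))"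

definition highest_root ::
    "(complex^'d \<Rightarrow> complex^'d \<Rightarrow> complex^'d) \<Rightarrow> (complex^'d) set \<Rightarrow>
     (complex^'d \<Rightarrow> complex) set \<Rightarrow> (complex^'d \<Rightarrow> complex) \<Rightarrow> bool" where
  "highest_root br H \<Delta> \<gamma> \<longleftrightarrow>
     \<gamma> \<in> roots br H \<and>
     (\<forall>\<alpha>\<in>roots br H. \<exists>m::(complex^'d \<Rightarrow> complex) \<Rightarrow> nat.
        \<forall>h\<in>H. \<gamma> h - \<alpha> h = (\<Sum>\<beta>\<in>\<Delta>. of_nat (m \<beta>) * \<beta> h))"

definition is_coroot ::
    "(complex^'d \<Rightarrow> complex^'d \<Rightarrow> complex^'d) \<Rightarrow> (complex^'d) set \<Rightarrow>
     (complex^'d \<Rightarrow> complex) \<Rightarrow> complex^'d \<Rightarrow> bool" where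
  "is_coroot br H \<alpha> h \<longleftrightarrow>
     h \<in> H \<and> \<alpha> h = 2 \<and>
     h \<in> vec.span {br x y | x y. x \<in> root_space br H \<alpha> \<and> y \<in> root_space br H (\<lambda>k. - \<alpha> k)}"

definition type_G2 ::
    "(complex^'d \<Rightarrow> complex^'d \<Rightarrow> complex^'d) \<Rightarrow> (complex^'d) set \<Rightarrow>
     (complex^'d \<Rightarrow> complex) set \<Rightarrow> bool" where
  "type_G2 br H \<Delta> \<longleftrightarrow>
     (\<exists>\<alpha> \<beta> h\<^sub>\<alpha> h\<^sub>\<beta>. \<Delta> = {\<alpha>, \<beta>} \<and> \<alpha> \<noteq> \<beta> \<and> is_coroot br H \<alpha> h\<^sub>\<alpha> \<and> is_coroot br H \<beta> h\<^sub>\<beta> \<and>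
        \<alpha> h\<^sub>\<beta> = - 1 \<and> \<beta> h\<^sub>\<alpha> = - 3)"

definition grade ::
    "(complex^'d \<Rightarrow> complex^'d \<Rightarrow> complex^'d) \<Rightarrow> complex^'d \<Rightarrow> int \<Rightarrow> (complex^'d) set" where
  "grade br h i = {x. br h x = of_int i *s x}"

section \<open>Polynomial functions\<close>

text \<open>
  Over the infinite field of complex numbers the symmetric algebra of the dual of \<open>W\<close> is the algebra
  of functions on \<open>W\<close> generated by the linear forms, and its degree \<open>k\<close> part consists of the functions
  homogeneous of degree \<open>k\<close>.
\<close>

inductive_set poly_functions ::
    "(complex \<Rightarrow> 'v \<Rightarrow> 'v) \<Rightarrow> 'v set \<Rightarrow> ('v::ab_group_add \<Rightarrow> complex) set"
  for s and W where
  const: "(\<lambda>w\<in>W. c) \<in> poly_functions s W"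
| form: "f \<in> linear_forms s W \<Longrightarrow> f \<in> poly_functions s W"
| add: "p \<in> poly_functions s W \<Longrightarrow> q \<in> poly_functions s W \<Longrightarrow>
    (\<lambda>w\<in>W. p w + q w) \<in> poly_functions s W"
| mult: "p \<in> poly_functions s W \<Longrightarrow> q \<in> poly_functions s W \<Longrightarrow>
    (\<lambda>w\<in>W. p w * q w) \<in> poly_functions s W"

definition sym_dual ::
    "(complex \<Rightarrow> 'v \<Rightarrow> 'v) \<Rightarrow> 'v set \<Rightarrow> ('v::ab_group_add \<Rightarrow> complex) ring" where
  "sym_dual s W =
     \<lparr>carrier = poly_functions s W,
      mult = (\<lambda>p q. \<lambda>w\<in>W. p w * q w),
      one = (\<lambda>w\<in>W. 1),
      zero = (\<lambda>w\<in>W. 0),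
      add = (\<lambda>p q. \<lambda>w\<in>W. p w + q w)\<rparr>"

definition homogeneous ::
    "(complex \<Rightarrow> 'v \<Rightarrow> 'v) \<Rightarrow> 'v set \<Rightarrow> nat \<Rightarrow> ('v::ab_group_add \<Rightarrow> complex) \<Rightarrow> bool" where
  "homogeneous s W k p \<longleftrightarrow>
     p \<in> poly_functions s W \<and> (\<forall>c. \<forall>w\<in>W. p (s c w) = c ^ k * p w)"

section \<open>Linear algebraic groups\<close>

definition GL :: "(complex^'d^'d) monoid" where
  "GL = \<lparr>carrier = {A. invertible A}, mult = (**), one = mat 1\<rparr>"

definition matpow :: "complex^'d^'d \<Rightarrow> nat \<Rightarrow> complex^'d^'d" where
  "matpow A k = (((**) A) ^^ k) (mat 1)"

definition matexp :: "complex^'d^'d \<Rightarrow> complex^'d^'d" where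
  "matexp A = (\<Sum>k. (1 / fact k) *\<^sub>R matpow A k)"

definition algebraic_group :: "(complex^'d^'d) set \<Rightarrow> bool" where
  "algebraic_group K \<longleftrightarrow>
     subgroup K GL \<and>
     (\<exists>F \<subseteq> poly_functions mscale UNIV. K = {A. invertible A \<and> (\<forall>f\<in>F. f A = 0)})"

definition unipotent :: "(complex^'d^'d) set \<Rightarrow> bool" where
  "unipotent K \<longleftrightarrow> (\<forall>A\<in>K. \<exists>k. matpow (A - mat 1) k = 0)"

text \<open>
  A complex algebraic group is connected in the Zariski topology iff it is connected in the
  classical topology, so \<open>connected\<close> refers to the latter.
\<close>

definition unipotent_radical :: "(complex^'d^'d) set \<Rightarrow> (complex^'d^'d) set \<Rightarrow> bool" where
  "unipotent_radical K U \<longleftrightarrow>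
     (let N = {U'. algebraic_group U' \<and> connected U' \<and> unipotent U' \<and>
                   U' \<lhd> (GL\<lparr>carrier := K\<rparr>)}
      in U \<in> N \<and> (\<forall>U'\<in>N. U' \<subseteq> U))"

definition reductive :: "(complex^'d^'d) set \<Rightarrow> bool" where
  "reductive K \<longleftrightarrow> algebraic_group K \<and> unipotent_radical K {mat 1}"

definition levi_decomposition ::
    "(complex^'d^'d) set \<Rightarrow> (complex^'d^'d) set \<Rightarrow> (complex^'d^'d) set \<Rightarrow> bool" where
  "levi_decomposition P G\<^sub>0 Pp \<longleftrightarrow>
     unipotent_radical P Pp \<and> reductive G\<^sub>0 \<and> connected G\<^sub>0 \<and>
     P = G\<^sub>0 <#>\<^bsub>GL\<^esub> Pp \<and> G\<^sub>0 \<inter> Pp = {mat 1}"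

definition lie_algebra_of :: "(complex^'d^'d) set \<Rightarrow> (complex^'d^'d) set" where
  "lie_algebra_of K = {X. \<forall>t::real. matexp (t *\<^sub>R X) \<in> K}"

definition lie_aut :: "(complex^'d \<Rightarrow> complex^'d \<Rightarrow> complex^'d) \<Rightarrow> (complex^'d^'d) set" where
  "lie_aut br = {A. invertible A \<and> (\<forall>x y. A *v br x y = br (A *v x) (A *v y))}"

definition lie_aut0 :: "(complex^'d \<Rightarrow> complex^'d \<Rightarrow> complex^'d) \<Rightarrow> (complex^'d^'d) set" where
  "lie_aut0 br = connected_component_set (lie_aut br) (mat 1)"

text \<open>
  Points of the projective space are lines. A subset of the projective space is closed iff the union
  of its lines, its affine cone, is closed.
\<close>

definition closed_orbit :: "(complex^'d^'d) set \<Rightarrow> (complex^'d) set set \<Rightarrow> bool" where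
  "closed_orbit K X \<longleftrightarrow>
     (\<exists>l. vec.subspace l \<and> vec.dim l = 1 \<and> X = (\<lambda>A. (*v) A ` l) ` K) \<and> closed (\<Union>X)"

definition line_stabilizer :: "(complex^'d^'d) set \<Rightarrow> (complex^'d) set \<Rightarrow> (complex^'d^'d) set" where
  "line_stabilizer K l = {A \<in> K. (*v) A ` l = l}"

section \<open>Exterior powers\<close>

text \<open>
  The \<open>n\<close>-th exterior power of a subspace of \<open>complex^'d\<close> is realized by alternating tensors. A tensor of
  rank \<open>n\<close> is a function of index lists that vanishes on lists of length other than \<open>n\<close>.
\<close>

type_synonym 'd tensor = "'d list \<Rightarrow> complex"

definition tscale :: "complex \<Rightarrow> 'd tensor \<Rightarrow> 'd tensor" where
  "tscale c t = (\<lambda>is. c * t is)"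

interpretation tensor: vector_space tscale
  by unfold_locales (auto simp: tscale_def fun_eq_iff algebra_simps)

definition wedge :: "(complex^'d) list \<Rightarrow> 'd tensor" where
  "wedge vs = (\<lambda>is. if length is = length vs
     then \<Sum>\<sigma> | \<sigma> permutes {..<length vs}.
            of_int (sign \<sigma>) * (\<Prod>k<length vs. (vs ! k) $ (is ! \<sigma> k))
     else 0)"

definition ext_power :: "nat \<Rightarrow> (complex^'d) set \<Rightarrow> ('d tensor) set" where
  "ext_power n V = tensor.span {wedge vs | vs. length vs = n \<and> set vs \<subseteq> V}"

text \<open>
  Contraction of the first two slots with the bracket. On \<open>wedge [v\<^sub>1, \<dots>, v\<^sub>n]\<close> with all \<open>v\<^sub>i\<close> in a
  subspace \<open>V\<close> it involves only the brackets of elements of \<open>V\<close>: it is twice the sum over \<open>i < j\<close> of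
  \<open>(-1)^(i+j+1) br v\<^sub>i v\<^sub>j\<close> times the wedge of the other vectors. On tensors of rank 1 it is zero.
\<close>

definition contraction ::
    "(complex^'d \<Rightarrow> complex^'d \<Rightarrow> complex^'d) \<Rightarrow> 'd tensor \<Rightarrow> 'd list \<Rightarrow> complex^'d" where
  "contraction br t =
     (\<lambda>is. \<Sum>i\<in>UNIV. \<Sum>j\<in>UNIV. t (i # j # is) *s br (axis i 1) (axis j 1))"

definition ext_power0 ::
    "(complex^'d \<Rightarrow> complex^'d \<Rightarrow> complex^'d) \<Rightarrow> nat \<Rightarrow> (complex^'d) set \<Rightarrow> ('d tensor) set" where
  "ext_power0 br n V = {t \<in> ext_power n V. contraction br t = (\<lambda>is. 0)}"

definition tensor_act :: "complex^'d^'d \<Rightarrow> 'd tensor \<Rightarrow> 'd tensor" where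
  "tensor_act A t = (\<lambda>is. \<Sum>js | length js = length is.
     (\<Prod>k<length is. A $ (is ! k) $ (js ! k)) * t js)"

section \<open>The coordinate ring of the Lagrangian Grassmannian and its invariants\<close>

text \<open>
  In this section \<open>V\<close> is a symplectic space whose form is the restriction of the bracket \<open>br\<close>; it will
  be the degree \<open>-1\<close> part of the contact grading. \<open>K\<close> is a group of matrices which preserve \<open>V\<close>, and
  the bracket on \<open>V\<close> up to scale.
\<close>

definition half_dim :: "(complex^'d) set \<Rightarrow> nat" where
  "half_dim V = vec.dim V div 2"

definition LGr ::
    "(complex^'d \<Rightarrow> complex^'d \<Rightarrow> complex^'d) \<Rightarrow> (complex^'d) set \<Rightarrow> (complex^'d) set set" where
  "LGr br V = {L. vec.subspace L \<and> L \<subseteq> V \<and> vec.dim L = half_dim V \<and> (\<forall>x\<in>L. \<forall>y\<in>L. br x y = 0)}"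

definition pluecker_space ::
    "(complex^'d \<Rightarrow> complex^'d \<Rightarrow> complex^'d) \<Rightarrow> (complex^'d) set \<Rightarrow> ('d tensor) set" where
  "pluecker_space br V = ext_power0 br (half_dim V) V"

definition pluecker_sym ::
    "(complex^'d \<Rightarrow> complex^'d \<Rightarrow> complex^'d) \<Rightarrow> (complex^'d) set \<Rightarrow> ('d tensor \<Rightarrow> complex) ring" where
  "pluecker_sym br V = sym_dual tscale (pluecker_space br V)"

definition pluecker_ideal ::
    "(complex^'d \<Rightarrow> complex^'d \<Rightarrow> complex^'d) \<Rightarrow> (complex^'d) set \<Rightarrow> ('d tensor \<Rightarrow> complex) set" where
  "pluecker_ideal br V =
     {p \<in> carrier (pluecker_sym br V). \<forall>L\<in>LGr br V. \<forall>w\<in>ext_power (half_dim V) L. p w = 0}"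

definition coord_ring ::
    "(complex^'d \<Rightarrow> complex^'d \<Rightarrow> complex^'d) \<Rightarrow> (complex^'d) set \<Rightarrow>
     (('d tensor \<Rightarrow> complex) set) ring" where
  "coord_ring br V = pluecker_sym br V Quot pluecker_ideal br V"

definition coord_act ::
    "(complex^'d \<Rightarrow> complex^'d \<Rightarrow> complex^'d) \<Rightarrow> (complex^'d) set \<Rightarrow> complex^'d^'d \<Rightarrow>
     ('d tensor \<Rightarrow> complex) set \<Rightarrow> ('d tensor \<Rightarrow> complex) set" where
  "coord_act br V A c =
     (\<lambda>p. \<lambda>w\<in>pluecker_space br V. p (tensor_act (matrix_inv A) w)) ` c"

definition invariant_ring ::
    "(complex^'d \<Rightarrow> complex^'d \<Rightarrow> complex^'d) \<Rightarrow> (complex^'d) set \<Rightarrow> (complex^'d^'d) set \<Rightarrow>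
     (('d tensor \<Rightarrow> complex) set) ring" where
  "invariant_ring br V K =
     (coord_ring br V)\<lparr>carrier :=
        {c \<in> carrier (coord_ring br V). \<forall>A\<in>derived GL K. coord_act br V A c = c}\<rparr>"

definition coord_const ::
    "(complex^'d \<Rightarrow> complex^'d \<Rightarrow> complex^'d) \<Rightarrow> (complex^'d) set \<Rightarrow> complex \<Rightarrow>
     ('d tensor \<Rightarrow> complex) set" where
  "coord_const br V a =
     pluecker_ideal br V +>\<^bsub>pluecker_sym br V\<^esub> (\<lambda>w\<in>pluecker_space br V. a)"

definition generates_invariants ::
    "(complex^'d \<Rightarrow> complex^'d \<Rightarrow> complex^'d) \<Rightarrow> (complex^'d) set \<Rightarrow> (complex^'d^'d) set \<Rightarrow>
     ('d tensor \<Rightarrow> complex) set set \<Rightarrow> bool" where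
  "generates_invariants br V K F \<longleftrightarrow>
     generate_ring (invariant_ring br V K) (range (coord_const br V) \<union> F) =
     carrier (invariant_ring br V K)"

text \<open>An element of degree \<open>k\<close> is required to be nonzero, so that its degree is well defined.\<close>

definition invariant_of_degree ::
    "(complex^'d \<Rightarrow> complex^'d \<Rightarrow> complex^'d) \<Rightarrow> (complex^'d) set \<Rightarrow> (complex^'d^'d) set \<Rightarrow>
     nat \<Rightarrow> ('d tensor \<Rightarrow> complex) set \<Rightarrow> bool" where
  "invariant_of_degree br V K k f \<longleftrightarrow>
     f \<in> carrier (invariant_ring br V K) \<and> f \<noteq> \<zero>\<^bsub>invariant_ring br V K\<^esub> \<and>
     (\<exists>p\<in>f. homogeneous tscale (pluecker_space br V) k p)"

definition torus_quotient :: "(complex^'d^'d) set \<Rightarrow> (complex^'d^'d) set monoid" where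
  "torus_quotient K = (GL\<lparr>carrier := K\<rparr>) Mod (derived GL K)"

definition has_weight ::
    "(complex^'d \<Rightarrow> complex^'d \<Rightarrow> complex^'d) \<Rightarrow> (complex^'d) set \<Rightarrow> (complex^'d^'d) set \<Rightarrow>
     ('d tensor \<Rightarrow> complex) set \<Rightarrow> ((complex^'d^'d) set \<Rightarrow> complex) \<Rightarrow> bool" where
  "has_weight br V K f \<theta> \<longleftrightarrow>
     (\<forall>t\<in>carrier (torus_quotient K). \<forall>A\<in>t.
        coord_act br V A f = coord_const br V (\<theta> t) \<otimes>\<^bsub>invariant_ring br V K\<^esub> f)"

end

(*
  The subgroup G0 is computed first: an element of the Levi subgroup preserves the filtration defined by the highest
  root line, those acting trivially on its graded pieces form a normal unipotent subgroup, which is trivial, and so G0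
  is the fixed group of the coroot in the stabiliser of the line. A polynomial function on the Pluecker space is
  then determined up to the ideal by its values on the wedge products of Lagrangian subspaces, and a semi-invariant
  of G0 is invariant under the commutator subgroup.

  Type A: the degree -1 part is M + M* for a vector space M of dimension n, and the commutator subgroup contains the
  transvections of M. They bring every Lagrangian subspace to a span of vectors a_i e_i + b_i f_i, for dual bases e
  and f, and by the torus an invariant depends on the products of the a_i and of the b_i only. These products are the
  Pluecker coordinates belonging to M and M*.

  Type G2: the degree -1 part is the space of binary cubics, the Pluecker space is the space of binary quartics and
  the Lagrangian Grassmannian is the quadric I = 0, where I is the quadratic invariant. Moving a root to infinity
  brings a quartic with I = 0 to the form a x^4 + d x y^3, and there the catalecticant J is a multiple of a d^2.
*)
theory Submission
 imports Defs "HOL-Computational_Algebra.Fundamental_Theorem_Algebra"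
begin

section \<open>Linear algebra\<close>

text \<open>No structure theory of semisimple Lie algebras is presupposed. It grows out of one fact:
  the highest root space is a line, being a point of the orbit. With the coroot this yields an
  sl2-triple, hence integral eigenvalues, hence a nonzero value of the Killing form, which is then
  nondegenerate by simplicity. The Levi subgroup is known only abstractly, so both inclusions need
  an argument. Its elements commute with the exponential of the coroot, since the commutator acts
  trivially on the graded space. Conversely, a unipotent u in \<open>Pp\<close> that fixes the
  coroot has to be trivial. The span of all u - 1 is closed under products and traceless;
  derivatives of conjugations stay in this closed space; and an inner derivation in it vanishes, for
  otherwise a nonzero element of H would appear all of whose powers are traceless. Torus arguments
  divide by coordinates, so they hold on open sets only and are extended by identities of
  polynomials. In type A the connectedness of the Levi subgroup excludes elements exchanging M and
  M*.\<close>

lemma power_sums_eq_0: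
 fixes c :: "'b \<Rightarrow> complex"
 assumes fin: "finite B" and sums: "\<And>k. k \<ge> 1 ==> (\<Sum>b\<in>B. c b ^ k) = 0" and b: "b \<in> B"
 shows "c b = 0"
proof (rule ccontr)
 assume nz: "c b \<noteq> 0"
 define S where "S = c ` B - {0, c b}"
 \<comment> \<open>The factor [:0, 1:] removes the constant term, because nothing is known about the
   sum of zeroth powers. As q vanishes at all values other than \<open>c b\<close>, the sum of q
   over the family is a positive multiple of q at \<open>c b\<close>.\<close>
 define q where "q = [:0, 1:] * (\<Prod>s\<in>S. [:-s, 1:])"
 have finS: "finite S" by (simp add: S_def fin)
 have "(\<Sum>x\<in>B. poly q (c x)) = (\<Sum>x\<in>B. \<Sum>i\<le>Polynomial.degree q. Polynomial.coeff q i * c x ^ i)"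
  by (simp add: poly_altdef)
 also have "\<dots> = (\<Sum>i\<le>Polynomial.degree q. Polynomial.coeff q i * (\<Sum>x\<in>B. c x ^ i))"
  by (subst sum.swap) (simp add: sum_distrib_left)
 also have "\<dots> = 0"
 proof (rule sum.neutral, safe)
  fix i show "Polynomial.coeff q i * (\<Sum>x\<in>B. c x ^ i) = 0"
   by (cases i) (use sums[of i] in \<open>auto simp: q_def\<close>)
 qed
 finally have zero: "(\<Sum>x\<in>B. poly q (c x)) = 0" .
 have "(\<Sum>x\<in>B. poly q (c x)) = (\<Sum>x\<in>{x\<in>B. c x = c b}. poly q (c b))"
 proof (rule sum.mono_neutral_cong_right)
  show "\<forall>x\<in>B - {x \<in> B. c x = c b}. poly q (c x) = 0"
   using finS by (auto simp: q_def poly_prod prod_zero_iff S_def)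
 qed (use fin in auto)
 also have "\<dots> = of_nat (card {x\<in>B. c x = c b}) * poly q (c b)" by simp
 finally have "of_nat (card {x\<in>B. c x = c b}) * poly q (c b) = 0" using zero by simp
 moreover have "card {x\<in>B. c x = c b} \<noteq> 0" using fin b by auto
 moreover have "poly q (c b) \<noteq> 0"
  using nz finS by (auto simp: q_def poly_prod prod_zero_iff S_def)
 ultimately show False by simp
qed

lemma vec_finite_independent: "vec.independent (B :: (complex^'d) set) ==> finite B"
 using vec.finiteI_independent by blast

lemma matrix_works_vec:
 "Vector_Spaces.linear (*s) (*s) f ==> matrix f *v x = f (x :: complex^'d)"
 by (rule matrix_works)

lemma vec_expand: "x = (\<Sum>i\<in>UNIV. (x $ i) *s axis i 1)" for x :: "complex^'d"
 by (simp add: vec_eq_iff axis_def if_distrib[of "\<lambda>z. _ * z"] cong: if_cong)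

lemma matrix_vector_axis: "(A *v axis j 1) $ i = A $ i $ j" for A :: "'a::comm_ring_1^'d^'e"
 by (simp add: matrix_vector_mult_def axis_def if_distrib[of "\<lambda>z. _ * z"] cong: if_cong)

text \<open>Expanding the standard vectors in B and exchanging the two sums turns diagonal entries
  into coefficients with respect to B. The main use is with weight bases.\<close>

lemma trace_representation:
 fixes A :: "complex^'d^'d"
 assumes ind: "vec.independent B" and sp: "vec.span B = UNIV"
 shows "trace A = (\<Sum>b\<in>B. vec.representation B (A *v b) b)"
proof -
 let ?r = "vec.representation B"
 have fin: "finite B" using ind by (rule vec_finite_independent)
 have exp: "x = (\<Sum>b\<in>B. ?r x b *s b)" for x
  using vec.sum_representation_eq[OF ind _ fin subset_refl, of x] sp by simp
 have lin: "Vector_Spaces.linear (*s) (*) (\<lambda>x. ?r x b)" for b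
  using vec.linear_representation[OF ind sp] .
 then have rlin: "?r x b = (\<Sum>i\<in>UNIV. x $ i * ?r (axis i 1) b)" for x b
 proof -
  interpret l: Vector_Spaces.linear "(*s)" "(*)" "\<lambda>x. ?r x b" by (rule lin)
  show ?thesis by (subst vec_expand[of x]) (simp add: l.sum l.scale)
 qed
 have entry: "A $ i $ i = (\<Sum>b\<in>B. ?r (axis i 1) b * (A *v b) $ i)" for i
 proof -
  have "A $ i $ i = (A *v axis i 1) $ i"
   by (rule matrix_vector_axis[symmetric])
  also have "\<dots> = (A *v (\<Sum>b\<in>B. ?r (axis i 1) b *s b)) $ i" using exp by metis
  also have "\<dots> = (\<Sum>b\<in>B. ?r (axis i 1) b * (A *v b) $ i)"
   by (simp add: vec.sum vec.scale sum_component)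
  finally show ?thesis .
 qed
 have "trace A = (\<Sum>i\<in>UNIV. \<Sum>b\<in>B. ?r (axis i 1) b * (A *v b) $ i)"
  unfolding trace_def using entry by (intro sum.cong refl)
 also have "\<dots> = (\<Sum>b\<in>B. ?r (A *v b) b)"
  by (subst sum.swap, subst rlin[of "A *v _"]) (simp add: mult.commute)
 finally show ?thesis .
qed

lemma vec_basis_exists:
 fixes S :: "(complex^'d) set"
 assumes "vec.span S = UNIV"
 obtains B where "B \<subseteq> S" "vec.independent B" "vec.span B = UNIV"
proof -
 obtain B where B: "B \<subseteq> S" "vec.independent B" "S \<subseteq> vec.span B"
  by (rule vec.maximal_independent_subset)
 have "vec.span S \<subseteq> vec.span B" using B(3) by (rule vec.span_minimal) simp
 with assms B that show ?thesis by blast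
qed

lemma matpow_0: "matpow A 0 = mat 1" and matpow_Suc: "matpow A (Suc k) = A ** matpow A k"
 by (simp_all add: matpow_def)

lemma matpow_vector: "matpow A k *v x = (((*v) A) ^^ k) x"
 by (induction k arbitrary: x) (simp_all add: matpow_0 matpow_Suc matrix_vector_mul_assoc[symmetric])

text \<open>In a basis adapted to the flag of images of the powers of X, every basis vector is sent
  into the span of the other ones, so all diagonal coefficients vanish.\<close>

lemma trace_nilpotent:
 fixes X :: "complex^'d^'d"
 assumes nil: "matpow X k = 0"
 shows "trace X = 0"
proof -
 let ?f = "(*v) X"
 define S where "S j = range (?f ^^ j)" for j
 have subS: "vec.subspace (S j)" for j
 proof -
  have "S j = range ((*v) (matpow X j))" unfolding S_def by (simp add: matpow_vector)
  then show ?thesis using vec.subspace_image[of UNIV "matpow X j"] by simp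
 qed
 have S_dec: "S (Suc j) \<subseteq> S j" for j
  unfolding S_def by (auto simp: funpow_swap1)
 have fS: "?f x \<in> S (Suc j)" if "x \<in> S j" for x j
  using that unfolding S_def by (auto simp del: funpow.simps) (metis funpow.simps(2) o_apply rangeI)
 \<comment> \<open>The flag is climbed from the image of \<open>matpow X k\<close>, which is zero,
   up to the whole space; step i treats \<open>S (k - i)\<close>.\<close>
 have "\<exists>B. vec.independent B \<and> B \<subseteq> S (k - i) \<and> S (k - i) \<subseteq> vec.span B \<and> (\<forall>b\<in>B. ?f b \<in> vec.span (B - {b}))"
  if "i \<le> k" for i
  using that
 proof (induction i)
  case 0
  have "S k = {0}" unfolding S_def using nil matpow_vector[of X k] by auto
  then show ?case by (intro exI[of _ "{}"]) (auto simp: vec.independent_empty)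
 next
  case (Suc i)
  define j where "j = k - Suc i"
  have kj: "k - i = Suc j" using Suc.prems j_def by simp
  obtain B where B: "vec.independent B" "B \<subseteq> S (Suc j)" "S (Suc j) \<subseteq> vec.span B"
   "\<forall>b\<in>B. ?f b \<in> vec.span (B - {b})" using Suc kj by auto
  obtain C where C: "B \<subseteq> C" "C \<subseteq> S j" "vec.independent C" "S j \<subseteq> vec.span C"
   using vec.maximal_independent_subset_extend[of B "S j"] B S_dec by blast
  have "?f b \<in> vec.span (C - {b})" if "b \<in> C" for b
  proof (cases "b \<in> B")
   case True
   then have "?f b \<in> vec.span (B - {b})" using B by blast
   then show ?thesis using vec.span_mono[of "B - {b}" "C - {b}"] C(1) by blast
  next
   case False
   have "?f b \<in> vec.span B" using that C(2) fS B(3) by blast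
   then show ?thesis using vec.span_mono[of "B" "C - {b}"] C(1) False by blast
  qed
  then show ?case using C j_def by blast
 qed
 from this[of k] obtain B where B: "vec.independent B" "S 0 \<subseteq> vec.span B"
  "\<forall>b\<in>B. ?f b \<in> vec.span (B - {b})" by auto
 have sp: "vec.span B = UNIV" using B(2) unfolding S_def by auto
 have "vec.representation B (X *v b) b = 0" if "b \<in> B" for b
 proof -
  have "vec.representation B (X *v b) = vec.representation (B - {b}) (X *v b)"
   using vec.representation_extend[OF B(1), of "X *v b" "B - {b}"] B(3) that by blast
  then show ?thesis using vec.representation_ne_zero[of "B - {b}" "X *v b" b] by auto
 qed
 then show ?thesis using trace_representation[OF B(1) sp, of X] by simp
qed

text \<open>Applying T - c0 removes the component at c0 and multiplies each other component by the
  nonzero number c - c0, so the induction hypothesis applies to the shorter sum.\<close>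

lemma eigen_components:
 fixes T :: "complex^'d \<Rightarrow> complex^'d"
 assumes T: "Vector_Spaces.linear (*s) (*s) T" and S: "vec.subspace S" and TS: "\<And>x. x \<in> S ==> T x \<in> S"
  and F: "finite F"
 shows "(\<And>c. c \<in> F ==> T (x c) = c *s x c) ==> (\<Sum>c\<in>F. x c) \<in> S ==> c \<in> F ==> x c \<in> S"
 using F
proof (induction F arbitrary: x c rule: finite_induct)
 case empty
 then show ?case by simp
next
 interpret T: Vector_Spaces.linear "(*s)" "(*s)" T by (rule T)
 case (insert c0 F)
 let ?y = "x c0 + (\<Sum>c\<in>F. x c)"
 have y: "?y \<in> S" using insert by simp
 have "T ?y - c0 *s ?y = (\<Sum>c\<in>F. (c - c0) *s x c)"
  using insert.prems(1) insert.hyps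
  by (simp add: T.add T.sum vec.scale_right_distrib vec.scale_sum_right vec.scale_left_diff_distrib sum_subtractf)
 moreover have "T ?y - c0 *s ?y \<in> S" using y TS S by (intro vec.subspace_diff vec.subspace_scale) auto
 ultimately have "(\<Sum>c\<in>F. (c - c0) *s x c) \<in> S" by simp
 moreover have "T ((c - c0) *s x c) = c *s ((c - c0) *s x c)" if "c \<in> F" for c
  using insert.prems(1)[of c] that by (simp only: T.scale vec.scale_left_commute insert_iff simp_thms)
 ultimately have *: "(c - c0) *s x c \<in> S" if "c \<in> F" for c
  using insert.IH[of "\<lambda>c. (c - c0) *s x c"] that by blast
 have xc: "x c \<in> S" if "c \<in> F" for c
 proof -
  have "c \<noteq> c0" using that insert.hyps by auto
  then have "x c = (1 / (c - c0)) *s ((c - c0) *s x c)" by (simp only: vector_smult_assoc) simp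
  then show ?thesis using *[OF that] S by (metis vec.subspace_scale)
 qed
 then have "(\<Sum>c\<in>F. x c) \<in> S" using S by (simp add: vec.subspace_sum)
 then have "x c0 \<in> S" using y S vec.subspace_diff by fastforce
 then show ?case using xc insert.prems by auto
qed

lemma span_eigen_decomposition:
 fixes T :: "complex^'d \<Rightarrow> complex^'d"
 assumes T: "Vector_Spaces.linear (*s) (*s) T"
  and "x \<in> vec.span {x. \<exists>c. T x = c *s x}"
 shows "\<exists>F y. finite F \<and> (\<forall>c\<in>F. T (y c) = c *s y c) \<and> x = (\<Sum>c\<in>F. y c)"
 using assms(2)
proof (induction rule: vec.span_induct_alt)
 case base
 show ?case by (intro exI[of _ "{}"]) auto
next
 interpret T: Vector_Spaces.linear "(*s)" "(*s)" T by (rule T)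
 case (step a v w)
 then obtain c0 F y where c0: "T v = c0 *s v" and F: "finite F" "\<forall>c\<in>F. T (y c) = c *s y c" "w = (\<Sum>c\<in>F. y c)"
  by auto
 \<comment> \<open>A new eigenvector is merged with the component of the same eigenvalue, so that
   the components stay indexed by eigenvalues.\<close>
 let ?y = "\<lambda>c. (if c = c0 then a *s v else 0) + (if c \<in> F then y c else 0)"
 have "(\<Sum>c\<in>insert c0 F. ?y c) = (\<Sum>c\<in>insert c0 F. if c = c0 then a *s v else 0) + (\<Sum>c\<in>insert c0 F. if c \<in> F then y c else 0)"
  by (rule sum.distrib)
 also have "\<dots> = a *s v + w"
 proof -
  have "(\<Sum>c\<in>insert c0 F. if c \<in> F then y c else 0) = (\<Sum>c\<in>F. y c)"
   by (rule sum.mono_neutral_cong_right) (use F in auto)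
  then show ?thesis using F by (simp add: sum.delta)
 qed
 finally have "a *s v + w = (\<Sum>c\<in>insert c0 F. ?y c)" by simp
 moreover have "\<forall>c\<in>insert c0 F. T (?y c) = c *s ?y c"
  using F c0 by (auto simp: T.add T.scale vec.scale_right_distrib mult.commute)
 ultimately show ?case using F(1) by (intro exI[of _ "insert c0 F"] exI[of _ ?y]) simp
qed

lemma stable_span_eigen:
 fixes T :: "complex^'d \<Rightarrow> complex^'d"
 assumes T: "Vector_Spaces.linear (*s) (*s) T" and diag: "vec.span {x. \<exists>c. T x = c *s x} = UNIV"
  and S: "vec.subspace S" and TS: "\<And>x. x \<in> S ==> T x \<in> S"
 shows "S \<subseteq> vec.span {x\<in>S. \<exists>c. T x = c *s x}"
proof
 fix x assume x: "x \<in> S"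
 obtain F y where F: "finite F" "\<forall>c\<in>F. T (y c) = c *s y c" "x = (\<Sum>c\<in>F. y c)"
  using span_eigen_decomposition[OF T, of x] diag by auto
 have "y c \<in> S" if "c \<in> F" for c
  using eigen_components[OF T S TS F(1), of y] F x that by blast
 then show "x \<in> vec.span {x\<in>S. \<exists>c. T x = c *s x}"
  unfolding F(3) using F(2) by (intro vec.span_sum vec.span_base) auto
qed

lemma stable_span_joint_eigen:
 fixes T :: "'i \<Rightarrow> complex^'d \<Rightarrow> complex^'d"
 assumes fin: "finite I" and T: "\<And>i. i \<in> I ==> Vector_Spaces.linear (*s) (*s) (T i)"
  and diag: "\<And>i. i \<in> I ==> vec.span {x. \<exists>c. T i x = c *s x} = UNIV"
  and comm: "\<And>i j x. i \<in> I ==> j \<in> I ==> T i (T j x) = T j (T i x)"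
  and S: "vec.subspace S" and TS: "\<And>i x. i \<in> I ==> x \<in> S ==> T i x \<in> S"
 shows "S \<subseteq> vec.span {x\<in>S. \<forall>i\<in>I. \<exists>c. T i x = c *s x}"
 using fin T diag comm TS
proof (induction I rule: finite_induct)
 case empty
 then show ?case by (simp add: vec.span_superset)
next
 case (insert h I)
 let ?Q = "{x\<in>S. \<forall>i\<in>insert h I. \<exists>c. T i x = c *s x}"
 have "S \<subseteq> vec.span {x\<in>S. \<forall>i\<in>I. \<exists>c. T i x = c *s x}" using insert by blast
 also have "\<dots> \<subseteq> vec.span ?Q"
 proof (rule vec.span_minimal)
  show "{x\<in>S. \<forall>i\<in>I. \<exists>c. T i x = c *s x} \<subseteq> vec.span ?Q"
  proof
   fix y assume y: "y \<in> {x\<in>S. \<forall>i\<in>I. \<exists>c. T i x = c *s x}"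
   then obtain c where c: "\<forall>i\<in>I. T i y = c i *s y" using bchoice[of I "\<lambda>i c. T i y = c *s y"] by auto
   \<comment> \<open>The joint eigenspace of the operators treated so far is stable under
     \<open>T h\<close> because the operators commute, so \<open>T h\<close> can be diagonalised
     inside it.\<close>
   let ?S = "{z\<in>S. \<forall>i\<in>I. T i z = c i *s z}"
   have lin: "Vector_Spaces.linear (*s) (*s) (T i)" if "i \<in> insert h I" for i using insert.prems(1) that by blast
   have add: "T i (u + v) = T i u + T i v" and scale: "T i (a *s u) = a *s T i u" and zero: "T i 0 = 0"
    if "i \<in> insert h I" for i u v a
   proof -
    interpret Ti: Vector_Spaces.linear "(*s)" "(*s)" "T i" by (rule lin[OF that])
    show "T i (u + v) = T i u + T i v" "T i (a *s u) = a *s T i u" "T i 0 = 0"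
     by (simp_all add: Ti.add Ti.scale)
   qed
   have sub: "vec.subspace ?S"
    unfolding vec.subspace_def using S
    by (auto simp: add scale zero vec.subspace_add vec.subspace_scale vec.subspace_0 vec.scale_right_distrib mult.commute)
   have stab: "T h z \<in> ?S" if z: "z \<in> ?S" for z
   proof -
    have "T i (T h z) = c i *s T h z" if "i \<in> I" for i
     using insert.prems(3)[of i h z] that z scale[of h "c i" z] by auto
    then show ?thesis using insert.prems(4)[of h z] z by auto
   qed
   have "y \<in> ?S" using y c by auto
   also have "?S \<subseteq> vec.span {x\<in>?S. \<exists>c. T h x = c *s x}"
    by (rule stable_span_eigen[OF lin _ sub stab]) (use insert.prems(2) in auto)
   also have "\<dots> \<subseteq> vec.span ?Q" by (rule vec.span_mono) auto
   finally show "y \<in> vec.span ?Q" .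
  qed
 qed simp
 finally show ?case .
qed

subsection \<open>Limits of matrices\<close>

lemma tendsto_vector_smult:
 fixes f :: "'t \<Rightarrow> complex^'d"
 assumes "(a \<longlongrightarrow> b) F" "(f \<longlongrightarrow> g) F" shows "((\<lambda>t. a t *s f t) \<longlongrightarrow> b *s g) F"
 by (rule vec_tendstoI) (auto intro!: tendsto_intros assms tendsto_vec_nth)

lemma tendsto_matrix_vector_mult:
 fixes M :: "'t \<Rightarrow> complex^'d^'e"
 assumes "(M \<longlongrightarrow> N) F" "(x \<longlongrightarrow> y) F" shows "((\<lambda>t. M t *v x t) \<longlongrightarrow> N *v y) F"
 by (rule vec_tendstoI) (auto simp: matrix_vector_mult_def intro!: tendsto_intros assms tendsto_vec_nth)

lemma tendsto_matrix_mult: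
 fixes M :: "'t \<Rightarrow> complex^'d^'e" and K :: "'t \<Rightarrow> complex^'f^'d"
 assumes "(M \<longlongrightarrow> N) F" "(K \<longlongrightarrow> L) F" shows "((\<lambda>t. M t ** K t) \<longlongrightarrow> N ** L) F"
 by (rule vec_tendstoI, rule vec_tendstoI)
  (auto simp: matrix_matrix_mult_def intro!: tendsto_intros assms tendsto_vec_nth)

lemma continuous_on_matrix_vector_mult:
 fixes M :: "'t::topological_space \<Rightarrow> complex^'d^'e"
 shows "continuous_on S M ==> continuous_on S x ==> continuous_on S (\<lambda>t. M t *v x t)"
 unfolding continuous_on_def by (auto intro: tendsto_matrix_vector_mult)

lemma continuous_on_matrix_mult:
 fixes M :: "'t::topological_space \<Rightarrow> complex^'d^'e" and K :: "'t \<Rightarrow> complex^'f^'d"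
 shows "continuous_on S M ==> continuous_on S K ==> continuous_on S (\<lambda>t. M t ** K t)"
 unfolding continuous_on_def by (auto intro: tendsto_matrix_mult)

text \<open>Allows limits of matrices to be checked on eigenvectors, where exponentials are
  scalars.\<close>

lemma matrix_tendsto_basis:
 fixes M :: "'t \<Rightarrow> complex^'d^'d"
 assumes sp: "vec.span B = UNIV" and lim: "\<And>b. b \<in> B ==> ((\<lambda>t. M t *v b) \<longlongrightarrow> N *v b) F"
 shows "(M \<longlongrightarrow> N) F"
proof -
 have all: "((\<lambda>t. M t *v x) \<longlongrightarrow> N *v x) F" for x
 proof -
  have "x \<in> vec.span B" using sp by simp
  then show ?thesis
  proof (induction rule: vec.span_induct_alt)
   case base then show ?case by simp
  next
   case (step c b y)
   then show ?case
    by (auto simp: vec.add vec.scale intro!: tendsto_add tendsto_vector_smult lim)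
  qed
 qed
 have entry: "M t $ i $ j = (M t *v axis j 1) $ i" for t i j
  by (rule matrix_vector_axis[symmetric])
 have entryN: "N $ i $ j = (N *v axis j 1) $ i" for i j
  by (rule matrix_vector_axis[symmetric])
 show ?thesis
  by (rule vec_tendstoI, rule vec_tendstoI) (unfold entry entryN, rule tendsto_vec_nth, rule all)
qed

lemma matrix_eq_span:
 fixes M N :: "complex^'d^'d"
 assumes sp: "vec.span B = UNIV" and eq: "\<And>b. b \<in> B ==> M *v b = N *v b"
 shows "M = N"
proof -
 have "M *v x = N *v x" for x
 proof -
  have "x \<in> vec.span B" using sp by simp
  then show ?thesis by (induction rule: vec.span_induct_alt) (auto simp: vec.add vec.scale eq)
 qed
 then show ?thesis by (simp add: matrix_eq)
qed

lemma scaleR_matrix_vector: "(t *\<^sub>R M) *v v = complex_of_real t *s (M *v v)" for M :: "complex^'d^'d"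
 unfolding vec_eq_iff
 by (simp add: matrix_vector_mult_def sum_distrib_left) (simp add: scaleR_conv_of_real mult.assoc)

text \<open>The series in \<open>matexp\<close> has to be shown convergent before it can be
  evaluated. On an eigenbasis its partial sums are those of scalar exponentials, which produces the
  limit \<open>matrix g\<close>; after that any eigenvector can be inserted.\<close>

lemma matexp_eigenvector:
 fixes X :: "complex^'d^'d"
 assumes diag: "vec.span {x. \<exists>c. X *v x = c *s x} = UNIV" and v: "X *v v = c *s v"
 shows "matexp X *v v = exp c *s v"
proof -
 obtain B where B: "B \<subseteq> {x. \<exists>c. X *v x = c *s x}" "vec.independent B" "vec.span B = UNIV"
  by (rule vec_basis_exists[OF diag])
 have "\<forall>b\<in>B. \<exists>c. X *v b = c *s b" using B(1) by blast
 then obtain \<mu> where \<mu>: "\<And>b. b \<in> B ==> X *v b = \<mu> b *s b" using bchoice[of B "\<lambda>b c. X *v b = c *s b"] by blast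
 obtain g where g: "Vector_Spaces.linear (*s) (*s) g" "\<forall>b\<in>B. g b = exp (\<mu> b) *s b"
  using vec.linear_independent_extend[OF B(2), of "\<lambda>b. exp (\<mu> b) *s b"] by blast
 have pow: "matpow X k *v w = d ^ k *s w" if "X *v w = d *s w" for w d k
  unfolding matpow_vector by (induction k) (simp_all add: vec.scale that mult.commute)
 have part: "(\<lambda>n. (\<Sum>k<n. (1 / fact k) *\<^sub>R matpow X k) *v w) \<longlonglongrightarrow> exp d *s w" if "X *v w = d *s w" for w d
 proof -
  have sm: "(\<Sum>k<n. M k) *v w = (\<Sum>k<n. M k *v w)" for n and M :: "nat \<Rightarrow> complex^'d^'d"
   by (induction n) (simp_all add: matrix_vector_mult_add_rdistrib)
  have "((1 / fact k) *\<^sub>R matpow X k) *v w = (d ^ k /\<^sub>R fact k) *s w" for k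
   unfolding scaleR_matrix_vector pow[OF that] vector_smult_assoc by (simp add: scaleR_conv_of_real divide_inverse)
  then have "(\<Sum>k<n. (1 / fact k) *\<^sub>R matpow X k) *v w = (\<Sum>k<n. d ^ k /\<^sub>R fact k) *s w" for n
   unfolding sm vec.scale_sum_left by (intro sum.cong) auto
  moreover have "(\<lambda>n. (\<Sum>k<n. d ^ k /\<^sub>R fact k)) \<longlonglongrightarrow> exp d"
   using exp_converges[of d] unfolding sums_def .
  ultimately show ?thesis by (simp add: tendsto_vector_smult)
 qed
 have "(\<lambda>n. \<Sum>k<n. (1 / fact k) *\<^sub>R matpow X k) \<longlonglongrightarrow> matrix g"
  by (rule matrix_tendsto_basis[OF B(3)]) (use part \<mu> g in \<open>simp add: matrix_works_vec\<close>)
 then have S: "(\<lambda>k. (1 / fact k) *\<^sub>R matpow X k) sums matrix g" unfolding sums_def .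
 then have E: "(\<lambda>n. \<Sum>k<n. (1 / fact k) *\<^sub>R matpow X k) \<longlonglongrightarrow> matexp X"
  unfolding matexp_def sums_unique[OF S, symmetric] sums_def .
 have "(\<lambda>n. (\<Sum>k<n. (1 / fact k) *\<^sub>R matpow X k) *v v) \<longlonglongrightarrow> matexp X *v v"
  by (rule tendsto_matrix_vector_mult[OF E tendsto_const])
 then show ?thesis using part[OF v] LIMSEQ_unique by blast
qed

lemma diag_scaleR:
 fixes X :: "complex^'d^'d"
 assumes diag: "vec.span {x. \<exists>c. X *v x = c *s x} = UNIV"
 shows "vec.span {x. \<exists>c. (t *\<^sub>R X) *v x = c *s x} = UNIV"
proof -
 have "{x. \<exists>c. X *v x = c *s x} \<subseteq> {x. \<exists>c. (t *\<^sub>R X) *v x = c *s x}"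
  by (auto simp: scaleR_matrix_vector)
 from vec.span_mono[OF this] show ?thesis using diag by auto
qed

lemma matexp_scaleR_eigenvector:
 fixes X :: "complex^'d^'d"
 assumes diag: "vec.span {x. \<exists>c. X *v x = c *s x} = UNIV" and v: "X *v v = c *s v"
 shows "matexp (t *\<^sub>R X) *v v = exp (of_real t * c) *s v"
 by (rule matexp_eigenvector[OF diag_scaleR[OF diag]]) (simp add: scaleR_matrix_vector v)

lemma matexp_derivative:
 fixes X :: "complex^'d^'d"
 assumes diag: "vec.span {x. \<exists>c. X *v x = c *s x} = UNIV"
 shows "((\<lambda>t. (1 / t) *\<^sub>R (matexp (t *\<^sub>R X) - mat 1)) \<longlongrightarrow> X) (at 0)"
proof (rule matrix_tendsto_basis[OF diag])
 fix b assume "b \<in> {x. \<exists>c. X *v x = c *s x}"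
 then obtain c where c: "X *v b = c *s b" by auto
 have "((\<lambda>z. exp (z * c)) has_field_derivative c) (at 0)"
  by (auto intro!: derivative_eq_intros)
 then have "((\<lambda>z. (exp (z * c) - 1) / z) \<longlongrightarrow> c) (at 0)"
  by (simp add: has_field_derivative_iff)
 moreover have "filterlim complex_of_real (at 0) (at 0)"
  unfolding filterlim_at by (auto simp: eventually_at_filter intro!: tendsto_eq_intros)
 ultimately have lim: "((\<lambda>t. (exp (of_real t * c) - 1) / complex_of_real t) \<longlongrightarrow> c) (at 0)"
  by (rule filterlim_compose)
 have eq: "((1 / t) *\<^sub>R (matexp (t *\<^sub>R X) - mat 1)) *v b = ((exp (of_real t * c) - 1) / complex_of_real t) *s b" for t
  using matexp_scaleR_eigenvector[OF diag c, of t]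
  by (simp add: scaleR_matrix_vector matrix_vector_mult_diff_rdistrib vec.scale_left_diff_distrib diff_divide_distrib
    vec.scale_right_diff_distrib)
 show "((\<lambda>t. ((1 / t) *\<^sub>R (matexp (t *\<^sub>R X) - mat 1)) *v b) \<longlongrightarrow> X *v b) (at 0)"
  unfolding eq c by (rule tendsto_vector_smult[OF lim tendsto_const])
qed

section \<open>Simple Lie algebras\<close>

locale simple_lie =
 fixes br :: "complex^'d \<Rightarrow> complex^'d \<Rightarrow> complex^'d"
 assumes simple: "simple_lie_algebra br"
begin

lemma lie: "lie_algebra br" using simple by (simp add: simple_lie_algebra_def)

lemma br_linear: "Vector_Spaces.linear (*s) (*s) (br x)" "Vector_Spaces.linear (*s) (*s) (\<lambda>y. br y x)"
 using lie by (auto simp: lie_algebra_def)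

lemma br_add_right: "br x (y + z) = br x y + br x z"
 and br_scale_right: "br x (c *s y) = c *s br x y"
 using br_linear(1)[of x] by (simp_all add: Vector_Spaces.linear_iff)

lemma br_add_left: "br (x + y) z = br x z + br y z"
 and br_scale_left: "br (c *s x) z = c *s br x z"
 using br_linear(2)[of z] by (simp_all add: Vector_Spaces.linear_iff)

lemma br_zero [simp]: "br x 0 = 0" "br 0 x = 0"
 using br_scale_right[of x 0 0] br_scale_left[of 0 0 x] by simp_all

lemma br_minus_right: "br x (- y) = - br x y" and br_minus_left: "br (- x) y = - br x y"
 using br_scale_right[of x "-1" y] br_scale_left[of "-1" x y] by simp_all

lemma br_diff_right: "br x (y - z) = br x y - br x z" and br_diff_left: "br (x - y) z = br x z - br y z"
 using br_add_right[of x y "-z"] br_add_left[of x "-y" z] by (simp_all add: br_minus_right br_minus_left)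

lemmas br_bilinear = br_add_left br_add_right br_scale_left br_scale_right br_minus_left br_minus_right
 br_diff_left br_diff_right

lemma br_sum_right: "br x (sum f A) = (\<Sum>a\<in>A. br x (f a))"
 and br_sum_left: "br (sum f A) x = (\<Sum>a\<in>A. br (f a) x)"
 by (induction A rule: infinite_finite_induct) (simp_all add: br_bilinear)

lemma br_self [simp]: "br x x = 0" using lie by (simp add: lie_algebra_def)

lemma br_skew: "br x y = - br y x"
proof -
 have "br (x + y) (x + y) = 0" by (rule br_self)
 then have "br y x + br x y = 0" unfolding br_add_left br_add_right by (simp add: add.commute)
 then show ?thesis by (simp add: eq_neg_iff_add_eq_0 add.commute)
qed

lemma jacobi: "br x (br y z) = br (br x y) z + br y (br x z)"
proof -
 have "br x (br y z) + br y (br z x) + br z (br x y) = 0" using lie by (simp add: lie_algebra_def)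
 moreover have "br y (br z x) = - br y (br x z)" using br_skew[of z x] by (simp add: br_minus_right)
 moreover have "br z (br x y) = - br (br x y) z" by (rule br_skew)
 ultimately show ?thesis by (simp add: algebra_simps eq_neg_iff_add_eq_0)
qed

lemma ad_vector [simp]: "matrix (br x) *v y = br x y"
 by (rule matrix_works_vec[OF br_linear(1)])

lemma matrix_mult_diff_left: "(A - B) ** C = A ** C - B ** C" for C :: "complex^'e^'f"
 by (simp add: vec_eq_iff matrix_matrix_mult_def left_diff_distrib sum_subtractf)

lemma matrix_mult_diff_right: "C ** (A - B) = C ** A - C ** B" for C :: "complex^'e^'f"
 by (simp add: vec_eq_iff matrix_matrix_mult_def right_diff_distrib sum_subtractf)

lemma ad_br: "matrix (br (br x y)) = matrix (br x) ** matrix (br y) - matrix (br y) ** matrix (br x)"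
 by (simp add: matrix_eq matrix_vector_mult_diff_rdistrib matrix_vector_mul_assoc[symmetric] jacobi[of x y])

text \<open>The centre is an ideal, and it is not everything because some bracket is
  nonzero.\<close>

lemma center_trivial:
 assumes "\<And>y. br x y = 0" shows "x = 0"
proof -
 have "br u x = 0" if "\<forall>y. br x y = 0" for u x using that br_skew[of u x] by simp
 then have "lie_ideal br {x. \<forall>y. br x y = 0}"
  unfolding lie_ideal_def vec.subspace_def by (simp add: br_add_left br_scale_left)
 then have "{x. \<forall>y. br x y = 0} = {0} \<or> {x. \<forall>y. br x y = 0} = UNIV"
  using simple by (simp add: simple_lie_algebra_def)
 moreover have "{x. \<forall>y. br x y = 0} \<noteq> UNIV" using simple by (auto simp: simple_lie_algebra_def)
 ultimately show ?thesis using assms by auto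
qed

definition killing :: "complex^'d \<Rightarrow> complex^'d \<Rightarrow> complex" where
 "killing x y = trace (matrix (br x) ** matrix (br y))"

lemma killing_sym: "killing x y = killing y x"
 unfolding killing_def by (rule trace_mul_sym)

lemma ad_add: "matrix (br (x + y)) = matrix (br x) + matrix (br y)"
 by (simp add: matrix_eq matrix_vector_mult_add_rdistrib br_bilinear)

lemma ad_scale: "matrix (br (c *s x)) = mscale c (matrix (br x))"
 by (simp add: matrix_eq mscale_def br_bilinear)
   (simp add: vec_eq_iff matrix_vector_mult_def mscale_def sum_distrib_left mult.assoc flip: ad_vector)

lemma killing_add: "killing (x + y) z = killing x z + killing y z"
 by (simp add: killing_def ad_add trace_def matrix_matrix_mult_def distrib_right sum.distrib)

lemma killing_scale: "killing (c *s x) y = c * killing x y"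
 by (simp add: killing_def ad_scale mscale_def trace_def matrix_matrix_mult_def sum_distrib_left mult.assoc)

lemma killing_diff: "killing (x - y) z = killing x z - killing y z"
 using killing_add[of "x - y" y z] by simp

text \<open>Both sides are differences of traces of triple products, and cyclic rotation matches the
  terms.\<close>

lemma killing_invariant: "killing (br x y) z = killing x (br y z)"
proof -
 let ?X = "matrix (br x)" and ?Y = "matrix (br y)" and ?Z = "matrix (br z)"
 have "trace (?Y ** ?X ** ?Z) = trace (?X ** (?Z ** ?Y))"
  by (metis matrix_mul_assoc trace_mul_sym)
 then show ?thesis
  by (simp add: killing_def ad_br matrix_mult_diff_left matrix_mult_diff_right trace_sub matrix_mul_assoc)
qed

text \<open>Bracketing preserves the radical, so it is an ideal.\<close>
lemma killing_nondegenerate: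
 assumes "killing a b \<noteq> 0" and "\<And>y. killing x y = 0"
 shows "x = 0"
proof -
 let ?R = "{x. \<forall>y. killing x y = 0}"
 have zero: "killing 0 y = 0" for y using killing_scale[of 0 0 y] by simp
 have "killing (br u x) y = 0" if "\<forall>y. killing x y = 0" for u x y
 proof -
  have "killing (br u x) y = - killing (br x u) y"
   using killing_scale[of "-1" "br x u" y] br_skew[of u x] by simp
  then show ?thesis using that by (simp add: killing_invariant)
 qed
 then have "lie_ideal br ?R"
  unfolding lie_ideal_def vec.subspace_def by (auto simp: killing_add killing_scale zero)
 then have "?R = {0} \<or> ?R = UNIV" using simple by (simp add: simple_lie_algebra_def)
 moreover have "?R \<noteq> UNIV" using assms(1) by blast
 ultimately show ?thesis using assms(2) by auto
qed

definition sl2 :: "complex^'d \<Rightarrow> complex^'d \<Rightarrow> complex^'d \<Rightarrow> bool" where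
 "sl2 x h y \<longleftrightarrow> br h x = 2 *s x \<and> br h y = (- 2) *s y \<and> br x y = h"

lemma sl2_flip: "sl2 x h y ==> sl2 y (- h) x"
 using br_skew[of y x] by (auto simp: sl2_def br_bilinear)

end

section \<open>Weights\<close>

locale cartan_lie = simple_lie br for br :: "complex^'d \<Rightarrow> complex^'d \<Rightarrow> complex^'d" +
 fixes H :: "(complex^'d) set"
 assumes cartan: "cartan_subalgebra br H"
begin

text \<open>Weights are arbitrary functions of which only the values on H matter, see
  \<open>wt_cong\<close>. The zero weight is allowed; by \<open>H_self\<close> its weight vectors
  lie in H.\<close>

abbreviation "\<W> \<equiv> root_space br H"

lemma H_subspace: "vec.subspace H"
 and H_comm: "h \<in> H ==> k \<in> H ==> br h k = 0"
 and H_self: "(\<And>h. h \<in> H ==> br h x = 0) ==> x \<in> H"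
 and H_diag: "h \<in> H ==> vec.span {x. \<exists>c. br h x = c *s x} = UNIV"
 using cartan by (auto simp: cartan_subalgebra_def)

lemma ad_diag: "h \<in> H ==> vec.span {x. \<exists>c. matrix (br h) *v x = c *s x} = UNIV"
 using H_diag by simp

lemma H_br_comm: "h \<in> H ==> k \<in> H ==> br h (br k x) = br k (br h x)"
 using jacobi[of h k x] H_comm by simp

lemma wt_subspace: "vec.subspace (\<W> \<alpha>)"
 by (auto simp: vec.subspace_def root_space_def br_bilinear vec.scale_right_distrib mult.commute)

lemma wtD: "x \<in> \<W> \<alpha> ==> h \<in> H ==> br h x = \<alpha> h *s x" by (simp add: root_space_def)

lemma wt_cong: "(\<And>h. h \<in> H ==> \<alpha> h = \<beta> h) ==> \<W> \<alpha> = \<W> \<beta>"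
 by (auto simp: root_space_def)

lemma br_wt: "x \<in> \<W> \<alpha> ==> y \<in> \<W> \<beta> ==> br x y \<in> \<W> (\<lambda>h. \<alpha> h + \<beta> h)"
 by (auto simp: root_space_def jacobi[of _ x y] br_bilinear vec.scale_left_distrib)

lemma wt_linear:
 assumes "x \<in> \<W> \<alpha>" "x \<noteq> 0"
 shows "h \<in> H ==> k \<in> H ==> \<alpha> (h + k) = \<alpha> h + \<alpha> k" "h \<in> H ==> \<alpha> (c *s h) = c * \<alpha> h"
proof -
 assume hk: "h \<in> H" "k \<in> H"
 then have "h + k \<in> H" using H_subspace by (simp add: vec.subspace_add)
 then have "br (h + k) x = \<alpha> (h + k) *s x" by (rule wtD[OF assms(1)])
 moreover have "br (h + k) x = (\<alpha> h + \<alpha> k) *s x"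
  using hk by (simp add: wtD[OF assms(1)] br_bilinear vec.scale_left_distrib)
 ultimately have "\<alpha> (h + k) *s x = (\<alpha> h + \<alpha> k) *s x" by simp
 then show "\<alpha> (h + k) = \<alpha> h + \<alpha> k" using assms(2) by (metis vec.scale_cancel_right)
next
 assume h: "h \<in> H"
 then have "c *s h \<in> H" using H_subspace by (simp add: vec.subspace_scale)
 then have "br (c *s h) x = \<alpha> (c *s h) *s x" by (rule wtD[OF assms(1)])
 moreover have "br (c *s h) x = (c * \<alpha> h) *s x" using h by (simp add: wtD[OF assms(1)] br_bilinear)
 ultimately have "\<alpha> (c *s h) *s x = (c * \<alpha> h) *s x" by (rule trans[OF sym])
 then show "\<alpha> (c *s h) = c * \<alpha> h" using assms(2) by (metis vec.scale_cancel_right)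
qed

lemma root_of_wt:
 assumes "x \<in> \<W> \<alpha>" "x \<noteq> 0" "h \<in> H" "\<alpha> h \<noteq> 0"
 shows "restrict \<alpha> H \<in> roots br H"
proof -
 have "\<W> (restrict \<alpha> H) = \<W> \<alpha>" by (rule wt_cong) simp
 then show ?thesis
  using assms wt_linear[OF assms(1,2)] H_subspace
  by (auto simp: roots_def linear_forms_def vec.subspace_add vec.subspace_scale)
qed

text \<open>Simultaneous diagonalisation handles finitely many operators, so it is applied to a
  basis T of H; a joint eigenvector of T is one of all of H by linearity.\<close>

lemma stable_span_weights:
 assumes S: "vec.subspace S" and HS: "\<And>h x. h \<in> H ==> x \<in> S ==> br h x \<in> S"
 shows "S \<subseteq> vec.span {x\<in>S. \<exists>\<alpha>. x \<in> \<W> \<alpha>}"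
proof -
 obtain T where T: "T \<subseteq> H" "vec.independent T" "H \<subseteq> vec.span T"
  by (rule vec.maximal_independent_subset)
 have fin: "finite T" using T(2) by (rule vec_finite_independent)
 have "S \<subseteq> vec.span {x\<in>S. \<forall>t\<in>T. \<exists>c. br t x = c *s x}"
 proof (rule stable_span_joint_eigen[where T=br, OF fin])
  show "br i (br j x) = br j (br i x)" if "i \<in> T" "j \<in> T" for i j x
   using that T(1) by (intro H_br_comm) auto
 qed (use T S HS H_diag br_linear in auto)
 also have "\<dots> \<subseteq> vec.span {x\<in>S. \<exists>\<alpha>. x \<in> \<W> \<alpha>}"
 proof (rule vec.span_mono, safe)
  fix x assume x: "x \<in> S" "\<forall>t\<in>T. \<exists>c. br t x = c *s x"
  have "\<exists>c. br h x = c *s x" if "h \<in> H" for h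
  proof -
   have "h \<in> vec.span T" using that T by auto
   then show ?thesis
   proof (induction rule: vec.span_induct_alt)
    case base
    then show ?case by (intro exI[of _ 0]) simp
   next
    case (step a t h)
    then obtain c d where "br t x = c *s x" "br h x = d *s x" using x by blast
    then have "br (a *s t + h) x = (a * c + d) *s x" by (simp add: br_bilinear vec.scale_left_distrib)
    then show ?case by blast
   qed
  qed
  \<comment> \<open>The weight is a choice of one eigenvalue for each element of H; for x = 0 the
    choice is arbitrary.\<close>
  then have "x \<in> \<W> (\<lambda>h. SOME c. br h x = c *s x)"
   unfolding root_space_def by (auto intro: someI_ex)
  then show "\<exists>\<alpha>. x \<in> \<W> \<alpha>" by blast
 qed
 finally show ?thesis .
qed

lemma stable_has_weight:
 assumes S: "vec.subspace S" and HS: "\<And>h x. h \<in> H ==> x \<in> S ==> br h x \<in> S" and nz: "S \<noteq> {0}"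
 obtains x \<alpha> where "x \<in> S" "x \<noteq> 0" "x \<in> \<W> \<alpha>"
proof -
 have "\<exists>x\<in>S. x \<noteq> 0 \<and> (\<exists>\<alpha>. x \<in> \<W> \<alpha>)"
 proof (rule ccontr)
  assume "\<not> ?thesis"
  then have "{x\<in>S. \<exists>\<alpha>. x \<in> \<W> \<alpha>} \<subseteq> {0}" by auto
  then have "vec.span {x\<in>S. \<exists>\<alpha>. x \<in> \<W> \<alpha>} \<subseteq> {0}" by (rule vec.span_minimal) simp
  then show False using stable_span_weights[OF S HS] nz vec.subspace_0[OF S] by blast
 qed
 then show ?thesis using that by blast
qed

lemma weights_span: "vec.span {x. \<exists>\<alpha>. x \<in> \<W> \<alpha>} = UNIV"
 using stable_span_weights[of UNIV] vec.subspace_UNIV by auto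

lemma weight_basis:
 obtains B w where "vec.independent B" "vec.span B = UNIV" "\<And>b. b \<in> B ==> b \<in> \<W> (w b)"
proof -
 obtain B where B: "B \<subseteq> {x. \<exists>\<alpha>. x \<in> \<W> \<alpha>}" "vec.independent B" "vec.span B = UNIV"
  by (rule vec_basis_exists[OF weights_span])
 then have "\<forall>b\<in>B. \<exists>\<alpha>. b \<in> \<W> \<alpha>" by blast
 then obtain w where "\<forall>b\<in>B. b \<in> \<W> (w b)" by (metis (no_types))
 with B that show ?thesis by blast
qed

text \<open>Applying h multiplies the coefficient at b by \<open>w b h\<close>, while x as a whole
  is multiplied by c; independence compares the two expansions.\<close>

lemma representation_weight:
 assumes ind: "vec.independent B" and sp: "vec.span B = UNIV" and w: "\<And>b. b \<in> B ==> b \<in> \<W> (w b)"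
  and h: "h \<in> H" and x: "br h x = c *s x" and b: "b \<in> B" "w b h \<noteq> c"
 shows "vec.representation B x b = 0"
proof -
 let ?r = "vec.representation B x"
 have fin: "finite B" by (rule vec_finite_independent[OF ind])
 have exp: "x = (\<Sum>b\<in>B. ?r b *s b)"
  using vec.sum_representation_eq[OF ind _ fin subset_refl, of x] sp by simp
 have "br h x = (\<Sum>b\<in>B. (?r b * w b h) *s b)"
  by (subst exp) (simp add: br_sum_right br_scale_right wtD[OF w h] cong: sum.cong)
 moreover have "c *s x = (\<Sum>b\<in>B. (c * ?r b) *s b)"
  by (subst exp) (simp add: vec.scale_sum_right)
 ultimately have "(\<Sum>b\<in>B. (?r b * w b h - c * ?r b) *s b) = 0"
  using x by (simp add: vec.scale_left_diff_distrib sum_subtractf)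
 then have "?r b * w b h - c * ?r b = 0"
  using vec.independentD[OF ind fin subset_refl, of "\<lambda>b. ?r b * w b h - c * ?r b" b] b by simp
 then show ?thesis using b(2) by (simp add: algebra_simps)
qed

lemma finite_eigenvalues:
 assumes h: "h \<in> H" shows "finite {c. \<exists>x. x \<noteq> 0 \<and> br h x = c *s x}"
proof -
 obtain B w where B: "vec.independent B" "vec.span B = UNIV" "\<And>b. b \<in> B ==> b \<in> \<W> (w b)"
  by (rule weight_basis) blast
 have fin: "finite B" by (rule vec_finite_independent[OF B(1)])
 have "{c. \<exists>x. x \<noteq> 0 \<and> br h x = c *s x} \<subseteq> (\<lambda>b. w b h) ` B"
 proof safe
  fix c x assume x: "x \<noteq> 0" "br h x = c *s x"
  show "c \<in> (\<lambda>b. w b h) ` B"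
  proof (rule ccontr)
   assume "c \<notin> (\<lambda>b. w b h) ` B"
   then have "vec.representation B x b = 0" if "b \<in> B" for b
    using representation_weight[OF B h x(2) that] that by auto
   then have "(\<Sum>b\<in>B. vec.representation B x b *s b) = 0" by simp
   then show False using vec.sum_representation_eq[OF B(1) _ fin subset_refl, of x] B(2) x(1) by simp
  qed
 qed
 then show ?thesis using fin finite_subset by blast
qed

text \<open>In a weight basis such an operator has no diagonal coefficients, since it changes the
  eigenvalue of h.\<close>

lemma trace_shift:
 assumes A: "\<And>\<alpha> x. x \<in> \<W> \<alpha> ==> A *v x \<in> \<W> (\<lambda>h. \<alpha> h + \<mu> h)" and h: "h \<in> H" "\<mu> h \<noteq> 0"
 shows "trace A = 0"
proof -
 obtain B w where B: "vec.independent B" "vec.span B = UNIV" "\<And>b. b \<in> B ==> b \<in> \<W> (w b)"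
  by (rule weight_basis) blast
 have "vec.representation B (A *v b) b = 0" if "b \<in> B" for b
  using representation_weight[OF B h(1) wtD[OF A[OF B(3)[OF that]] h(1)] that] h by simp
 then show ?thesis using trace_representation[OF B(1,2), of A] by simp
qed

lemma killing_wt:
 assumes "x \<in> \<W> \<alpha>" "y \<in> \<W> \<beta>" "h \<in> H" "\<alpha> h + \<beta> h \<noteq> 0" shows "killing x y = 0"
 unfolding killing_def
proof (rule trace_shift[where \<mu>="\<lambda>h. \<alpha> h + \<beta> h" and h=h, OF _ assms(3,4)])
 fix \<delta> z assume "z \<in> \<W> \<delta>"
 then have "br x (br y z) \<in> \<W> (\<lambda>h. \<alpha> h + (\<beta> h + \<delta> h))" using assms br_wt by blast
 then show "(matrix (br x) ** matrix (br y)) *v z \<in> \<W> (\<lambda>h. \<delta> h + (\<alpha> h + \<beta> h))"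
  by (simp add: matrix_vector_mul_assoc[symmetric] algebra_simps)
qed

lemma H_eq_0_of_weights:
 assumes s: "s \<in> H" and z: "\<And>x \<alpha>. x \<in> \<W> \<alpha> ==> x \<noteq> 0 ==> \<alpha> s = 0" shows "s = 0"
proof (rule center_trivial)
 fix y
 have "y \<in> vec.span {x. \<exists>\<alpha>. x \<in> \<W> \<alpha>}" using weights_span by simp
 then show "br s y = 0"
 proof (induction rule: vec.span_induct_alt)
  case (step c x y)
  then obtain \<alpha> where x: "x \<in> \<W> \<alpha>" by auto
  have "br s x = 0" using wtD[OF x s] z[OF x] by (cases "x = 0") auto
  then show ?case using step by (simp add: br_bilinear)
 qed simp
qed

text \<open>The traces are the power sums of the eigenvalues of s in a weight basis. By
  \<open>power_sums_eq_0\<close> these eigenvalues vanish, so s is central.\<close>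

lemma H_eq_0_of_traces:
 assumes s: "s \<in> H" and tr: "\<And>k. k \<ge> 1 ==> trace (matpow (matrix (br s)) k) = 0"
 shows "s = 0"
proof -
 obtain B w where B: "vec.independent B" "vec.span B = UNIV" "\<And>b. b \<in> B ==> b \<in> \<W> (w b)"
  by (rule weight_basis) blast
 have fin: "finite B" by (rule vec_finite_independent[OF B(1)])
 have pow: "matpow (matrix (br s)) k *v x = (\<alpha> s) ^ k *s x" if "x \<in> \<W> \<alpha>" for x \<alpha> k
  unfolding matpow_vector using that s by (induction k) (simp_all add: wtD br_scale_right mult.commute)
 have "trace (matpow (matrix (br s)) k) = (\<Sum>b\<in>B. (w b s) ^ k)" for k
  unfolding trace_representation[OF B(1,2)]
  by (intro sum.cong refl)
    (simp add: pow[OF B(3)] vec.representation_scale[OF B(1)] B(2) vec.representation_basis[OF B(1)])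
 then have w0: "w b s = 0" if "b \<in> B" for b
  using power_sums_eq_0[OF fin, of "\<lambda>b. w b s"] tr that by simp
 have "br s y = 0" for y
 proof -
  have "y \<in> vec.span B" using B(2) by simp
  then show ?thesis
  proof (induction rule: vec.span_induct_alt)
   case (step c b y)
   then show ?case using wtD[OF B(3) s, of b] w0[of b] by (simp add: br_bilinear)
  qed simp
 qed
 then show ?thesis by (rule center_trivial)
qed

subsection \<open>Representations of sl2\<close>

lemma eigen_funpow:
 assumes "br h x = a *s x" "br h v = c *s v" shows "br h ((br x ^^ j) v) = (c + of_nat j * a) *s (br x ^^ j) v"
proof (induction j)
 case (Suc j)
 then show ?case using assms
  by (simp add: jacobi[of h x] br_bilinear vec.scale_left_distrib algebra_simps)
qed (use assms in simp)

text \<open>Otherwise h would have the infinitely many eigenvalues c + j a.\<close>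

lemma eigen_nilpotent:
 assumes h: "h \<in> H" and x: "br h x = a *s x" "a \<noteq> 0" and v: "br h v = c *s v"
 shows "\<exists>j. (br x ^^ j) v = 0"
proof (rule ccontr)
 assume "\<not> ?thesis"
 then have "range (\<lambda>j::nat. c + of_nat j * a) \<subseteq> {c. \<exists>x. x \<noteq> 0 \<and> br h x = c *s x}"
  using eigen_funpow[OF x(1) v] by auto
 then have "finite (range (\<lambda>j::nat. c + of_nat j * a))" using finite_eigenvalues[OF h] finite_subset by blast
 moreover have "inj (\<lambda>j::nat. c + of_nat j * a)" using x(2) by (auto intro: injI)
 ultimately show False using finite_imageD infinite_UNIV_nat by blast
qed

lemma eigen_top:
 assumes h: "h \<in> H" and x: "br h x = a *s x" "a \<noteq> 0" and v: "br h v = c *s v" "v \<noteq> 0"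
 obtains m where "\<And>j. j \<le> m ==> (br x ^^ j) v \<noteq> 0" "(br x ^^ Suc m) v = 0"
proof -
 define n where "n = (LEAST j. (br x ^^ j) v = 0)"
 have n: "(br x ^^ n) v = 0" unfolding n_def using eigen_nilpotent[OF h x v(1)] by (rule LeastI_ex)
 have less: "(br x ^^ j) v \<noteq> 0" if "j < n" for j using that unfolding n_def by (rule not_less_Least)
 have "n \<noteq> 0" using n v(2) by (cases n) auto
 then obtain m where "n = Suc m" by (cases n) auto
 with n less that show ?thesis by (metis less_Suc_eq_le)
qed

lemma lowest_weight:
 assumes h: "h \<in> H" and sl: "sl2 x h y" and v: "br h v = c *s v" "v \<noteq> 0" and low: "br y v = 0"
 obtains m where "c = - of_nat m" "\<And>j. j \<le> m ==> (br x ^^ j) v \<noteq> 0" "(br x ^^ Suc m) v = 0"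
proof -
 have rel: "br h x = 2 *s x" "br h y = (-2) *s y" "br x y = h" using sl by (auto simp: sl2_def)
 obtain m where m: "\<And>j. j \<le> m ==> (br x ^^ j) v \<noteq> 0" "(br x ^^ Suc m) v = 0"
  by (rule eigen_top[OF h rel(1) _ v]) auto
 \<comment> \<open>The commutation formula along an sl2-string. At the top of the string, j = m, its
   left side is zero, and this determines c.\<close>
 have "br y ((br x ^^ Suc j) v) = (- (of_nat (Suc j) * (c + of_nat j))) *s (br x ^^ j) v" for j
 proof (induction j)
  case 0
  then show ?case using v low rel by (simp add: jacobi[of y x] br_skew[of y x] br_bilinear)
 next
  case (Suc j)
  let ?u = "(br x ^^ Suc j) v"
  have "br y (br x ?u) = - br h ?u + br x (br y ?u)"
   using rel by (simp add: jacobi[of y x] br_skew[of y x] br_bilinear)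
  also have "\<dots> = (- (c + of_nat (Suc j) * 2) - of_nat (Suc j) * (c + of_nat j)) *s ?u"
   unfolding Suc eigen_funpow[OF rel(1) v(1)] by (simp add: br_bilinear vec.scale_left_diff_distrib)
  also have "(- (c + of_nat (Suc j) * 2) - of_nat (Suc j) * (c + of_nat j)) = - (of_nat (Suc (Suc j)) * (c + of_nat (Suc j)))"
   by (simp add: algebra_simps)
  finally show ?case by simp
 qed
 from this[of m] have "(- (of_nat (Suc m) * (c + of_nat m))) *s (br x ^^ m) v = 0" using m(2) by simp
 then have "of_nat (Suc m) * (c + of_nat m) = 0" using m(1)[of m] by (simp del: of_nat_Suc)
 then have "c = - of_nat m" by (simp only: mult_eq_0_iff of_nat_eq_0_iff) (simp add: eq_neg_iff_add_eq_0)
 then show ?thesis using m that by blast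
qed

lemma highest_weight:
 assumes h: "h \<in> H" and sl: "sl2 x h y" and v: "br h v = c *s v" "v \<noteq> 0" and high: "br x v = 0"
 obtains m where "c = of_nat m" "\<And>j. j \<le> m ==> (br y ^^ j) v \<noteq> 0" "(br y ^^ Suc m) v = 0"
proof -
 have "- h \<in> H" using h H_subspace by (rule vec.subspace_neg[rotated])
 moreover have "br (- h) v = (- c) *s v" using v by (simp add: br_bilinear)
 ultimately show ?thesis using lowest_weight[OF _ sl2_flip[OF sl] _ v(2) high, of "-c"] that by (metis neg_equal_iff_equal)
qed

text \<open>Raising v until the next step gives zero produces a highest weight vector; its weight is
  a natural number and differs from c by an even integer.\<close>

lemma eigen_integer:
 assumes h: "h \<in> H" and sl: "sl2 x h y" and v: "br h v = c *s v" "v \<noteq> 0"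
 obtains i where "c = of_int i"
proof -
 have rel: "br h x = 2 *s x" using sl by (auto simp: sl2_def)
 obtain m where m: "\<And>j. j \<le> m ==> (br x ^^ j) v \<noteq> 0" "(br x ^^ Suc m) v = 0"
  by (rule eigen_top[OF h rel _ v]) auto
 obtain n where "c + of_nat m * 2 = of_nat n"
  by (rule highest_weight[OF h sl eigen_funpow[OF rel v(1), of m]]) (use m in auto)
 then have "c = of_int (int n - 2 * int m)" by (simp add: algebra_simps)
 then show ?thesis by (rule that)
qed

end

section \<open>The contact grading\<close>

text \<open>That the highest root space is a line is taken as a hypothesis: it provides the first
  sl2-triple at a stage where one-dimensionality of root spaces in general, which rests on the
  Killing form, is not yet available.\<close>

locale contact_lie = cartan_lie br H
 for br :: "complex^'d \<Rightarrow> complex^'d \<Rightarrow> complex^'d" and H :: "(complex^'d) set" +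
 fixes \<Delta> :: "(complex^'d \<Rightarrow> complex) set" and \<gamma> :: "complex^'d \<Rightarrow> complex" and h :: "complex^'d"
 assumes base: "root_base br H \<Delta>" and highest: "highest_root br H \<Delta> \<gamma>"
  and coroot: "is_coroot br H \<gamma> h" and dim_highest: "vec.dim (root_space br H \<gamma>) = 1"
begin

lemma h_H [simp]: "h \<in> H" and \<gamma>_h [simp]: "\<gamma> h = 2" using coroot by (auto simp: is_coroot_def)

definition ee :: "complex^'d" where "ee = (SOME e. e \<noteq> 0 \<and> \<W> \<gamma> = range (\<lambda>c. c *s e))"

lemma ee: "ee \<noteq> 0" "\<W> \<gamma> = range (\<lambda>c. c *s ee)"
proof -
 obtain B where B: "B \<subseteq> \<W> \<gamma>" "vec.independent B" "\<W> \<gamma> \<subseteq> vec.span B" "card B = vec.dim (\<W> \<gamma>)"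
  by (rule vec.basis_exists)
 then obtain e where e: "B = {e}" using dim_highest by (auto simp: card_1_singleton_iff)
 have "vec.span B = \<W> \<gamma>" using B wt_subspace vec.span_minimal by blast
 then have "\<W> \<gamma> = range (\<lambda>c. c *s e)" using e by (simp add: vec.span_singleton)
 moreover have "e \<noteq> 0" using B(2) e vec.dependent_zero by auto
 ultimately have "\<exists>e. e \<noteq> 0 \<and> \<W> \<gamma> = range (\<lambda>c. c *s e)" by blast
 from someI_ex[OF this] show "ee \<noteq> 0" "\<W> \<gamma> = range (\<lambda>c. c *s ee)" unfolding ee_def by auto
qed

lemma ee_wt: "ee \<in> \<W> \<gamma>" unfolding ee(2) by (rule range_eqI[of _ _ 1]) simp

text \<open>The coroot is only a linear combination of brackets by definition. If the root space is
  spanned by x, each bracket has x on the left up to a factor, and bilinearity collects the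
  right-hand entries into one vector.\<close>

lemma coroot_bracket:
 assumes co: "is_coroot br H \<alpha> k" and x: "\<And>x'. x' \<in> \<W> \<alpha> ==> \<exists>c. x' = c *s x"
 shows "\<exists>y. y \<in> \<W> (\<lambda>k. - \<alpha> k) \<and> br x y = k"
proof -
 have "k \<in> vec.span {br x y | x y. x \<in> \<W> \<alpha> \<and> y \<in> \<W> (\<lambda>k. - \<alpha> k)}"
  using co by (auto simp: is_coroot_def)
 then show ?thesis
 proof (induction rule: vec.span_induct_alt)
  case base
  show ?case by (intro exI[of _ 0]) (use wt_subspace vec.subspace_0 in auto)
 next
  case (step a z w)
  then obtain x' y' y where z: "z = br x' y'" "x' \<in> \<W> \<alpha>" "y' \<in> \<W> (\<lambda>k. - \<alpha> k)"
   and y: "y \<in> \<W> (\<lambda>k. - \<alpha> k)" "br x y = w" by blast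
  obtain c where c: "x' = c *s x" using x z(2) by blast
  have "(a * c) *s y' + y \<in> \<W> (\<lambda>k. - \<alpha> k)"
   using z(3) y(1) wt_subspace by (simp add: vec.subspace_add vec.subspace_scale)
  moreover have "br x ((a * c) *s y' + y) = a *s z + w" using z(1) c y(2) by (simp add: br_bilinear)
  ultimately show ?case by blast
 qed
qed

definition ff :: "complex^'d" where "ff = (SOME f. f \<in> \<W> (\<lambda>k. - \<gamma> k) \<and> br ee f = h)"

lemma ff_wt: "ff \<in> \<W> (\<lambda>k. - \<gamma> k)" and ee_ff: "br ee ff = h"
proof -
 have "\<exists>f. f \<in> \<W> (\<lambda>k. - \<gamma> k) \<and> br ee f = h"
  by (rule coroot_bracket[OF coroot]) (use ee(2) in auto)
 from someI_ex[OF this] show "ff \<in> \<W> (\<lambda>k. - \<gamma> k)" "br ee ff = h" unfolding ff_def by auto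
qed

lemma sl2_h: "sl2 ee h ff"
 unfolding sl2_def using wtD[OF ee_wt h_H] wtD[OF ff_wt h_H] ee_ff by simp

lemma h_nz: "h \<noteq> 0"
 using wtD[OF ee_wt h_H] ee(1) by auto

lemma ff_nz: "ff \<noteq> 0" using ee_ff h_nz by auto

text \<open>By the theory of sl2 all eigenvalues of h are integers, so the trace of the square of ad
  h is a sum of squares of integers; the eigenvalue 2 of \<open>ee\<close> makes it
  positive.\<close>

lemma killing_h: "killing h h \<noteq> 0"
proof -
 obtain B w where B: "vec.independent B" "vec.span B = UNIV" "\<And>b. b \<in> B ==> b \<in> \<W> (w b)"
  by (rule weight_basis) blast
 have fin: "finite B" by (rule vec_finite_independent[OF B(1)])
 have b0: "b \<noteq> 0" if "b \<in> B" for b using that B(1) vec.dependent_zero by auto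
 have "\<forall>b\<in>B. \<exists>i. w b h = of_int i"
  using eigen_integer[OF h_H sl2_h wtD[OF B(3) h_H] b0] by metis
 then obtain n where n: "\<And>b. b \<in> B ==> w b h = of_int (n b)" by metis
 have "killing h h = (\<Sum>b\<in>B. (w b h)\<^sup>2)"
  unfolding killing_def trace_representation[OF B(1,2)]
  by (intro sum.cong refl)
    (simp add: matrix_vector_mul_assoc[symmetric] wtD[OF B(3) h_H] br_scale_right power2_eq_square
     vec.representation_scale[OF B(1)] B(2) vec.representation_basis[OF B(1)])
 also have "\<dots> = of_int (\<Sum>b\<in>B. (n b)\<^sup>2)" using n by simp
 finally have K: "killing h h = of_int (\<Sum>b\<in>B. (n b)\<^sup>2)" .
 have "\<exists>b\<in>B. w b h = 2"
 proof (rule ccontr)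
  assume "\<not> ?thesis"
  then have "vec.representation B ee b = 0" if "b \<in> B" for b
   using representation_weight[OF B h_H, of ee 2 b] wtD[OF ee_wt h_H] that by auto
  then show False using vec.sum_representation_eq[OF B(1) _ fin subset_refl, of ee] B(2) ee(1) by simp
 qed
 then obtain b where b: "b \<in> B" "w b h = 2" by blast
 then have "complex_of_int (n b) = 2" using n by metis
 then have "(n b)\<^sup>2 > 0" by (metis of_int_0 zero_less_power2 zero_neq_numeral)
 moreover have "(n b)\<^sup>2 \<le> (\<Sum>b\<in>B. (n b)\<^sup>2)" by (rule member_le_sum) (use b fin in auto)
 ultimately show ?thesis unfolding K by (metis less_le_trans of_int_eq_0_iff order_less_irrefl)
qed

lemma killing_nondeg: "(\<And>y. killing x y = 0) ==> x = 0"
 using killing_nondegenerate[OF killing_h] by blast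

lemma killing_right_add: "killing z (x + y) = killing z x + killing z y"
 and killing_right_scale: "killing z (c *s x) = c * killing z x"
 using killing_add[of x y z] killing_scale[of c x z] by (simp_all add: killing_sym)

lemma killing_weight_span:
 assumes "\<And>y \<alpha>. y \<in> \<W> \<alpha> ==> killing x y = 0" shows "x = 0"
proof (rule killing_nondeg)
 fix y
 have "y \<in> vec.span {x. \<exists>\<alpha>. x \<in> \<W> \<alpha>}" using weights_span by simp
 then show "killing x y = 0"
 proof (induction rule: vec.span_induct_alt)
  case base
  show ?case using killing_right_scale[of x 0 0] by simp
 qed (use assms in \<open>auto simp: killing_right_add killing_right_scale\<close>)
qed

lemma br_opposite_H:
 assumes "x \<in> \<W> \<alpha>" "y \<in> \<W> (\<lambda>k. - \<alpha> k)" shows "br x y \<in> H"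
 using br_wt[OF assms] by (intro H_self) (simp add: root_space_def)

lemma killing_br_H:
 assumes "y \<in> \<W> (\<lambda>k. - \<alpha> k)" "k \<in> H" shows "killing (br x y) k = \<alpha> k * killing x y"
proof -
 have "br y k = \<alpha> k *s y" using wtD[OF assms] br_skew[of y k] by simp
 then show ?thesis by (simp add: killing_invariant killing_right_scale)
qed

lemma H_killing:
 assumes "x \<in> H" "\<And>k. k \<in> H ==> killing x k = 0" shows "x = 0"
proof (rule killing_weight_span)
 have x0: "x \<in> \<W> (\<lambda>_. 0)" using H_comm assms(1) by (simp add: root_space_def)
 fix y \<alpha> assume y: "y \<in> \<W> \<alpha>"
 show "killing x y = 0"
 proof (cases "\<forall>k\<in>H. \<alpha> k = 0")
  case True
  then have "y \<in> H" using y by (intro H_self) (simp add: root_space_def)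
  then show ?thesis by (rule assms(2))
 next
  case False
  then show ?thesis using killing_wt[OF x0 y] by auto
 qed
qed

text \<open>The bracket lies in H, its Killing product with k is
  \<open>\<alpha> k * killing x y\<close>, and the form is nondegenerate on H.\<close>

lemma br_opposite_eq_0:
 assumes x: "x \<in> \<W> \<alpha>" and y: "y \<in> \<W> (\<lambda>k. - \<alpha> k)" and K: "killing x y = 0" shows "br x y = 0"
 using H_killing[OF br_opposite_H[OF x y]] killing_br_H[OF y] K by simp

text \<open>Nondegeneracy gives a weight vector that pairs nontrivially with x, and weights with
  nonzero sum are orthogonal.\<close>

lemma opposite_exists:
 assumes x: "x \<in> \<W> \<alpha>" "x \<noteq> 0" shows "\<exists>y. y \<in> \<W> (\<lambda>k. - \<alpha> k) \<and> killing x y \<noteq> 0"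
proof -
 obtain y \<beta> where y: "y \<in> \<W> \<beta>" "killing x y \<noteq> 0" using killing_weight_span x by blast
 then have "\<And>k. k \<in> H ==> \<beta> k = - \<alpha> k"
  using killing_wt[OF x(1) y(1)] by (metis add.commute add.inverse_inverse eq_neg_iff_add_eq_0)
 then have "y \<in> \<W> (\<lambda>k. - \<alpha> k)" using y(1) wt_cong[of \<beta> "\<lambda>k. - \<alpha> k"] by simp
 then show ?thesis using y by blast
qed

text \<open>If \<open>\<alpha> t = 0\<close> then \<open>t = [x, y]\<close> commutes with \<open>x\<close>, so all powers of \<open>ad t\<close> are traceless.\<close>
lemma opposite_bracket_nonzero:
 assumes x: "x \<in> \<W> \<alpha>" and y: "y \<in> \<W> (\<lambda>k. - \<alpha> k)" and t: "br x y \<noteq> 0"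
 shows "\<alpha> (br x y) \<noteq> 0"
proof
 let ?t = "br x y" let ?T = "matrix (br ?t)" let ?X = "matrix (br x)" let ?Y = "matrix (br y)"
 assume "\<alpha> ?t = 0"
 have tH: "?t \<in> H" by (rule br_opposite_H[OF x y])
 have "br ?t x = 0" using wtD[OF x tH] \<open>\<alpha> ?t = 0\<close> by simp
 then have comm1: "?T ** ?X = ?X ** ?T" 
 proof -
  have "matrix (br 0) = 0" by (simp add: matrix_eq)
  then show ?thesis using ad_br[of ?t x] \<open>br ?t x = 0\<close> by simp
 qed
 have comm: "matpow ?T j ** ?X = ?X ** matpow ?T j" for j
  by (induction j) (simp_all add: matpow_0 matpow_Suc, metis comm1 matrix_mul_assoc)
 have "trace (matpow ?T k) = 0" if "k \<ge> 1" for k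
 proof -
  obtain j where k: "k = Suc j" using \<open>k \<ge> 1\<close> by (cases k) auto
  have "matpow ?T k = matpow ?T j ** ?T"
   unfolding k by (induction j) (simp_all add: matpow_0 matpow_Suc matrix_mul_assoc)
  also have "\<dots> = matpow ?T j ** ?X ** ?Y - matpow ?T j ** ?Y ** ?X"
   by (simp add: ad_br matrix_mult_diff_right matrix_mul_assoc)
  finally have T: "matpow ?T k = matpow ?T j ** ?X ** ?Y - matpow ?T j ** ?Y ** ?X" .
  have "trace (matpow ?T j ** ?Y ** ?X) = trace (?X ** (matpow ?T j ** ?Y))" by (rule trace_mul_sym)
  also have "?X ** (matpow ?T j ** ?Y) = matpow ?T j ** ?X ** ?Y"
   unfolding comm by (rule matrix_mul_assoc)
  finally show ?thesis unfolding T trace_sub by simp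
 qed
 then show False using H_eq_0_of_traces[OF tH] t by blast
qed

lemma root_triple:
 assumes x: "x \<in> \<W> \<alpha>" "x \<noteq> 0" and k0: "k0 \<in> H" "\<alpha> k0 \<noteq> 0"
 obtains y k where "y \<in> \<W> (\<lambda>k. - \<alpha> k)" "y \<noteq> 0" "k \<in> H" "\<alpha> k = 2" "sl2 x k y"
proof -
 obtain y where y: "y \<in> \<W> (\<lambda>k. - \<alpha> k)" "killing x y \<noteq> 0" using opposite_exists[OF x] by blast
 let ?t = "br x y"
 have tH: "?t \<in> H" by (rule br_opposite_H[OF x(1) y(1)])
 have "killing ?t k0 \<noteq> 0" using killing_br_H[OF y(1) k0(1)] y(2) k0(2) by simp
 then have "?t \<noteq> 0" using killing_scale[of 0 0 k0] by auto
 then have \<alpha>t: "\<alpha> ?t \<noteq> 0" by (rule opposite_bracket_nonzero[OF x(1) y(1)])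
 \<comment> \<open>The scaling of y that gives its bracket with x the value 2 under
   \<alpha>.\<close>
 let ?c = "2 / \<alpha> ?t" let ?y = "?c *s y" let ?k = "?c *s ?t"
 have kH: "?k \<in> H" using tH H_subspace by (simp add: vec.subspace_scale)
 have \<alpha>k: "\<alpha> ?k = 2" using wt_linear(2)[OF x tH] \<alpha>t by simp
 have yw: "?y \<in> \<W> (\<lambda>k. - \<alpha> k)" using y(1) wt_subspace by (simp add: vec.subspace_scale)
 have "br x ?y = ?k" by (simp add: br_bilinear)
 then have "sl2 x ?k ?y" unfolding sl2_def using wtD[OF x(1) kH] wtD[OF yw kH] \<alpha>k by simp
 moreover have "?y \<noteq> 0" using \<open>?t \<noteq> 0\<close> \<alpha>t by auto
 ultimately show ?thesis using that yw kH \<alpha>k by blast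
qed

text \<open>Subtracting from x' the multiple of x with the same Killing product with y leaves a
  vector z that y annihilates. If z were nonzero, it would be a lowest weight vector of weight 2,
  but lowest weights are not positive.\<close>

lemma root_space_one_dim:
 assumes x: "x \<in> \<W> \<alpha>" "x \<noteq> 0" and k0: "k0 \<in> H" "\<alpha> k0 \<noteq> 0" and x': "x' \<in> \<W> \<alpha>"
 shows "\<exists>c. x' = c *s x"
proof -
 obtain y k where y: "y \<in> \<W> (\<lambda>k. - \<alpha> k)" "k \<in> H" "\<alpha> k = 2" "sl2 x k y" by (rule root_triple[OF x k0])
 have "br x y \<noteq> 0" using y wt_linear(2)[OF x y(2), of 0] H_subspace by (auto simp: sl2_def)
 then have K: "killing x y \<noteq> 0" using br_opposite_eq_0[OF x(1) y(1)] by blast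
 let ?c = "killing x' y / killing x y" let ?z = "x' - ?c *s x"
 have z: "?z \<in> \<W> \<alpha>" using x(1) x' wt_subspace by (simp add: vec.subspace_diff vec.subspace_scale)
 have "killing ?z y = 0" using K by (simp add: killing_diff killing_scale)
 then have "br ?z y = 0" by (rule br_opposite_eq_0[OF z y(1)])
 then have yz: "br y ?z = 0" using br_skew[of y ?z] by simp
 have "?z = 0"
 proof (rule ccontr)
  assume "?z \<noteq> 0"
  from lowest_weight[OF y(2,4) wtD[OF z y(2)] this yz] obtain m where "\<alpha> k = - of_nat m" by metis
  then have "(2 :: complex) + of_nat m = 0" using y(3) by (metis eq_neg_iff_add_eq_0)
  then have "of_nat (2 + m) = (0 :: complex)" by simp
  then show False by (simp only: of_nat_eq_0_iff)
 qed
 then show ?thesis by auto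
qed

end

section \<open>Eigenvalues of the coroot and the contact grading\<close>

context contact_lie
begin

lemma wt_funpow: "y \<in> \<W> \<beta> ==> v \<in> \<W> \<alpha> ==> (br y ^^ j) v \<in> \<W> (\<lambda>k. \<alpha> k + of_nat j * \<beta> k)"
proof (induction j)
 case (Suc j)
 then have "br y ((br y ^^ j) v) \<in> \<W> (\<lambda>k. \<beta> k + (\<alpha> k + of_nat j * \<beta> k))" by (intro br_wt) auto
 then show ?case by (simp add: algebra_simps)
qed simp

lemma below_highest:
 assumes "x \<in> \<W> \<alpha>" "x \<noteq> 0" "k0 \<in> H" "\<alpha> k0 \<noteq> 0"
 obtains m :: "(complex^'d \<Rightarrow> complex) \<Rightarrow> nat" where "\<And>k. k \<in> H ==> \<gamma> k - \<alpha> k = (\<Sum>\<beta>\<in>\<Delta>. of_nat (m \<beta>) * \<beta> k)"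
proof -
 have "\<exists>m::(complex^'d \<Rightarrow> complex) \<Rightarrow> nat. \<forall>k\<in>H. \<gamma> k - restrict \<alpha> H k = (\<Sum>\<beta>\<in>\<Delta>. of_nat (m \<beta>) * \<beta> k)"
  using highest root_of_wt[OF assms] unfolding highest_root_def by blast
 then show ?thesis using that by auto
qed

lemma finite_\<Delta>: "finite \<Delta>" using base by (simp add: root_base_def)

lemma \<Delta>_independent: "(\<And>k. k \<in> H ==> (\<Sum>\<beta>\<in>\<Delta>. c \<beta> * \<beta> k) = 0) ==> \<beta> \<in> \<Delta> ==> c \<beta> = 0"
 using base unfolding root_base_def by blast

text \<open>The root \<open>\<alpha> - M \<gamma>\<close> is the image of \<open>\<alpha>\<close> under the reflection in \<open>\<gamma>\<close>; comparing its negative with the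
 highest root forces \<open>\<alpha> = \<gamma>\<close>.\<close>
lemma extreme_weight:
 assumes v: "v \<in> \<W> \<alpha>" "v \<noteq> 0" and M: "\<alpha> h = of_int M" "M \<ge> 2" and ev: "br ee v = 0"
 shows "M = 2" "\<And>k. k \<in> H ==> \<alpha> k = \<gamma> k"
proof -
 obtain m where m: "of_int M = (of_nat m :: complex)" "\<And>j. j \<le> m ==> (br ff ^^ j) v \<noteq> 0"
  using highest_weight[OF h_H sl2_h wtD[OF v(1) h_H] v(2) ev] M(1) by metis
 have Mm: "M = int m" using m(1) by (metis of_int_eq_iff of_int_of_nat_eq)
 then have m2: "m \<ge> 2" using M(2) by simp
 let ?u = "(br ff ^^ m) v" let ?\<delta> = "\<lambda>k. \<alpha> k + of_nat m * - \<gamma> k"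
 have u: "?u \<in> \<W> ?\<delta>" "?u \<noteq> 0" using wt_funpow[OF ff_wt v(1)] m(2) by auto
 have "?\<delta> h \<noteq> 0" using M(1) Mm m2 by (simp add: algebra_simps)
 then obtain y where y: "y \<in> \<W> (\<lambda>k. - ?\<delta> k)" "y \<noteq> 0" by (rule root_triple[OF u h_H])
 obtain m1 where m1: "\<And>k. k \<in> H ==> \<gamma> k - - ?\<delta> k = (\<Sum>\<beta>\<in>\<Delta>. of_nat (m1 \<beta>) * \<beta> k)"
  by (rule below_highest[OF y h_H]) (use \<open>?\<delta> h \<noteq> 0\<close> in \<open>auto simp: add_eq_0_iff\<close>)
 obtain m2' where m2': "\<And>k. k \<in> H ==> \<gamma> k - \<alpha> k = (\<Sum>\<beta>\<in>\<Delta>. of_nat (m2' \<beta>) * \<beta> k)"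
  by (rule below_highest[OF v h_H]) (use M in auto)
 obtain m3 where m3: "\<And>k. k \<in> H ==> \<gamma> k - - \<gamma> k = (\<Sum>\<beta>\<in>\<Delta>. of_nat (m3 \<beta>) * \<beta> k)"
  by (rule below_highest[OF ff_wt ff_nz h_H]) auto
 \<comment> \<open>With \<delta> = \<alpha> - m \<gamma>, the combination 2 ((\<gamma> + \<delta>) +
   (\<gamma> - \<alpha>)) + (m - 2) (2 \<gamma>) is zero. As m >= 2, it is a combination of simple
   roots with natural coefficients, each of which must vanish; this kills the coefficients of
   \<gamma> - \<alpha>.\<close>
 have "(\<Sum>\<beta>\<in>\<Delta>. of_nat (2 * (m1 \<beta> + m2' \<beta>) + (m - 2) * m3 \<beta>) * \<beta> k) = 0" if k: "k \<in> H" for k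
 proof -
  have "(\<Sum>\<beta>\<in>\<Delta>. of_nat (2 * (m1 \<beta> + m2' \<beta>) + (m - 2) * m3 \<beta>) * \<beta> k)
   = 2 * ((\<gamma> k - - ?\<delta> k) + (\<gamma> k - \<alpha> k)) + of_nat (m - 2) * (\<gamma> k - - \<gamma> k)"
  proof -
   have "of_nat (2 * (m1 \<beta> + m2' \<beta>) + (m - 2) * m3 \<beta>) * \<beta> k =
    2 * (of_nat (m1 \<beta>) * \<beta> k + of_nat (m2' \<beta>) * \<beta> k) + of_nat (m - 2) * (of_nat (m3 \<beta>) * \<beta> k)" for \<beta>
    by (simp only: of_nat_add of_nat_mult) (simp only: ring_distribs mult.assoc of_nat_numeral)
   then show ?thesis unfolding m1[OF k] m2'[OF k] m3[OF k]
    by (simp only: sum_distrib_left[symmetric] sum.distrib)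
  qed
  also have "\<dots> = 0" using m2 by (simp add: of_nat_diff algebra_simps)
  finally show ?thesis .
 qed
 then have "of_nat (2 * (m1 \<beta> + m2' \<beta>) + (m - 2) * m3 \<beta>) = (0 :: complex)" if "\<beta> \<in> \<Delta>" for \<beta>
  using \<Delta>_independent[of "\<lambda>\<beta>. of_nat (2 * (m1 \<beta> + m2' \<beta>) + (m - 2) * m3 \<beta>)" \<beta>] that by blast
 then have "m2' \<beta> = 0" if "\<beta> \<in> \<Delta>" for \<beta>
  using that by (simp only: of_nat_eq_0_iff) simp
 then show eq: "\<alpha> k = \<gamma> k" if "k \<in> H" for k using m2'[OF that] by simp
 from eq[OF h_H] M(1) have "of_int M = (of_int 2 :: complex)" by simp
 then show "M = 2" by (simp only: of_int_eq_iff)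
qed

text \<open>The eigenspace for the largest integral eigenvalue M is stable under H and so contains a
  weight vector. It is annihilated by \<open>ee\<close>, since M + 2 is no eigenvalue, and
  \<open>extreme_weight\<close> gives M = 2.\<close>

lemma eigen_h_le:
 assumes x: "br h x = of_int i *s x" "x \<noteq> 0" shows "i \<le> 2"
proof -
 let ?Z = "{i::int. \<exists>x. x \<noteq> 0 \<and> br h x = of_int i *s x}"
 have "of_int ` ?Z \<subseteq> {c. \<exists>x. x \<noteq> 0 \<and> br h x = c *s x}" by blast
 then have "finite (complex_of_int ` ?Z)" by (rule finite_subset[OF _ finite_eigenvalues[OF h_H]])
 then have fin: "finite ?Z" by (rule finite_imageD) (simp add: inj_on_def)
 have "2 \<in> ?Z" using ee(1) wtD[OF ee_wt h_H] by auto
 define M where "M = Max ?Z"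
 have M: "M \<in> ?Z" "\<And>i. i \<in> ?Z ==> i \<le> M"
 proof -
  have "?Z \<noteq> {}" using \<open>2 \<in> ?Z\<close> by (rule ex_in_conv[THEN iffD1, OF exI])
  then show "M \<in> ?Z" unfolding M_def by (rule Max_in[OF fin])
  show "\<And>i. i \<in> ?Z ==> i \<le> M" unfolding M_def by (rule Max_ge[OF fin])
 qed
 let ?E = "{x. br h x = of_int M *s x}"
 have "vec.subspace ?E" by (auto simp: vec.subspace_def br_bilinear vec.scale_right_distrib mult.commute)
 moreover have "br k x \<in> ?E" if "k \<in> H" "x \<in> ?E" for k x
  using that H_br_comm[OF h_H that(1)] by (simp add: br_scale_right)
 moreover have "?E \<noteq> {0}" using M(1) by auto
 ultimately obtain v \<alpha> where v: "v \<in> ?E" "v \<noteq> 0" "v \<in> \<W> \<alpha>" by (rule stable_has_weight) blast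
 have "br h v = of_int M *s v" using v(1) by simp
 then have "of_int M *s v = \<alpha> h *s v" using wtD[OF v(3) h_H] by (rule trans[OF sym])
 then have \<alpha>h: "\<alpha> h = of_int M" using v(2) vec.scale_cancel_right by metis
 have "br ee v = 0"
 proof (rule ccontr)
  assume "br ee v \<noteq> 0"
  moreover have "br h (br ee v) = of_int (M + 2) *s br ee v"
   using eigen_funpow[OF wtD[OF ee_wt h_H] wtD[OF v(3) h_H], of 1] \<alpha>h by simp
  ultimately have "M + 2 \<in> ?Z" by blast
  then show False using M(2) by fastforce
 qed
 then have "M = 2" using extreme_weight(1)[OF v(3,2) \<alpha>h] M(2)[OF \<open>2 \<in> ?Z\<close>] by blast
 then show ?thesis using M(2) x by blast
qed

lemma weight_h_integer: "x \<in> \<W> \<alpha> ==> x \<noteq> 0 ==> \<exists>i. \<alpha> h = of_int i"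
 by (rule eigen_integer[OF h_H sl2_h wtD[OF _ h_H]]) auto

text \<open>The bracket of \<open>ee\<close> with x would have eigenvalue 4 and is therefore zero,
  so \<open>extreme_weight\<close> applies.\<close>

lemma weight_h_2:
 assumes x: "x \<in> \<W> \<alpha>" "x \<noteq> 0" "\<alpha> h = 2" and k: "k \<in> H" shows "\<alpha> k = \<gamma> k"
proof -
 have "br h (br ee x) = of_int 4 *s br ee x"
  using eigen_funpow[OF wtD[OF ee_wt h_H] wtD[OF x(1) h_H], of 1] x(3) by simp
 then have "br ee x = 0" using eigen_h_le by fastforce
 then show ?thesis using extreme_weight(2)[OF x(1,2), of 2] x(3) k by simp
qed

lemma weight_h_bounds:
 assumes x: "x \<in> \<W> \<alpha>" "x \<noteq> 0" and i: "\<alpha> h = of_int i" shows "- 2 \<le> i" "i \<le> 2"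
proof -
 show "i \<le> 2" using eigen_h_le[of x i] wtD[OF x(1) h_H] x(2) i by simp
 show "- 2 \<le> i"
 proof (cases "i = 0")
  case False
  then obtain y where y: "y \<in> \<W> (\<lambda>k. - \<alpha> k)" "y \<noteq> 0" using root_triple[OF x h_H] i by auto
  then have "- i \<le> 2" using eigen_h_le[of y "- i"] wtD[OF y(1) h_H] i by simp
  then show ?thesis by simp
 qed simp
qed

abbreviation gr :: "int \<Rightarrow> (complex^'d) set" where "gr \<equiv> grade br h"

lemma gr_iff: "x \<in> gr i \<longleftrightarrow> br h x = of_int i *s x" by (simp add: grade_def)

lemma gr_subspace: "vec.subspace (gr i)"
 by (auto simp: gr_iff vec.subspace_def br_bilinear vec.scale_right_distrib mult.commute)

lemma gr_stable: "k \<in> H ==> x \<in> gr i ==> br k x \<in> gr i"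
 using H_br_comm[OF h_H, of k x] by (simp add: gr_iff br_scale_right)

lemma gr_weights: "gr i \<subseteq> vec.span {x \<in> gr i. \<exists>\<alpha>. x \<in> \<W> \<alpha>}"
 by (rule stable_span_weights[OF gr_subspace gr_stable])

lemma gr_weight: "x \<in> gr i ==> x \<noteq> 0 ==> x \<in> \<W> \<alpha> ==> \<alpha> h = of_int i"
 using wtD[OF _ h_H, of x \<alpha>] gr_iff[of x i] by simp

lemma gr_outside: "i < - 2 \<or> i > 2 ==> gr i = {0}"
proof (rule ccontr)
 assume i: "i < - 2 \<or> i > 2" "gr i \<noteq> {0}"
 obtain x \<alpha> where "x \<in> gr i" "x \<noteq> 0" "x \<in> \<W> \<alpha>"
  by (rule stable_has_weight[OF gr_subspace gr_stable i(2)])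
 then show False using gr_weight weight_h_bounds i(1) by fastforce
qed

lemma gr_2: "gr 2 = range (\<lambda>c. c *s ee)"
proof
 have "{x \<in> gr 2. \<exists>\<alpha>. x \<in> \<W> \<alpha>} \<subseteq> \<W> \<gamma>"
 proof safe
  fix x \<alpha> assume x: "x \<in> gr 2" "x \<in> \<W> \<alpha>"
  show "x \<in> \<W> \<gamma>"
  proof (cases "x = 0")
   case True then show ?thesis using wt_subspace vec.subspace_0 by blast
  next
   case False
   then have "\<And>k. k \<in> H ==> \<alpha> k = \<gamma> k" using weight_h_2[OF x(2) False] gr_weight[OF x(1) False x(2)] by simp
   then show ?thesis using x(2) wt_cong[of \<alpha> \<gamma>] by simp
  qed
 qed
 then have "vec.span {x \<in> gr 2. \<exists>\<alpha>. x \<in> \<W> \<alpha>} \<subseteq> \<W> \<gamma>" using wt_subspace by (rule vec.span_minimal)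
 then show "gr 2 \<subseteq> range (\<lambda>c. c *s ee)" using gr_weights ee(2) by blast
 show "range (\<lambda>c. c *s ee) \<subseteq> gr 2"
  using wtD[OF ee_wt h_H] by (auto simp: gr_iff br_bilinear)
qed

text \<open>A weight in grade -2 has an opposite root in grade 2, which is \<gamma> by
  \<open>weight_h_2\<close>; the root space of its negative is a line.\<close>

lemma gr_minus_2: "gr (- 2) = range (\<lambda>c. c *s ff)"
proof
 have "{x \<in> gr (- 2). \<exists>\<alpha>. x \<in> \<W> \<alpha>} \<subseteq> range (\<lambda>c. c *s ff)"
 proof safe
  fix x \<alpha> assume x: "x \<in> gr (- 2)" "x \<in> \<W> \<alpha>"
  show "x \<in> range (\<lambda>c. c *s ff)"
  proof (cases "x = 0")
   case True then show ?thesis by (intro range_eqI[of _ _ 0]) simp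
  next
   case False
   have ah: "\<alpha> h = - 2" using gr_weight[OF x(1) False x(2)] by simp
   then obtain y where y: "y \<in> \<W> (\<lambda>k. - \<alpha> k)" "y \<noteq> 0" using root_triple[OF x(2) False h_H] by auto
   have "- \<alpha> k = \<gamma> k" if "k \<in> H" for k using weight_h_2[OF y _ that] ah by simp
   then have "\<And>k. k \<in> H ==> \<alpha> k = - \<gamma> k" by (metis add.inverse_inverse)
   then have "x \<in> \<W> (\<lambda>k. - \<gamma> k)" using x(2) wt_cong[of \<alpha> "\<lambda>k. - \<gamma> k"] by simp
   then show ?thesis using root_space_one_dim[OF ff_wt ff_nz h_H] by auto
  qed
 qed
 then have "vec.span {x \<in> gr (- 2). \<exists>\<alpha>. x \<in> \<W> \<alpha>} \<subseteq> range (\<lambda>c. c *s ff)"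
  by (rule vec.span_minimal) (simp add: vec.span_singleton[symmetric])
 then show "gr (- 2) \<subseteq> range (\<lambda>c. c *s ff)" using gr_weights by blast
 show "range (\<lambda>c. c *s ff) \<subseteq> gr (- 2)"
  using wtD[OF ff_wt h_H] by (auto simp: gr_iff br_bilinear)
qed

lemma br_gr: "x \<in> gr i ==> y \<in> gr j ==> br x y \<in> gr (i + j)"
 by (simp add: gr_iff jacobi[of h x y] br_bilinear vec.scale_left_distrib)

lemma gr_span: "vec.span (\<Union>i\<in>{-2..2}. gr i) = UNIV"
proof -
 have "{x. \<exists>\<alpha>. x \<in> \<W> \<alpha>} \<subseteq> (\<Union>i\<in>{-2..2}. gr i)"
 proof safe
  fix x \<alpha> assume x: "x \<in> \<W> \<alpha>"
  show "x \<in> (\<Union>i\<in>{-2..2}. gr i)"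
  proof (cases "x = 0")
   case True then show ?thesis by (auto simp: gr_iff intro!: bexI[of _ 0])
  next
   case False
   then obtain i where i: "\<alpha> h = of_int i" using weight_h_integer[OF x] by blast
   have "x \<in> gr i" using wtD[OF x h_H] i by (simp add: gr_iff)
   then show ?thesis using weight_h_bounds[OF x False i] by auto
  qed
 qed
 from vec.span_mono[OF this] show ?thesis using weights_span by blast
qed

end

subsection \<open>Exponentials of nilpotent derivations\<close>

text \<open>A finite Cauchy product: the square i, j < K lies in the triangle i + j < 2 K, and g
  vanishes on the rest of the triangle.\<close>

lemma sum_square_triangle:
 fixes g :: "nat \<Rightarrow> nat \<Rightarrow> 'a::comm_monoid_add"
 assumes "\<And>i j. i \<ge> K \<or> j \<ge> K ==> g i j = 0"
 shows "(\<Sum>i<K. \<Sum>j<K. g i j) = (\<Sum>k<2*K. \<Sum>i\<le>k. g i (k - i))"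
proof -
 have "(\<Sum>k<2*K. \<Sum>i\<le>k. g i (k - i)) = sum (\<lambda>(i, j). g i j) {(i, j). i + j < 2 * K}"
  by (rule sum.triangle_reindex[symmetric])
 also have "\<dots> = sum (\<lambda>(i, j). g i j) ({..<K} \<times> {..<K})"
 proof (rule sum.mono_neutral_right)
  show "finite {(i, j). i + j < 2 * K}"
   by (rule finite_subset[of _ "{..<2*K} \<times> {..<2*K}"]) auto
  show "\<forall>x\<in>{(i, j). i + j < 2 * K} - {..<K} \<times> {..<K}. (case x of (i, j) \<Rightarrow> g i j) = 0"
  proof
   fix x assume x: "x \<in> {(i, j). i + j < 2 * K} - {..<K} \<times> {..<K}"
   obtain i j where ij: "x = (i, j)" by (cases x)
   with x have "i \<ge> K \<or> j \<ge> K" by auto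
   then show "(case x of (i, j) \<Rightarrow> g i j) = 0" using assms ij by simp
  qed
 qed auto
 also have "\<dots> = (\<Sum>i<K. \<Sum>j<K. g i j)" by (rule sum.cartesian_product[symmetric])
 finally show ?thesis by simp
qed

lemma invertible_eq_0: "invertible A ==> A *v x = 0 ==> x = 0" for A :: "complex^'d^'d"
 by (metis invertible_def matrix_vector_mul_assoc matrix_vector_mul_lid matrix_vector_mult_0_right)

context simple_lie
begin

text \<open>The exponential series of t ad x cut off after K terms; it is the exponential once the
  K-th power of ad x is zero.\<close>

definition nexp :: "nat \<Rightarrow> complex^'d \<Rightarrow> complex \<Rightarrow> complex^'d^'d" where
 "nexp K x t = matrix (\<lambda>v. \<Sum>k<K. (t ^ k / fact k) *s (br x ^^ k) v)"

lemma funpow_linear: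
 "(br x ^^ k) (u + v) = (br x ^^ k) u + (br x ^^ k) v" "(br x ^^ k) (c *s v) = c *s (br x ^^ k) v" "(br x ^^ k) 0 = 0"
 by (induction k) (simp_all add: br_bilinear)

lemma funpow_sum: "(br x ^^ k) (sum f A) = (\<Sum>a\<in>A. (br x ^^ k) (f a))"
 by (induction A rule: infinite_finite_induct) (simp_all add: funpow_linear)

lemma nexp_vector: "nexp K x t *v v = (\<Sum>k<K. (t ^ k / fact k) *s (br x ^^ k) v)"
 unfolding nexp_def
 by (rule matrix_works_vec)
   (simp add: Vector_Spaces.linear_iff funpow_linear vec.scale_right_distrib sum.distrib vec.scale_sum_right
    mult.commute vec.vector_space_axioms)

lemma funpow_zero_ge:
 assumes "\<And>v. (br x ^^ K) v = 0" "k \<ge> K" shows "(br x ^^ k) v = 0"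
proof -
 have "br x ^^ k = (br x ^^ K) \<circ> (br x ^^ (k - K))" using assms(2) by (metis funpow_add le_add_diff_inverse)
 then show ?thesis using assms(1) by simp
qed

lemma nexp_vector_ge:
 assumes nil: "\<And>v. (br x ^^ K) v = 0" and n: "n \<ge> K"
 shows "nexp K x t *v v = (\<Sum>k<n. (t ^ k / fact k) *s (br x ^^ k) v)"
 unfolding nexp_vector by (rule sum.mono_neutral_left) (use n funpow_zero_ge[OF nil] in auto)

lemma nexp_0: "K > 0 ==> nexp K x 0 = mat 1"
 by (simp add: matrix_eq nexp_vector power_0_left if_distrib[of "\<lambda>c. c / _"] if_distrib[of "\<lambda>c. c *s _"] sum.delta cong: if_cong)

lemma nexp_add:
 assumes nil: "\<And>v. (br x ^^ K) v = 0"
 shows "nexp K x s ** nexp K x t = nexp K x (s + t)"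
 unfolding matrix_eq
proof
 fix v
 let ?g = "\<lambda>i j. ((s ^ i / fact i) * (t ^ j / fact j)) *s (br x ^^ (i + j)) v"
 have "(nexp K x s ** nexp K x t) *v v = (\<Sum>i<K. \<Sum>j<K. ?g i j)"
  by (simp add: matrix_vector_mul_assoc[symmetric] nexp_vector funpow_sum funpow_linear vec.scale_sum_right funpow_add)
 also have "\<dots> = (\<Sum>k<2*K. \<Sum>i\<le>k. ?g i (k - i))"
  by (rule sum_square_triangle) (use funpow_zero_ge[OF nil] in auto)
 also have "\<dots> = (\<Sum>k<2*K. ((s + t) ^ k / fact k) *s (br x ^^ k) v)"
 proof (rule sum.cong[OF refl])
  fix k
  have "(\<Sum>i\<le>k. ?g i (k - i)) = (\<Sum>i\<le>k. (s ^ i / fact i) * (t ^ (k - i) / fact (k - i))) *s (br x ^^ k) v"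
   unfolding vec.scale_sum_left by (intro sum.cong refl) simp
  also have "(\<Sum>i\<le>k. (s ^ i / fact i) * (t ^ (k - i) / fact (k - i))) = (s + t) ^ k / fact k"
   unfolding binomial_ring sum_divide_distrib
   by (intro sum.cong refl) (simp add: binomial_fact)
  finally show "(\<Sum>i\<le>k. ?g i (k - i)) = ((s + t) ^ k / fact k) *s (br x ^^ k) v" .
 qed
 also have "\<dots> = nexp K x (s + t) *v v" by (rule nexp_vector_ge[OF nil, symmetric]) simp
 finally show "(nexp K x s ** nexp K x t) *v v = nexp K x (s + t) *v v" .
qed

lemma nexp_inverse:
 assumes nil: "\<And>v. (br x ^^ K) v = 0" and K: "K > 0"
 shows "nexp K x t ** nexp K x (- t) = mat 1" "nexp K x (- t) ** nexp K x t = mat 1"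
 using nexp_add[OF nil] nexp_0[OF K] by simp_all

lemma leibniz: "(br x ^^ k) (br y z) = (\<Sum>j\<le>k. of_nat (k choose j) *s br ((br x ^^ j) y) ((br x ^^ (k - j)) z))"
proof (induction k)
 case (Suc k)
 let ?Y = "\<lambda>j. (br x ^^ j) y" and ?Z = "\<lambda>j. (br x ^^ j) z"
 have "(br x ^^ Suc k) (br y z) = (\<Sum>j\<le>k. of_nat (k choose j) *s (br (?Y (Suc j)) (?Z (k - j)) + br (?Y j) (?Z (Suc (k - j)))))"
  by (simp add: Suc br_sum_right br_scale_right jacobi[of x "?Y _"])
 also have "\<dots> = (\<Sum>j\<le>k. of_nat (k choose j) *s br (?Y (Suc j)) (?Z (k - j))) + (\<Sum>j\<le>k. of_nat (k choose j) *s br (?Y j) (?Z (Suc k - j)))"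
  by (simp add: vec.scale_right_distrib sum.distrib Suc_diff_le)
 also have "(\<Sum>j\<le>k. of_nat (k choose j) *s br (?Y j) (?Z (Suc k - j))) = (\<Sum>j\<le>Suc k. of_nat (k choose j) *s br (?Y j) (?Z (Suc k - j)))"
  by simp
 also have "\<dots> = br y (?Z (Suc k)) + (\<Sum>j\<le>k. of_nat (k choose Suc j) *s br (?Y (Suc j)) (?Z (k - j)))"
  by (subst sum.atMost_Suc_shift) simp
 finally have "(br x ^^ Suc k) (br y z) = br y (?Z (Suc k)) + (\<Sum>j\<le>k. of_nat (Suc k choose Suc j) *s br (?Y (Suc j)) (?Z (k - j)))"
  by (simp add: vec.scale_left_distrib sum.distrib algebra_simps)
 then show ?case by (subst sum.atMost_Suc_shift) simp
qed simp

text \<open>The exponential of a nilpotent derivation: the Leibniz rule makes the left side the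
  Cauchy product of the two exponential series on the right. Summation up to 2 K gives room for all
  products.\<close>

lemma nexp_br:
 assumes nil: "\<And>v. (br x ^^ K) v = 0"
 shows "nexp K x t *v br y z = br (nexp K x t *v y) (nexp K x t *v z)"
proof -
 let ?g = "\<lambda>i j. ((t ^ i / fact i) * (t ^ j / fact j)) *s br ((br x ^^ i) y) ((br x ^^ j) z)"
 have "nexp K x t *v br y z = (\<Sum>k<2*K. (t ^ k / fact k) *s (br x ^^ k) (br y z))"
  by (rule nexp_vector_ge[OF nil]) simp
 also have "\<dots> = (\<Sum>k<2*K. \<Sum>i\<le>k. ?g i (k - i))"
 proof (rule sum.cong[OF refl])
  fix k
  show "(t ^ k / fact k) *s (br x ^^ k) (br y z) = (\<Sum>i\<le>k. ?g i (k - i))"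
   unfolding leibniz vec.scale_sum_right vector_smult_assoc
  proof (rule sum.cong[OF refl])
   fix i assume i: "i \<in> {..k}"
   have "t ^ k / fact k * of_nat (k choose i) = t ^ i / fact i * (t ^ (k - i) / fact (k - i))"
    using i by (simp add: binomial_fact power_add[symmetric])
   then show "(t ^ k / fact k * of_nat (k choose i)) *s br ((br x ^^ i) y) ((br x ^^ (k - i)) z) = ?g i (k - i)"
    by (simp only:)
  qed
 qed
 also have "\<dots> = (\<Sum>i<K. \<Sum>j<K. ?g i j)"
  by (rule sum_square_triangle[symmetric]) (use funpow_zero_ge[OF nil] in auto)
 also have "\<dots> = br (nexp K x t *v y) (nexp K x t *v z)"
  unfolding nexp_vector br_sum_left br_scale_left
  unfolding br_sum_right br_scale_right vec.scale_sum_right vector_smult_assoc by (rule refl)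
 finally show ?thesis .
qed

lemma nexp_derivative:
 assumes nil: "\<And>v. (br x ^^ K) v = 0" and K: "K > 0"
 shows "((\<lambda>t. (1 / t) *\<^sub>R (nexp K x (of_real t) - mat 1)) \<longlongrightarrow> matrix (br x)) (at 0)"
proof (rule matrix_tendsto_basis[of UNIV])
 fix v
 let ?f = "\<lambda>t::real. \<Sum>k<K. (of_real t ^ k / fact (Suc k)) *s (br x ^^ Suc k) v"
 have eq: "((1 / t) *\<^sub>R (nexp K x (of_real t) - mat 1)) *v v = ?f t" if "t \<noteq> 0" for t
 proof -
  have "nexp K x (of_real t) *v v = (\<Sum>k<Suc K. (of_real t ^ k / fact k) *s (br x ^^ k) v)"
   by (rule nexp_vector_ge[OF nil]) simp
  also have "\<dots> = v + (\<Sum>k<K. (of_real t ^ Suc k / fact (Suc k)) *s (br x ^^ Suc k) v)"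
   by (subst sum.lessThan_Suc_shift) simp
  also have "(\<Sum>k<K. (of_real t ^ Suc k / fact (Suc k)) *s (br x ^^ Suc k) v) = of_real t *s ?f t"
   unfolding vec.scale_sum_right vector_smult_assoc by (simp only: power_Suc times_divide_eq_right)
  finally have "(nexp K x (of_real t) - mat 1) *v v = of_real t *s ?f t"
   by (simp add: matrix_vector_mult_diff_rdistrib)
  then have "((1 / t) *\<^sub>R (nexp K x (of_real t) - mat 1)) *v v = (of_real (1 / t) * of_real t) *s ?f t"
   unfolding scaleR_matrix_vector vector_smult_assoc[symmetric] by simp
  then show ?thesis using that by simp
 qed
 have "(?f \<longlongrightarrow> (\<Sum>k<K. (of_real 0 ^ k / fact (Suc k)) *s (br x ^^ Suc k) v)) (at 0)"
  by (intro tendsto_sum tendsto_vector_smult tendsto_divide tendsto_power tendsto_of_real tendsto_ident_at tendsto_const) (auto simp del: fact_Suc)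
 also have "(\<Sum>k<K. (of_real 0 ^ k / fact (Suc k)) *s (br x ^^ Suc k) v) = br x v"
  using K by (simp add: power_0_left if_distrib[of "\<lambda>c. c / _"] if_distrib[of "\<lambda>c. c *s _"] sum.delta del: fact_Suc cong: if_cong)
 finally show "((\<lambda>t. ((1 / t) *\<^sub>R (nexp K x (of_real t) - mat 1)) *v v) \<longlongrightarrow> matrix (br x) *v v) (at 0)"
  unfolding ad_vector by (rule Lim_transform_eventually) (auto simp: eventually_at_filter eq)
qed simp

lemma nexp_continuous: "continuous_on UNIV (\<lambda>t::real. nexp K x (of_real t * c))"
 unfolding continuous_on_def
 by (intro ballI matrix_tendsto_basis[of UNIV])
   (auto simp: nexp_vector intro!: tendsto_intros tendsto_vector_smult)

lemma lie_autD: "A \<in> lie_aut br ==> A *v br x y = br (A *v x) (A *v y)" "A \<in> lie_aut br ==> invertible A"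
 by (auto simp: lie_aut_def)

text \<open>The curve s \<mapsto> exp (s t ad x) joins it to the identity inside the automorphism
  group.\<close>

lemma nexp_lie_aut0:
 assumes nil: "\<And>v. (br x ^^ K) v = 0" and K: "K > 0"
 shows "nexp K x t \<in> lie_aut0 br"
proof -
 let ?g = "\<lambda>s::real. nexp K x (of_real s * t)"
 have aut: "nexp K x s \<in> lie_aut br" for s
  unfolding lie_aut_def using nexp_br[OF nil] nexp_inverse[OF nil K] invertible_def by blast
 have "connected (range ?g)" by (intro connected_continuous_image nexp_continuous connected_UNIV)
 moreover have "mat 1 \<in> range ?g" using nexp_0[OF K] by (intro range_eqI[of _ _ 0]) simp
 moreover have "nexp K x t \<in> range ?g" by (intro range_eqI[of _ _ 1]) simp
 moreover have "range ?g \<subseteq> lie_aut br" using aut by blast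
 ultimately show ?thesis unfolding lie_aut0_def connected_component_def
  by (intro CollectI exI[of _ "range ?g"] conjI)
qed

end

subsection \<open>Components with respect to the grading\<close>

context contact_lie
begin

lemma gr_independent:
 assumes y: "\<And>i. i \<in> I ==> y i \<in> gr i" and I: "finite I" and s: "(\<Sum>i\<in>I. y i) = 0" and i: "i \<in> I"
 shows "y i = 0"
proof -
 \<comment> \<open>\<open>eigen_components\<close> indexes components by complex eigenvalues, so the
   integral grade has to be recovered from its image in the complex numbers.\<close>
 let ?n = "inv_into UNIV complex_of_int"
 have inv: "?n (of_int i) = i" for i by (rule inv_f_f) (simp add: inj_on_def)
 have sum: "(\<Sum>c\<in>of_int ` I. y (?n c)) = 0"
  using s by (subst sum.reindex) (auto simp: inv inj_on_def)
 have "y (?n (of_int i)) \<in> {0}"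
 proof (rule eigen_components[where T="br h" and F="of_int ` I" and x="\<lambda>c. y (?n c)", OF br_linear(1)])
  show "br h (y (?n c)) = c *s y (?n c)" if "c \<in> of_int ` I" for c
   using that y by (auto simp: inv gr_iff)
 qed (use sum I i in auto)
 then show ?thesis by (simp add: inv)
qed

lemma gr_decomposition: "\<exists>y. (\<forall>i. y i \<in> gr i) \<and> x = (\<Sum>i\<in>{-2..2}. y i)"
proof -
 have zero: "0 \<in> gr i" for i by (simp add: gr_iff)
 have "x \<in> vec.span (\<Union>i\<in>{-2..2}. gr i)" using gr_span by simp
 then show ?thesis
 proof (induction rule: vec.span_induct_alt)
  case base
  then show ?case using zero by (intro exI[of _ "\<lambda>_. 0"]) simp
 next
  case (step c v w)
  then obtain j y where j: "j \<in> {-2..2}" "v \<in> gr j" and y: "\<forall>i. y i \<in> gr i" "w = (\<Sum>i\<in>{-2..2}. y i)" by blast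
  let ?y = "\<lambda>i. (if i = j then c *s v else 0) + y i"
  have "?y i \<in> gr i" for i using j y zero gr_subspace by (auto simp: vec.subspace_add vec.subspace_scale)
  moreover have "c *s v + w = (\<Sum>i\<in>{-2..2}. ?y i)" using j y(2) by (simp add: sum.distrib sum.delta)
  ultimately show ?case by (intro exI[of _ ?y] conjI allI)
 qed
qed

definition comp :: "int \<Rightarrow> complex^'d \<Rightarrow> complex^'d" where
 "comp k x = (SOME y. (\<forall>i. y i \<in> gr i) \<and> x = (\<Sum>i\<in>{-2..2}. y i)) k"

lemma comp_gr: "comp k x \<in> gr k" and sum_comp: "(\<Sum>i\<in>{-2..2}. comp i x) = x"
 using someI_ex[OF gr_decomposition[of x]] unfolding comp_def by auto

lemma comp_unique:
 assumes "\<And>i. y i \<in> gr i" "x = (\<Sum>i\<in>{-2..2}. y i)" shows "comp k x = y k"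
proof (cases "k \<in> {-2..2}")
 case True
 have "comp k x - y k = 0"
  by (rule gr_independent[of "{-2..2}"])
    (use True assms comp_gr gr_subspace sum_comp[of x] in \<open>auto simp: vec.subspace_diff sum_subtractf\<close>)
 then show ?thesis by simp
next
 case False
 then have "gr k = {0}" by (intro gr_outside) auto
 then show ?thesis using assms(1)[of k] comp_gr[of k x] by auto
qed

lemma comp_add: "comp k (x + y) = comp k x + comp k y"
 by (rule comp_unique) (use gr_subspace comp_gr sum_comp in \<open>auto simp: vec.subspace_add sum.distrib\<close>)

lemma comp_scale: "comp k (c *s x) = c *s comp k x"
 by (rule comp_unique) (use gr_subspace comp_gr sum_comp in \<open>auto simp: vec.subspace_scale vec.scale_sum_right[symmetric]\<close>)

lemma comp_0 [simp]: "comp k 0 = 0" using comp_scale[of k 0 0] by simp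

lemma comp_diff: "comp k (x - y) = comp k x - comp k y"
 using comp_add[of k "x - y" y] by simp

lemma comp_sum: "comp k (sum f A) = (\<Sum>a\<in>A. comp k (f a))"
 by (induction A rule: infinite_finite_induct) (simp_all add: comp_add)

lemma comp_of_gr: "x \<in> gr i ==> comp k x = (if k = i then x else 0)"
proof (cases "i \<in> {-2..2}")
 case True
 assume x: "x \<in> gr i"
 have "comp k x = (\<lambda>k. if k = i then x else 0) k"
  by (rule comp_unique) (use x True in \<open>auto simp: gr_iff sum.delta\<close>)
 then show ?thesis by simp
next
 case False
 assume "x \<in> gr i"
 then have "x = 0" using gr_outside[of i] False by auto
 then show ?thesis by simp
qed

lemma comp_eq_self: "(\<And>k. k \<noteq> i ==> comp k x = 0) ==> x \<in> gr i"
proof -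
 assume z: "\<And>k. k \<noteq> i ==> comp k x = 0"
 have "x = (\<Sum>k\<in>{-2..2}. if k = i then comp i x else 0)"
  by (subst sum_comp[symmetric]) (intro sum.cong refl, simp add: z)
 also have "\<dots> \<in> gr i"
  using comp_gr gr_subspace by (cases "i \<in> {-2..2}") (auto simp: sum.delta vec.subspace_0)
 finally show ?thesis .
qed

lemma comp_outside: "k \<notin> {-2..2} ==> comp k x = 0"
 using comp_gr[of k x] gr_outside[of k] by auto

lemma ee_gr: "ee \<in> gr 2" and ff_gr: "ff \<in> gr (- 2)" and h_gr: "h \<in> gr 0"
 using sl2_h by (auto simp: sl2_def gr_iff)

lemma comp_br_ee: "comp (k + 2) (br ee x) = br ee (comp k x)"
proof -
 have "comp (k + 2) (br ee x) = (\<Sum>i\<in>{-2..2}. comp (k + 2) (br ee (comp i x)))"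
  by (subst sum_comp[of x, symmetric]) (simp only: br_sum_right comp_sum)
 also have "\<dots> = (\<Sum>i\<in>{-2..2}. if i = k then br ee (comp k x) else 0)"
 proof (rule sum.cong[OF refl])
  fix i
  have "br ee (comp i x) \<in> gr (2 + i)" by (rule br_gr[OF ee_gr comp_gr])
  then show "comp (k + 2) (br ee (comp i x)) = (if i = k then br ee (comp k x) else 0)"
   using comp_of_gr by auto
 qed
 also have "\<dots> = br ee (comp k x)" using comp_outside[of k x] by (auto simp: sum.delta)
 finally show ?thesis .
qed

lemma comp_br_ee': "comp k (br ee x) = br ee (comp (k - 2) x)"
 using comp_br_ee[of "k - 2" x] by simp

text \<open>The bracket of \<open>ff\<close> with x has grade -3 and is zero; what remains in the
  Jacobi identity is minus the bracket of h with x, which is x.\<close>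

lemma br_ff_ee_minus_1: "x \<in> gr (- 1) ==> br ff (br ee x) = x"
proof -
 assume x: "x \<in> gr (- 1)"
 have "br ff x \<in> gr (- 3)" using br_gr[OF ff_gr x] by simp
 then have "br ff x = 0" using gr_outside[of "-3"] by auto
 moreover have "br ff ee = - h" using ee_ff br_skew[of ff ee] by simp
 moreover have "br h x = - x" using x by (simp add: gr_iff)
 ultimately show ?thesis using jacobi[of ff ee x] by (simp add: br_minus_left)
qed

lemma br_ee_ff_1: "x \<in> gr 1 ==> br ee (br ff x) = x"
proof -
 assume x: "x \<in> gr 1"
 have "br ee x \<in> gr 3" using br_gr[OF ee_gr x] by simp
 then have "br ee x = 0" using gr_outside[of "3"] by auto
 moreover have "br h x = x" using x by (simp add: gr_iff)
 ultimately show ?thesis using jacobi[of ee ff x] ee_ff by simp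
qed

text \<open>The decreasing filtration attached to the grading. The lemmas below describe every step
  of it by the bracket and the line of \<open>ee\<close> alone, so the stabiliser of that line
  preserves it, although it need not preserve the grading.\<close>

definition Fil :: "int \<Rightarrow> (complex^'d) set" where "Fil j = {x. \<forall>i<j. comp i x = 0}"

lemma Fil_subspace: "vec.subspace (Fil j)"
 by (auto simp: Fil_def vec.subspace_def comp_add comp_scale)

lemma Fil_bot: "Fil (- 2) = UNIV" using comp_outside by (auto simp: Fil_def)

lemma Fil_top: "Fil 3 = {0}"
proof -
 have "x = 0" if "x \<in> Fil 3" for x
  using that by (subst sum_comp[of x, symmetric]) (auto simp: Fil_def intro!: sum.neutral)
 then show ?thesis using Fil_subspace vec.subspace_0 by auto
qed

lemma Fil_mono: "i \<le> j ==> Fil j \<subseteq> Fil i" by (auto simp: Fil_def)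

lemma Fil_2: "x \<in> Fil 2 \<longleftrightarrow> x \<in> gr 2"
proof
 assume "x \<in> Fil 2"
 then have "comp k x = 0" if "k \<noteq> 2" for k
  using that comp_outside[of k x] by (cases "k < 2") (auto simp: Fil_def)
 then show "x \<in> gr 2" by (rule comp_eq_self)
qed (auto simp: Fil_def comp_of_gr)

lemma comp_minus_2_eq_0: "br ee (comp (- 2) x) = 0 \<or> br ee (br ee (comp (- 2) x)) = 0 ==> comp (- 2) x = 0"
proof -
 assume *: "br ee (comp (- 2) x) = 0 \<or> br ee (br ee (comp (- 2) x)) = 0"
 obtain c where c: "comp (- 2) x = c *s ff" using comp_gr[of "-2" x] gr_minus_2 by auto
 have "br ee h = (- 2) *s ee" using br_skew[of ee h] ee_gr by (simp add: gr_iff)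
 then have "c = 0" using * ee(1) h_nz by (auto simp: c br_scale_right ee_ff)
 then show ?thesis using c by simp
qed

lemma comp_minus_1_eq_0: "br ee (comp (- 1) x) = 0 ==> comp (- 1) x = 0"
 using br_ff_ee_minus_1[OF comp_gr] by (metis br_zero(1))

lemma Fil_minus_1: "x \<in> Fil (- 1) \<longleftrightarrow> br ee (br ee x) = 0"
proof -
 have "x \<in> Fil (- 1) \<longleftrightarrow> comp (- 2) x = 0"
 proof -
  have "i < - 1 \<longleftrightarrow> i = - 2 \<or> i < - 2" for i :: int by auto
  then show ?thesis using comp_outside by (auto simp: Fil_def)
 qed
 also have "\<dots> \<longleftrightarrow> br ee (br ee x) = 0"
 proof
  assume z: "comp (- 2) x = 0"
  have "comp k (br ee (br ee x)) = 0" for k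
  proof -
   have eq: "comp k (br ee (br ee x)) = br ee (br ee (comp (k - 4) x))" by (simp add: comp_br_ee')
   consider "k - 4 = - 2" | "k - 4 < - 2" | "k - 4 > - 2" by linarith
   then show ?thesis
   proof cases
    case 3
    then have "k \<notin> {-2..2}" by simp
    then show ?thesis by (rule comp_outside)
   qed (use eq z comp_outside[of "k - 4" x] in auto)
  qed
  then show "br ee (br ee x) = 0" by (subst sum_comp[symmetric]) simp
 next
  assume "br ee (br ee x) = 0"
  then have "br ee (br ee (comp (- 2) x)) = 0" using comp_br_ee'[of 2 "br ee x"] comp_br_ee'[of 0 x] by simp
  then show "comp (- 2) x = 0" using comp_minus_2_eq_0 by blast
 qed
 finally show ?thesis .
qed

lemma Fil_0: "x \<in> Fil 0 \<longleftrightarrow> br ee x \<in> gr 2"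
proof
 assume x: "x \<in> Fil 0"
 show "br ee x \<in> gr 2"
 proof (rule comp_eq_self)
  fix k :: int assume "k \<noteq> 2"
  then consider "k - 2 < 0" | "k \<notin> {-2..2}" by force
  then show "comp k (br ee x) = 0"
   using x comp_outside[of k "br ee x"] by cases (auto simp: Fil_def comp_br_ee')
 qed
next
 assume "br ee x \<in> gr 2"
 then have z: "comp k (br ee x) = 0" if "k \<noteq> 2" for k using that comp_of_gr by auto
 have "comp (- 2) x = 0" using z[of 0] comp_minus_2_eq_0[of x] by (simp add: comp_br_ee')
 moreover have "comp (- 1) x = 0" using z[of 1] comp_minus_1_eq_0[of x] by (simp add: comp_br_ee')
 ultimately have "comp i x = 0" if "i < 0" for i
 proof (cases "i = - 2 \<or> i = - 1")
  case True
  then show ?thesis using \<open>comp (- 2) x = 0\<close> \<open>comp (- 1) x = 0\<close> by auto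
 next
  case False
  then have "i \<notin> {-2..2}" using that by auto
  then show ?thesis by (rule comp_outside)
 qed
 then show "x \<in> Fil 0" by (simp add: Fil_def)
qed

text \<open>The centraliser of \<open>ee\<close> is too large in grade 0. Among brackets with
  \<open>ee\<close> the grade 0 part is a multiple of h, which \<open>ee\<close> does not centralise
  unless it is zero.\<close>

lemma Fil_1: "x \<in> Fil 1 \<longleftrightarrow> br ee x = 0 \<and> (\<exists>z. x = br ee z)"
proof
 assume x: "x \<in> Fil 1"
 have "comp k (br ee x) = 0" for k
 proof -
  consider "k - 2 < 1" | "k \<notin> {-2..2}" by force
  then show ?thesis using x comp_outside[of k "br ee x"] by cases (auto simp: Fil_def comp_br_ee')
 qed
 then have "br ee x = 0" by (subst sum_comp[symmetric]) simp
 moreover have "\<exists>z. x = br ee z"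
 proof -
  have set: "{-2..2} = {-2, -1, 0, 1, 2 :: int}" by auto
  have x12: "x = comp 1 x + comp 2 x"
   using x by (subst sum_comp[of x, symmetric]) (simp add: set Fil_def)
  obtain c where c: "comp 2 x = c *s ee" using comp_gr[of 2 x] gr_2 by auto
  have "br ee h = (- 2) *s ee" using br_skew[of ee h] ee_gr by (simp add: gr_iff)
  then have "comp 2 x = br ee ((- c / 2) *s h)" 
   by (simp only: c br_scale_right vector_smult_assoc) simp
  moreover have "comp 1 x = br ee (br ff (comp 1 x))" by (rule br_ee_ff_1[OF comp_gr, symmetric])
  ultimately have "x = br ee (br ff (comp 1 x) + (- c / 2) *s h)" 
   using x12 br_add_right[of ee "br ff (comp 1 x)" "(- c / 2) *s h"] by metis
  then show ?thesis by blast
 qed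
 ultimately show "br ee x = 0 \<and> (\<exists>z. x = br ee z)" by blast
next
 assume "br ee x = 0 \<and> (\<exists>z. x = br ee z)"
 then obtain z where ex: "br ee x = 0" and z: "x = br ee z" by blast
 have "x \<in> Fil 0" using ex Fil_0[of x] gr_subspace vec.subspace_0 by auto
 moreover have "comp 0 x = 0"
 proof -
  obtain c where c: "comp (- 2) z = c *s ff" using comp_gr[of "-2" z] gr_minus_2 by auto
  have "comp 0 x = c *s h" using comp_br_ee'[of 0 z] z c by (simp add: br_scale_right ee_ff)
  moreover have "br ee (comp 0 x) = 0" using comp_br_ee'[of 2 x] ex by simp
  moreover have "br ee h = (- 2) *s ee" using br_skew[of ee h] ee_gr by (simp add: gr_iff)
  ultimately have "c = 0" using ee(1) by (simp add: br_scale_right)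
  then show ?thesis using \<open>comp 0 x = c *s h\<close> by simp
 qed
 ultimately have "comp i x = 0" if "i < 1" for i
  using that by (cases "i = 0") (simp_all add: Fil_def)
 then show "x \<in> Fil 1" by (simp add: Fil_def)
qed

lemma Fil_preserved:
 assumes A: "A \<in> lie_aut br" and l: "(*v) A ` gr 2 = gr 2" and x: "x \<in> Fil j"
 shows "A *v x \<in> Fil j"
proof -
 have Al: "A *v y \<in> gr 2" if "y \<in> gr 2" for y
  using imageI[OF that, of "(*v) A"] unfolding l .
 have "A *v ee \<in> gr 2" by (rule Al[OF ee_gr])
 then obtain a where a: "A *v ee = a *s ee" using gr_2 by auto
 have "a \<noteq> 0"
 proof
  assume "a = 0"
  then have "A *v ee = 0" using a by simp
  then show False using invertible_eq_0[OF lie_autD(2)[OF A]] ee(1) by blast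
 qed
 have br: "br ee (A *v x) = (1 / a) *s (A *v br ee x)" for x
  using lie_autD(1)[OF A, of ee x] a \<open>a \<noteq> 0\<close> by (simp add: br_scale_left)
 consider "j \<le> - 2" | "j = - 1" | "j = 0" | "j = 1" | "j = 2" | "j \<ge> 3" by linarith
 then show ?thesis
 proof cases
  case 1
  then show ?thesis using Fil_mono[of j "-2"] Fil_bot by blast
 next
  case 2
  then have "br ee (br ee x) = 0" using x Fil_minus_1 by simp
  then show ?thesis using 2 by (simp add: Fil_minus_1 br br_scale_right)
 next
  case 3
  then have "A *v br ee x \<in> gr 2" using x Fil_0 Al by blast
  then show ?thesis using 3 gr_subspace by (simp add: Fil_0 br vec.subspace_scale)
 next
  case 4
  then obtain z where z: "br ee x = 0" "x = br ee z" using x Fil_1 by blast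
  then have "A *v x = br ee (a *s (A *v z))" using lie_autD(1)[OF A, of ee z] a by (simp add: br_scale_left br_scale_right)
  moreover have "br ee (A *v x) = 0" using z(1) br by simp
  ultimately show ?thesis unfolding 4 Fil_1 by blast
 next
  case 5
  then show ?thesis using x Al Fil_2 by blast
 next
  case 6
  then have "x = 0" using x Fil_mono[of 3 j] Fil_top by blast
  then show ?thesis using vec.subspace_0[OF Fil_subspace] by simp
 qed
qed

end

section \<open>Matrix groups\<close>

lemma GL_simps [simp]: "carrier GL = {A. invertible A}" "A \<otimes>\<^bsub>GL\<^esub> B = A ** B" "\<one>\<^bsub>GL\<^esub> = mat 1"
 by (simp_all add: GL_def)

lemma matrix_inv_works:
 fixes A :: "complex^'d^'d"
 assumes "invertible A" shows "matrix_inv A ** A = mat 1" "A ** matrix_inv A = mat 1"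
 using someI_ex[of "\<lambda>A'. A ** A' = mat 1 \<and> A' ** A = mat 1"] assms
 unfolding matrix_inv_def invertible_def by auto

lemma invertible_matrix_inv: "invertible (matrix_inv A)" if "invertible A" for A :: "complex^'d^'d"
 using matrix_inv_works[OF that] unfolding invertible_def by blast

lemma matrix_inv_unique: "B ** A = mat 1 ==> invertible A ==> matrix_inv A = B" for A :: "complex^'d^'d"
 by (metis matrix_inv_works(2) matrix_mul_assoc matrix_mul_lid matrix_mul_rid)

lemma matrix_inv_vector:
 fixes A :: "complex^'d^'d"
 assumes "invertible A" shows "matrix_inv A *v (A *v x) = x" "A *v (matrix_inv A *v x) = x"
 using matrix_inv_works[OF assms] by (simp_all add: matrix_vector_mul_assoc)

lemma invertible_mult_complex: "invertible A ==> invertible B ==> invertible (A ** B)" for A B :: "complex^'d^'d"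
 by (rule invertible_mult)

lemma group_GL: "group (GL :: (complex^'d^'d) monoid)"
proof (rule groupI)
 fix x :: "complex^'d^'d" assume "x \<in> carrier GL"
 then show "\<exists>y\<in>carrier GL. y \<otimes>\<^bsub>GL\<^esub> x = \<one>\<^bsub>GL\<^esub>"
  using matrix_inv_works invertible_matrix_inv by auto
next
 show "\<one>\<^bsub>GL\<^esub> \<in> carrier (GL :: (complex^'d^'d) monoid)"
  unfolding GL_simps invertible_def by (intro CollectI exI[of _ "mat 1"]) simp
qed (simp_all add: invertible_mult_complex matrix_mul_assoc)

lemma GL_restrict_inv:
 assumes G: "group (GL\<lparr>carrier := S\<rparr>)" and x: "x \<in> S" "invertible x"
 shows "inv\<^bsub>GL\<lparr>carrier := S\<rparr>\<^esub> x = matrix_inv (x :: complex^'d^'d)"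
 using group.l_inv[OF G, of x] x by (simp add: GL_def matrix_inv_unique)

lemma GL_inv: "invertible x ==> inv\<^bsub>GL\<^esub> x = matrix_inv (x :: complex^'d^'d)"
 using group.l_inv[OF group_GL, of x] by (simp add: matrix_inv_unique)

lemma mscale_vector: "mscale c A *v x = c *s (A *v x)" for A :: "complex^'d^'e"
 by (simp add: vec_eq_iff mscale_def matrix_vector_mult_def sum_distrib_left mult.assoc)

lemma linear_form_sum:
 assumes "f \<in> linear_forms mscale UNIV"
 shows "f (\<Sum>k<n::nat. mscale (c k) (M k :: complex^'d^'e)) = (\<Sum>k<n. c k * f (M k))"
proof (induction n)
 case 0
 have "f (mscale 0 0) = 0 * f 0" using assms unfolding linear_forms_def by blast
 moreover have "mscale 0 (0 :: complex^'d^'e) = 0" by (simp add: vec_eq_iff mscale_def)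
 ultimately show ?case by simp
next
 case (Suc n)
 then show ?case using assms by (simp add: linear_forms_def)
qed

text \<open>Reduces vanishing on a polynomial curve of matrices to counting the zeros of a
  polynomial in one variable.\<close>

lemma poly_function_curve:
 assumes "f \<in> poly_functions mscale UNIV"
 shows "\<exists>r. \<forall>t. f (\<Sum>k<(n::nat). mscale (poly (q k) t) (M k :: complex^'d^'e)) = poly r t"
 using assms
proof (induction rule: poly_functions.induct)
 case (const c)
 then show ?case by (intro exI[of _ "[:c:]"]) simp
next
 case (form f)
 show ?case unfolding linear_form_sum[OF form]
  by (intro exI[of _ "\<Sum>k<n. Polynomial.smult (f (M k)) (q k)"]) (simp add: poly_sum mult.commute)
next
 case (add p q')
 then obtain r1 r2 where "\<forall>t. p (\<Sum>k<n. mscale (poly (q k) t) (M k)) = poly r1 t"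
  "\<forall>t. q' (\<Sum>k<n. mscale (poly (q k) t) (M k)) = poly r2 t" by blast
 then show ?case by (intro exI[of _ "r1 + r2"]) simp
next
 case (mult p q')
 then obtain r1 r2 where "\<forall>t. p (\<Sum>k<n. mscale (poly (q k) t) (M k)) = poly r1 t"
  "\<forall>t. q' (\<Sum>k<n. mscale (poly (q k) t) (M k)) = poly r2 t" by blast
 then show ?case by (intro exI[of _ "r1 * r2"]) simp
qed

text \<open>Complex powers of a unipotent matrix \<open>1 + X\<close>.\<close>
definition upow :: "nat \<Rightarrow> complex^'d^'d \<Rightarrow> complex \<Rightarrow> complex^'d^'d" where
 "upow K X t = (\<Sum>k<Suc K. mscale (t gchoose k) (matpow X k))"

lemma sum_matrix_vector: "(\<Sum>k\<in>S. M k) *v w = (\<Sum>k\<in>S. M k *v w)" for M :: "'i \<Rightarrow> complex^'d^'e"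
 by (induction S rule: infinite_finite_induct) (simp_all add: matrix_vector_mult_add_rdistrib)

lemma upow_vector: "upow K X t *v v = (\<Sum>k<Suc K. (t gchoose k) *s (matpow X k *v v))"
 unfolding upow_def sum_matrix_vector by (simp only: mscale_vector)

lemma upow_Suc:
 assumes "matpow X (Suc K) = 0"
 shows "upow K X (t + 1) = (mat 1 + X) ** upow K X t"
 unfolding matrix_eq
proof
 fix v
 let ?P = "\<lambda>k. matpow X k *v v"
 have "((mat 1 + X) ** upow K X t) *v v = upow K X t *v v + X *v (upow K X t *v v)"
  by (simp add: matrix_vector_mul_assoc[symmetric] matrix_vector_mult_add_rdistrib)
 also have "X *v (upow K X t *v v) = (\<Sum>k<Suc K. (t gchoose k) *s ?P (Suc k))"
  by (simp only: upow_vector vec.sum vec.scale matpow_Suc matrix_vector_mul_assoc)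
 also have "\<dots> = (\<Sum>k<K. (t gchoose k) *s ?P (Suc k))" using assms by simp
 also have "upow K X t *v v = ?P 0 + (\<Sum>k<K. (t gchoose Suc k) *s ?P (Suc k))"
  unfolding upow_vector by (subst sum.lessThan_Suc_shift) simp
 finally have "((mat 1 + X) ** upow K X t) *v v = ?P 0 + (\<Sum>k<K. ((t gchoose Suc k) + (t gchoose k)) *s ?P (Suc k))"
  by (simp add: vec.scale_left_distrib sum.distrib)
 also have "\<dots> = ?P 0 + (\<Sum>k<K. ((t + 1) gchoose Suc k) *s ?P (Suc k))"
 proof -
  have "(t + 1) gchoose Suc k = (t gchoose Suc k) + (t gchoose k)" for k by (simp add: gbinomial_Suc_Suc)
  then show ?thesis by simp
 qed
 also have "\<dots> = upow K X (t + 1) *v v"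
  unfolding upow_vector by (subst sum.lessThan_Suc_shift) simp
 finally show "upow K X (t + 1) *v v = ((mat 1 + X) ** upow K X t) *v v" by simp
qed

lemma upow_0: "upow K X 0 = mat 1"
proof -
 have "upow K X 0 *v v = v" for v
  unfolding upow_vector by (subst sum.lessThan_Suc_shift) (simp add: matpow_0)
 then show ?thesis by (simp add: matrix_eq)
qed

lemma upow_nat: "matpow X (Suc K) = 0 ==> upow K X (of_nat m) = matpow (mat 1 + X) m"
proof (induction m)
 case (Suc m)
 then show ?case using upow_Suc[of X K "of_nat m"] by (simp add: matpow_Suc add.commute)
qed (simp add: upow_0 matpow_0)

text \<open>Along t the function is a polynomial, because the binomial coefficients are, and it has
  all natural numbers as zeros. Hence an algebraic group contains the complex powers of its
  unipotent elements as soon as they are invertible.\<close>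

lemma upow_poly_zero:
 assumes f: "f \<in> poly_functions mscale UNIV" and nil: "matpow X (Suc K) = 0"
  and z: "\<And>m. f (matpow (mat 1 + X) m) = 0"
 shows "f (upow K X t) = 0"
proof -
 define q :: "nat \<Rightarrow> complex poly" where "q k = Polynomial.smult (1 / fact k) (\<Prod>i<k. [:- of_nat i, 1:])"for k
 have q: "poly (q k) t = t gchoose k" for k and t :: complex
  by (simp add: q_def gbinomial_prod_rev poly_prod atLeast0LessThan)
 obtain r where r: "\<And>t. f (upow K X t) = poly r t"
  using poly_function_curve[OF f, where n="Suc K" and q=q and M="matpow X"] unfolding upow_def q by blast
 have "of_nat m \<in> {t. poly r t = 0}" for m
  using r[of "of_nat m"] upow_nat[OF nil] z by simp
 then have "range (of_nat :: nat \<Rightarrow> complex) \<subseteq> {t. poly r t = 0}" by blast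
 moreover have "infinite (range (of_nat :: nat \<Rightarrow> complex))"
  by (rule range_inj_infinite) (simp add: inj_on_def)
 ultimately have "r = 0" using poly_roots_finite[of r] finite_subset by blast
 then show ?thesis using r by simp
qed

lemma upow_continuous: "continuous_on S (\<lambda>t::real. upow K X (of_real t))"
 unfolding continuous_on_def
proof (intro ballI matrix_tendsto_basis[of UNIV])
 fix t :: real and v
 have "((\<lambda>t. of_real t gchoose k) \<longlongrightarrow> (of_real t gchoose k :: complex)) (at t within S)" for k
  unfolding gbinomial_prod_rev by (intro tendsto_intros) auto
 then show "((\<lambda>t. upow K X (of_real t) *v v) \<longlongrightarrow> upow K X (of_real t) *v v) (at t within S)"
  unfolding upow_vector by (intro tendsto_sum tendsto_vector_smult tendsto_const)
qed simp

interpretation matrix_space: vector_space "mscale :: complex \<Rightarrow> complex^'n^'m \<Rightarrow> complex^'n^'m"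
 by unfold_locales (simp_all add: vec_eq_iff mscale_def algebra_simps)

section \<open>The Levi subgroup\<close>

locale levi_lie = contact_lie br H \<Delta> \<gamma> h
 for br :: "complex^'d \<Rightarrow> complex^'d \<Rightarrow> complex^'d" and H \<Delta> \<gamma> h +
 fixes G\<^sub>0 Pp :: "(complex^'d^'d) set"
 assumes levi: "levi_decomposition (line_stabilizer (lie_aut0 br) (root_space br H \<gamma>)) G\<^sub>0 Pp"
  and H_lie: "(\<lambda>h. matrix (br h)) ` H \<subseteq> lie_algebra_of G\<^sub>0"
begin

definition PP :: "(complex^'d^'d) set" where
 "PP = line_stabilizer (lie_aut0 br) (root_space br H \<gamma>)"

lemma PP_iff: "A \<in> PP \<longleftrightarrow> A \<in> lie_aut0 br \<and> (*v) A ` gr 2 = gr 2"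
 unfolding PP_def line_stabilizer_def ee(2) gr_2 by simp

lemma PP_aut: "A \<in> PP ==> A \<in> lie_aut br"
 using connected_component_subset[of "lie_aut br" "mat 1"] by (auto simp: PP_iff lie_aut0_def)

lemma PP_invertible: "A \<in> PP ==> invertible A" using PP_aut lie_autD by blast

lemma levi_facts: "unipotent_radical PP Pp" "reductive G\<^sub>0" "connected G\<^sub>0" "PP = G\<^sub>0 <#>\<^bsub>GL\<^esub> Pp"
 using levi unfolding levi_decomposition_def PP_def[symmetric] by blast+

lemma Pp_normal: "Pp \<lhd> GL\<lparr>carrier := PP\<rparr>" and Pp_unipotent: "unipotent Pp"
 using levi_facts(1) by (simp_all add: unipotent_radical_def Let_def)

lemma PP_group: "group (GL\<lparr>carrier := PP\<rparr>)"
 using Pp_normal by (simp add: normal_def)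

lemma G0_alg: "algebraic_group G\<^sub>0" and G0_radical: "unipotent_radical G\<^sub>0 {mat 1}"
 using levi_facts(2) by (simp_all add: reductive_def)

lemma G0_subgroup: "subgroup G\<^sub>0 GL" using G0_alg by (simp add: algebraic_group_def)

lemma G0_invertible: "A \<in> G\<^sub>0 ==> invertible A" using subgroup.subset[OF G0_subgroup] by auto

lemma G0_mult: "A \<in> G\<^sub>0 ==> B \<in> G\<^sub>0 ==> A ** B \<in> G\<^sub>0"
 using subgroup.m_closed[OF G0_subgroup, of A B] by simp

lemma G0_one: "mat 1 \<in> G\<^sub>0" using subgroup.one_closed[OF G0_subgroup] by simp

lemma G0_inv: "A \<in> G\<^sub>0 ==> matrix_inv A \<in> G\<^sub>0"
 using subgroup.m_inv_closed[OF G0_subgroup, of A] by (simp add: GL_inv G0_invertible)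

lemma G0_group: "group (GL\<lparr>carrier := G\<^sub>0\<rparr>)"
 by (rule subgroup.subgroup_is_group[OF G0_subgroup group_GL])

lemma Pp_one: "mat 1 \<in> Pp"
 using subgroup.one_closed[OF normal_imp_subgroup[OF Pp_normal]] by (simp add: GL_def)

lemma Pp_PP: "u \<in> Pp ==> u \<in> PP"
 using subgroup.subset[OF normal_imp_subgroup[OF Pp_normal]] by (auto simp: GL_def)

lemma Pp_mult: "u \<in> Pp ==> v \<in> Pp ==> u ** v \<in> Pp"
 using subgroup.m_closed[OF normal_imp_subgroup[OF Pp_normal], of u v] by (simp add: GL_def)

lemma Pp_conj: "A \<in> PP ==> u \<in> Pp ==> A ** u ** matrix_inv A \<in> Pp"
 using normal.inv_op_closed2[OF Pp_normal, of A u] GL_restrict_inv[OF PP_group, of A] PP_invertible[of A]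
 by (simp add: GL_def)

lemma Pp_inv: "u \<in> Pp ==> matrix_inv u \<in> Pp"
 using subgroup.m_inv_closed[OF normal_imp_subgroup[OF Pp_normal], of u]
  GL_restrict_inv[OF PP_group, of u] PP_invertible[of u] Pp_PP[of u] by simp

lemma PP_decompose: "A \<in> PP ==> \<exists>B\<in>G\<^sub>0. \<exists>u\<in>Pp. A = B ** u"
 using levi_facts(4) by (auto simp: set_mult_def)

lemma G0_PP: "A \<in> G\<^sub>0 ==> A \<in> PP"
proof -
 assume "A \<in> G\<^sub>0"
 then have "A ** mat 1 \<in> G\<^sub>0 <#>\<^bsub>GL\<^esub> Pp" using Pp_one unfolding set_mult_def GL_simps by blast
 then show ?thesis using levi_facts(4) by simp
qed

lemma PP_Fil: "A \<in> PP ==> x \<in> Fil j ==> A *v x \<in> Fil j"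
 using Fil_preserved[OF PP_aut] PP_iff by blast

lemma G0_Fil: "A \<in> G\<^sub>0 ==> x \<in> Fil j ==> A *v x \<in> Fil j"
 by (rule PP_Fil[OF G0_PP])

text \<open>The elements of the Levi subgroup that act trivially on the associated graded space form a normal unipotent
 subgroup, which is trivial because the Levi subgroup is reductive.\<close>
definition NN :: "(complex^'d^'d) set" where
 "NN = {A \<in> G\<^sub>0. \<forall>j. \<forall>x\<in>Fil j. A *v x - x \<in> Fil (j + 1)}"

lemma NN_D: "A \<in> NN ==> x \<in> Fil j ==> A *v x - x \<in> Fil (j + 1)" by (simp add: NN_def)

lemma NN_one: "mat 1 \<in> NN" using G0_one vec.subspace_0[OF Fil_subspace] by (simp add: NN_def)

lemma NN_mult: assumes "A \<in> NN" "B \<in> NN" shows "A ** B \<in> NN"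
proof -
 have "(A ** B) *v x - x \<in> Fil (j + 1)" if x: "x \<in> Fil j" for x j
 proof -
  have "A *v (B *v x - x) \<in> Fil (j + 1)" using G0_Fil NN_D[OF assms(2) x] assms(1) by (simp add: NN_def)
  then have "A *v (B *v x - x) + (A *v x - x) \<in> Fil (j + 1)"
   using NN_D[OF assms(1) x] by (rule vec.subspace_add[OF Fil_subspace])
  then show ?thesis by (simp add: matrix_vector_mul_assoc[symmetric] vec.diff)
 qed
 then show ?thesis using assms G0_mult by (simp add: NN_def)
qed

lemma NN_inv: assumes "A \<in> NN" shows "matrix_inv A \<in> NN"
proof -
 have A: "A \<in> G\<^sub>0" "invertible A" using assms G0_invertible by (auto simp: NN_def)
 have "matrix_inv A *v x - x \<in> Fil (j + 1)" if x: "x \<in> Fil j" for x j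
 proof -
  have "matrix_inv A *v (A *v x - x) \<in> Fil (j + 1)" by (rule G0_Fil[OF G0_inv[OF A(1)] NN_D[OF assms x]])
  then have "- (matrix_inv A *v (A *v x - x)) \<in> Fil (j + 1)" by (rule vec.subspace_neg[OF Fil_subspace])
  then show ?thesis by (simp add: vec.diff matrix_inv_vector[OF A(2)])
 qed
 then show ?thesis using A G0_inv by (simp add: NN_def)
qed

lemma NN_conj: assumes A: "A \<in> G\<^sub>0" and B: "B \<in> NN" shows "A ** B ** matrix_inv A \<in> NN"
proof -
 have "(A ** B ** matrix_inv A) *v x - x \<in> Fil (j + 1)" if x: "x \<in> Fil j" for x j
 proof -
  let ?y = "matrix_inv A *v x"
  have "B *v ?y - ?y \<in> Fil (j + 1)" by (rule NN_D[OF B G0_Fil[OF G0_inv[OF A] x]])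
  then have "A *v (B *v ?y - ?y) \<in> Fil (j + 1)" by (rule G0_Fil[OF A])
  then show ?thesis
   by (simp add: matrix_vector_mul_assoc[symmetric] vec.diff matrix_inv_vector[OF G0_invertible[OF A]])
 qed
 then show ?thesis using A B G0_mult G0_inv by (simp add: NN_def)
qed

lemma NN_power_Fil:
 assumes A: "A \<in> NN" and x: "x \<in> Fil j" shows "matpow (A - mat 1) k *v x \<in> Fil (j + int k)"
proof (induction k)
 case (Suc k)
 have "A *v (matpow (A - mat 1) k *v x) - matpow (A - mat 1) k *v x \<in> Fil (j + int k + 1)"
  by (rule NN_D[OF A Suc])
 then show ?case by (simp add: matpow_Suc matrix_vector_mul_assoc[symmetric] matrix_vector_mult_diff_rdistrib ac_simps)
qed (simp add: matpow_0 x)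

text \<open>Five steps lead from \<open>Fil (- 2)\<close>, which is everything, to
  \<open>Fil 3\<close>, which is zero. The exponent has the form \<open>Suc 4\<close> to fit
  \<open>upow 4\<close>.\<close>

lemma NN_nilpotent: "A \<in> NN ==> matpow (A - mat 1) (Suc 4) = 0"
proof -
 assume A: "A \<in> NN"
 have "matpow (A - mat 1) (Suc 4) *v x = 0" for x
  using NN_power_Fil[OF A, of x "-2" "Suc 4"] Fil_bot Fil_top by simp
 then show ?thesis by (simp add: matrix_eq)
qed

lemma NN_unipotent: "unipotent NN"
 unfolding unipotent_def using NN_nilpotent by blast

lemma NN_matpow: "A \<in> NN ==> matpow A m \<in> NN"
 by (induction m) (simp_all add: matpow_0 matpow_Suc NN_one NN_mult)

text \<open>A coordinate of the grade k component of A x - x, as an affine function of A. The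
  vanishing of these for x in \<open>Fil j\<close> and k <= j cuts \<open>NN\<close> out of the Levi
  subgroup and makes it algebraic.\<close>

definition NN_form :: "int \<Rightarrow> complex^'d \<Rightarrow> 'd \<Rightarrow> complex^'d^'d \<Rightarrow> complex" where
 "NN_form k x c A = comp k (A *v x) $ c + - (comp k x $ c)"

lemma NN_form_poly: "NN_form k x c \<in> poly_functions mscale UNIV"
proof -
 have "(\<lambda>A. comp k (A *v x) $ c) \<in> poly_functions mscale UNIV"
  by (rule poly_functions.form)
    (simp add: linear_forms_def matrix_vector_mult_add_rdistrib mscale_vector comp_add comp_scale)
 moreover have "(\<lambda>w\<in>UNIV. - (comp k x $ c)) \<in> poly_functions mscale UNIV" by (rule poly_functions.const)
 ultimately have "(\<lambda>w\<in>UNIV. comp k (w *v x) $ c + (\<lambda>w\<in>UNIV. - (comp k x $ c)) w) \<in> poly_functions mscale UNIV"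
  by (rule poly_functions.add)
 moreover have "(\<lambda>w\<in>UNIV. comp k (w *v x) $ c + (\<lambda>w\<in>UNIV. - (comp k x $ c)) w) = NN_form k x c"
  by (rule ext) (simp add: NN_form_def)
 ultimately show ?thesis by simp
qed

definition NN_forms :: "(complex^'d^'d \<Rightarrow> complex) set" where
 "NN_forms = {NN_form k x c | k x c j. x \<in> Fil j \<and> k < j + 1}"

lemma NN_eq:
 assumes "G\<^sub>0 = {A. invertible A \<and> (\<forall>f\<in>F. f A = 0)}"
 shows "NN = {A. invertible A \<and> (\<forall>f\<in>F \<union> NN_forms. f A = 0)}"
proof -
 have "(\<forall>f\<in>NN_forms. f A = 0) \<longleftrightarrow> (\<forall>j. \<forall>x\<in>Fil j. A *v x - x \<in> Fil (j + 1))" for A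
 proof
  assume z: "\<forall>f\<in>NN_forms. f A = 0"
  show "\<forall>j. \<forall>x\<in>Fil j. A *v x - x \<in> Fil (j + 1)"
  proof (intro allI ballI)
   fix j x assume x: "x \<in> Fil j"
   have "comp k (A *v x - x) = 0" if k: "k < j + 1" for k
   proof -
    have "NN_form k x c A = 0" for c using z x k unfolding NN_forms_def by blast
    then show ?thesis by (simp add: vec_eq_iff NN_form_def comp_diff)
   qed
   then show "A *v x - x \<in> Fil (j + 1)" by (simp add: Fil_def)
  qed
 next
  assume z: "\<forall>j. \<forall>x\<in>Fil j. A *v x - x \<in> Fil (j + 1)"
  show "\<forall>f\<in>NN_forms. f A = 0"
  proof
   fix f assume "f \<in> NN_forms"
   then obtain k x c j where f: "f = NN_form k x c" "x \<in> Fil j" "k < j + 1" unfolding NN_forms_def by blast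
   have "comp k (A *v x - x) = 0" using z f(2,3) by (simp add: Fil_def)
   then have "(comp k (A *v x) - comp k x) $ c = 0" by (simp add: comp_diff)
   then show "f A = 0" by (simp add: f(1) NN_form_def)
  qed
 qed
 moreover have "A \<in> G\<^sub>0 \<longleftrightarrow> invertible A \<and> (\<forall>f\<in>F. f A = 0)" for A by (subst assms) simp
 ultimately show ?thesis by (auto simp: NN_def)
qed

lemma NN_equations:
 obtains F where "F \<subseteq> poly_functions mscale UNIV" "NN = {A. invertible A \<and> (\<forall>f\<in>F. f A = 0)}"
proof -
 obtain F where F: "F \<subseteq> poly_functions mscale UNIV" "G\<^sub>0 = {A. invertible A \<and> (\<forall>f\<in>F. f A = 0)}"
  using G0_alg unfolding algebraic_group_def by blast
 have "NN_forms \<subseteq> poly_functions mscale UNIV" unfolding NN_forms_def using NN_form_poly by blast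
 then show ?thesis using that[of "F \<union> NN_forms"] F(1) NN_eq[OF F(2)] by blast
qed

lemma NN_subgroup: "subgroup NN GL"
proof (rule group.subgroupI[OF group_GL])
 have inv: "invertible A" if "A \<in> NN" for A using that G0_invertible by (simp add: NN_def)
 then show "NN \<subseteq> carrier GL" by auto
 show "NN \<noteq> {}" using NN_one by blast
 show "inv\<^bsub>GL\<^esub> A \<in> NN" if "A \<in> NN" for A using NN_inv[OF that] GL_inv[OF inv[OF that]] by simp
 show "A \<otimes>\<^bsub>GL\<^esub> B \<in> NN" if "A \<in> NN" "B \<in> NN" for A B using NN_mult[OF that] by simp
qed

lemma NN_algebraic: "algebraic_group NN"
proof -
 obtain F where "F \<subseteq> poly_functions mscale UNIV" "NN = {A. invertible A \<and> (\<forall>f\<in>F. f A = 0)}"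
  by (rule NN_equations)
 then show ?thesis unfolding algebraic_group_def using NN_subgroup by blast
qed

text \<open>The polynomial equations of \<open>NN\<close> pass to complex powers by
  \<open>upow_poly_zero\<close>. Invertibility is not an equation and is read off from the trivial
  action on the graded space.\<close>

lemma NN_upow:
 assumes A: "A \<in> NN" shows "upow 4 (A - mat 1) t \<in> NN"
proof -
 obtain F where F: "F \<subseteq> poly_functions mscale UNIV" "NN = {A. invertible A \<and> (\<forall>f\<in>F. f A = 0)}"
  by (rule NN_equations)
 let ?X = "A - mat 1"
 have X: "mat 1 + ?X = A" by simp
 have "f (upow 4 ?X t) = 0" if f: "f \<in> F" for f
 proof (rule upow_poly_zero[OF _ NN_nilpotent[OF A]])
  show "f (matpow (mat 1 + ?X) m) = 0" for m unfolding X using NN_matpow[OF A, of m] F(2) f by blast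
 qed (use F(1) f in blast)
 moreover have "invertible (upow 4 ?X t)"
 proof -
  have step: "upow 4 ?X t *v x - x \<in> Fil (j + 1)" if x: "x \<in> Fil j" for x j
  proof -
   have "upow 4 ?X t *v x - x = (\<Sum>k<4. (t gchoose Suc k) *s (matpow ?X (Suc k) *v x))"
    unfolding upow_vector by (subst sum.lessThan_Suc_shift) (simp add: matpow_0)
   also have "\<dots> \<in> Fil (j + 1)"
   proof (intro vec.subspace_sum vec.subspace_scale Fil_subspace)
    fix k
    have "matpow ?X (Suc k) *v x \<in> Fil (j + int (Suc k))" by (rule NN_power_Fil[OF A x])
    also have "\<dots> \<subseteq> Fil (j + 1)" by (rule Fil_mono) simp
    finally show "matpow ?X (Suc k) *v x \<in> Fil (j + 1)" .
   qed
   finally show ?thesis .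
  qed
  \<comment> \<open>A vector in the kernel moves up the filtration by one step at a time and ends in
    \<open>Fil 3\<close>.\<close>
  have ker: "x = 0" if z: "upow 4 ?X t *v x = 0" for x
  proof -
   have up: "x \<in> Fil (j + 1)" if "x \<in> Fil j" for j
    using vec.subspace_neg[OF Fil_subspace step[OF that]] z by simp
   have "x \<in> Fil (- 2)" using Fil_bot by simp
   from up[OF up[OF up[OF up[OF up[OF this]]]]] show ?thesis using Fil_top by simp
  qed
  have "inj ((*v) (upow 4 ?X t))"
  proof (rule injI)
   fix x y assume "upow 4 ?X t *v x = upow 4 ?X t *v y"
   then have "upow 4 ?X t *v (x - y) = 0" by (simp add: vec.diff)
   then show "x = y" using ker by fastforce
  qed
  then show ?thesis using invertible_left_inverse matrix_left_invertible_injective by blast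
 qed
 ultimately show ?thesis using F(2) by blast
qed

text \<open>Each element lies on the curve of its real powers, which is contained in
  \<open>NN\<close> and passes through the identity.\<close>

lemma NN_connected: "connected NN"
proof -
 let ?g = "\<lambda>A. (\<lambda>t::real. upow 4 (A - mat 1) (of_real t)) ` UNIV"
 have "NN = \<Union>(?g ` NN)"
 proof
  show "NN \<subseteq> \<Union>(?g ` NN)"
  proof
   fix A assume A: "A \<in> NN"
   have "upow 4 (A - mat 1) (of_real 1) = A"
    using upow_nat[OF NN_nilpotent[OF A], of 1] by (simp add: matpow_Suc matpow_0)
   then show "A \<in> \<Union>(?g ` NN)" using A by (metis UN_I rangeI)
  qed
  show "\<Union>(?g ` NN) \<subseteq> NN" using NN_upow by blast
 qed
 moreover have "connected (\<Union>(?g ` NN))"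
 proof (rule connected_Union)
  show "connected S" if S: "S \<in> ?g ` NN" for S
  proof -
   obtain A where "S = ?g A" using S by blast
   then show ?thesis using connected_continuous_image[OF upow_continuous connected_UNIV] by simp
  qed
  have "mat 1 \<in> ?g A" for A by (rule range_eqI[of _ _ 0]) (simp add: upow_0)
  then show "\<Inter>(?g ` NN) \<noteq> {}" by blast
 qed
 ultimately show ?thesis by simp
qed

lemma NN_normal: "NN \<lhd> GL\<lparr>carrier := G\<^sub>0\<rparr>"
proof (rule group.normal_invI[OF G0_group])
 have sub: "NN \<subseteq> G\<^sub>0" by (auto simp: NN_def)
 show "subgroup NN (GL\<lparr>carrier := G\<^sub>0\<rparr>)"
  by (rule group.subgroup_incl[OF group_GL NN_subgroup G0_subgroup sub])
 show "x \<otimes>\<^bsub>GL\<lparr>carrier := G\<^sub>0\<rparr>\<^esub> y \<otimes>\<^bsub>GL\<lparr>carrier := G\<^sub>0\<rparr>\<^esub> inv\<^bsub>GL\<lparr>carrier := G\<^sub>0\<rparr>\<^esub> x \<in> NN"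
  if "x \<in> carrier (GL\<lparr>carrier := G\<^sub>0\<rparr>)" "y \<in> NN" for x y
  using that NN_conj[of x y] GL_restrict_inv[OF G0_group, of x] G0_invertible[of x] by (simp add: GL_def)
qed

lemma NN_trivial: "A \<in> NN ==> A = mat 1"
proof -
 have "\<forall>U'\<in>{U'. algebraic_group U' \<and> connected U' \<and> unipotent U' \<and> U' \<lhd> GL\<lparr>carrier := G\<^sub>0\<rparr>}. U' \<subseteq> {mat 1}"
  using G0_radical unfolding unipotent_radical_def Let_def by (rule conjunct2)
 then have "NN \<subseteq> {mat 1}" by (rule bspec) (simp add: NN_algebraic NN_connected NN_unipotent NN_normal)
 then show "A \<in> NN ==> A = mat 1" by blast
qed

lemma comp_diagonal:
 assumes "\<And>k x. x \<in> gr k ==> M *v x = c k *s x" shows "comp k (M *v x) = c k *s comp k x"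
proof -
 have "M *v x = (\<Sum>i\<in>{-2..2}. c i *s comp i x)"
  using arg_cong[OF sum_comp[of x], of "\<lambda>x. M *v x"] by (simp only: vec.sum assms[OF comp_gr])
 then show ?thesis
  by (intro comp_unique[of "\<lambda>i. c i *s comp i x"]) (auto simp: comp_gr vec.subspace_scale[OF gr_subspace])
qed

lemma diagonal_Fil:
 assumes "\<And>k x. x \<in> gr k ==> M *v x = c k *s x" and x: "x \<in> Fil j"
 shows "M *v x - c j *s x \<in> Fil (j + 1)"
proof -
 have "comp k (M *v x - c j *s x) = 0" if "k < j + 1" for k
  using that x comp_diagonal[of M c, OF assms(1)] by (cases "k = j") (auto simp: comp_diff comp_scale Fil_def)
 then show ?thesis by (simp add: Fil_def)
qed

text \<open>The one element of the torus that is needed to recover the grading: it acts on grade k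
  by the number e^k, and these numbers are distinct.\<close>

definition EE :: "complex^'d^'d" where "EE = matexp (matrix (br h))"

lemma EE_G0: "EE \<in> G\<^sub>0"
proof -
 have "matrix (br h) \<in> lie_algebra_of G\<^sub>0" using H_lie h_H by blast
 then have "matexp (1 *\<^sub>R matrix (br h)) \<in> G\<^sub>0" unfolding lie_algebra_of_def by blast
 then show ?thesis by (simp add: EE_def)
qed

lemma EE_gr: "x \<in> gr k ==> EE *v x = exp (of_int k) *s x"
 unfolding EE_def by (rule matexp_eigenvector[OF ad_diag[OF h_H]]) (simp add: gr_iff)

lemma EE_inv_gr: "x \<in> gr k ==> matrix_inv EE *v x = exp (- of_int k) *s x"
proof -
 assume x: "x \<in> gr k"
 have "matrix_inv EE *v (EE *v x) = exp (of_int k) *s (matrix_inv EE *v x)"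
  by (simp only: EE_gr[OF x] vec.scale)
 then have "x = exp (of_int k) *s (matrix_inv EE *v x)"
  by (simp only: matrix_inv_vector(1)[OF G0_invertible[OF EE_G0]])
 then have "exp (- of_int k) *s x = exp (- of_int k) *s (exp (of_int k) *s (matrix_inv EE *v x))"
  by (rule arg_cong[of _ _ "\<lambda>v. exp (- of_int k) *s v"])
 also have "\<dots> = matrix_inv EE *v x" unfolding vector_smult_assoc by (simp add: exp_minus)
 finally show ?thesis by (rule sym)
qed

text \<open>\<open>EE\<close> is scalar on every graded piece, so its commutator with A is trivial
  on the graded space. That commutator lies in \<open>NN\<close> and is therefore the
  identity.\<close>

lemma G0_commutes_EE: assumes A: "A \<in> G\<^sub>0" shows "A ** EE = EE ** A"
proof -
 let ?A' = "matrix_inv A" and ?E' = "matrix_inv EE"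
 let ?K = "A ** EE ** ?A' ** ?E'"
 note inv = matrix_inv_works[OF G0_invertible[OF A]] matrix_inv_works[OF G0_invertible[OF EE_G0]]
 have "?K \<in> G\<^sub>0" by (intro G0_mult A EE_G0 G0_inv)
 moreover have "?K *v x - x \<in> Fil (j + 1)" if x: "x \<in> Fil j" for x j
 proof -
  let ?e = "exp (of_int j) :: complex" and ?e' = "exp (- of_int j) :: complex"
  \<comment> \<open>\<open>r1\<close> and \<open>r2\<close> are the errors made by replacing
    \<open>EE\<close> and its inverse by scalars; they lie one step higher in the filtration, and
    the two scalars cancel.\<close>
  define r1 where "r1 = ?E' *v x - ?e' *s x"
  have r1: "r1 \<in> Fil (j + 1)" unfolding r1_def by (rule diagonal_Fil[OF EE_inv_gr x])
  define y where "y = ?A' *v x"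
  have y: "y \<in> Fil j" unfolding y_def by (rule G0_Fil[OF G0_inv[OF A] x])
  define r2 where "r2 = EE *v y - ?e *s y"
  have r2: "r2 \<in> Fil (j + 1)" unfolding r2_def by (rule diagonal_Fil[OF EE_gr y])
  have ee': "?e' * ?e = 1" by (simp add: exp_minus)
  have "?E' *v x = ?e' *s x + r1" by (simp add: r1_def)
  then have "?K *v x = ?e' *s (A *v (EE *v y)) + A *v (EE *v (?A' *v r1))"
   by (simp add: matrix_vector_mul_assoc[symmetric] vec.add vec.scale y_def)
  also have "EE *v y = ?e *s y + r2" by (simp add: r2_def)
  also have "?e' *s (A *v (?e *s y + r2)) = (?e' * ?e) *s (A *v y) + ?e' *s (A *v r2)"
   by (simp only: vec.add vec.scale vec.scale_right_distrib vector_smult_assoc)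
  also have "A *v y = x" by (simp add: y_def matrix_inv_vector[OF G0_invertible[OF A]])
  finally have "?K *v x - x = ?e' *s (A *v r2) + A *v (EE *v (?A' *v r1))" by (simp add: ee')
  also have "\<dots> \<in> Fil (j + 1)"
   by (intro vec.subspace_add vec.subspace_scale Fil_subspace G0_Fil A EE_G0 G0_inv r1 r2)
  finally show ?thesis .
 qed
 ultimately have "?K \<in> NN" by (simp add: NN_def)
 then have "?K = mat 1" by (rule NN_trivial)
 then have "?K ** EE ** A = EE ** A" by simp
 moreover have "?K ** EE ** A = A ** EE"
  by (simp only: matrix_mul_assoc[symmetric] inv matrix_mul_rid matrix_mul_lid)
 ultimately show ?thesis by simp
qed

lemma exp_of_int_inj: "exp (complex_of_int k) = exp (of_int i) ==> k = i"
proof -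
 assume "exp (complex_of_int k) = exp (of_int i)"
 then have "exp (complex_of_real (of_int k)) = exp (complex_of_real (of_int i))" by simp
 then have "complex_of_real (exp (of_int k)) = complex_of_real (exp (of_int i))" by (simp only: exp_of_real)
 then show ?thesis by (simp only: of_real_eq_iff exp_inj_iff of_int_eq_iff)
qed

lemma G0_gr: assumes A: "A \<in> G\<^sub>0" and x: "x \<in> gr i" shows "A *v x \<in> gr i"
proof (rule comp_eq_self)
 fix k assume k: "k \<noteq> i"
 have "EE *v (A *v x) = A *v (EE *v x)" by (simp only: matrix_vector_mul_assoc G0_commutes_EE[OF A])
 also have "\<dots> = exp (of_int i) *s (A *v x)" by (simp only: EE_gr[OF x] vec.scale)
 finally have "comp k (EE *v (A *v x)) = exp (of_int i) *s comp k (A *v x)" by (simp only: comp_scale)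
 then have "exp (of_int k) *s comp k (A *v x) = exp (of_int i) *s comp k (A *v x)"
  by (simp only: comp_diagonal[of EE "\<lambda>k. exp (of_int k)", OF EE_gr])
 then have "exp (complex_of_int k) = exp (of_int i) \<or> comp k (A *v x) = 0" by (simp only: vec.scale_cancel_right)
 then show "comp k (A *v x) = 0" using exp_of_int_inj k by blast
qed

text \<open>As A preserves the grading, the image of h acts on each grade as h does, so the
  difference is central.\<close>

lemma G0_h: assumes A: "A \<in> G\<^sub>0" shows "A *v h = h"
proof -
 have "br (A *v h - h) y = 0" for y
 proof -
  have sp: "x \<in> vec.span (\<Union>i\<in>{-2..2}. gr i) ==> br (A *v h - h) (A *v x) = 0" for x
  proof (induction rule: vec.span_induct_alt)
   case (step c x w)
   then obtain i where x: "x \<in> gr i" by blast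
   have "br (A *v h) (A *v x) = of_int i *s (A *v x)"
    using lie_autD(1)[OF PP_aut[OF G0_PP[OF A]], of h x] x by (simp add: gr_iff vec.scale)
   moreover have "br h (A *v x) = of_int i *s (A *v x)" using G0_gr[OF A x] by (simp add: gr_iff)
   ultimately have "br (A *v h - h) (A *v x) = 0" by (simp add: br_diff_left)
   then show ?case using step by (simp add: vec.add vec.scale br_add_right br_scale_right)
  qed simp
  have "br (A *v h - h) (A *v (matrix_inv A *v y)) = 0" by (rule sp) (simp add: gr_span)
  then show ?thesis by (simp add: matrix_inv_vector[OF G0_invertible[OF A]])
 qed
 then have "A *v h - h = 0" by (rule center_trivial)
 then show ?thesis by simp
qed

end

lemma mscale_mult_left: "mscale c A ** B = mscale c (A ** B)" for B :: "complex^'e^'f"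
 by (simp add: vec_eq_iff mscale_def matrix_matrix_mult_def sum_distrib_left mult.assoc)

lemma mscale_mult_right: "A ** mscale c B = mscale c (A ** B)" for B :: "complex^'e^'f"
 by (simp add: vec_eq_iff mscale_def matrix_matrix_mult_def sum_distrib_left mult.left_commute)

lemma matrix_mult_add_left: "(A + B) ** C = A ** C + B ** C" for C :: "complex^'e^'f"
 by (simp add: vec_eq_iff matrix_matrix_mult_def distrib_right sum.distrib)

lemma matrix_mult_add_right: "C ** (A + B) = C ** A + C ** B" for C :: "complex^'e^'f"
 by (simp add: vec_eq_iff matrix_matrix_mult_def distrib_left sum.distrib)

lemma scaleR_mscale: "c *\<^sub>R A = mscale (of_real c) A" for A :: "complex^'e^'f"
 unfolding vec_eq_iff mscale_def vec_lambda_beta vector_smult_component vector_scaleR_component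
 by (simp add: scaleR_conv_of_real[where 'a=complex])

lemma matrix_inv_mult:
 fixes A B :: "complex^'d^'d"
 assumes "invertible A" "invertible B"
 shows "matrix_inv (A ** B) = matrix_inv B ** matrix_inv A"
proof (rule matrix_inv_unique)
 have "matrix_inv B ** matrix_inv A ** (A ** B) = matrix_inv B ** (matrix_inv A ** A) ** B"
  by (simp only: matrix_mul_assoc)
 then show "matrix_inv B ** matrix_inv A ** (A ** B) = mat 1" by (simp add: matrix_inv_works assms)
qed (rule invertible_mult_complex[OF assms])

context simple_lie
begin

lemma nexp_fixes:
 assumes "br x v = 0" "K > 0" shows "nexp K x t *v v = v"
proof -
 have "(br x ^^ k) v = (if k = 0 then v else 0)" for k
  by (induction k) (simp_all add: assms(1) funpow_linear)
 then have "nexp K x t *v v = (\<Sum>k<K. if k = 0 then v else 0)"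
  unfolding nexp_vector by (intro sum.cong refl) simp
 then show ?thesis using assms(2) by (simp add: sum.delta)
qed

end

section \<open>The Levi subgroup as the centraliser of the coroot\<close>

context levi_lie
begin

definition CC :: "(complex^'d^'d) set" where "CC = {A \<in> PP. A *v h = h}"
definition DD :: "(complex^'d^'d) set" where "DD = {u \<in> Pp. u *v h = h}"
text \<open>A substitute for the Lie algebra of \<open>DD\<close>. It is closed under products
  because \<open>DD\<close> is, consists of traceless matrices because u - 1 is nilpotent, is stable
  under conjugation by \<open>CC\<close>, and is topologically closed because it is a
  finite-dimensional subspace.\<close>

definition II :: "(complex^'d^'d) set" where "II = matrix_space.span ((\<lambda>u. u - mat 1) ` DD)"

lemma G0_CC: "A \<in> G\<^sub>0 ==> A \<in> CC" using G0_PP G0_h by (simp add: CC_def)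

lemma CC_invertible: "A \<in> CC ==> invertible A" using PP_invertible by (simp add: CC_def)

lemma inv_fixes: "invertible A ==> A *v x = x ==> matrix_inv A *v x = x" for A :: "complex^'d^'d"
 using matrix_inv_vector(1)[of A x] by simp

lemma DD_invertible: "u \<in> DD ==> invertible u" using PP_invertible Pp_PP by (simp add: DD_def)

lemma DD_mult: "u \<in> DD ==> v \<in> DD ==> u ** v \<in> DD"
 using Pp_mult by (simp add: DD_def matrix_vector_mul_assoc[symmetric])

lemma DD_inv: "u \<in> DD ==> matrix_inv u \<in> DD"
 using Pp_inv inv_fixes[OF DD_invertible] by (simp add: DD_def)

lemma DD_conj: "A \<in> CC ==> u \<in> DD ==> A ** u ** matrix_inv A \<in> DD"
 using Pp_conj inv_fixes[OF CC_invertible] by (simp add: CC_def DD_def matrix_vector_mul_assoc[symmetric])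

lemma II_subspace: "matrix_space.subspace II" unfolding II_def by (rule matrix_space.subspace_span)

lemmas II_add = matrix_space.subspace_add[OF II_subspace]
 and II_scale = matrix_space.subspace_scale[OF II_subspace]
 and II_diff = matrix_space.subspace_diff[OF II_subspace]
 and II_0 = matrix_space.subspace_0[OF II_subspace]

lemma II_DD: "u \<in> DD ==> u - mat 1 \<in> II" unfolding II_def by (rule matrix_space.span_base) simp

lemma II_induct [consumes 1, case_names zero step]:
 assumes "M \<in> II" "P 0" "\<And>c u M. u \<in> DD ==> M \<in> II ==> P M ==> P (mscale c (u - mat 1) + M)"
 shows "P M"
proof -
 have "M \<in> II \<and> P M"
  using assms(1)[unfolded II_def]
 proof (induction rule: matrix_space.span_induct_alt)
  case base
  then show ?case using II_0 assms(2) by simp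
 next
  case (step c x y)
  then obtain u where u: "u \<in> DD" "x = u - mat 1" by blast
  then show ?case using step assms(3) II_add II_scale II_DD by simp
 qed
 then show ?thesis by simp
qed

lemma II_left: "M \<in> II ==> u \<in> DD ==> u ** M \<in> II"
proof (induction rule: II_induct)
 case zero
 then show ?case using II_0 by (simp add: matrix_matrix_mult_def zero_vec_def)
next
 case (step c v M)
 have "u ** (v - mat 1) = (u ** v - mat 1) - (u - mat 1)" by (simp add: matrix_mult_diff_right)
 then have "u ** (v - mat 1) \<in> II" using II_diff[OF II_DD[OF DD_mult] II_DD] step by simp
 then show ?case using step by (simp add: matrix_mult_add_right mscale_mult_right II_add II_scale)
qed

lemma II_mult: "M \<in> II ==> N \<in> II ==> M ** N \<in> II"
proof (induction rule: II_induct)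
 case zero
 then show ?case using II_0 by (simp add: matrix_matrix_mult_def zero_vec_def)
next
 case (step c u M)
 then have "(u - mat 1) ** N \<in> II" using II_diff[OF II_left] by (simp add: matrix_mult_diff_left)
 then show ?case using step by (simp add: matrix_mult_add_left mscale_mult_left II_add II_scale)
qed

lemma II_matpow: "M \<in> II ==> k \<ge> 1 ==> matpow M k \<in> II"
proof (induction k)
 case (Suc k)
 then show ?case by (cases k) (simp_all add: matpow_Suc matpow_0 II_mult)
qed simp

lemma II_trace: "M \<in> II ==> trace M = 0"
proof (induction rule: II_induct)
 case zero
 then show ?case by (simp add: trace_def)
next
 case (step c u M)
 obtain k where "matpow (u - mat 1) k = 0"
  using Pp_unipotent step.hyps by (auto simp: unipotent_def DD_def)
 then have "trace (u - mat 1) = 0" by (rule trace_nilpotent)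
 moreover have "trace (mscale c (u - mat 1)) = c * trace (u - mat 1)"
  unfolding trace_def sum_distrib_left by (simp add: mscale_def right_diff_distrib)
 ultimately show ?case using step by (simp add: trace_add)
qed

lemma II_conj: "M \<in> II ==> A \<in> CC ==> A ** M ** matrix_inv A \<in> II"
proof (induction rule: II_induct)
 case zero
 then show ?case using II_0 by (simp add: matrix_matrix_mult_def zero_vec_def)
next
 case (step c u M)
 have "A ** (u - mat 1) ** matrix_inv A = A ** u ** matrix_inv A - mat 1"
  using matrix_inv_works[OF CC_invertible[OF step.prems]] by (simp add: matrix_mult_diff_right matrix_mult_diff_left)
 then have "A ** (u - mat 1) ** matrix_inv A \<in> II" using II_DD[OF DD_conj[OF step.prems step.hyps(1)]] by simp
 then show ?case using step
  by (simp add: matrix_mult_add_right matrix_mult_add_left mscale_mult_right mscale_mult_left II_add II_scale)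
qed

lemma II_h: "M \<in> II ==> M *v br h x = br h (M *v x)"
proof (induction rule: II_induct)
 case (step c u M)
 have "u \<in> lie_aut br" using PP_aut Pp_PP step.hyps by (simp add: DD_def)
 then have "u *v br h x = br h (u *v x)" using lie_autD(1)[of u h x] step.hyps by (simp add: DD_def)
 then show ?case using step.IH
  by (simp add: matrix_vector_mult_add_rdistrib mscale_vector matrix_vector_mult_diff_rdistrib br_add_right br_diff_right br_scale_right)
qed simp

lemma II_closed: "closed II"
proof (rule closed_subspace)
 show "subspace II" unfolding subspace_def using II_0 II_add II_scale by (simp add: scaleR_mscale)
qed

lemma II_limit:
 assumes "((\<lambda>t. f t) \<longlongrightarrow> M) (at (0::real))" "\<And>t. f t \<in> II" shows "M \<in> II"
 by (rule Lim_in_closed_set[OF II_closed _ _ assms(1)]) (use assms(2) in auto)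

text \<open>E is a curve in \<open>CC\<close> with derivative X at 0 and with the inverses of a
  one-parameter group. It will be the exponential of an element of H or of a root vector of grade
  0.\<close>

context
 fixes E :: "real \<Rightarrow> complex^'d^'d" and X :: "complex^'d^'d"
 assumes E_CC: "\<And>t. E t \<in> CC" and E_inv: "\<And>t. matrix_inv (E t) = E (- t)"
  and E_lim: "((\<lambda>t. (1 / t) *\<^sub>R (E t - mat 1)) \<longlongrightarrow> X) (at 0)"
begin

lemma E_lim_minus: "((\<lambda>t. (1 / t) *\<^sub>R (E (- t) - mat 1)) \<longlongrightarrow> - X) (at 0)"
proof -
 have "filterlim uminus (at (0::real)) (at 0)"
  unfolding filterlim_at by (auto simp: eventually_at_filter intro!: tendsto_eq_intros)
 from filterlim_compose[OF E_lim this]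
 have "((\<lambda>t. - ((1 / - t) *\<^sub>R (E (- t) - mat 1))) \<longlongrightarrow> - X) (at 0)" by (rule tendsto_minus)
 then show ?thesis by simp
qed

lemma E_tendsto_1: "((\<lambda>t. E (- t)) \<longlongrightarrow> mat 1) (at 0)"
proof -
 have "((\<lambda>t. mat 1 + t *\<^sub>R ((1 / t) *\<^sub>R (E (- t) - mat 1))) \<longlongrightarrow> mat 1 + 0 *\<^sub>R - X) (at 0)"
  by (intro tendsto_intros E_lim_minus)
 moreover have "eventually (\<lambda>t::real. mat 1 + t *\<^sub>R ((1 / t) *\<^sub>R (E (- t) - mat 1)) = E (- t)) (at 0)"
  by (simp add: eventually_at_filter)
 ultimately show ?thesis using tendsto_cong by force
qed

text \<open>The bracket is the derivative at 0 of the conjugate of M by \<open>E t\<close>, a curve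
  that stays in the closed space \<open>II\<close>.\<close>

lemma II_bracket: assumes M: "M \<in> II" shows "X ** M - M ** X \<in> II"
proof (rule II_limit)
 let ?Q = "\<lambda>t. (1 / t) *\<^sub>R (E t - mat 1)" and ?Q' = "\<lambda>t. (1 / t) *\<^sub>R (E (- t) - mat 1)"
 have "((\<lambda>t. ?Q t ** (M ** E (- t)) + M ** ?Q' t) \<longlongrightarrow> X ** (M ** mat 1) + M ** (- X)) (at 0)"
  by (intro tendsto_add tendsto_matrix_mult tendsto_const E_lim E_lim_minus E_tendsto_1)
 moreover have "X ** (M ** mat 1) + M ** (- X) = X ** M - M ** X"
 proof -
  have "M ** (- X) = - (M ** X)" by (simp add: vec_eq_iff matrix_matrix_mult_def sum_negf)
  then show ?thesis by simp
 qed
 ultimately show "((\<lambda>t. ?Q t ** (M ** E (- t)) + M ** ?Q' t) \<longlongrightarrow> X ** M - M ** X) (at 0)" by simp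
 fix t
 have "?Q t ** (M ** E (- t)) + M ** ?Q' t = (1 / t) *\<^sub>R (E t ** M ** E (- t) - M)"
  unfolding scaleR_mscale
  by (simp add: mscale_mult_left mscale_mult_right matrix_mult_diff_left matrix_mult_diff_right matrix_mul_assoc
    matrix_space.scale_right_distrib[symmetric])
 moreover have "E t ** M ** E (- t) \<in> II" using II_conj[OF M E_CC] E_inv by simp
 ultimately show "?Q t ** (M ** E (- t)) + M ** ?Q' t \<in> II" using M by (simp add: scaleR_mscale II_scale II_diff)
qed

text \<open>The left side is the derivative at 0 of the commutator of u with \<open>E t\<close>,
  which lies in \<open>DD\<close> because \<open>CC\<close> normalises \<open>DD\<close>.\<close>

lemma DD_bracket: assumes u: "u \<in> DD" shows "u ** X ** matrix_inv u - X \<in> II"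
proof (rule II_limit)
 let ?Q = "\<lambda>t. (1 / t) *\<^sub>R (E t - mat 1)" and ?Q' = "\<lambda>t. (1 / t) *\<^sub>R (E (- t) - mat 1)" and ?v = "matrix_inv u"
 have "((\<lambda>t. u ** ?Q t ** ?v ** E (- t) + ?Q' t) \<longlongrightarrow> u ** X ** ?v ** mat 1 + - X) (at 0)"
  by (intro tendsto_add tendsto_matrix_mult tendsto_const E_lim E_lim_minus E_tendsto_1)
 then show "((\<lambda>t. u ** ?Q t ** ?v ** E (- t) + ?Q' t) \<longlongrightarrow> u ** X ** ?v - X) (at 0)" by simp
 fix t
 have uv: "u ** ?v = mat 1" by (rule matrix_inv_works[OF DD_invertible[OF u]])
 have "u ** ?Q t ** ?v ** E (- t) + ?Q' t = (1 / t) *\<^sub>R (u ** (E t ** ?v ** matrix_inv (E t)) - mat 1)"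
  unfolding scaleR_mscale E_inv
  by (simp add: mscale_mult_left mscale_mult_right matrix_mult_diff_left matrix_mult_diff_right matrix_mul_assoc uv
    matrix_space.scale_right_distrib[symmetric])
 moreover have "u ** (E t ** ?v ** matrix_inv (E t)) - mat 1 \<in> II"
  by (rule II_DD[OF DD_mult[OF u DD_conj[OF E_CC DD_inv[OF u]]]])
 ultimately show "u ** ?Q t ** ?v ** E (- t) + ?Q' t \<in> II" by (simp add: scaleR_mscale II_scale)
qed

end

definition TT :: "complex^'d \<Rightarrow> complex^'d^'d" where "TT z = matexp (matrix (br z))"

lemma TT_G0: "z \<in> H ==> TT z \<in> G\<^sub>0"
proof -
 assume "z \<in> H"
 then have "matrix (br z) \<in> lie_algebra_of G\<^sub>0" using H_lie by blast
 then have "matexp (1 *\<^sub>R matrix (br z)) \<in> G\<^sub>0" unfolding lie_algebra_of_def by blast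
 then show ?thesis by (simp add: TT_def)
qed

lemma TT_eigen: "z \<in> H ==> br z v = c *s v ==> TT z *v v = exp c *s v"
 unfolding TT_def by (rule matexp_eigenvector[OF ad_diag]) simp_all

lemma ad_scaleR: "t *\<^sub>R matrix (br z) = matrix (br (of_real t *s z))"
 by (simp add: scaleR_mscale ad_scale)

lemma TT_derivative: "z \<in> H ==> ((\<lambda>t. (1 / t) *\<^sub>R (TT (of_real t *s z) - mat 1)) \<longlongrightarrow> matrix (br z)) (at 0)"
 using matexp_derivative[OF ad_diag[of z]] unfolding TT_def ad_scaleR .

lemma H_scale: "z \<in> H ==> c *s z \<in> H" by (rule vec.subspace_scale[OF H_subspace])

lemma TT_inv: assumes z: "z \<in> H" shows "matrix_inv (TT (of_real t *s z)) = TT (of_real (- t) *s z)"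
proof (rule matrix_inv_unique)
 show "TT (of_real (- t) *s z) ** TT (of_real t *s z) = mat 1"
 proof (rule matrix_eq_span[OF H_diag[OF z]])
  fix x assume "x \<in> {x. \<exists>c. br z x = c *s x}"
  then obtain c where c: "br z x = c *s x" by blast
  have "br (of_real s *s z) x = (of_real s * c) *s x" for s using c by (simp add: br_scale_left)
  note E = TT_eigen[OF H_scale[OF z] this]
  have "TT (of_real (- t) *s z) *v (TT (of_real t *s z) *v x) = (exp (of_real t * c) * exp (of_real (- t) * c)) *s x"
   by (simp only: E vec.scale vector_smult_assoc)
  also have "exp (of_real t * c) * exp (of_real (- t) * c) = 1" by (simp add: exp_minus)
  finally show "(TT (of_real (- t) *s z) ** TT (of_real t *s z)) *v x = mat 1 *v x"
   by (simp add: matrix_vector_mul_assoc[symmetric])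
 qed
qed (rule G0_invertible[OF TT_G0[OF H_scale[OF z]]])

lemma root_nilpotent:
 assumes x: "x \<in> \<W> \<alpha>" and k0: "k0 \<in> H" "\<alpha> k0 \<noteq> 0"
 obtains K where "K > 0" "\<And>v. (br x ^^ K) v = 0"
proof -
 obtain B w where B: "vec.independent B" "vec.span B = UNIV" "\<And>b. b \<in> B ==> b \<in> \<W> (w b)"
  by (rule weight_basis) blast
 have fin: "finite B" by (rule vec_finite_independent[OF B(1)])
 have "\<forall>b\<in>B. \<exists>j. (br x ^^ j) b = 0"
  using eigen_nilpotent[OF k0(1) wtD[OF x k0(1)] k0(2) wtD[OF B(3) k0(1)]] by blast
 from bchoice[OF this] obtain j where j: "\<forall>b\<in>B. (br x ^^ j b) b = 0" by blast
 let ?K = "Suc (\<Sum>b\<in>B. j b)"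
 have "(br x ^^ ?K) b = 0" if b: "b \<in> B" for b
 proof -
  have "j b \<le> (\<Sum>b\<in>B. j b)" using fin b by (simp add: member_le_sum)
  then obtain i where "?K = i + j b" by (metis add.commute le_SucI le_iff_add)
  then have "(br x ^^ ?K) b = (br x ^^ i) ((br x ^^ j b) b)" by (simp only: funpow_add o_apply)
  then show ?thesis using j b funpow_linear(3) by simp
 qed
 then have "(br x ^^ ?K) v = 0" for v
 proof -
  assume z: "\<And>b. b \<in> B ==> (br x ^^ ?K) b = 0"
  have "v \<in> vec.span B" using B(2) by simp
  then show ?thesis
  proof (induction rule: vec.span_induct_alt)
   case base
   show ?case by (rule funpow_linear(3))
  next
   case (step c b y)
   have "(br x ^^ ?K) (c *s b + y) = c *s (br x ^^ ?K) b + (br x ^^ ?K) y" by (simp only: funpow_linear)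
   then show ?case by (simp only: step(2) z[OF step(1)]) simp
  qed
 qed
 then show ?thesis using that by blast
qed

text \<open>The bracket of x with \<open>ee\<close> is a multiple of \<open>ee\<close>, since x has
  grade 0, but its weight differs from \<gamma> by \<alpha>. So it is zero, and the exponential
  fixes both \<open>ee\<close> and h.\<close>

lemma nexp_CC:
 assumes x: "x \<in> \<W> \<alpha>" and k0: "k0 \<in> H" "\<alpha> k0 \<noteq> 0" and \<alpha>h: "\<alpha> h = 0"
  and K: "K > 0" "\<And>v. (br x ^^ K) v = 0"
 shows "nexp K x t \<in> CC"
proof -
 have "br h x = 0" using wtD[OF x h_H] \<alpha>h by simp
 then have xh: "br x h = 0" using br_skew[of x h] by simp
 have x0: "x \<in> gr 0" using \<open>br h x = 0\<close> by (simp add: gr_iff)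
 have "br x ee = 0"
 proof -
  have "br x ee \<in> gr 2" using br_gr[OF x0 ee_gr] by simp
  then obtain c where c: "br x ee = c *s ee" using gr_2 by auto
  have "br k0 (br x ee) = (\<alpha> k0 + \<gamma> k0) *s br x ee" using wtD[OF br_wt[OF x ee_wt] k0(1)] by simp
  moreover have "br k0 (br x ee) = \<gamma> k0 *s br x ee" unfolding c br_scale_right wtD[OF ee_wt k0(1)] by (simp add: mult.commute)
  ultimately have "(\<alpha> k0 + \<gamma> k0) *s br x ee = \<gamma> k0 *s br x ee" by (rule trans[OF sym])
  then show ?thesis using k0(2) by (simp add: vec.scale_left_distrib)
 qed
 then have e: "nexp K x t *v ee = ee" by (rule nexp_fixes[OF _ K(1)])
 have "(*v) (nexp K x t) ` gr 2 = gr 2"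
  unfolding gr_2 image_image vec.scale e ..
 moreover have "nexp K x t \<in> lie_aut0 br" by (rule nexp_lie_aut0[OF K(2,1)])
 ultimately show ?thesis using nexp_fixes[OF xh K(1)] by (simp add: CC_def PP_iff)
qed

text \<open>The inner derivations in \<open>II\<close>. They form a subspace stable under H and
  under root vectors of grade 0.\<close>

definition JJ :: "(complex^'d) set" where "JJ = {y. matrix (br y) \<in> II}"

lemma JJ_subspace: "vec.subspace JJ"
proof -
 have "matrix (br 0) = 0" by (simp add: matrix_eq)
 then show ?thesis unfolding vec.subspace_def JJ_def using II_0 II_add II_scale by (simp add: ad_add ad_scale)
qed

lemma JJ_H: assumes z: "z \<in> H" and y: "y \<in> JJ" shows "br z y \<in> JJ"
proof -
 have "matrix (br z) ** matrix (br y) - matrix (br y) ** matrix (br z) \<in> II"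
  by (rule II_bracket[where E="\<lambda>t. TT (of_real t *s z)", OF G0_CC[OF TT_G0[OF H_scale[OF z]]] TT_inv[OF z] TT_derivative[OF z]])
    (use y in \<open>simp add: JJ_def\<close>)
 then show ?thesis by (simp add: JJ_def ad_br)
qed

lemma JJ_root:
 assumes x: "x \<in> \<W> \<alpha>" and k0: "k0 \<in> H" "\<alpha> k0 \<noteq> 0" and \<alpha>h: "\<alpha> h = 0" and y: "y \<in> JJ"
 shows "br x y \<in> JJ"
proof -
 obtain K where K: "K > 0" "\<And>v. (br x ^^ K) v = 0" by (rule root_nilpotent[OF x k0]) blast
 let ?E = "\<lambda>t::real. nexp K x (of_real t)"
 have CC: "?E t \<in> CC" for t by (rule nexp_CC[OF x k0 \<alpha>h K])
 have inv: "matrix_inv (?E t) = ?E (- t)" for t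
  using matrix_inv_unique[OF nexp_inverse(2)[OF K(2,1)] CC_invertible[OF CC]] by simp
 have "matrix (br x) ** matrix (br y) - matrix (br y) ** matrix (br x) \<in> II"
  by (rule II_bracket[where E="?E", OF CC inv nexp_derivative[OF K(2,1)]]) (use y in \<open>simp add: JJ_def\<close>)
 then show ?thesis by (simp add: JJ_def ad_br)
qed

lemma JJ_gr0: "y \<in> JJ ==> y \<in> gr 0"
proof -
 assume y: "y \<in> JJ"
 have "br (br h y) x = 0" for x
  using II_h[of "matrix (br y)" x] y jacobi[of h y x] by (simp add: JJ_def)
 then have "br h y = 0" by (rule center_trivial)
 then show ?thesis by (simp add: gr_iff)
qed

lemma JJ_Int_H: "y \<in> JJ ==> y \<in> H ==> y = 0"
 by (rule H_eq_0_of_traces) (simp_all add: JJ_def II_matpow II_trace)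

text \<open>It meets H trivially, because all powers of a matrix in \<open>II\<close> are traceless.
  If it contained a root vector, the bracket with an opposite root vector would put a nonzero
  element of H into it.\<close>

lemma JJ_trivial: "JJ = {0}"
proof (rule ccontr)
 assume nz: "JJ \<noteq> {0}"
 obtain y \<alpha> where y: "y \<in> JJ" "y \<noteq> 0" "y \<in> \<W> \<alpha>"
  by (rule stable_has_weight[OF JJ_subspace JJ_H nz])
 show False
 proof (cases "\<forall>k\<in>H. \<alpha> k = 0")
  case True
  then have "y \<in> H" using y(3) by (intro H_self) (simp add: root_space_def)
  then show False using JJ_Int_H y by blast
 next
  case False
  then obtain k0 where k0: "k0 \<in> H" "\<alpha> k0 \<noteq> 0" by blast
  obtain y' k where k: "y' \<in> \<W> (\<lambda>k. - \<alpha> k)" "k \<in> H" "\<alpha> k = 2" "sl2 y k y'"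
   by (rule root_triple[OF y(3,2) k0]) blast
  have \<alpha>h: "\<alpha> h = 0" using gr_weight[OF JJ_gr0[OF y(1)] y(2,3)] by simp
  have "br y' y \<in> JJ" by (rule JJ_root[OF k(1) k0(1)]) (use k0 \<alpha>h y in auto)
  then have "(- 1) *s br y' y \<in> JJ" by (rule vec.subspace_scale[OF JJ_subspace])
  moreover have "(- 1) *s br y' y = k" using k(4) br_skew[of y y'] by (simp add: sl2_def)
  ultimately have "k = 0" using JJ_Int_H k(2) by simp
  then show False using k(3) wt_linear(2)[OF y(3,2) k0(1), of 0] by simp
 qed
qed

text \<open>By \<open>DD_bracket\<close> the vector u z - z lies in \<open>JJ\<close> for z in H, so
  u fixes H pointwise. Then u preserves each root line, and being unipotent it acts there by
  1.\<close>

lemma DD_trivial: assumes u: "u \<in> DD" shows "u = mat 1"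
proof (rule matrix_eq_span[OF weights_span])
 have aut: "u \<in> lie_aut br" using PP_aut Pp_PP u by (simp add: DD_def)
 have inv: "invertible u" by (rule DD_invertible[OF u])
 have uH: "u *v z = z" if z: "z \<in> H" for z
 proof -
  have "u ** matrix (br z) ** matrix_inv u - matrix (br z) \<in> II"
   by (rule DD_bracket[where E="\<lambda>t. TT (of_real t *s z)", OF G0_CC[OF TT_G0[OF H_scale[OF z]]] TT_inv[OF z] TT_derivative[OF z] u])
  moreover have "u ** matrix (br z) ** matrix_inv u - matrix (br z) = matrix (br (u *v z - z))"
   unfolding matrix_eq
   by (simp add: matrix_vector_mult_diff_rdistrib matrix_vector_mul_assoc[symmetric] lie_autD(1)[OF aut]
     matrix_inv_vector[OF inv] br_diff_left)
  ultimately have "u *v z - z \<in> JJ" by (simp add: JJ_def)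
  then show ?thesis using JJ_trivial by simp
 qed
 fix x assume "x \<in> {x. \<exists>\<alpha>. x \<in> \<W> \<alpha>}"
 then obtain \<alpha> where x: "x \<in> \<W> \<alpha>" by blast
 show "u *v x = mat 1 *v x"
 proof (cases "x = 0 \<or> (\<forall>k\<in>H. \<alpha> k = 0)")
  case True
  then have "x \<in> H" using x by (intro H_self) (auto simp: root_space_def)
  then show ?thesis using uH by simp
 next
  case False
  then obtain k0 where k0: "k0 \<in> H" "\<alpha> k0 \<noteq> 0" and x0: "x \<noteq> 0" by blast
  have "br k (u *v x) = \<alpha> k *s (u *v x)" if k: "k \<in> H" for k
   using lie_autD(1)[OF aut, of k x] uH[OF k] wtD[OF x k] by (simp add: vec.scale)
  then have "u *v x \<in> \<W> \<alpha>" by (simp add: root_space_def)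
  then obtain c where c: "u *v x = c *s x" using root_space_one_dim[OF x x0 k0] by blast
  obtain n where n: "matpow (u - mat 1) n = 0" using Pp_unipotent u by (auto simp: unipotent_def DD_def)
  have "matpow (u - mat 1) j *v x = (c - 1) ^ j *s x" for j
   unfolding matpow_vector
  proof (induction j)
   case (Suc j)
   have "(u - mat 1) *v x = (c - 1) *s x" by (simp add: matrix_vector_mult_diff_rdistrib c vec.scale_left_diff_distrib)
   then show ?case by (simp only: funpow.simps o_apply Suc vec.scale vector_smult_assoc power_Suc2)
  qed simp
  from this[of n] have "(c - 1) ^ n *s x = 0" by (simp add: n)
  then have "c = 1" using x0 by simp
  then show ?thesis using c by simp
 qed
qed

text \<open>In a decomposition A = B u of an element fixing h, the factor B fixes h by
  \<open>G0_h\<close>; so does u, which is then trivial by \<open>DD_trivial\<close>.\<close>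

theorem G0_eq: "G\<^sub>0 = CC"
proof
 show "G\<^sub>0 \<subseteq> CC" using G0_CC by blast
 show "CC \<subseteq> G\<^sub>0"
 proof
  fix A assume A: "A \<in> CC"
  then obtain B u where B: "B \<in> G\<^sub>0" "u \<in> Pp" "A = B ** u" using PP_decompose unfolding CC_def by blast
  have "B *v (u *v h) = h" using A B(3) by (simp add: CC_def matrix_vector_mul_assoc)
  then have "u *v h = matrix_inv B *v h" using matrix_inv_vector(1)[OF G0_invertible[OF B(1)], of "u *v h"] by simp
  also have "\<dots> = h" by (rule inv_fixes[OF G0_invertible[OF B(1)] G0_h[OF B(1)]])
  finally have "u \<in> DD" using B(2) by (simp add: DD_def)
  then have "u = mat 1" by (rule DD_trivial)
  then show "A \<in> G\<^sub>0" using B by simp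
 qed
qed

end

section \<open>Exterior powers\<close>

text \<open>Tensors are functions; their sums and their zero are evaluated pointwise only on
  request, through \<open>fun_apply\<close>.\<close>

declare zero_fun_apply [simp del] plus_fun_apply [simp del]
lemmas fun_apply = zero_fun_apply plus_fun_apply

text \<open>The Leibniz determinant with a natural number as size, as the size is half the dimension
  of a subspace and not the cardinality of a type.\<close>

definition ldet :: "nat \<Rightarrow> (nat \<Rightarrow> nat \<Rightarrow> complex) \<Rightarrow> complex" where
 "ldet n f = (\<Sum>\<sigma> | \<sigma> permutes {..<n}. of_int (sign \<sigma>) * (\<Prod>k<n. f k (\<sigma> k)))"

lemma wedge_ldet:
 "wedge vs is = (if length is = length vs then ldet (length vs) (\<lambda>k j. (vs ! k) $ (is ! j)) else 0)"
 by (simp add: wedge_def ldet_def)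

lemma ldet_cong: "(\<And>i j. i < n ==> j < n ==> f i j = g i j) ==> ldet n f = ldet n g"
 unfolding ldet_def
 by (intro sum.cong arg_cong2[where f="(*)"] prod.cong refl) (auto dest: permutes_in_image)

lemma ldet_permute_rows:
 assumes \<tau>: "\<tau> permutes {..<n}"
 shows "ldet n (\<lambda>i j. b (\<tau> i) j) = of_int (sign \<tau>) * ldet n b"
proof -
 have "ldet n (\<lambda>i j. b (\<tau> i) j) = (\<Sum>\<sigma> | \<sigma> permutes {..<n}. of_int (sign (\<sigma> \<circ> \<tau>)) * (\<Prod>k<n. b (\<tau> k) ((\<sigma> \<circ> \<tau>) k)))"
  unfolding ldet_def by (rule sum_permutations_compose_right[OF \<tau>])
 also have "\<dots> = (\<Sum>\<sigma> | \<sigma> permutes {..<n}. of_int (sign \<tau>) * (of_int (sign \<sigma>) * (\<Prod>k<n. b k (\<sigma> k))))"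
 proof (rule sum.cong[OF refl])
  fix \<sigma> assume "\<sigma> \<in> {\<sigma>. \<sigma> permutes {..<n}}"
  then have \<sigma>: "\<sigma> permutes {..<n}" by simp
  have "sign (\<sigma> \<circ> \<tau>) = sign \<sigma> * sign \<tau>"
   by (rule sign_compose) (use \<sigma> \<tau> permutation_permutes in blast)+
  moreover have "(\<Prod>k<n. b k (\<sigma> k)) = (\<Prod>k<n. b (\<tau> k) ((\<sigma> \<circ> \<tau>) k))"
   using prod.permute[OF \<tau>, of "\<lambda>k. b k (\<sigma> k)"] by (simp add: o_def)
  ultimately show "of_int (sign (\<sigma> \<circ> \<tau>)) * (\<Prod>k<n. b (\<tau> k) ((\<sigma> \<circ> \<tau>) k)) =
    of_int (sign \<tau>) * (of_int (sign \<sigma>) * (\<Prod>k<n. b k (\<sigma> k)))" by (simp only:) simp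
 qed
 finally show ?thesis by (simp only: ldet_def sum_distrib_left)
qed

lemma ldet_equal_rows:
 assumes "i < n" "j < n" "i \<noteq> j" "\<And>k. b i k = b j k" shows "ldet n b = 0"
proof -
 let ?\<tau> = "Transposition.transpose i j"
 have \<tau>: "?\<tau> permutes {..<n}" using assms by (intro permutes_swap_id) auto
 have "b (?\<tau> k) l = b k l" for k l using assms(4) by (simp add: Transposition.transpose_def)
 then have "ldet n b = - ldet n b" using ldet_permute_rows[OF \<tau>, of b] assms(3) by (simp add: sign_swap_id)
 then show ?thesis by simp
qed

text \<open>Expanding all rows gives a sum over the functions f from rows to rows. Those that are
  not injective repeat a row and contribute zero; the others are restrictions of
  permutations.\<close>

lemma ldet_mult: "ldet n (\<lambda>i j. \<Sum>k<n. a i k * b k j) = ldet n a * ldet n b"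
proof -
 let ?F = "Pi\<^sub>E {..<n} (\<lambda>_. {..<n})" and ?P = "{\<sigma>. \<sigma> permutes {..<n}}"
 let ?G = "\<lambda>f. (\<Prod>i<n. a i (f i)) * ldet n (\<lambda>i j. b (f i) j)"
 have finF: "finite ?F" by (intro finite_PiE) auto
 have "ldet n (\<lambda>i j. \<Sum>k<n. a i k * b k j) =
   (\<Sum>\<sigma>\<in>?P. of_int (sign \<sigma>) * (\<Sum>f\<in>?F. \<Prod>i<n. a i (f i) * b (f i) (\<sigma> i)))"
  unfolding ldet_def by (subst prod_sum_PiE) auto
 also have "\<dots> = (\<Sum>f\<in>?F. ?G f)"
  unfolding ldet_def sum_distrib_left
  by (subst sum.swap) (simp add: prod.distrib mult.left_commute)
 also have "\<dots> = (\<Sum>f\<in>(\<lambda>\<sigma>. restrict \<sigma> {..<n}) ` ?P. ?G f)"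
 proof (rule sum.mono_neutral_right[OF finF])
  show "(\<lambda>\<sigma>. restrict \<sigma> {..<n}) ` ?P \<subseteq> ?F" using permutes_in_image by fastforce
  show "\<forall>f\<in>?F - (\<lambda>\<sigma>. restrict \<sigma> {..<n}) ` ?P. ?G f = 0"
  proof
   fix f assume f: "f \<in> ?F - (\<lambda>\<sigma>. restrict \<sigma> {..<n}) ` ?P"
   have "\<not> inj_on f {..<n}"
   proof
    assume inj: "inj_on f {..<n}"
    have "f ` {..<n} = {..<n}"
     by (rule card_subset_eq) (use f inj in \<open>auto simp: card_image\<close>)
    then have bij: "bij_betw f {..<n} {..<n}" using inj by (simp add: bij_betw_def)
    let ?\<sigma> = "\<lambda>x. if x < n then f x else x"
    have "?\<sigma> permutes {..<n}"
    proof (rule bij_imp_permutes)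
     show "bij_betw ?\<sigma> {..<n} {..<n}" using bij by (subst bij_betw_cong[of _ _ f]) auto
    qed auto
    moreover have "f = restrict ?\<sigma> {..<n}"
     using f by (intro ext) (auto simp: restrict_def PiE_def extensional_def)
    ultimately show False using f by blast
   qed
   then obtain i j where "i < n" "j < n" "i \<noteq> j" "f i = f j" by (auto simp: inj_on_def)
   then have "ldet n (\<lambda>i j. b (f i) j) = 0" by (intro ldet_equal_rows[of i n j]) auto
   then show "?G f = 0" by simp
  qed
 qed
 also have "\<dots> = (\<Sum>\<sigma>\<in>?P. ?G (restrict \<sigma> {..<n}))"
 proof (rule sum.reindex[unfolded o_def])
  show "inj_on (\<lambda>\<sigma>. restrict \<sigma> {..<n}) ?P"
  proof (rule inj_onI)
   fix \<sigma> \<tau> assume st: "\<sigma> \<in> ?P" "\<tau> \<in> ?P" "restrict \<sigma> {..<n} = restrict \<tau> {..<n}"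
   show "\<sigma> = \<tau>"
   proof
    fix x
    have eq: "restrict \<sigma> {..<n} x = restrict \<tau> {..<n} x" by (rule fun_cong[OF st(3)])
    show "\<sigma> x = \<tau> x"
    proof (cases "x < n")
     case True
     then show ?thesis using eq by simp
    next
     case False
     then show ?thesis using st(1,2) by (simp add: permutes_def)
    qed
   qed
  qed
 qed
 also have "\<dots> = (\<Sum>\<sigma>\<in>?P. (\<Prod>i<n. a i (\<sigma> i)) * (of_int (sign \<sigma>) * ldet n b))"
 proof (rule sum.cong[OF refl])
  fix \<sigma> assume "\<sigma> \<in> ?P"
  then have \<sigma>: "\<sigma> permutes {..<n}" by simp
  have "ldet n (\<lambda>i j. b (restrict \<sigma> {..<n} i) j) = ldet n (\<lambda>i j. b (\<sigma> i) j)" by (rule ldet_cong) simp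
  then show "?G (restrict \<sigma> {..<n}) = (\<Prod>i<n. a i (\<sigma> i)) * (of_int (sign \<sigma>) * ldet n b)"
   by (simp add: ldet_permute_rows[OF \<sigma>])
 qed
 also have "\<dots> = ldet n a * ldet n b"
  unfolding ldet_def[of n a] sum_distrib_right by (simp add: mult_ac)
 finally show ?thesis .
qed

lemma ldet_diagonal: "ldet n (\<lambda>i j. if i = j then d i else 0) = (\<Prod>i<n. d i)"
proof -
 have "ldet n (\<lambda>i j. if i = j then d i else 0) = (\<Sum>\<sigma> | \<sigma> permutes {..<n}. if \<sigma> = id then (\<Prod>i<n. d i) else 0)"
  unfolding ldet_def
 proof (rule sum.cong[OF refl])
  fix \<sigma> assume "\<sigma> \<in> {\<sigma>. \<sigma> permutes {..<n}}"
  then have \<sigma>: "\<sigma> permutes {..<n}" by simp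
  show "of_int (sign \<sigma>) * (\<Prod>k<n. if k = \<sigma> k then d k else 0) = (if \<sigma> = id then (\<Prod>i<n. d i) else 0)"
  proof (cases "\<sigma> = id")
   case False
   then obtain k where k: "\<sigma> k \<noteq> k" by (auto simp: fun_eq_iff)
   then have "k < n" using \<sigma> by (auto simp: permutes_def)
   then have "(\<Prod>k<n. if k = \<sigma> k then d k else 0) = 0" using k by (intro prod_zero bexI[of _ k]) auto
   then show ?thesis using False by simp
  qed (simp add: sign_id)
 qed
 also have "\<dots> = (\<Prod>i<n. d i)" by (simp add: sum.delta finite_permutations permutes_id)
 finally show ?thesis .
qed

lemma lists_Suc: "{js :: 'd list. length js = Suc n} = (\<lambda>(j, js). j # js) ` (UNIV \<times> {js. length js = n})"
 by (auto simp: length_Suc_conv image_iff)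

lemma sum_lists_Suc:
 "(\<Sum>js | length js = Suc n. F (js :: 'd::finite list)) = (\<Sum>j\<in>UNIV. \<Sum>js | length js = n. F (j # js))"
 unfolding lists_Suc
 by (subst sum.reindex) (auto simp: inj_on_def sum.cartesian_product case_prod_unfold)

lemma sum_lists_prod:
 "(\<Sum>js | length (js :: 'd::finite list) = n. \<Prod>k<n. g k (js ! k)) = (\<Prod>k<n. \<Sum>j\<in>UNIV. (g k j :: complex))"
proof (induction n arbitrary: g)
 case (Suc n)
 have "(\<Sum>js | length (js :: 'd list) = Suc n. \<Prod>k<Suc n. g k (js ! k)) =
   (\<Sum>j\<in>UNIV. \<Sum>js | length (js :: 'd list) = n. g 0 j * (\<Prod>k<n. g (Suc k) (js ! k)))"
  unfolding sum_lists_Suc by (subst prod.lessThan_Suc_shift) simp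
 also have "\<dots> = (\<Sum>j\<in>UNIV. g 0 j) * (\<Prod>k<n. \<Sum>j\<in>UNIV. g (Suc k) j)"
  unfolding sum_distrib_left[symmetric] Suc[of "\<lambda>k. g (Suc k)"] by (simp add: sum_distrib_right)
 finally show ?case by (subst prod.lessThan_Suc_shift) simp
qed simp

text \<open>Applying linear forms to the slots of a decomposable tensor; the forms are given by their coefficients \<open>g m\<close>.\<close>
lemma sum_wedge:
 fixes vs :: "(complex^'d) list"
 assumes n: "length vs = n"
 shows "(\<Sum>js | length js = n. (\<Prod>m<n. g m (js ! m)) * wedge vs js) = ldet n (\<lambda>k j. \<Sum>i\<in>UNIV. g j i * (vs ! k) $ i)"
proof -
 have "(\<Sum>js | length js = n. (\<Prod>m<n. g m (js ! m)) * wedge vs js) =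
   (\<Sum>js | length js = n. \<Sum>\<sigma> | \<sigma> permutes {..<n}. of_int (sign \<sigma>) * (\<Prod>k<n. g (\<sigma> k) (js ! \<sigma> k) * (vs ! k) $ (js ! \<sigma> k)))"
 proof (rule sum.cong[OF refl])
  fix js :: "'d list" assume "js \<in> {js. length js = n}"
  then have len: "length js = n" by simp
  have P: "(\<Prod>m<n. g m (js ! m)) = (\<Prod>k<n. g (\<sigma> k) (js ! \<sigma> k))" if "\<sigma> permutes {..<n}" for \<sigma>
   using prod.permute[OF that, of "\<lambda>m. g m (js ! m)"] by (simp add: o_def)
  then show "(\<Prod>m<n. g m (js ! m)) * wedge vs js =
    (\<Sum>\<sigma> | \<sigma> permutes {..<n}. of_int (sign \<sigma>) * (\<Prod>k<n. g (\<sigma> k) (js ! \<sigma> k) * (vs ! k) $ (js ! \<sigma> k)))"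
   unfolding wedge_ldet ldet_def len n if_P[OF refl] sum_distrib_left
  proof (intro sum.cong refl)
   fix \<sigma> assume "\<sigma> \<in> {\<sigma>. \<sigma> permutes {..<n}}"
   then have "\<sigma> permutes {..<n}" by simp
   then show "(\<Prod>m<n. g m (js ! m)) * (of_int (sign \<sigma>) * (\<Prod>k<n. vs ! k $ (js ! \<sigma> k))) =
     of_int (sign \<sigma>) * (\<Prod>k<n. g (\<sigma> k) (js ! \<sigma> k) * vs ! k $ (js ! \<sigma> k))"
    by (simp add: P prod.distrib mult.left_commute)
  qed
 qed
 also have "\<dots> = (\<Sum>\<sigma> | \<sigma> permutes {..<n}. of_int (sign \<sigma>) *
   (\<Sum>js | length js = n. \<Prod>k<n. g (\<sigma> k) (js ! \<sigma> k) * (vs ! k) $ (js ! \<sigma> k)))"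
  by (subst sum.swap) (simp add: sum_distrib_left)
 also have "\<dots> = ldet n (\<lambda>k j. \<Sum>i\<in>UNIV. g j i * (vs ! k) $ i)"
  unfolding ldet_def
 proof (rule sum.cong[OF refl])
  fix \<sigma> assume "\<sigma> \<in> {\<sigma>. \<sigma> permutes {..<n}}"
  then have \<sigma>: "\<sigma> permutes {..<n}" and \<sigma>': "inv_into UNIV \<sigma> permutes {..<n}" using permutes_inv by auto
  let ?\<tau> = "inv_into UNIV \<sigma>"
  have \<sigma>\<tau>: "\<sigma> (?\<tau> m) = m" "?\<tau> (\<sigma> m) = m" for m using permutes_inverses[OF \<sigma>] by auto
  have "(\<Prod>k<n. g (\<sigma> k) (js ! \<sigma> k) * (vs ! k) $ (js ! \<sigma> k)) = (\<Prod>m<n. g m (js ! m) * (vs ! ?\<tau> m) $ (js ! m))" for js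
   using prod.permute[OF \<sigma>', of "\<lambda>k. g (\<sigma> k) (js ! \<sigma> k) * (vs ! k) $ (js ! \<sigma> k)"] by (simp add: o_def \<sigma>\<tau>)
  then have "(\<Sum>js | length js = n. \<Prod>k<n. g (\<sigma> k) (js ! \<sigma> k) * (vs ! k) $ (js ! \<sigma> k)) =
    (\<Prod>m<n. \<Sum>j\<in>UNIV. g m j * (vs ! ?\<tau> m) $ j)"
   using sum_lists_prod[where n=n and g="\<lambda>m j. g m j * (vs ! ?\<tau> m) $ j"] by simp
  also have "\<dots> = (\<Prod>k<n. \<Sum>j\<in>UNIV. g (\<sigma> k) j * (vs ! k) $ j)"
   using prod.permute[OF \<sigma>, of "\<lambda>m. \<Sum>j\<in>UNIV. g m j * (vs ! ?\<tau> m) $ j"] by (simp add: o_def \<sigma>\<tau>)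
  finally show "of_int (sign \<sigma>) * (\<Sum>js | length js = n. \<Prod>k<n. g (\<sigma> k) (js ! \<sigma> k) * (vs ! k) $ (js ! \<sigma> k)) =
    of_int (sign \<sigma>) * (\<Prod>k<n. \<Sum>i\<in>UNIV. g (\<sigma> k) i * (vs ! k) $ i)" by simp
 qed
 finally show ?thesis .
qed

lemma tensor_act_wedge: "tensor_act A (wedge vs) = wedge (map ((*v) A) vs)"
proof
 fix is' :: "'a list"
 show "tensor_act A (wedge vs) is' = wedge (map ((*v) A) vs) is'"
 proof (cases "length is' = length vs")
  case True
  have "tensor_act A (wedge vs) is' = ldet (length vs) (\<lambda>k j. \<Sum>i\<in>UNIV. A $ (is' ! j) $ i * (vs ! k) $ i)"
   unfolding tensor_act_def True by (rule sum_wedge) simp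
  also have "\<dots> = wedge (map ((*v) A) vs) is'"
   by (simp add: wedge_ldet True) (rule ldet_cong, simp add: matrix_vector_mult_def)
  finally show ?thesis .
 next
  case False
  then show ?thesis by (simp add: tensor_act_def wedge_ldet)
 qed
qed

lemma tensor_act_add: "tensor_act A (s + t) = tensor_act A s + tensor_act A t"
 by (simp add: tensor_act_def fun_eq_iff fun_apply distrib_left sum.distrib)

lemma tensor_act_scale: "tensor_act A (tscale c t) = tscale c (tensor_act A t)"
 by (simp add: tensor_act_def tscale_def fun_eq_iff sum_distrib_left mult.left_commute)

lemma tensor_act_0 [simp]: "tensor_act A 0 = 0"
 by (simp add: tensor_act_def fun_eq_iff fun_apply)

text \<open>Evaluation of a tensor on a list of linear forms, which are represented by their
  coefficient vectors.\<close>

definition pairing :: "(complex^'d) list \<Rightarrow> 'd tensor \<Rightarrow> complex" where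
 "pairing Xs t = (\<Sum>js | length js = length Xs. (\<Prod>m<length Xs. (Xs ! m) $ (js ! m)) * t js)"

lemma pairing_add: "pairing Xs (s + t) = pairing Xs s + pairing Xs t"
 by (simp add: pairing_def fun_apply distrib_left sum.distrib)

lemma pairing_scale: "pairing Xs (tscale c t) = c * pairing Xs t"
 by (simp add: pairing_def tscale_def sum_distrib_left mult.left_commute)

text \<open>The bilinear pairing, without complex conjugation.\<close>

definition dotp :: "complex^'d \<Rightarrow> complex^'d \<Rightarrow> complex" where "dotp x y = (\<Sum>i\<in>UNIV. x $ i * y $ i)"

lemma pairing_wedge:
 "length vs = length Xs ==> pairing Xs (wedge vs) = ldet (length Xs) (\<lambda>k j. dotp (Xs ! j) (vs ! k))"
 unfolding pairing_def dotp_def by (rule sum_wedge)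

lemma dotp_add: "dotp x (y + z) = dotp x y + dotp x z" "dotp (x + y) z = dotp x z + dotp y z"
 and dotp_scale: "dotp x (c *s y) = c * dotp x y" "dotp (c *s x) y = c * dotp x y"
 and dotp_0 [simp]: "dotp x 0 = 0" "dotp 0 x = 0"
 by (simp_all add: dotp_def distrib_left distrib_right sum.distrib sum_distrib_left mult.left_commute mult.assoc)

lemma dotp_diff: "dotp x (y - z) = dotp x y - dotp x z" "dotp (x - y) z = dotp x z - dotp y z"
 by (simp_all add: dotp_def left_diff_distrib right_diff_distrib sum_subtractf)

lemma dotp_sum: "dotp x (sum f A) = (\<Sum>a\<in>A. dotp x (f a))" "dotp (sum f A) x = (\<Sum>a\<in>A. dotp (f a) x)"
 by (induction A rule: infinite_finite_induct) (simp_all add: dotp_add)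

lemma wedge_linear_combination:
 assumes n: "length vs = n" "length us = n" and us: "\<And>k. k < n ==> us ! k = (\<Sum>l<n. a k l *s vs ! l)"
 shows "wedge us = tscale (ldet n a) (wedge vs)"
proof
 fix is' :: "'a list"
 have "ldet n (\<lambda>k j. us ! k $ (is' ! j)) = ldet n (\<lambda>k j. \<Sum>l<n. a k l * vs ! l $ (is' ! j))"
  by (rule ldet_cong) (simp add: us)
 then show "wedge us is' = tscale (ldet n a) (wedge vs) is'"
  by (simp add: wedge_ldet tscale_def n ldet_mult)
qed

lemma wedge_linear_slot:
 assumes i: "i < length vs"
 shows "wedge (vs[i := a *s x + b *s y]) = tscale a (wedge (vs[i := x])) + tscale b (wedge (vs[i := y]))"
proof
 fix js
 let ?n = "length vs"
 have "(\<Prod>k<?n. (vs[i := a *s x + b *s y] ! k) $ (js ! \<sigma> k)) =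
   a * (\<Prod>k<?n. (vs[i := x] ! k) $ (js ! \<sigma> k)) + b * (\<Prod>k<?n. (vs[i := y] ! k) $ (js ! \<sigma> k))" for \<sigma>
 proof -
  have split: "(\<Prod>k<?n. (vs[i := z] ! k) $ (js ! \<sigma> k)) = z $ (js ! \<sigma> i) * (\<Prod>k\<in>{..<?n} - {i}. (vs ! k) $ (js ! \<sigma> k))" for z
   by (subst prod.remove[of _ i]) (use i in auto)
  show ?thesis unfolding split by (simp add: distrib_left distrib_right mult.assoc)
 qed
 then show "wedge (vs[i := a *s x + b *s y]) js = (tscale a (wedge (vs[i := x])) + tscale b (wedge (vs[i := y]))) js"
  by (simp add: wedge_ldet tscale_def ldet_def fun_apply distrib_left sum.distrib sum_distrib_left mult.left_commute)
qed

lemma ext_power_wedge: "length vs = n ==> set vs \<subseteq> V ==> wedge vs \<in> ext_power n V"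
 unfolding ext_power_def by (rule tensor.span_base) auto

lemma ext_power_subspace: "tensor.subspace (ext_power n V)"
 unfolding ext_power_def by (rule tensor.subspace_span)

lemma ext_power_induct [consumes 1, case_names zero step]:
 assumes "t \<in> ext_power n V" "P 0"
  "\<And>c vs t. length vs = n ==> set vs \<subseteq> V ==> t \<in> ext_power n V ==> P t ==> P (tscale c (wedge vs) + t)"
 shows "P t"
proof -
 have "t \<in> ext_power n V \<and> P t"
  using assms(1)[unfolded ext_power_def]
 proof (induction rule: tensor.span_induct_alt)
  case base
  then show ?case using assms(2) unfolding ext_power_def by (simp add: tensor.span_zero)
 next
  case (step c x y)
  then obtain vs where vs: "x = wedge vs" "length vs = n" "set vs \<subseteq> V" by blast
  have y: "y \<in> ext_power n V" "P y" using step(2) by (simp_all add: ext_power_def)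
  have "tscale c x + y \<in> ext_power n V"
   unfolding vs(1) by (intro tensor.subspace_add tensor.subspace_scale ext_power_subspace ext_power_wedge vs y)
  then show ?case using assms(3)[OF vs(2,3) y] vs(1) by (simp add: ext_power_def)
 qed
 then show ?thesis by blast
qed

lemma tensor_act_mult:
 assumes "t \<in> ext_power n V" shows "tensor_act (A ** B) t = tensor_act A (tensor_act B t)"
 using assms
proof (induction rule: ext_power_induct)
 case (step c vs t)
 have "map ((*v) (A ** B)) vs = map ((*v) A) (map ((*v) B) vs)" by (simp add: matrix_vector_mul_assoc)
 then show ?case by (simp only: tensor_act_add tensor_act_scale tensor_act_wedge step)
qed simp

lemma tensor_act_one: assumes "t \<in> ext_power n V" shows "tensor_act (mat 1) t = t"
 using assms
proof (induction rule: ext_power_induct)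
 case (step c vs t)
 have "map ((*v) (mat 1)) vs = vs" by (simp add: map_idI)
 then show ?case using step by (simp add: tensor_act_add tensor_act_scale tensor_act_wedge)
qed simp

lemma tensor_act_ext_power:
 assumes "t \<in> ext_power n V" and A: "\<And>v. v \<in> V ==> A *v v \<in> V'" shows "tensor_act A t \<in> ext_power n V'"
 using assms(1)
proof (induction rule: ext_power_induct)
 case zero
 then show ?case using tensor.subspace_0[OF ext_power_subspace] by simp
next
 case (step c vs t)
 have "wedge (map ((*v) A) vs) \<in> ext_power n V'" by (rule ext_power_wedge) (use step A in auto)
 then show ?case unfolding tensor_act_add tensor_act_scale tensor_act_wedge
  by (intro tensor.subspace_add tensor.subspace_scale ext_power_subspace step)
qed

lemma sum_swap3:
 "(\<Sum>j\<in>J. \<Sum>a\<in>A. \<Sum>b\<in>B. \<Sum>c\<in>C. f j a b c) = (\<Sum>a\<in>A. \<Sum>b\<in>B. \<Sum>c\<in>C. \<Sum>j\<in>J. f j a b c)"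
 for f :: "_ \<Rightarrow> _ \<Rightarrow> _ \<Rightarrow> _ \<Rightarrow> 'm::comm_monoid_add"
proof -
 have "(\<Sum>j\<in>J. \<Sum>a\<in>A. \<Sum>b\<in>B. \<Sum>c\<in>C. f j a b c) = (\<Sum>a\<in>A. \<Sum>j\<in>J. \<Sum>b\<in>B. \<Sum>c\<in>C. f j a b c)"
  by (rule sum.swap)
 also have "\<dots> = (\<Sum>a\<in>A. \<Sum>b\<in>B. \<Sum>j\<in>J. \<Sum>c\<in>C. f j a b c)" by (intro sum.cong refl sum.swap)
 also have "\<dots> = (\<Sum>a\<in>A. \<Sum>b\<in>B. \<Sum>c\<in>C. \<Sum>j\<in>J. f j a b c)" by (intro sum.cong refl sum.swap)
 finally show ?thesis .
qed

context simple_lie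
begin

lemma vec_sum_expand: "(\<Sum>i\<in>UNIV. \<Sum>j\<in>UNIV. (u $ i * v $ j) *s br (axis i 1) (axis j 1)) = br u v"
proof -
 have "br u v = br (\<Sum>i\<in>UNIV. (u $ i) *s axis i 1) (\<Sum>j\<in>UNIV. (v $ j) *s axis j 1)"
  using vec_expand by metis
 then show ?thesis
  unfolding br_sum_left br_scale_left
  by (simp only: br_sum_right br_scale_right vec.scale_sum_right vector_smult_assoc)
qed

lemma contraction_add: "contraction br (s + t) = contraction br s + contraction br t"
 by (simp add: contraction_def fun_eq_iff fun_apply vec.scale_left_distrib sum.distrib)

lemma contraction_scale: "contraction br (tscale c t) = (\<lambda>is. c *s contraction br t is)"
 by (simp add: contraction_def tscale_def vec.scale_sum_right)

lemma contraction_0: "contraction br 0 = (\<lambda>is. 0)"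
 by (simp add: contraction_def fun_apply)

text \<open>For each permutation the first two slots carry two vectors of the list, and contracting
  them gives their bracket, which is zero.\<close>

lemma contraction_wedge:
 assumes "\<And>x y. x \<in> set vs ==> y \<in> set vs ==> br x y = 0" shows "contraction br (wedge vs) = (\<lambda>is. 0)"
proof
 fix js :: "'d list"
 show "contraction br (wedge vs) js = 0"
 proof (cases "length vs = Suc (Suc (length js))")
  case False
  then show ?thesis by (simp add: contraction_def wedge_ldet)
 next
  case True
  let ?n = "length vs"
  \<comment> \<open>The product over the vectors is rewritten as one over the slots, so that the two
    contracted slots split off.\<close>
  have P: "(\<Prod>k<?n. (vs ! k) $ ((i # j # js) ! \<sigma> k)) =
    (vs ! inv_into UNIV \<sigma> 0) $ i * (vs ! inv_into UNIV \<sigma> 1) $ j * (\<Prod>m<length js. (vs ! inv_into UNIV \<sigma> (Suc (Suc m))) $ (js ! m))"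
   if \<sigma>: "\<sigma> permutes {..<?n}" for \<sigma> i j
  proof -
   have "(\<Prod>k<?n. (vs ! k) $ ((i # j # js) ! \<sigma> k)) = (\<Prod>m<?n. (vs ! inv_into UNIV \<sigma> m) $ ((i # j # js) ! m))"
    using prod.permute[OF permutes_inv[OF \<sigma>], of "\<lambda>k. (vs ! k) $ ((i # j # js) ! \<sigma> k)"]
    by (simp add: o_def permutes_inverses[OF \<sigma>])
   then show ?thesis unfolding True
    by (simp add: prod.lessThan_Suc_shift mult.assoc del: prod.lessThan_Suc)
  qed
  have "contraction br (wedge vs) js = (\<Sum>i\<in>UNIV. \<Sum>j\<in>UNIV. \<Sum>\<sigma> | \<sigma> permutes {..<?n}.
    (of_int (sign \<sigma>) * (\<Prod>k<?n. (vs ! k) $ ((i # j # js) ! \<sigma> k))) *s br (axis i 1) (axis j 1))"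
   unfolding contraction_def wedge_def using True by (simp add: vec.scale_sum_left)
  also have "\<dots> = (\<Sum>\<sigma> | \<sigma> permutes {..<?n}. \<Sum>i\<in>UNIV. \<Sum>j\<in>UNIV.
    (of_int (sign \<sigma>) * (\<Prod>k<?n. (vs ! k) $ ((i # j # js) ! \<sigma> k))) *s br (axis i 1) (axis j 1))"
  proof -
   have "(\<Sum>i\<in>I. \<Sum>j\<in>J. \<Sum>\<sigma>\<in>S. g i j \<sigma>) = (\<Sum>\<sigma>\<in>S. \<Sum>i\<in>I. \<Sum>j\<in>J. g i j \<sigma>)"
    for I J :: "'d set" and S :: "(nat \<Rightarrow> nat) set" and g :: "'d \<Rightarrow> 'd \<Rightarrow> (nat \<Rightarrow> nat) \<Rightarrow> complex^'d"
    by (rule trans[OF sum.cong[OF refl sum.swap] sum.swap])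
   then show ?thesis .
  qed
  also have "\<dots> = 0"
  proof (rule sum.neutral, rule ballI)
   fix \<sigma> assume "\<sigma> \<in> {\<sigma>. \<sigma> permutes {..<?n}}"
   then have \<sigma>: "\<sigma> permutes {..<?n}" by simp
   let ?\<tau> = "inv_into UNIV \<sigma>"
   define c where "c = of_int (sign \<sigma>) * (\<Prod>m<length js. (vs ! ?\<tau> (Suc (Suc m))) $ (js ! m))"
   have in_vs: "vs ! ?\<tau> m \<in> set vs" if "m < ?n" for m
    using permutes_in_image[OF permutes_inv[OF \<sigma>], of m] that by simp
   have "(\<Sum>i\<in>UNIV. \<Sum>j\<in>UNIV. (of_int (sign \<sigma>) * (\<Prod>k<?n. (vs ! k) $ ((i # j # js) ! \<sigma> k))) *s br (axis i 1) (axis j 1))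
     = c *s (\<Sum>i\<in>UNIV. \<Sum>j\<in>UNIV. ((vs ! ?\<tau> 0) $ i * (vs ! ?\<tau> 1) $ j) *s br (axis i 1) (axis j 1))"
    unfolding P[OF \<sigma>] vec.scale_sum_right vector_smult_assoc c_def
    by (intro sum.cong refl arg_cong2[where f="(*s)"]) (simp add: mult_ac)
   also have "\<dots> = 0" unfolding vec_sum_expand using assms[OF in_vs in_vs] True by simp
   finally show "(\<Sum>i\<in>UNIV. \<Sum>j\<in>UNIV. (of_int (sign \<sigma>) * (\<Prod>k<?n. (vs ! k) $ ((i # j # js) ! \<sigma> k))) *s br (axis i 1) (axis j 1)) = 0" .
  qed
  finally show ?thesis .
 qed
qed

text \<open>Contraction commutes with automorphisms: the contraction of the transformed tensor
  consists of combinations of images under A of the contraction of t.\<close>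

lemma contraction_tensor_act:
 assumes A: "A \<in> lie_aut br" and t: "contraction br t = (\<lambda>is. 0)"
 shows "contraction br (tensor_act A t) = (\<lambda>is. 0)"
proof
 fix js :: "'d list"
 define c where "c ks = (\<Prod>k<length js. A $ (js ! k) $ (ks ! k))" for ks
 let ?N = "{ks :: 'd list. length ks = length js}"
 have P: "(\<Prod>k<length (i # j # js). A $ ((i # j # js) ! k) $ ((i' # j' # ks) ! k)) = A $ i $ i' * A $ j $ j' * c ks"
  for i j i' j' ks unfolding c_def by (simp add: prod.lessThan_Suc_shift mult.assoc del: prod.lessThan_Suc)
 have "tensor_act A t (i # j # js) = (\<Sum>i'\<in>UNIV. \<Sum>j'\<in>UNIV. \<Sum>ks\<in>?N. A $ i $ i' * A $ j $ j' * c ks * t (i' # j' # ks))" for i j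
  unfolding tensor_act_def list.size add_0_right add_Suc_right sum_lists_Suc P[unfolded list.size add_0_right add_Suc_right] ..
 then have "contraction br (tensor_act A t) js = (\<Sum>i\<in>UNIV. \<Sum>j\<in>UNIV. \<Sum>i'\<in>UNIV. \<Sum>j'\<in>UNIV. \<Sum>ks\<in>?N.
   (c ks * t (i' # j' # ks)) *s ((A $ i $ i' * A $ j $ j') *s br (axis i 1) (axis j 1)))"
  unfolding contraction_def by (simp add: vec.scale_sum_left mult_ac)
 also have "\<dots> = (\<Sum>i'\<in>UNIV. \<Sum>j'\<in>UNIV. \<Sum>ks\<in>?N. (c ks * t (i' # j' # ks)) *s
   (\<Sum>i\<in>UNIV. \<Sum>j\<in>UNIV. (A $ i $ i' * A $ j $ j') *s br (axis i 1) (axis j 1)))"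
  (is "?l = ?r")
 proof -
  let ?f = "\<lambda>i j i' j' ks. (c ks * t (i' # j' # ks)) *s ((A $ i $ i' * A $ j $ j') *s br (axis i 1) (axis j 1))"
  have "?l = (\<Sum>i\<in>UNIV. \<Sum>i'\<in>UNIV. \<Sum>j'\<in>UNIV. \<Sum>ks\<in>?N. \<Sum>j\<in>UNIV. ?f i j i' j' ks)"
   by (intro sum.cong refl sum_swap3)
  also have "\<dots> = (\<Sum>i'\<in>UNIV. \<Sum>j'\<in>UNIV. \<Sum>ks\<in>?N. \<Sum>i\<in>UNIV. \<Sum>j\<in>UNIV. ?f i j i' j' ks)"
   by (rule sum_swap3)
  also have "\<dots> = ?r" by (simp only: vec.scale_sum_right)
  finally show ?thesis .
 qed
 also have "\<dots> = (\<Sum>i'\<in>UNIV. \<Sum>j'\<in>UNIV. \<Sum>ks\<in>?N. (c ks * t (i' # j' # ks)) *s (A *v br (axis i' 1) (axis j' 1)))"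
 proof -
  have "(\<Sum>i\<in>UNIV. \<Sum>j\<in>UNIV. (A $ i $ i' * A $ j $ j') *s br (axis i 1) (axis j 1)) = A *v br (axis i' 1) (axis j' 1)" for i' j'
   using vec_sum_expand[of "A *v axis i' 1" "A *v axis j' 1"] lie_autD(1)[OF A]
   by (simp add: matrix_vector_axis)
  then show ?thesis by simp
 qed
 also have "\<dots> = (\<Sum>ks\<in>?N. c ks *s (A *v contraction br t ks))"
 proof -
  have "(\<Sum>i\<in>I. \<Sum>j\<in>J. \<Sum>k\<in>S. g i j k) = (\<Sum>k\<in>S. \<Sum>i\<in>I. \<Sum>j\<in>J. g i j k)"
   for I J :: "'d set" and S :: "'d list set" and g :: "'d \<Rightarrow> 'd \<Rightarrow> 'd list \<Rightarrow> complex^'d"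
   by (rule trans[OF sum.cong[OF refl sum.swap] sum.swap])
  then show ?thesis by (simp only: contraction_def vec.sum vec.scale vec.scale_sum_right vector_smult_assoc)
 qed
 also have "\<dots> = 0" unfolding t by simp
 finally show "contraction br (tensor_act A t) js = 0" .
qed

end

section \<open>Rings of polynomial functions\<close>

declare restrict_apply [simp del] restrict_apply' [simp]

lemma poly_functions_extensional: "p \<in> poly_functions s W ==> p \<in> extensional W"
 by (induction rule: poly_functions.induct) (auto simp: linear_forms_def restrict_extensional)

lemma poly_functions_eqI:
 "p \<in> poly_functions s W ==> q \<in> poly_functions s W ==> (\<And>w. w \<in> W ==> p w = q w) ==> p = q"
 by (rule extensionalityI[OF poly_functions_extensional poly_functions_extensional])

lemma sym_dual_simps [simp]:
 "carrier (sym_dual s W) = poly_functions s W"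
 "p \<otimes>\<^bsub>sym_dual s W\<^esub> q = (\<lambda>w\<in>W. p w * q w)"
 "p \<oplus>\<^bsub>sym_dual s W\<^esub> q = (\<lambda>w\<in>W. p w + q w)"
 "\<one>\<^bsub>sym_dual s W\<^esub> = (\<lambda>w\<in>W. 1)" "\<zero>\<^bsub>sym_dual s W\<^esub> = (\<lambda>w\<in>W. 0)"
 by (simp_all add: sym_dual_def)

lemma cring_sym_dual: "cring (sym_dual s W)"
proof (rule cringI)
 note PF = poly_functions.const poly_functions.add poly_functions.mult
 show "abelian_group (sym_dual s W)"
 proof (rule abelian_groupI; unfold sym_dual_simps)
  fix p assume p: "p \<in> poly_functions s W"
  show "\<exists>q\<in>poly_functions s W. (\<lambda>w\<in>W. q w + p w) = (\<lambda>w\<in>W. 0)"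
   by (rule bexI[of _ "\<lambda>w\<in>W. (\<lambda>w\<in>W. - 1) w * p w"]) (auto intro!: PF p restrict_ext)
  show "(\<lambda>w\<in>W. (\<lambda>w\<in>W. 0) w + p w) = p"
   by (rule poly_functions_eqI) (auto intro!: PF p)
 qed (auto intro!: PF restrict_ext simp: add_ac)
 show "Group.comm_monoid (sym_dual s W)"
 proof (rule comm_monoidI; unfold sym_dual_simps)
  fix p assume p: "p \<in> poly_functions s W"
  show "(\<lambda>w\<in>W. (\<lambda>w\<in>W. 1) w * p w) = p"
   by (rule poly_functions_eqI) (auto intro!: PF p)
 qed (auto intro!: PF restrict_ext simp: mult_ac)
qed (auto intro!: restrict_ext simp: distrib_right)

lemma poly_functions_compose:
 assumes p: "p \<in> poly_functions s W" and T: "\<And>w. w \<in> W ==> T w \<in> W"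
  "\<And>x y. x \<in> W ==> y \<in> W ==> T (x + y) = T x + T y" "\<And>c x. x \<in> W ==> T (s c x) = s c (T x)"
  and W: "\<And>x y. x \<in> W ==> y \<in> W ==> x + y \<in> W" "\<And>c x. x \<in> W ==> s c x \<in> W"
 shows "(\<lambda>w\<in>W. p (T w)) \<in> poly_functions s W"
 using p
proof (induction rule: poly_functions.induct)
 case (const c)
 have "(\<lambda>w\<in>W. (\<lambda>w\<in>W. c) (T w)) = (\<lambda>w\<in>W. c)" by (rule restrict_ext) (simp add: T)
 then show ?case by (simp add: poly_functions.const)
next
 case (form f)
 then show ?case by (intro poly_functions.form) (auto simp: linear_forms_def T W)
next
 case (add p q)
 have "(\<lambda>w\<in>W. (\<lambda>w\<in>W. p w + q w) (T w)) = (\<lambda>w\<in>W. (\<lambda>w\<in>W. p (T w)) w + (\<lambda>w\<in>W. q (T w)) w)"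
  by (rule restrict_ext) (simp add: T)
 then show ?case using poly_functions.add[OF add.IH] by simp
next
 case (mult p q)
 have "(\<lambda>w\<in>W. (\<lambda>w\<in>W. p w * q w) (T w)) = (\<lambda>w\<in>W. (\<lambda>w\<in>W. p (T w)) w * (\<lambda>w\<in>W. q (T w)) w)"
  by (rule restrict_ext) (simp add: T)
 then show ?case using poly_functions.mult[OF mult.IH] by simp
qed

text \<open>A polynomial in two variables is encoded as a \<open>complex poly poly\<close>: the
  outer variable is replaced by the constant polynomial [:x:], and the result is evaluated at
  y.\<close>

lemma poly_functions_plane:
 assumes p: "p \<in> poly_functions s W" and u: "u \<in> W" "v \<in> W"
  and W: "\<And>x y. x \<in> W ==> y \<in> W ==> x + y \<in> W" "\<And>c x. x \<in> W ==> s c x \<in> W"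
 shows "\<exists>r. \<forall>x y. p (s x u + s y v) = poly (poly r [:x:]) y"
 using p
proof (induction rule: poly_functions.induct)
 case (const c)
 show ?case by (intro exI[of _ "[:[:c:]:]"]) (simp add: u W)
next
 case (form f)
 then have "f (s x u + s y v) = x * f u + y * f v" for x y using u W by (simp add: linear_forms_def)
 then show ?case by (intro exI[of _ "[:[:0, f v:], [:f u:]:]"]) (simp add: algebra_simps)
next
 case (add p q)
 then obtain r1 r2 where "\<forall>x y. p (s x u + s y v) = poly (poly r1 [:x:]) y" "\<forall>x y. q (s x u + s y v) = poly (poly r2 [:x:]) y"
  by blast
 then show ?case by (intro exI[of _ "r1 + r2"]) (simp add: u W)
next
 case (mult p q)
 then obtain r1 r2 where "\<forall>x y. p (s x u + s y v) = poly (poly r1 [:x:]) y" "\<forall>x y. q (s x u + s y v) = poly (poly r2 [:x:]) y"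
  by blast
 then show ?case by (intro exI[of _ "r1 * r2"]) (simp add: u W)
qed

section \<open>Invariants in the coordinate ring\<close>

locale pluecker_action = simple_lie br
 for br :: "complex^'d \<Rightarrow> complex^'d \<Rightarrow> complex^'d" +
 fixes V :: "(complex^'d) set" and K :: "(complex^'d^'d) set"
 assumes K_group: "subgroup K GL" and K_aut: "A \<in> K ==> A \<in> lie_aut br"
  and K_V: "A \<in> K ==> v \<in> V ==> A *v v \<in> V" and V_subspace: "vec.subspace V"
begin

abbreviation "W \<equiv> pluecker_space br V"
abbreviation "S \<equiv> pluecker_sym br V"
abbreviation "I \<equiv> pluecker_ideal br V"
abbreviation "n \<equiv> half_dim V"

text \<open>The affine cone over the Lagrangian Grassmannian. The ideal is the set of polynomial
  functions vanishing on it, so a class in the coordinate ring is known from its values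
  there.\<close>

definition cone :: "('d tensor) set" where "cone = (\<Union>L\<in>LGr br V. ext_power n L)"

lemma W_iff: "w \<in> W \<longleftrightarrow> w \<in> ext_power n V \<and> contraction br w = (\<lambda>is. 0)"
 by (simp add: pluecker_space_def ext_power0_def)

lemma W_add: "x \<in> W ==> y \<in> W ==> x + y \<in> W"
 unfolding W_iff contraction_add
 by (intro conjI tensor.subspace_add[OF ext_power_subspace]) (simp_all add: plus_fun_def)

lemma W_scale: "x \<in> W ==> tscale c x \<in> W"
 unfolding W_iff contraction_scale
 by (intro conjI tensor.subspace_scale[OF ext_power_subspace]) simp_all

lemma W_zero: "0 \<in> W"
 unfolding W_iff contraction_0
 by (intro conjI refl tensor.subspace_0[OF ext_power_subspace])

lemma isotropic_W:
 assumes "L \<subseteq> V" "\<And>x y. x \<in> L ==> y \<in> L ==> br x y = 0" "w \<in> ext_power n L" shows "w \<in> W"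
 using assms(3)
proof (induction rule: ext_power_induct)
 case zero
 show ?case by (rule W_zero)
next
 case (step c vs t)
 have "contraction br (wedge vs) = (\<lambda>is. 0)"
  by (rule contraction_wedge) (use step(2) assms(2) in blast)
 moreover have "wedge vs \<in> ext_power n V" using step(1,2) assms(1) by (intro ext_power_wedge) auto
 ultimately have "wedge vs \<in> W" by (simp add: W_iff)
 then show ?case using step by (intro W_add W_scale)
qed

lemma LGr_D: "L \<in> LGr br V ==> vec.subspace L \<and> L \<subseteq> V \<and> vec.dim L = n \<and> (\<forall>x\<in>L. \<forall>y\<in>L. br x y = 0)"
 by (simp add: LGr_def)

lemma cone_W: "w \<in> cone ==> w \<in> W"
proof -
 assume "w \<in> cone"
 then obtain L where "L \<in> LGr br V" "w \<in> ext_power n L" unfolding cone_def by blast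
 then show ?thesis using LGr_D[of L] by (intro isotropic_W[of L]) auto
qed

lemma K_invertible: "A \<in> K ==> invertible A" using K_aut lie_autD by blast

lemma K_mult: "A \<in> K ==> B \<in> K ==> A ** B \<in> K"
 using subgroup.m_closed[OF K_group, of A B] by simp

lemma K_inv: "A \<in> K ==> matrix_inv A \<in> K"
 using subgroup.m_inv_closed[OF K_group, of A] by (simp add: GL_inv K_invertible)

lemma K_one: "mat 1 \<in> K" using subgroup.one_closed[OF K_group] by simp

lemma act_W: "A \<in> K ==> w \<in> W ==> tensor_act A w \<in> W"
 using tensor_act_ext_power[of w n V A V] contraction_tensor_act[OF K_aut] K_V by (simp add: W_iff)

lemma act_cone: assumes A: "A \<in> K" and w: "w \<in> cone" shows "tensor_act A w \<in> cone"
proof -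
 obtain L where L: "L \<in> LGr br V" "w \<in> ext_power n L" using w unfolding cone_def by blast
 have inj: "inj ((*v) A)"
  by (rule inj_on_inverseI[of _ "(*v) (matrix_inv A)"]) (simp add: matrix_inv_vector K_invertible[OF A])
 have "vec.dim ((*v) A ` L) = vec.dim L"
  by (rule vec.dim_image_eq) (use inj in \<open>auto intro: inj_on_subset\<close>)
 moreover have "vec.subspace ((*v) A ` L)" using LGr_D[OF L(1)] by (intro vec.subspace_image) auto
 moreover have "br (A *v x) (A *v y) = 0" if "x \<in> L" "y \<in> L" for x y
  using lie_autD(1)[OF K_aut[OF A], of x y] LGr_D[OF L(1)] that by simp
 ultimately have "(*v) A ` L \<in> LGr br V" using LGr_D[OF L(1)] K_V[OF A] by (auto simp: LGr_def)
 moreover have "tensor_act A w \<in> ext_power n ((*v) A ` L)" by (rule tensor_act_ext_power[OF L(2)]) blast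
 ultimately show ?thesis unfolding cone_def by blast
qed

lemma act_mult: "w \<in> W ==> tensor_act (A ** B) w = tensor_act A (tensor_act B w)"
 by (rule tensor_act_mult[of w n V]) (simp add: W_iff)

lemma act_inv: "A \<in> K ==> w \<in> W ==> tensor_act (matrix_inv A) (tensor_act A w) = w"
  "A \<in> K ==> w \<in> W ==> tensor_act A (tensor_act (matrix_inv A) w) = w"
 using act_mult[of w "matrix_inv A" A] act_mult[of w A "matrix_inv A"] tensor_act_one[of w n V]
 by (simp_all add: matrix_inv_works K_invertible W_iff)

lemma carrier_S: "carrier S = poly_functions tscale W" by (simp add: pluecker_sym_def)

lemma S_simps [simp]:
 "p \<otimes>\<^bsub>S\<^esub> q = (\<lambda>w\<in>W. p w * q w)" "p \<oplus>\<^bsub>S\<^esub> q = (\<lambda>w\<in>W. p w + q w)" "\<one>\<^bsub>S\<^esub> = (\<lambda>w\<in>W. 1)" "\<zero>\<^bsub>S\<^esub> = (\<lambda>w\<in>W. 0)"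
 by (simp_all add: pluecker_sym_def)

lemma cring_S: "cring S" unfolding pluecker_sym_def by (rule cring_sym_dual)

lemma S_const: "(\<lambda>w\<in>W. c) \<in> carrier S" and S_add: "p \<in> carrier S ==> q \<in> carrier S ==> (\<lambda>w\<in>W. p w + q w) \<in> carrier S"
 and S_mult: "p \<in> carrier S ==> q \<in> carrier S ==> (\<lambda>w\<in>W. p w * q w) \<in> carrier S"
 by (simp_all add: carrier_S poly_functions.const poly_functions.add poly_functions.mult)

lemma S_compose: "p \<in> carrier S ==> A \<in> K ==> (\<lambda>w\<in>W. p (tensor_act A w)) \<in> carrier S"
 unfolding carrier_S
 by (rule poly_functions_compose) (simp_all add: act_W tensor_act_add tensor_act_scale W_add W_scale)

lemma I_iff: "p \<in> I \<longleftrightarrow> p \<in> carrier S \<and> (\<forall>w\<in>cone. p w = 0)"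
 by (auto simp: pluecker_ideal_def cone_def)

lemma ideal_I: "ideal I S"
proof (rule idealI)
 interpret S: cring S by (rule cring_S)
 show "Ring.ring S" by (rule S.ring_axioms)
 show "subgroup I (add_monoid S)"
 proof (rule group.subgroupI)
  show "group (add_monoid S)" by (rule S.add.group_axioms)
  show "I \<subseteq> carrier (add_monoid S)" by (auto simp: I_iff)
  have "(\<lambda>w\<in>W. 0) \<in> I" by (simp add: I_iff S_const cone_W)
  then show "I \<noteq> {}" by blast
  fix p q assume p: "p \<in> I"
  have m: "(\<lambda>w\<in>W. (\<lambda>w\<in>W. - 1) w * p w) \<in> carrier S" using p S_mult[OF S_const] by (simp add: I_iff)
  have "\<ominus>\<^bsub>S\<^esub> p = (\<lambda>w\<in>W. (\<lambda>w\<in>W. - 1) w * p w)"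
   by (rule S.minus_equality) (use p m in \<open>auto simp: I_iff intro!: restrict_ext\<close>)
  then show "inv\<^bsub>add_monoid S\<^esub> p \<in> I" using p m by (simp add: a_inv_def I_iff cone_W)
  assume "q \<in> I"
  then show "p \<otimes>\<^bsub>add_monoid S\<^esub> q \<in> I" using p S_add by (simp add: I_iff cone_W)
 qed
qed (auto simp: I_iff cone_W S_mult)

text \<open>The coset of p modulo the ideal, described by values on the cone; this form makes
  equality of classes a pointwise statement.\<close>

definition cls :: "('d tensor \<Rightarrow> complex) \<Rightarrow> ('d tensor \<Rightarrow> complex) set" where
 "cls p = {q \<in> carrier S. \<forall>w\<in>cone. q w = p w}"

lemma coset_cls: assumes p: "p \<in> carrier S" shows "I +>\<^bsub>S\<^esub> p = cls p"
proof
 show "I +>\<^bsub>S\<^esub> p \<subseteq> cls p"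
  using p S_add by (auto simp: a_r_coset_def' I_iff cls_def cone_W)
 show "cls p \<subseteq> I +>\<^bsub>S\<^esub> p"
 proof
  fix q assume q: "q \<in> cls p"
  let ?m = "\<lambda>w\<in>W. (\<lambda>w\<in>W. - 1) w * p w"
  let ?d = "\<lambda>w\<in>W. q w + ?m w"
  have "?m \<in> carrier S" by (rule S_mult[OF S_const p])
  then have "?d \<in> carrier S" using q by (intro S_add) (simp_all add: cls_def)
  then have "?d \<in> I" using q by (simp add: I_iff cls_def cone_W)
  moreover have "q = ?d \<oplus>\<^bsub>S\<^esub> p"
   using q by (intro extensionalityI[of q W]) (auto simp: cls_def carrier_S poly_functions_extensional)
  ultimately show "q \<in> I +>\<^bsub>S\<^esub> p" unfolding a_r_coset_def' by blast
 qed
qed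

lemma cls_eq_iff: "p \<in> carrier S ==> q \<in> carrier S ==> cls p = cls q \<longleftrightarrow> (\<forall>w\<in>cone. p w = q w)"
 unfolding cls_def by auto

lemma cls_self: "p \<in> carrier S ==> p \<in> cls p" by (simp add: cls_def)

lemma coord_ring_carrier: "carrier (coord_ring br V) = cls ` carrier S"
 using coset_cls by (auto simp: coord_ring_def FactRing_def A_RCOSETS_def' image_iff)

lemma cls_mult: "p \<in> carrier S ==> q \<in> carrier S ==> cls p \<otimes>\<^bsub>coord_ring br V\<^esub> cls q = cls (\<lambda>w\<in>W. p w * q w)"
 using ideal.rcoset_mult_add[OF ideal_I, of p q] coset_cls[of p] coset_cls[of q] coset_cls[OF S_mult, of p q]
 by (simp add: coord_ring_def FactRing_def)

lemma cls_add: "p \<in> carrier S ==> q \<in> carrier S ==> cls p \<oplus>\<^bsub>coord_ring br V\<^esub> cls q = cls (\<lambda>w\<in>W. p w + q w)"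
proof -
 interpret I: ideal I S by (rule ideal_I)
 show "p \<in> carrier S ==> q \<in> carrier S ==> ?thesis"
  using I.a_rcos_sum[of p q] coset_cls[of p] coset_cls[of q] coset_cls[OF S_add, of p q]
  by (simp add: coord_ring_def FactRing_def)
qed

lemma coord_ring_one: "\<one>\<^bsub>coord_ring br V\<^esub> = cls (\<lambda>w\<in>W. 1)"
 using coset_cls[OF S_const] by (simp add: coord_ring_def FactRing_def)

lemma coord_ring_zero: "\<zero>\<^bsub>coord_ring br V\<^esub> = cls (\<lambda>w\<in>W. 0)"
 by (auto simp: coord_ring_def FactRing_def cls_def I_iff cone_W)

lemma coord_ring_ring: "Ring.ring (coord_ring br V)"
 unfolding coord_ring_def by (rule ideal.quotient_is_ring[OF ideal_I])

lemma coord_const_cls: "coord_const br V c = cls (\<lambda>w\<in>W. c)"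
 unfolding coord_const_def by (rule coset_cls[OF S_const])

lemma coord_act_cls:
 assumes p: "p \<in> carrier S" and A: "A \<in> K"
 shows "coord_act br V A (cls p) = cls (\<lambda>w\<in>W. p (tensor_act (matrix_inv A) w))"
proof
 show "coord_act br V A (cls p) \<subseteq> cls (\<lambda>w\<in>W. p (tensor_act (matrix_inv A) w))"
  using S_compose[OF _ K_inv[OF A]] act_cone[OF K_inv[OF A]] by (auto simp: coord_act_def cls_def cone_W)
 show "cls (\<lambda>w\<in>W. p (tensor_act (matrix_inv A) w)) \<subseteq> coord_act br V A (cls p)"
 proof
  fix q assume q: "q \<in> cls (\<lambda>w\<in>W. p (tensor_act (matrix_inv A) w))"
  let ?q = "\<lambda>w\<in>W. q (tensor_act A w)"
  have "?q \<in> carrier S" using q by (intro S_compose A) (simp add: cls_def)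
  moreover have "?q w = p w" if w: "w \<in> cone" for w
   using q act_cone[OF A w] act_inv(1)[OF A cone_W[OF w]] by (simp add: cls_def cone_W w act_W[OF A])
  ultimately have "?q \<in> cls p" by (simp add: cls_def)
  moreover have "q = (\<lambda>w\<in>W. ?q (tensor_act (matrix_inv A) w))"
   using q by (intro extensionalityI[of q W])
    (auto simp: cls_def carrier_S poly_functions_extensional act_W[OF K_inv[OF A]] act_inv(2)[OF A])
  ultimately show "q \<in> coord_act br V A (cls p)" unfolding coord_act_def by blast
 qed
qed

lemma derived_subset: "derived GL K \<subseteq> K"
 by (rule group.derived_incl[OF group_GL subset_refl K_group])

lemma derived_inv: assumes "A \<in> derived GL K" shows "matrix_inv A \<in> derived GL K"
proof -
 have "subgroup (derived GL K) GL"
  by (rule group.derived_is_subgroup[OF group_GL]) (use K_invertible in auto)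
 then show ?thesis using subgroup.m_inv_closed[of "derived GL K" GL A] assms derived_subset K_invertible
  by (auto simp: GL_inv subset_iff)
qed

lemma derived_mult: "A \<in> derived GL K ==> B \<in> derived GL K ==> A ** B \<in> derived GL K"
 using subgroup.m_closed[OF group.derived_is_subgroup[OF group_GL, of K], of A B] K_invertible by auto

lemma derived_one: "mat 1 \<in> derived GL K"
 using subgroup.one_closed[OF group.derived_is_subgroup[OF group_GL, of K]] K_invertible by auto

lemma commutator_derived: "A \<in> K ==> B \<in> K ==> A ** B ** matrix_inv A ** matrix_inv B \<in> derived GL K"
 unfolding derived_def
 by (rule generate.incl, rule UN_I[of A], assumption, rule UN_I[of B], assumption) (simp add: GL_inv K_invertible)

definition invariant :: "('d tensor \<Rightarrow> complex) \<Rightarrow> bool" where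
 "invariant p \<longleftrightarrow> p \<in> carrier S \<and> (\<forall>A\<in>derived GL K. \<forall>w\<in>cone. p (tensor_act A w) = p w)"

lemma invariantD: "invariant p ==> A \<in> derived GL K ==> w \<in> cone ==> p (tensor_act A w) = p w"
 by (simp add: invariant_def)

lemma cls_invariant: assumes p: "p \<in> carrier S" shows "cls p \<in> carrier (invariant_ring br V K) \<longleftrightarrow> invariant p"
proof -
 have "coord_act br V A (cls p) = cls p \<longleftrightarrow> (\<forall>w\<in>cone. p (tensor_act (matrix_inv A) w) = p w)"
  if "A \<in> derived GL K" for A
 proof -
  have A: "A \<in> K" using that derived_subset by blast
  show ?thesis unfolding coord_act_cls[OF p A] cls_eq_iff[OF S_compose[OF p K_inv[OF A]] p]
   by (simp add: cone_W)
 qed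
 then have "cls p \<in> carrier (invariant_ring br V K) \<longleftrightarrow> (\<forall>A\<in>derived GL K. \<forall>w\<in>cone. p (tensor_act (matrix_inv A) w) = p w)"
  using p by (simp add: invariant_ring_def coord_ring_carrier)
 also have "\<dots> \<longleftrightarrow> invariant p"
 proof
  assume *: "\<forall>A\<in>derived GL K. \<forall>w\<in>cone. p (tensor_act (matrix_inv A) w) = p w"
  have "p (tensor_act A w) = p w" if A: "A \<in> derived GL K" and w: "w \<in> cone" for A w
  proof -
   have "matrix_inv (matrix_inv A) = A"
    using A derived_subset K_invertible by (intro matrix_inv_unique matrix_inv_works invertible_matrix_inv) auto
   then show ?thesis using bspec[OF bspec[OF * derived_inv[OF A]] w] by simp
  qed
  then show "invariant p" using p by (simp add: invariant_def)
 qed (simp add: invariant_def derived_inv)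
 finally show ?thesis .
qed

lemma invariant_ring_carrier: "carrier (invariant_ring br V K) = {cls p | p. invariant p}"
proof -
 have "carrier (invariant_ring br V K) \<subseteq> cls ` carrier S" by (auto simp: invariant_ring_def coord_ring_carrier)
 moreover have "cls p \<in> carrier (invariant_ring br V K)" if "invariant p" for p
  using that cls_invariant[of p] by (simp add: invariant_def)
 ultimately show ?thesis using cls_invariant by blast
qed

lemma invariant_ring_simps:
 "x \<otimes>\<^bsub>invariant_ring br V K\<^esub> y = x \<otimes>\<^bsub>coord_ring br V\<^esub> y" "x \<oplus>\<^bsub>invariant_ring br V K\<^esub> y = x \<oplus>\<^bsub>coord_ring br V\<^esub> y"
 "\<one>\<^bsub>invariant_ring br V K\<^esub> = cls (\<lambda>w\<in>W. 1)" "\<zero>\<^bsub>invariant_ring br V K\<^esub> = cls (\<lambda>w\<in>W. 0)"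
 by (simp_all add: invariant_ring_def coord_ring_one coord_ring_zero)

lemma invariant_const: "invariant (\<lambda>w\<in>W. c)"
 using derived_subset act_W by (auto simp: invariant_def S_const cone_W subset_iff)

lemma invariant_add: "invariant p ==> invariant q ==> invariant (\<lambda>w\<in>W. p w + q w)"
 and invariant_mult: "invariant p ==> invariant q ==> invariant (\<lambda>w\<in>W. p w * q w)"
 using derived_subset act_W by (auto simp: invariant_def S_add S_mult cone_W subset_iff)

lemma invariant_S: "invariant p ==> p \<in> carrier S" by (simp add: invariant_def)

lemma invariant_ring_ring: "Ring.ring (invariant_ring br V K)"
proof -
 let ?C = "{cls p | p. invariant p}"
 interpret C: Ring.ring "coord_ring br V" by (rule coord_ring_ring)
 have "subring ?C (coord_ring br V)"
 proof (rule C.subringI)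
  show "?C \<subseteq> carrier (coord_ring br V)" using invariant_S by (auto simp: coord_ring_carrier)
  show "\<one>\<^bsub>coord_ring br V\<^esub> \<in> ?C" using invariant_const coord_ring_one by blast
  fix x y assume "x \<in> ?C" "y \<in> ?C"
  then obtain p q where pq: "x = cls p" "y = cls q" "invariant p" "invariant q" by blast
  show "x \<otimes>\<^bsub>coord_ring br V\<^esub> y \<in> ?C" using cls_mult invariant_mult invariant_S pq by blast
  show "x \<oplus>\<^bsub>coord_ring br V\<^esub> y \<in> ?C" using cls_add invariant_add invariant_S pq by blast
 next
  fix x assume "x \<in> ?C"
  then obtain p where p: "x = cls p" "invariant p" by blast
  let ?m = "\<lambda>w\<in>W. (\<lambda>w\<in>W. - 1) w * p w"
  have m: "invariant ?m" by (rule invariant_mult[OF invariant_const p(2)])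
  have "cls ?m \<oplus>\<^bsub>coord_ring br V\<^esub> x = cls (\<lambda>w\<in>W. ?m w + p w)"
   unfolding p(1) by (rule cls_add[OF invariant_S[OF m] invariant_S[OF p(2)]])
  also have "(\<lambda>w\<in>W. ?m w + p w) = (\<lambda>w\<in>W. 0)" by (rule restrict_ext) simp
  finally have "cls ?m \<oplus>\<^bsub>coord_ring br V\<^esub> x = \<zero>\<^bsub>coord_ring br V\<^esub>" by (simp only: coord_ring_zero)
  then have "\<ominus>\<^bsub>coord_ring br V\<^esub> x = cls ?m"
   by (rule C.minus_equality) (use p m invariant_S in \<open>auto simp: coord_ring_carrier\<close>)
  then show "\<ominus>\<^bsub>coord_ring br V\<^esub> x \<in> ?C" using m by blast
 qed
 then have "Ring.ring ((coord_ring br V)\<lparr>carrier := ?C\<rparr>)" by (rule C.subring_is_ring)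
 moreover have "(coord_ring br V)\<lparr>carrier := ?C\<rparr> = invariant_ring br V K"
  using invariant_ring_carrier by (simp add: invariant_ring_def)
 ultimately show ?thesis by simp
qed

definition gens :: "('d tensor \<Rightarrow> complex) set set \<Rightarrow> ('d tensor \<Rightarrow> complex) set set" where
 "gens F = generate_ring (invariant_ring br V K) (range (coord_const br V) \<union> F)"

lemma gens_const: "cls (\<lambda>w\<in>W. c) \<in> gens F"
 unfolding gens_def coord_const_cls[symmetric] by (rule generate_ring.incl) simp

lemma gens_base: "f \<in> F ==> f \<in> gens F"
 unfolding gens_def by (rule generate_ring.incl) simp

lemma gens_add: "p \<in> carrier S ==> q \<in> carrier S ==> cls p \<in> gens F ==> cls q \<in> gens F ==> cls (\<lambda>w\<in>W. p w + q w) \<in> gens F"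
 unfolding gens_def cls_add[symmetric] invariant_ring_simps(2)[symmetric] by (rule generate_ring.eng_add)

lemma gens_mult: "p \<in> carrier S ==> q \<in> carrier S ==> cls p \<in> gens F ==> cls q \<in> gens F ==> cls (\<lambda>w\<in>W. p w * q w) \<in> gens F"
 unfolding gens_def cls_mult[symmetric] invariant_ring_simps(1)[symmetric] by (rule generate_ring.eng_mult)

lemma gens_poly:
 assumes f: "f \<in> carrier S" "cls f \<in> gens F"
 shows "(\<lambda>w\<in>W. poly r (f w)) \<in> carrier S \<and> cls (\<lambda>w\<in>W. poly r (f w)) \<in> gens F"
proof (induction r)
 case 0
 then show ?case by (simp add: S_const gens_const)
next
 case (pCons a r)
 have "(\<lambda>w\<in>W. poly (pCons a r) (f w)) = (\<lambda>w\<in>W. (\<lambda>w\<in>W. a) w + (\<lambda>w\<in>W. f w * (\<lambda>w\<in>W. poly r (f w)) w) w)"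
  by (rule restrict_ext) simp
 moreover have "(\<lambda>w\<in>W. f w * (\<lambda>w\<in>W. poly r (f w)) w) \<in> carrier S"
  "cls (\<lambda>w\<in>W. f w * (\<lambda>w\<in>W. poly r (f w)) w) \<in> gens F"
  using pCons f by (blast intro: S_mult gens_mult)+
 ultimately show ?case by (simp only: S_add S_const gens_add gens_const simp_thms)
qed

lemma gens_poly2:
 assumes f: "f \<in> carrier S" "cls f \<in> gens F" and g: "g \<in> carrier S" "cls g \<in> gens F"
 shows "(\<lambda>w\<in>W. poly (poly r [:f w:]) (g w)) \<in> carrier S \<and> cls (\<lambda>w\<in>W. poly (poly r [:f w:]) (g w)) \<in> gens F"
proof (induction r)
 case 0
 then show ?case by (simp add: S_const gens_const)
next
 case (pCons a r)
 have "(\<lambda>w\<in>W. poly (poly (pCons a r) [:f w:]) (g w)) =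
   (\<lambda>w\<in>W. (\<lambda>w\<in>W. poly a (g w)) w + (\<lambda>w\<in>W. f w * (\<lambda>w\<in>W. poly (poly r [:f w:]) (g w)) w) w)"
  by (rule restrict_ext) simp
 moreover have "(\<lambda>w\<in>W. f w * (\<lambda>w\<in>W. poly (poly r [:f w:]) (g w)) w) \<in> carrier S"
  "cls (\<lambda>w\<in>W. f w * (\<lambda>w\<in>W. poly (poly r [:f w:]) (g w)) w) \<in> gens F"
  using pCons f by (blast intro: S_mult gens_mult)+
 ultimately show ?case using gens_poly[OF g, of a] by (simp only: S_add gens_add simp_thms)
qed

lemma generates_invariantsI:
 assumes F: "F \<subseteq> {cls p | p. invariant p}" and gen: "\<And>p. invariant p ==> cls p \<in> gens F"
 shows "generates_invariants br V K F"
proof -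
 have "range (coord_const br V) \<union> F \<subseteq> carrier (invariant_ring br V K)"
  using F invariant_const unfolding invariant_ring_carrier coord_const_cls by blast
 then have "gens F \<subseteq> carrier (invariant_ring br V K)"
  unfolding gens_def by (rule ring.generate_ring_incl[OF invariant_ring_ring])
 moreover have "carrier (invariant_ring br V K) \<subseteq> gens F" using gen unfolding invariant_ring_carrier by blast
 ultimately show ?thesis unfolding generates_invariants_def gens_def by blast
qed

text \<open>A semi-invariant is invariant under commutators because its character is multiplicative.\<close>
lemma semi_invariant:
 assumes f: "f \<in> carrier S" and semi: "\<And>A. A \<in> K ==> \<exists>c. \<forall>w\<in>cone. f (tensor_act A w) = c * f w"
  and w0: "w0 \<in> cone" "f w0 \<noteq> 0"
 shows "invariant f"
proof -
 obtain \<kappa> where \<kappa>: "\<And>A w. A \<in> K ==> w \<in> cone ==> f (tensor_act A w) = \<kappa> A * f w"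
  using bchoice[of K "\<lambda>A c. \<forall>w\<in>cone. f (tensor_act A w) = c * f w"] semi by blast
 have \<kappa>_mult: "\<kappa> (A ** B) = \<kappa> A * \<kappa> B" if A: "A \<in> K" "B \<in> K" for A B
 proof -
  have "\<kappa> (A ** B) * f w0 = f (tensor_act (A ** B) w0)" by (rule \<kappa>[OF K_mult[OF A] w0(1), symmetric])
  also have "\<dots> = f (tensor_act A (tensor_act B w0))" by (simp only: act_mult[OF cone_W[OF w0(1)]])
  also have "\<dots> = (\<kappa> A * \<kappa> B) * f w0"
   by (simp only: \<kappa>[OF A(1) act_cone[OF A(2) w0(1)]] \<kappa>[OF A(2) w0(1)] mult.assoc)
  finally have "\<kappa> (A ** B) * f w0 = (\<kappa> A * \<kappa> B) * f w0" .
  then show ?thesis by (rule mult_right_cancel[THEN iffD1, OF w0(2)])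
 qed
 have \<kappa>_one: "\<kappa> (mat 1) = 1"
  using \<kappa>[OF K_one w0(1)] tensor_act_one[of w0 n V] cone_W[OF w0(1)] w0(2) by (simp add: W_iff)
 have \<kappa>_inv: "\<kappa> A * \<kappa> (matrix_inv A) = 1" if "A \<in> K" for A
  using \<kappa>_mult[OF that K_inv[OF that]] \<kappa>_one by (simp add: matrix_inv_works K_invertible that)
 have der: "A \<in> K \<and> \<kappa> A = 1" if "A \<in> derived GL K" for A
  using that unfolding derived_def
 proof (induction rule: generate.induct)
  case one
  then show ?case using K_one \<kappa>_one by simp
 next
  case (incl h)
  then obtain A B where AB: "A \<in> K" "B \<in> K" "h = A ** B ** matrix_inv A ** matrix_inv B"
   by (auto simp: GL_inv K_invertible)
  then have "\<kappa> h = (\<kappa> A * \<kappa> (matrix_inv A)) * (\<kappa> B * \<kappa> (matrix_inv B))"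
   by (simp add: \<kappa>_mult K_mult K_inv)
  then show ?case using AB \<kappa>_inv by (simp add: K_mult K_inv)
 next
  case (inv h)
  then obtain A B where AB: "A \<in> K" "B \<in> K" "h = A ** B ** matrix_inv A ** matrix_inv B"
   by (auto simp: GL_inv K_invertible)
  then have h: "h \<in> K" by (simp add: K_mult K_inv)
  have "\<kappa> h = (\<kappa> A * \<kappa> (matrix_inv A)) * (\<kappa> B * \<kappa> (matrix_inv B))"
   using AB by (simp add: \<kappa>_mult K_mult K_inv)
  then have "\<kappa> h = 1" using AB \<kappa>_inv by simp
  then have "\<kappa> (matrix_inv h) = 1" using \<kappa>_inv[OF h] by simp
  then show ?case using h by (simp add: GL_inv K_invertible K_inv)
 next
  case (eng h1 h2)
  then show ?case by (simp add: K_mult \<kappa>_mult)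
 qed
 then have "f (tensor_act A w) = f w" if "A \<in> derived GL K" "w \<in> cone" for A w
  using \<kappa>[of A w] der[OF that(1)] that by simp
 then show ?thesis using f by (simp add: invariant_def)
qed

text \<open>The value at the coset of A is the character at the inverse of A, because functions are
  acted on through inverses; it is well defined because f is invariant under the derived group. The
  values are part of the conclusion so that weights can be compared.\<close>

lemma weight_exists:
 assumes f: "f \<in> carrier S" and \<kappa>: "\<And>A w. A \<in> K ==> w \<in> cone ==> f (tensor_act A w) = \<kappa> A * f w"
  and w0: "w0 \<in> cone" "f w0 \<noteq> 0"
 shows "\<exists>\<theta>. has_weight br V K (cls f) \<theta> \<and>
  (\<forall>A\<in>K. derived GL K #>\<^bsub>GL\<lparr>carrier := K\<rparr>\<^esub> A \<in> carrier (torus_quotient K) \<and>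
   \<theta> (derived GL K #>\<^bsub>GL\<lparr>carrier := K\<rparr>\<^esub> A) = \<kappa> (matrix_inv A))"
proof -
 let ?D = "derived GL K"
 have inv: "invariant f" using semi_invariant[OF f _ w0] \<kappa> by blast
 have coset: "?D #>\<^bsub>GL\<lparr>carrier := K\<rparr>\<^esub> A = {d ** A | d. d \<in> ?D}" for A
  by (auto simp: r_coset_def GL_def)
 have const: "\<kappa> (matrix_inv B) = \<kappa> (matrix_inv A)" if A: "A \<in> K" and B: "B \<in> {d ** A | d. d \<in> ?D}" for A B
 proof -
  obtain d where d: "d \<in> ?D" "B = d ** A" using B by blast
  have dK: "d \<in> K" using d derived_subset by blast
  have "matrix_inv B = matrix_inv A ** matrix_inv d"
   unfolding d(2) by (rule matrix_inv_mult) (use dK A K_invertible in auto)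
  then have "\<kappa> (matrix_inv B) * f w0 = f (tensor_act (matrix_inv A) (tensor_act (matrix_inv d) w0))"
   using \<kappa>[OF K_inv w0(1), of B] act_mult[OF cone_W[OF w0(1)]] K_mult[OF dK A] d(2) by simp
  also have "\<dots> = \<kappa> (matrix_inv A) * f w0"
   using \<kappa>[OF K_inv[OF A] act_cone[OF K_inv[OF dK] w0(1)]] invariantD[OF inv derived_inv[OF d(1)] w0(1)] by simp
  finally show ?thesis using w0(2) by simp
 qed
 let ?\<theta> = "\<lambda>t. \<kappa> (matrix_inv (SOME A. A \<in> t))"
 have self: "A \<in> {d ** A | d. d \<in> ?D}" for A using derived_one by (auto intro!: exI[of _ "mat 1"])
 have \<theta>: "?\<theta> {d ** A | d. d \<in> ?D} = \<kappa> (matrix_inv A)" if A: "A \<in> K" for A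
  by (rule const[OF A someI[of "\<lambda>B. B \<in> {d ** A | d. d \<in> ?D}", OF self]])
 have carr: "carrier (torus_quotient K) = {{d ** A | d. d \<in> ?D} | A. A \<in> K}"
  unfolding torus_quotient_def FactGroup_def RCOSETS_def coset by auto
 have "has_weight br V K (cls f) ?\<theta>"
  unfolding has_weight_def
 proof (intro ballI)
  fix t B assume t: "t \<in> carrier (torus_quotient K)" and B: "B \<in> t"
  obtain A where A: "A \<in> K" "t = {d ** A | d. d \<in> ?D}" using t carr by blast
  have BK: "B \<in> K" using B A derived_subset K_mult by blast
  have th: "?\<theta> t = \<kappa> (matrix_inv B)" unfolding A(2) \<theta>[OF A(1)] by (rule const[OF A(1), symmetric]) (use B A(2) in simp)
  show "coord_act br V B (cls f) = coord_const br V (?\<theta> t) \<otimes>\<^bsub>invariant_ring br V K\<^esub> cls f"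
   unfolding th coord_act_cls[OF f BK] coord_const_cls invariant_ring_simps cls_mult[OF S_const f]
   by (subst cls_eq_iff[OF S_compose[OF f K_inv[OF BK]] S_mult[OF S_const f]])
     (simp add: cone_W \<kappa>[OF K_inv[OF BK]])
 qed
 moreover have "{d ** A | d. d \<in> ?D} \<in> carrier (torus_quotient K)" if "A \<in> K" for A using carr that by blast
 ultimately show ?thesis unfolding coset using \<theta> by (intro exI[of _ ?\<theta>]) blast
qed

lemma invariant_of_degreeI:
 assumes "invariant f" "\<And>c w. w \<in> W ==> f (tscale c w) = c ^ k * f w" "w0 \<in> cone" "f w0 \<noteq> 0"
 shows "invariant_of_degree br V K k (cls f)"
proof -
 have "cls f \<noteq> cls (\<lambda>w\<in>W. 0)" using cls_eq_iff[OF invariant_S[OF assms(1)] S_const] assms(3,4) cone_W by auto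
 moreover have "homogeneous tscale W k f" using assms(1,2) by (simp add: homogeneous_def invariant_def carrier_S)
 ultimately show ?thesis
  using assms(1) cls_self[OF invariant_S[OF assms(1)]]
  by (auto simp: invariant_of_degree_def invariant_ring_simps invariant_ring_carrier)
qed

end

context levi_lie
begin

sublocale pl: pluecker_action br "gr (- 1)" G\<^sub>0
 by (intro pluecker_action.intro simple_lie_axioms pluecker_action_axioms.intro;
   (rule G0_subgroup | rule gr_subspace | (rule PP_aut[OF G0_PP], assumption) | (rule G0_gr, assumption, assumption)))

end

section \<open>The root system of type G2\<close>

context contact_lie
begin

lemma coroot_triple:
 assumes co: "is_coroot br H \<delta> k" and root: "\<delta> \<in> roots br H"
 shows "\<exists>x y. x \<in> \<W> \<delta> \<and> x \<noteq> 0 \<and> y \<in> \<W> (\<lambda>k. - \<delta> k) \<and> y \<noteq> 0 \<and> sl2 x k y"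
proof -
 have k: "k \<in> H" "\<delta> k = 2" using co by (auto simp: is_coroot_def)
 have "\<W> \<delta> \<noteq> {0}" using root by (simp add: roots_def)
 then obtain x where x: "x \<in> \<W> \<delta>" "x \<noteq> 0" using vec.subspace_0[OF wt_subspace] by blast
 obtain y where y: "y \<in> \<W> (\<lambda>k. - \<delta> k)" "br x y = k"
  using coroot_bracket[OF co, of x] root_space_one_dim[OF x k(1)] k(2) by auto
 have "k \<noteq> 0" using k wt_linear(2)[OF x k(1), of 0] by auto
 then have "y \<noteq> 0" using y(2) by auto
 moreover have "sl2 x k y" unfolding sl2_def using wtD[OF x(1) k(1)] wtD[OF y(1) k(1)] k(2) y(2) by simp
 ultimately show ?thesis using x y by blast
qed

text \<open>At the top of the x-string through v the weight is M \<delta> with M >= 2, and the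
  string going down has 2 M + 1 members. After M - 1 steps down it reaches a multiple of x, which y
  annihilates in three more steps, although M + 2 <= 2 M.\<close>

lemma no_multiple_root:
 assumes sl: "sl2 x k y" and x: "x \<in> \<W> \<delta>" "x \<noteq> 0" and y: "y \<in> \<W> (\<lambda>k. - \<delta> k)" and k: "k \<in> H" "\<delta> k = 2"
  and v: "v \<in> \<W> (\<lambda>k. of_nat N * \<delta> k)" and N: "N \<ge> 2"
 shows "v = 0"
proof (rule ccontr)
 assume v0: "v \<noteq> 0"
 have rel: "br k x = 2 *s x" "br k y = (- 2) *s y" "br x y = k" using sl by (auto simp: sl2_def)
 obtain m where m: "\<And>j. j \<le> m ==> (br x ^^ j) v \<noteq> 0" "(br x ^^ Suc m) v = 0"
  by (rule eigen_top[OF k(1) rel(1) _ wtD[OF v k(1)] v0]) auto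
 define M where "M = N + m"
 let ?u = "(br x ^^ m) v"
 have "?u \<in> \<W> (\<lambda>k. of_nat N * \<delta> k + of_nat m * \<delta> k)" by (rule wt_funpow[OF x(1) v])
 then have u: "?u \<in> \<W> (\<lambda>k. of_nat M * \<delta> k)" by (simp add: M_def distrib_right)
 have u0: "?u \<noteq> 0" "br x ?u = 0" using m by auto
 obtain m' where m': "of_nat M * \<delta> k = of_nat m'" "\<And>j. j \<le> m' ==> (br y ^^ j) ?u \<noteq> 0"
  using highest_weight[OF k(1) sl wtD[OF u k(1)] u0] by metis
 have "of_nat (M * 2) = (of_nat m' :: complex)" using m'(1) k(2) by simp
 then have mM: "m' = M * 2" by (simp only: of_nat_eq_iff)
 have M2: "M \<ge> 2" using N by (simp add: M_def)
 let ?z = "(br y ^^ (M - 1)) ?u"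
 have "?z \<in> \<W> (\<lambda>k. of_nat M * \<delta> k + of_nat (M - 1) * - \<delta> k)" by (rule wt_funpow[OF y u])
 moreover have "of_nat M * \<delta> k + of_nat (M - 1) * - \<delta> k = \<delta> k" for k using M2 by (simp add: of_nat_diff algebra_simps)
 ultimately have "?z \<in> \<W> \<delta>" by simp
 then obtain c where c: "?z = c *s x" using root_space_one_dim[OF x k(1)] k(2) by auto
 have yx: "br y x = - k" using rel br_skew[of y x] by simp
 have yk: "br y k = 2 *s y" using rel br_skew[of y k] by simp
 \<comment> \<open>From x the steps lead to -k, then to -2 y, then to 0.\<close>
 have "(br y ^^ 3) ?z = 0" unfolding c by (simp add: numeral_3_eq_3 br_bilinear yx yk)
 then have "(br y ^^ (3 + (M - 1))) ?u = 0" by (simp only: funpow_add o_apply)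
 moreover have "3 + (M - 1) \<le> m'" using mM M2 by simp
 ultimately show False using m'(2) by blast
qed

end

text \<open>The values of \<open>cartan_int\<close> make \<open>al\<close> the short and
  \<open>be\<close> the long simple root.\<close>

locale g2_lie = levi_lie br H \<Delta> \<gamma> h G\<^sub>0 Pp
 for br :: "complex^'d \<Rightarrow> complex^'d \<Rightarrow> complex^'d" and H \<Delta> \<gamma> h G\<^sub>0 Pp +
 fixes al be :: "complex^'d \<Rightarrow> complex" and ha hb :: "complex^'d"
 assumes Delta: "\<Delta> = {al, be}" "al \<noteq> be" and coroots: "is_coroot br H al ha" "is_coroot br H be hb"
  and cartan_int: "al hb = - 1" "be ha = - 3"
begin

lemma ha: "ha \<in> H" "al ha = 2" and hb: "hb \<in> H" "be hb = 2"
 using coroots by (auto simp: is_coroot_def)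

lemma simple_roots: "al \<in> roots br H" "be \<in> roots br H"
 using base Delta by (auto simp: root_base_def)

lemma sum_Delta: "(\<Sum>\<delta>\<in>\<Delta>. f \<delta>) = f al + f be"
 using Delta by simp

lemma indep2:
 assumes "\<And>k. k \<in> H ==> a * al k + b * be k = 0" shows "a = 0" "b = 0"
 using \<Delta>_independent[of "\<lambda>\<delta>. if \<delta> = al then a else b" al] \<Delta>_independent[of "\<lambda>\<delta>. if \<delta> = al then a else b" be]
  assms Delta by (auto simp: sum_Delta)

definition ww :: "int \<Rightarrow> int \<Rightarrow> complex^'d \<Rightarrow> complex" where
 "ww m n k = of_int m * al k + of_int n * be k"

abbreviation "R m n \<equiv> \<W> (ww m n)"

lemma ww_eqD: assumes "\<And>k. k \<in> H ==> ww m n k = ww m' n' k" shows "m = m'" "n = n'"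
proof -
 have z: "\<And>k. k \<in> H ==> (of_int m - of_int m') * al k + (of_int n - of_int n') * be k = 0"
  using assms by (simp add: ww_def algebra_simps)
 have "complex_of_int m - of_int m' = 0" "complex_of_int n - of_int n' = 0" by (rule indep2[OF z], assumption)+
 then show "m = m'" "n = n'" by simp_all
qed

lemma ww_nonzero: "(m, n) \<noteq> (0, 0) ==> \<exists>k\<in>H. ww m n k \<noteq> 0"
proof (rule ccontr)
 assume mn: "(m, n) \<noteq> (0, 0)" and "\<not> (\<exists>k\<in>H. ww m n k \<noteq> 0)"
 then have "\<And>k. k \<in> H ==> ww m n k = ww 0 0 k" by (auto simp: ww_def)
 then show False using ww_eqD[of m n 0 0] mn by blast
qed

lemma R_br: "x \<in> R m n ==> y \<in> R m' n' ==> br x y \<in> R (m + m') (n + n')"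
proof -
 assume "x \<in> R m n" "y \<in> R m' n'"
 then have "br x y \<in> \<W> (\<lambda>k. ww m n k + ww m' n' k)" by (rule br_wt)
 moreover have "(\<lambda>k. ww m n k + ww m' n' k) = ww (m + m') (n + n')"
  by (rule ext) (simp add: ww_def algebra_simps)
 ultimately show ?thesis by simp
qed

lemma R_minus: "\<W> (\<lambda>k. - ww m n k) = R (- m) (- n)"
 by (rule wt_cong) (simp add: ww_def)

lemma R_opposite: "v \<in> R m n ==> v \<noteq> 0 ==> \<exists>y. y \<in> R (- m) (- n) \<and> y \<noteq> 0"
proof -
 assume v: "v \<in> R m n" "v \<noteq> 0"
 obtain y where y: "y \<in> \<W> (\<lambda>k. - ww m n k)" "killing v y \<noteq> 0" using opposite_exists[OF v] by blast
 have "y \<noteq> 0" using y(2) killing_right_scale[of v 0 0] by auto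
 then show ?thesis using y(1) R_minus by auto
qed

lemma R_one_dim: "(m, n) \<noteq> (0, 0) ==> x \<in> R m n ==> x \<noteq> 0 ==> x' \<in> R m n ==> \<exists>c. x' = c *s x"
 using ww_nonzero root_space_one_dim by blast

lemma root_combination:
 assumes v: "v \<in> \<W> \<delta>" "v \<noteq> 0" and k0: "k0 \<in> H" "\<delta> k0 \<noteq> 0"
 obtains m n where "\<And>k. k \<in> H ==> \<delta> k = ww m n k" "(m \<ge> 0 \<and> n \<ge> 0) \<or> (m \<le> 0 \<and> n \<le> 0)"
proof -
 have "restrict \<delta> H \<in> roots br H" by (rule root_of_wt[OF v k0])
 then obtain f :: "(complex^'d \<Rightarrow> complex) \<Rightarrow> nat" where
  "(\<forall>k\<in>H. restrict \<delta> H k = (\<Sum>\<beta>\<in>\<Delta>. of_nat (f \<beta>) * \<beta> k)) \<or> (\<forall>k\<in>H. restrict \<delta> H k = - (\<Sum>\<beta>\<in>\<Delta>. of_nat (f \<beta>) * \<beta> k))"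
  using base unfolding root_base_def by blast
 then show ?thesis
 proof
  assume "\<forall>k\<in>H. restrict \<delta> H k = (\<Sum>\<beta>\<in>\<Delta>. of_nat (f \<beta>) * \<beta> k)"
  then show ?thesis by (intro that[of "int (f al)" "int (f be)"]) (auto simp: sum_Delta ww_def)
 next
  assume "\<forall>k\<in>H. restrict \<delta> H k = - (\<Sum>\<beta>\<in>\<Delta>. of_nat (f \<beta>) * \<beta> k)"
  then show ?thesis by (intro that[of "- int (f al)" "- int (f be)"]) (auto simp: sum_Delta ww_def)
 qed
qed

lemma R_sign: assumes v: "v \<in> R m n" "v \<noteq> 0" shows "(m \<ge> 0 \<and> n \<ge> 0) \<or> (m \<le> 0 \<and> n \<le> 0)"
proof (cases "(m, n) = (0, 0)")
 case False
 then obtain k0 where k0: "k0 \<in> H" "ww m n k0 \<noteq> 0" using ww_nonzero by blast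
 obtain m' n' where mn: "\<And>k. k \<in> H ==> ww m n k = ww m' n' k" "(m' \<ge> 0 \<and> n' \<ge> 0) \<or> (m' \<le> 0 \<and> n' \<le> 0)"
  by (rule root_combination[OF v k0]) blast
 have "m = m'" "n = n'" by (rule ww_eqD[OF mn(1)], assumption)+
 then show ?thesis using mn(2) by simp
qed auto

lemma weight_combination:
 assumes v: "v \<in> \<W> \<delta>" "v \<noteq> 0" obtains m n where "\<And>k. k \<in> H ==> \<delta> k = ww m n k"
proof (cases "\<forall>k\<in>H. \<delta> k = 0")
 case True
 then show ?thesis by (intro that[of 0 0]) (simp add: ww_def)
next
 case False
 then show ?thesis using root_combination[OF v] that by blast
qed

definition "pa = (SOME p. fst p \<in> \<W> al \<and> fst p \<noteq> 0 \<and> snd p \<in> \<W> (\<lambda>k. - al k) \<and> snd p \<noteq> 0 \<and> sl2 (fst p) ha (snd p))"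
definition "pb = (SOME p. fst p \<in> \<W> be \<and> fst p \<noteq> 0 \<and> snd p \<in> \<W> (\<lambda>k. - be k) \<and> snd p \<noteq> 0 \<and> sl2 (fst p) hb (snd p))"

definition "xa = fst pa" definition "ya = snd pa" definition "xb = fst pb" definition "yb = snd pb"

lemma triple_a: "xa \<in> \<W> al" "xa \<noteq> 0" "ya \<in> \<W> (\<lambda>k. - al k)" "ya \<noteq> 0" "sl2 xa ha ya"
proof -
 have "\<exists>p. fst p \<in> \<W> al \<and> fst p \<noteq> 0 \<and> snd p \<in> \<W> (\<lambda>k. - al k) \<and> snd p \<noteq> 0 \<and> sl2 (fst p) ha (snd p)"
  using coroot_triple[OF coroots(1) simple_roots(1)] by auto
 from someI_ex[OF this, folded pa_def]
 show "xa \<in> \<W> al" "xa \<noteq> 0" "ya \<in> \<W> (\<lambda>k. - al k)" "ya \<noteq> 0" "sl2 xa ha ya" by (auto simp: xa_def ya_def)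
qed

lemma triple_b: "xb \<in> \<W> be" "xb \<noteq> 0" "yb \<in> \<W> (\<lambda>k. - be k)" "yb \<noteq> 0" "sl2 xb hb yb"
proof -
 have "\<exists>p. fst p \<in> \<W> be \<and> fst p \<noteq> 0 \<and> snd p \<in> \<W> (\<lambda>k. - be k) \<and> snd p \<noteq> 0 \<and> sl2 (fst p) hb (snd p)"
  using coroot_triple[OF coroots(2) simple_roots(2)] by auto
 from someI_ex[OF this, folded pb_def]
 show "xb \<in> \<W> be" "xb \<noteq> 0" "yb \<in> \<W> (\<lambda>k. - be k)" "yb \<noteq> 0" "sl2 xb hb yb" by (auto simp: xb_def yb_def)
qed

lemma rel_a: "br ha xa = 2 *s xa" "br ha ya = (- 2) *s ya" "br xa ya = ha"
 using triple_a(5) by (auto simp: sl2_def)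

lemma R_simple: "xa \<in> R 1 0" "ya \<in> R (- 1) 0" "xb \<in> R 0 1" "yb \<in> R 0 (- 1)"
proof -
 have "ww 1 0 = al" "ww (- 1) 0 = (\<lambda>k. - al k)" "ww 0 1 = be" "ww 0 (- 1) = (\<lambda>k. - be k)"
  by (auto simp: ww_def)
 then show "xa \<in> R 1 0" "ya \<in> R (- 1) 0" "xb \<in> R 0 1" "yb \<in> R 0 (- 1)" using triple_a triple_b by auto
qed

lemma R_multiple_al: assumes v: "v \<in> R m 0" "v \<noteq> 0" shows "- 1 \<le> m" "m \<le> 1"
proof -
 have le: "m \<le> 1" if v: "v \<in> R m 0" "v \<noteq> 0" for m v
 proof (rule ccontr)
  assume "\<not> m \<le> 1"
  then have N: "nat m \<ge> 2" "m = int (nat m)" by auto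
  have "ww m 0 = (\<lambda>k. of_nat (nat m) * al k)" by (rule ext, subst N(2)) (simp add: ww_def)
  then have "v \<in> \<W> (\<lambda>k. of_nat (nat m) * al k)" using v(1) by simp
  then show False using no_multiple_root[OF triple_a(5,1,2,3) ha _ N(1)] v(2) by blast
 qed
 show "m \<le> 1" by (rule le[OF v])
 obtain y where "y \<in> R (- m) (- 0)" "y \<noteq> 0" using R_opposite[OF v] by blast
 then have "- m \<le> 1" using le[of y "- m"] by simp
 then show "- 1 \<le> m" by simp
qed

lemma funpow_R: "x \<in> R m n ==> v \<in> R m' n' ==> (br x ^^ j) v \<in> R (m' + int j * m) (n' + int j * n)"
proof (induction j)
 case (Suc j)
 then have "br x ((br x ^^ j) v) \<in> R (m + (m' + int j * m)) (n + (n' + int j * n))" by (intro R_br) auto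
 then show ?case by (simp add: algebra_simps)
qed simp

lemma ww_ha: "ww m n ha = of_int (2 * m - 3 * n)" and ww_hb: "ww m n hb = of_int (2 * n - m)"
 using ha hb cartan_int by (simp_all add: ww_def)

text \<open>Raising v leads to weight M al + be with M >= m, a highest weight 2 M - 3. Lowering that
  many times leads to (3 - M) al + be, whose coefficients cannot have opposite signs, so M <=
  3.\<close>

lemma R_al_string: assumes v: "v \<in> R m 1" "v \<noteq> 0" shows "0 \<le> m" "m \<le> 3"
proof -
 show "0 \<le> m" using R_sign[OF v] by auto
 obtain j where j: "\<And>i. i \<le> j ==> (br xa ^^ i) v \<noteq> 0" "(br xa ^^ Suc j) v = 0"
  by (rule eigen_top[OF ha(1) rel_a(1) _ wtD[OF v(1) ha(1)] v(2)]) auto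
 let ?u = "(br xa ^^ j) v"
 have u: "?u \<in> R (m + int j) 1" using funpow_R[OF R_simple(1) v(1), of j] by simp
 have u0: "?u \<noteq> 0" "br xa ?u = 0" using j by auto
 obtain m' where m': "ww (m + int j) 1 ha = of_nat m'" "\<And>j. j \<le> m' ==> (br ya ^^ j) ?u \<noteq> 0"
  using highest_weight[OF ha(1) triple_a(5) wtD[OF u ha(1)] u0] by metis
 have "complex_of_int (2 * (m + int j) - 3) = of_int (int m')" using m'(1) unfolding ww_ha by simp
 then have eq: "2 * (m + int j) - 3 = int m'" by (simp only: of_int_eq_iff)
 have "(br ya ^^ m') ?u \<in> R (m + int j + int m' * - 1) (1 + int m' * 0)" by (rule funpow_R[OF R_simple(2) u])
 moreover have "(br ya ^^ m') ?u \<noteq> 0" using m'(2) by blast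
 ultimately have "m + int j + int m' * - 1 \<ge> 0" using R_sign by fastforce
 then show "m \<le> 3" using eq by simp
qed

text \<open>Since be - al is not a root, \<open>xb\<close> is a lowest weight vector for the triple
  of \<open>al\<close>, of weight -3.\<close>

lemma xa_string: "(br xa ^^ 3) xb \<noteq> 0"
proof -
 have "br ya xb \<in> R (- 1) 1" using R_br[OF R_simple(2,3)] by simp
 then have low: "br ya xb = 0" using R_sign by fastforce
 obtain m where m: "ww 0 1 ha = - of_nat m" "\<And>j. j \<le> m ==> (br xa ^^ j) xb \<noteq> 0"
  using lowest_weight[OF ha(1) triple_a(5) wtD[OF R_simple(3) ha(1)] triple_b(2) low] by metis
 have "complex_of_int 3 = of_int (int m)" using m(1) unfolding ww_ha by simp
 then have "3 = int m" by (simp only: of_int_eq_iff)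
 then show ?thesis using m(2) by simp
qed

text \<open>The vector of weight 3 al + be is a lowest weight vector of weight -1 for the triple of
  \<open>be\<close>, as 3 al is not a root; so it can be raised once.\<close>

lemma R_3_2: "\<exists>v. v \<in> R 3 2 \<and> v \<noteq> 0"
proof -
 let ?u = "(br xa ^^ 3) xb"
 have u: "?u \<in> R 3 1" using funpow_R[OF R_simple(1,3), of 3] by simp
 have "br yb ?u \<in> R 3 0" using R_br[OF R_simple(4) u] by simp
 then have low: "br yb ?u = 0" using R_multiple_al(2) by fastforce
 obtain m where m: "ww 3 1 hb = - of_nat m" "\<And>j. j \<le> m ==> (br xb ^^ j) ?u \<noteq> 0"
  using lowest_weight[OF hb(1) triple_b(5) wtD[OF u hb(1)] xa_string low] by metis
 have "complex_of_int 1 = of_int (int m)" using m(1) unfolding ww_hb by simp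
 then have "1 = int m" by (simp only: of_int_eq_iff)
 then have "br xb ?u \<noteq> 0" using m(2)[of 1] by simp
 moreover have "br xb ?u \<in> R 3 2" using R_br[OF R_simple(3) u] by simp
 ultimately show ?thesis by blast
qed

lemma highest_combination:
 obtains a b where "\<And>k. k \<in> H ==> \<gamma> k = ww a b k" "a \<ge> 3" "b \<ge> 2"
proof -
 obtain v where v: "v \<in> R 3 2" "v \<noteq> 0" using R_3_2 by blast
 obtain k0 where k0: "k0 \<in> H" "ww 3 2 k0 \<noteq> 0" using ww_nonzero[of 3 2] by auto
 obtain f :: "(complex^'d \<Rightarrow> complex) \<Rightarrow> nat" where f: "\<And>k. k \<in> H ==> \<gamma> k - ww 3 2 k = (\<Sum>\<beta>\<in>\<Delta>. of_nat (f \<beta>) * \<beta> k)"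
  by (rule below_highest[OF v k0]) blast
 have "\<gamma> k = ww (3 + int (f al)) (2 + int (f be)) k" if "k \<in> H" for k
  using f[OF that] by (simp add: sum_Delta ww_def algebra_simps)
 then show ?thesis by (rule that) auto
qed

text \<open>A positive root with negative value on h would not be annihilated by \<open>ee\<close>,
  and the bracket would have a weight above the highest one. With nonnegative integers i and j, a i
  + b j = 2, a >= 3 and b >= 2 leave only i = 0 and j = 1.\<close>

lemma al_h: "al h = 0" and be_h: "be h = 1"
proof -
 obtain a b where ab: "\<And>k. k \<in> H ==> \<gamma> k = ww a b k" "a \<ge> 3" "b \<ge> 2" by (rule highest_combination) blast
 have nonneg: "i \<ge> 0" if v: "v \<in> R m n" "v \<noteq> 0" "m \<ge> 0" "n \<ge> 0" "(m, n) \<noteq> (0, 0)" and i: "ww m n h = of_int i" for v m n i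
 proof (rule ccontr)
  assume neg: "\<not> i \<ge> 0"
  have "br ee v \<noteq> 0"
  proof
   assume "br ee v = 0"
   then obtain j where "ww m n h = of_nat j" using highest_weight[OF h_H sl2_h wtD[OF v(1) h_H] v(2)] by metis
   then have "complex_of_int i = of_int (int j)" using i by simp
   then show False using neg by (simp only: of_int_eq_iff)
  qed
  have g: "ee \<in> R a b" using ee_wt wt_cong[of \<gamma> "ww a b"] ab(1) by simp
  have w: "br ee v \<in> R (a + m) (b + n)" by (rule R_br[OF g v(1)])
  obtain k0 where k0: "k0 \<in> H" "ww (a + m) (b + n) k0 \<noteq> 0" using ww_nonzero[of "a + m" "b + n"] ab v by auto
  obtain f :: "(complex^'d \<Rightarrow> complex) \<Rightarrow> nat" where
   f: "\<And>k. k \<in> H ==> \<gamma> k - ww (a + m) (b + n) k = (\<Sum>\<beta>\<in>\<Delta>. of_nat (f \<beta>) * \<beta> k)"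
   by (rule below_highest[OF w \<open>br ee v \<noteq> 0\<close> k0]) blast
  have eq: "ww (- m) (- n) k = ww (int (f al)) (int (f be)) k" if "k \<in> H" for k
   using f[OF that] ab(1)[OF that] by (simp add: sum_Delta ww_def algebra_simps)
  have "- m = int (f al)" "- n = int (f be)" by (rule ww_eqD[OF eq], assumption)+
  then show False using v(3-5) by auto
 qed
 obtain i where i: "al h = of_int i" using weight_h_integer[OF triple_a(1,2)] by blast
 obtain j where j: "be h = of_int j" using weight_h_integer[OF triple_b(1,2)] by blast
 have "i \<ge> 0" by (rule nonneg[OF R_simple(1) triple_a(2)]) (use i in \<open>auto simp: ww_def\<close>)
 have "j \<ge> 0" by (rule nonneg[OF R_simple(3) triple_b(2)]) (use j in \<open>auto simp: ww_def\<close>)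
 have "complex_of_int 2 = of_int (a * i + b * j)" using ab(1)[OF h_H] i j by (simp add: ww_def)
 then have eq: "a * i + b * j = 2" by (simp only: of_int_eq_iff)
 have "i = 0"
 proof (rule ccontr)
  assume "i \<noteq> 0"
  then have "a * i \<ge> 3 * 1" using \<open>i \<ge> 0\<close> ab(2) by (intro mult_mono) auto
  moreover have "b * j \<ge> 0" using \<open>j \<ge> 0\<close> ab(3) by simp
  ultimately show False using eq by simp
 qed
 have "j = 1"
 proof -
  have bj: "b * j = 2" using eq \<open>i = 0\<close> by simp
  then have "j \<noteq> 0" by auto
  moreover have "j < 2"
  proof (rule ccontr)
   assume "\<not> j < 2"
   then have "b * j \<ge> 2 * 2" using ab(3) by (intro mult_mono) auto
   then show False using bj by simp
  qed
  ultimately show ?thesis using \<open>j \<ge> 0\<close> by simp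
 qed
 show "al h = 0" "be h = 1" using i j \<open>i = 0\<close> \<open>j = 1\<close> by simp_all
qed

lemma ww_h: "ww m n h = of_int n" by (simp add: ww_def al_h be_h)

lemma xa_gr0: "xa \<in> gr 0" "ya \<in> gr 0" "ha \<in> gr 0"
 using wtD[OF R_simple(1) h_H] wtD[OF R_simple(2) h_H] H_comm[OF h_H ha(1)] by (simp_all add: gr_iff ww_h)

lemma br_gr0_2: assumes x: "x \<in> R m 0" "m \<noteq> 0" shows "br x ee = 0" "br x ff = 0"
proof -
 have x0: "x \<in> gr 0" using wtD[OF x(1) h_H] by (simp add: gr_iff ww_h)
 obtain k0 where k0: "k0 \<in> H" "ww m 0 k0 \<noteq> 0" using ww_nonzero[of m 0] x(2) by auto
 have main: "br x z = 0" if z: "z \<in> \<W> \<delta>" and c: "br x z = c *s z" for z \<delta> c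
 proof -
  have "br k0 (br x z) = (ww m 0 k0 + \<delta> k0) *s br x z" using wtD[OF br_wt[OF x(1) z] k0(1)] by simp
  moreover have "br k0 (br x z) = \<delta> k0 *s br x z" unfolding c br_scale_right wtD[OF z k0(1)] by (simp add: mult.commute)
  ultimately have "(ww m 0 k0 + \<delta> k0) *s br x z = \<delta> k0 *s br x z" by (rule trans[OF sym])
  then show ?thesis using k0(2) by (simp add: vec.scale_left_distrib)
 qed
 have "br x ee \<in> gr 2" using br_gr[OF x0 ee_gr] by simp
 then obtain c where c: "br x ee = c *s ee" using gr_2 by auto
 show "br x ee = 0" by (rule main[OF ee_wt c])
 have "br x ff \<in> gr (- 2)" using br_gr[OF x0 ff_gr] by simp
 then obtain d where d: "br x ff = d *s ff" using gr_minus_2 by auto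
 show "br x ff = 0" by (rule main[OF ff_wt d])
qed

lemma kills: "br xa ee = 0" "br ya ee = 0" "br xa ff = 0" "br ya ff = 0" "br ha ee = 0" "br ha ff = 0"
proof -
 show *: "br xa ee = 0" "br ya ee = 0" "br xa ff = 0" "br ya ff = 0"
  using br_gr0_2[OF R_simple(1)] br_gr0_2[OF R_simple(2)] by simp_all
 show "br ha ee = 0" "br ha ff = 0"
  using jacobi[of xa ya ee] jacobi[of xa ya ff] by (simp_all add: * rel_a(3))
qed

text \<open>The sl2 of the short root, characterised by the grading and the line of
  \<open>ee\<close>, which makes its stability under the Levi subgroup visible.\<close>

definition ss :: "(complex^'d) set" where "ss = {z \<in> gr 0. br z ee = 0}"

lemma ss_members: "xa \<in> ss" "ha \<in> ss" "ya \<in> ss"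
 using xa_gr0 kills by (simp_all add: ss_def)

lemma ss_span: assumes z: "z \<in> ss" shows "\<exists>a b c. z = a *s xa + b *s ha + c *s ya"
proof -
 let ?T = "{z. \<exists>k\<in>H. \<exists>a c. z = k + a *s xa + c *s ya}"
 have T: "vec.subspace ?T"
  unfolding vec.subspace_def
 proof (intro conjI allI impI ballI)
  show "0 \<in> ?T" using vec.subspace_0[OF H_subspace] by (auto intro!: bexI[of _ 0] exI[of _ 0])
 next
  fix x y assume "x \<in> ?T" "y \<in> ?T"
  then obtain k a c k' a' c' where kk: "k \<in> H" "x = k + a *s xa + c *s ya" "k' \<in> H" "y = k' + a' *s xa + c' *s ya" by blast
  have "x + y = (k + k') + (a + a') *s xa + (c + c') *s ya" using kk by (simp add: vec.scale_left_distrib)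
  then show "x + y \<in> ?T" using vec.subspace_add[OF H_subspace kk(1,3)] by blast
 next
  fix x t assume "x \<in> ?T"
  then obtain k a c where kk: "k \<in> H" "x = k + a *s xa + c *s ya" by blast
  have "t *s x = t *s k + (t * a) *s xa + (t * c) *s ya" using kk by (simp add: vec.scale_right_distrib)
  then show "t *s x \<in> ?T" using vec.subspace_scale[OF H_subspace kk(1)] by blast
 qed
 have "gr 0 \<subseteq> vec.span {x \<in> gr 0. \<exists>\<alpha>. x \<in> \<W> \<alpha>}" by (rule gr_weights)
 also have "\<dots> \<subseteq> ?T"
 proof (rule vec.span_minimal[OF _ T], safe)
  fix x \<delta> assume x: "x \<in> gr 0" "x \<in> \<W> \<delta>"
  show "\<exists>k\<in>H. \<exists>a c. x = k + a *s xa + c *s ya"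
  proof (cases "x \<in> H")
   case True
   then show ?thesis by (intro bexI[of _ x] exI[of _ 0]) simp_all
  next
   case False
   then have x0: "x \<noteq> 0" using vec.subspace_0[OF H_subspace] by auto
   obtain m n where mn: "\<And>k. k \<in> H ==> \<delta> k = ww m n k" by (rule weight_combination[OF x(2) x0]) blast
   have xR: "x \<in> R m n" using x(2) wt_cong[OF mn] by simp
   have "ww m n h = of_int 0" using gr_weight[OF x(1) x0 xR] by simp
   then have n: "n = 0" by (simp add: ww_h)
   have m: "- 1 \<le> m" "m \<le> 1" using R_multiple_al[of x m] xR x0 n by auto
   have "m \<noteq> 0"
   proof
    assume "m = 0"
    then have "x \<in> H" using xR n by (intro H_self) (simp add: root_space_def ww_def)
    then show False using False by blast
   qed
   then consider "m = 1" | "m = - 1" using m by linarith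
   then show ?thesis
   proof cases
    case 1
    then obtain c where "x = c *s xa" using R_one_dim[of 1 0 xa x] R_simple(1) triple_a(2) xR n by auto
    then show ?thesis using vec.subspace_0[OF H_subspace] by (intro bexI[of _ 0] exI[of _ c] exI[of _ 0]) simp_all
   next
    case 2
    then obtain c where "x = c *s ya" using R_one_dim[of "-1" 0 ya x] R_simple(2) triple_a(4) xR n by auto
    then show ?thesis using vec.subspace_0[OF H_subspace] by (intro bexI[of _ 0] exI[of _ 0] exI[of _ c]) simp_all
   qed
  qed
 qed
 finally obtain k a c where k: "k \<in> H" "z = k + a *s xa + c *s ya" using z unfolding ss_def by blast
 have "br k ee = 0" using z k(2) kills by (simp add: ss_def br_add_left br_scale_left)
 then have \<gamma>k: "\<gamma> k = 0" using wtD[OF ee_wt k(1)] ee(1) by simp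
 obtain p q where pq: "\<And>k. k \<in> H ==> \<gamma> k = ww p q k" "p \<ge> 3" "q \<ge> 2" by (rule highest_combination) blast
 \<comment> \<open>Subtracting a multiple of \<open>ha\<close> makes the value of \<open>al\<close>
   zero. The value of \<gamma> is zero already, and since \<gamma> involves \<open>be\<close> with a
   nonzero coefficient, all weights vanish on the difference.\<close>
 let ?k = "k - (al k / 2) *s ha"
 have kH: "?k \<in> H" using k(1) ha(1) H_subspace by (simp add: vec.subspace_diff vec.subspace_scale)
 have lin: "\<delta> ?k = \<delta> k - (al k / 2) * \<delta> ha" if "x \<in> \<W> \<delta>" "x \<noteq> 0" for x \<delta>
 proof -
  have s: "k - (al k / 2) *s ha = k + (- (al k / 2)) *s ha" by simp
  show ?thesis
   unfolding s wt_linear(1)[OF that k(1) H_scale[OF ha(1)]] wt_linear(2)[OF that ha(1)] by simp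
 qed
 have al0: "al ?k = 0" using lin[OF triple_a(1,2)] ha(2) by simp
 have "\<gamma> ha = 0" using kills(5) wtD[OF ee_wt ha(1)] ee(1) by simp
 then have "\<gamma> ?k = 0" using lin[OF ee_wt ee(1)] \<gamma>k by simp
 then have be0: "be ?k = 0" using pq(1)[OF kH] al0 pq(3) by (simp add: ww_def)
 have "?k = 0"
 proof (rule H_eq_0_of_weights[OF kH])
  fix x \<delta> assume x: "x \<in> \<W> \<delta>" "x \<noteq> 0"
  obtain m n where mn: "\<And>k. k \<in> H ==> \<delta> k = ww m n k" by (rule weight_combination[OF x]) blast
  show "\<delta> ?k = 0" using mn[OF kH] al0 be0 by (simp add: ww_def)
 qed
 then have "k = (al k / 2) *s ha" by simp
 then have "z = a *s xa + (al k / 2) *s ha + c *s ya" using k(2) by (simp add: add.commute)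
 then show ?thesis by blast
qed

subsection \<open>The four-dimensional representation\<close>

text \<open>\<open>yb\<close> is a highest weight vector of weight 3 for the triple of
  \<open>al\<close>, so its string is the representation on binary cubics. The factors 1/2 and 1/3
  give divided powers, hence the integral formulas of \<open>ya_v\<close> and
  \<open>xa_v\<close>.\<close>

definition v0 :: "complex^'d" where "v0 = yb"
definition v1 :: "complex^'d" where "v1 = br ya v0"
definition v2 :: "complex^'d" where "v2 = (1/2) *s br ya v1"
definition v3 :: "complex^'d" where "v3 = (1/3) *s br ya v2"

lemma v_R: "v0 \<in> R 0 (- 1)" "v1 \<in> R (- 1) (- 1)" "v2 \<in> R (- 2) (- 1)" "v3 \<in> R (- 3) (- 1)"
proof -
 show 0: "v0 \<in> R 0 (- 1)" using R_simple(4) by (simp add: v0_def)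
 show 1: "v1 \<in> R (- 1) (- 1)" using R_br[OF R_simple(2) 0] by (simp add: v1_def)
 show 2: "v2 \<in> R (- 2) (- 1)" using R_br[OF R_simple(2) 1] unfolding v2_def by (intro vec.subspace_scale wt_subspace) simp
 show "v3 \<in> R (- 3) (- 1)" using R_br[OF R_simple(2) 2] unfolding v3_def by (intro vec.subspace_scale wt_subspace) simp
qed

lemma ha_v: "br ha v0 = 3 *s v0" "br ha v1 = v1" "br ha v2 = - v2" "br ha v3 = (- 3) *s v3"
 using v_R[THEN wtD, OF ha(1)] by (simp_all add: ww_ha)

lemma xa_v0: "br xa v0 = 0"
proof -
 have "br xa v0 \<in> R 1 (- 1)" using R_br[OF R_simple(1) v_R(1)] by simp
 then show ?thesis using R_sign by fastforce
qed

lemma v_string: "(br ya ^^ 3) v0 \<noteq> 0" "(br ya ^^ 4) v0 = 0"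
proof -
 obtain m where m: "ww 0 (- 1) ha = of_nat m" "\<And>j. j \<le> m ==> (br ya ^^ j) v0 \<noteq> 0" "(br ya ^^ Suc m) v0 = 0"
  using highest_weight[OF ha(1) triple_a(5) wtD[OF v_R(1) ha(1)] _ xa_v0] triple_b(4) unfolding v0_def by metis
 have "complex_of_int 3 = of_int (int m)" using m(1) unfolding ww_ha by simp
 then have "3 = int m" by (simp only: of_int_eq_iff)
 then have "m = 3" by simp
 then show "(br ya ^^ 3) v0 \<noteq> 0" "(br ya ^^ 4) v0 = 0" using m(2)[of 3] m(3) by simp_all
qed

lemma ya_v: "br ya v0 = v1" "br ya v1 = 2 *s v2" "br ya v2 = 3 *s v3" "br ya v3 = 0"
proof -
 show 0: "br ya v0 = v1" "br ya v1 = 2 *s v2" "br ya v2 = 3 *s v3" by (simp_all add: v1_def v2_def v3_def)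
 have "(br ya ^^ 4) v0 = 6 *s br ya v3" by (simp add: eval_nat_numeral 0 br_scale_right)
 then show "br ya v3 = 0" using v_string(2) by simp
qed

lemma v3_nz: "v3 \<noteq> 0"
proof
 assume "v3 = 0"
 moreover have "(br ya ^^ 3) v0 = 6 *s v3" by (simp add: eval_nat_numeral ya_v br_scale_right)
 ultimately show False using v_string(1) by simp
qed

lemma v_nz: "v0 \<noteq> 0" "v1 \<noteq> 0" "v2 \<noteq> 0"
proof -
 show v2: "v2 \<noteq> 0" using v3_nz ya_v(3) by auto
 show v1: "v1 \<noteq> 0" using v2 ya_v(2) by auto
 show "v0 \<noteq> 0" using v1 ya_v(1) by auto
qed

lemma xa_v: "br xa v1 = 3 *s v0" "br xa v2 = 2 *s v1" "br xa v3 = v2"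
proof -
 have step: "br xa (br ya v) = br ha v + br ya (br xa v)" for v using jacobi[of xa ya v] by (simp add: rel_a(3))
 show 1: "br xa v1 = 3 *s v0" unfolding v1_def using step[of v0] by (simp add: ha_v xa_v0)
 have "br xa (br ya v1) = 4 *s v1" using step[of v1]
  by (simp add: ha_v 1 br_scale_right ya_v vec_eq_iff)
 then show 2: "br xa v2 = 2 *s v1" unfolding v2_def by (simp add: br_scale_right)
 have "br xa (br ya v2) = 3 *s v2" using step[of v2] by (simp add: ha_v 2 br_scale_right ya_v vec_eq_iff)
 then show "br xa v3 = v2" unfolding v3_def by (simp add: br_scale_right)
qed

lemma v_gr: "v0 \<in> gr (- 1)" "v1 \<in> gr (- 1)" "v2 \<in> gr (- 1)" "v3 \<in> gr (- 1)"
 using v_R[THEN wtD, OF h_H] by (simp_all add: gr_iff ww_h)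

lemma V_span: assumes x: "x \<in> gr (- 1)" shows "\<exists>a b c d. x = a *s v0 + b *s v1 + c *s v2 + d *s v3"
proof -
 let ?B = "{v0, v1, v2, v3}"
 have "{x \<in> gr (- 1). \<exists>\<alpha>. x \<in> \<W> \<alpha>} \<subseteq> vec.span ?B"
 proof safe
  fix x \<delta> assume x: "x \<in> gr (- 1)" "x \<in> \<W> \<delta>"
  show "x \<in> vec.span ?B"
  proof (cases "x = 0")
   case True then show ?thesis by (simp add: vec.span_zero)
  next
   case x0: False
   obtain m n where mn: "\<And>k. k \<in> H ==> \<delta> k = ww m n k" by (rule weight_combination[OF x(2) x0]) blast
   have xR: "x \<in> R m n" using x(2) wt_cong[OF mn] by simp
   have "ww m n h = of_int (- 1)" by (rule gr_weight[OF x(1) x0 xR])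
   then have n: "n = - 1" unfolding ww_h of_int_eq_iff .
   obtain y where "y \<in> R (- m) 1" "y \<noteq> 0" using R_opposite[OF xR x0] n by auto
   then have "0 \<le> - m" "- m \<le> 3" by (rule R_al_string)+
   then consider "m = 0" | "m = - 1" | "m = - 2" | "m = - 3" by linarith
   then have "\<exists>v\<in>?B. \<exists>c. x = c *s v"
   proof cases
    case 1
    then show ?thesis using R_one_dim[of m n v0 x] v_R(1) v_nz xR n by auto
   next
    case 2
    then show ?thesis using R_one_dim[of m n v1 x] v_R(2) v_nz xR n by auto
   next
    case 3
    then show ?thesis using R_one_dim[of m n v2 x] v_R(3) v_nz xR n by auto
   next
    case 4
    then show ?thesis using R_one_dim[of m n v3 x] v_R(4) v3_nz xR n by auto
   qed
   then obtain v c where "v \<in> ?B" "x = c *s v" by blast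
   then show ?thesis using vec.span_scale[OF vec.span_base, of v ?B c] by simp
  qed
 qed
 then have "vec.span {x \<in> gr (- 1). \<exists>\<alpha>. x \<in> \<W> \<alpha>} \<subseteq> vec.span ?B" by (rule vec.span_minimal) simp
 then have "x \<in> vec.span ?B" using gr_weights x by blast
 then obtain a where "x - a *s v0 \<in> vec.span {v1, v2, v3}" using vec.span_breakdown_eq[of x v0 "{v1, v2, v3}"] by blast
 then obtain b where "x - a *s v0 - b *s v1 \<in> vec.span {v2, v3}"
  using vec.span_breakdown_eq[of "x - a *s v0" v1 "{v2, v3}"] by blast
 then obtain c where "x - a *s v0 - b *s v1 - c *s v2 \<in> vec.span {v3}"
  using vec.span_breakdown_eq[of "x - a *s v0 - b *s v1" v2 "{v3}"] by blast
 then obtain d where "x - a *s v0 - b *s v1 - c *s v2 = d *s v3" by (auto simp: vec.span_singleton)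
 then have "x = a *s v0 + b *s v1 + c *s v2 + d *s v3" by (simp add: algebra_simps)
 then show ?thesis by blast
qed

definition om :: complex where "om = (SOME c. br v0 v3 = c *s ff)"

text \<open>\<open>v3\<close> is a highest weight vector of weight 1 for the triple of
  \<open>be\<close>, so lowering it once by \<open>yb\<close>, which is \<open>v0\<close>, gives a
  nonzero vector.\<close>

lemma om: "br v0 v3 = om *s ff" "om \<noteq> 0"
proof -
 have "br v0 v3 \<in> gr (- 2)" using br_gr[OF v_gr(1,4)] by simp
 then have "\<exists>c. br v0 v3 = c *s ff" using gr_minus_2 by auto
 then show eq: "br v0 v3 = om *s ff" unfolding om_def by (rule someI_ex)
 have hb1: "ww (- 3) (- 1) hb = of_int 1" unfolding ww_hb by simp
 have "br xb v3 \<in> R (- 3) 0" using R_br[OF R_simple(3) v_R(4)] by simp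
 then have high: "br xb v3 = 0" using R_multiple_al(1)[of "br xb v3" "- 3"] by auto
 obtain m where m: "ww (- 3) (- 1) hb = of_nat m" "\<And>j. j \<le> m ==> (br yb ^^ j) v3 \<noteq> 0"
  by (rule highest_weight[OF hb(1) triple_b(5) wtD[OF v_R(4) hb(1)] v3_nz high]) blast
 have "complex_of_int 1 = of_int (int m)" using m(1) unfolding hb1 by simp
 then have "1 = int m" by (simp only: of_int_eq_iff)
 then have "br v0 v3 \<noteq> 0" using m(2)[of 1] by (simp add: v0_def)
 then show "om \<noteq> 0" using eq by auto
qed

lemma br_v_zero: assumes "u \<in> gr (- 1)" "v \<in> gr (- 1)" "br ha u = a *s u" "br ha v = b *s v" "a + b \<noteq> 0" shows "br u v = 0"
proof -
 have "br u v \<in> gr (- 2)" using br_gr[OF assms(1,2)] by simp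
 then obtain c where c: "br u v = c *s ff" using gr_minus_2 by auto
 have "br ha (br u v) = (a + b) *s br u v" using jacobi[of ha u v] assms by (simp add: br_bilinear vec.scale_left_distrib)
 moreover have "br ha (br u v) = 0" by (simp add: c br_scale_right kills)
 ultimately have "(a + b) *s br u v = 0" by (rule trans[OF sym])
 then show ?thesis using assms(5) vec.scale_eq_0_iff by blast
qed

text \<open>The bracket of two weight vectors is a multiple of \<open>ff\<close>, on which
  \<open>ha\<close> acts by zero, so only opposite weights pair. The factor -3 comes from applying
  \<open>ya\<close> to the vanishing bracket of \<open>v0\<close> and \<open>v2\<close>.\<close>

lemma br_v: "br v0 v1 = 0" "br v0 v2 = 0" "br v1 v3 = 0" "br v2 v3 = 0" "br v1 v2 = (- 3 * om) *s ff"
proof -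
 have w: "br ha v1 = 1 *s v1" "br ha v2 = (- 1) *s v2" using ha_v by simp_all
 show "br v0 v1 = 0" by (rule br_v_zero[OF v_gr(1,2) ha_v(1) w(1)]) simp
 show 02: "br v0 v2 = 0" by (rule br_v_zero[OF v_gr(1,3) ha_v(1) w(2)]) simp
 show "br v1 v3 = 0" by (rule br_v_zero[OF v_gr(2,4) w(1) ha_v(4)]) simp
 show "br v2 v3 = 0" by (rule br_v_zero[OF v_gr(3,4) w(2) ha_v(4)]) simp
 have "br v1 v2 + 3 *s br v0 v3 = 0" using jacobi[of ya v0 v2] by (simp add: 02 ya_v br_scale_right)
 then have "br v1 v2 = - (3 *s br v0 v3)" by (simp add: eq_neg_iff_add_eq_0)
 then show "br v1 v2 = (- 3 * om) *s ff" by (simp add: om)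
qed

lemma br_v': "br v1 v0 = 0" "br v2 v0 = 0" "br v3 v1 = 0" "br v3 v2 = 0" "br v2 v1 = (3 * om) *s ff" "br v3 v0 = (- om) *s ff"
 using br_v br_skew[of v1 v0] br_skew[of v2 v0] br_skew[of v3 v1] br_skew[of v3 v2] br_skew[of v2 v1] br_skew[of v3 v0] om(1)
 by simp_all

lemma br_coords:
 "br (a *s v0 + b *s v1 + c *s v2 + d *s v3) (a' *s v0 + b' *s v1 + c' *s v2 + d' *s v3)
  = (om * (a * d' - d * a' - 3 * (b * c' - c * b'))) *s ff"
 by (simp add: br_add_left br_add_right br_scale_left br_scale_right br_v br_v' om vec_eq_iff algebra_simps)

lemma v_independent:
 assumes "a *s v0 + b *s v1 + c *s v2 + d *s v3 = 0" shows "a = 0" "b = 0" "c = 0" "d = 0"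
proof -
 let ?x = "a *s v0 + b *s v1 + c *s v2 + d *s v3"
 have z: "br ?x y = 0" for y using assms by simp
 show "a = 0" using z[of v3] om ff_nz by (simp add: br_add_left br_scale_left br_v)
 show "d = 0" using z[of v0] om ff_nz by (simp add: br_add_left br_scale_left br_v')
 show "b = 0" using z[of v2] om ff_nz by (simp add: br_add_left br_scale_left br_v br_v')
 show "c = 0" using z[of v1] om ff_nz by (simp add: br_add_left br_scale_left br_v br_v')
qed

lemma V_dim: "vec.dim (gr (- 1)) = 4"
proof -
 let ?f = "\<lambda>c :: complex^4. c $ 1 *s v0 + c $ 2 *s v1 + c $ 3 *s v2 + c $ 4 *s v3"
 have lin: "Vector_Spaces.linear (*s) (*s) ?f"
  by (simp add: Vector_Spaces.linear_iff vec.vector_space_axioms vec.scale_left_distrib vec.scale_right_distrib)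
 have inj: "inj ?f"
 proof (rule injI)
  fix x y assume "?f x = ?f y"
  then have "(x $ 1 - y $ 1) *s v0 + (x $ 2 - y $ 2) *s v1 + (x $ 3 - y $ 3) *s v2 + (x $ 4 - y $ 4) *s v3 = 0"
   by (simp add: vec.scale_left_diff_distrib algebra_simps)
  from v_independent[OF this] show "x = y" by (simp add: vec_eq_iff forall_4)
 qed
 have "range ?f = gr (- 1)"
 proof
  show "range ?f \<subseteq> gr (- 1)" using v_gr gr_subspace by (auto intro!: vec.subspace_add vec.subspace_scale)
  show "gr (- 1) \<subseteq> range ?f"
  proof
   fix x assume "x \<in> gr (- 1)"
   then obtain a b c d where "x = a *s v0 + b *s v1 + c *s v2 + d *s v3" using V_span by blast
   then have "x = ?f (vector [a, b, c, d])" by (simp add: vector_def)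
   then show "x \<in> range ?f" by blast
  qed
 qed
 moreover have "vec.dim (range ?f) = vec.dim (UNIV :: (complex^4) set)"
  by (rule vec.dim_image_eq[OF lin]) (use inj in simp)
 ultimately show ?thesis by (simp only: vec_dim_card) simp
qed

lemma V_half_dim: "half_dim (gr (- 1)) = 2" by (simp add: half_dim_def V_dim)

end

section \<open>Invariants of binary quartics and type G2\<close>

text \<open>Along the diagonal line through (x, y) both sides are polynomials in one variable e, and
  they agree except possibly at e = -x and e = -y. This transfers torus arguments to points with
  vanishing coordinates.\<close>

lemma poly2_eqI:
 fixes r s :: "complex poly poly"
 assumes "\<And>x y. x \<noteq> 0 ==> y \<noteq> 0 ==> poly (poly r [:x:]) y = poly (poly s [:x:]) y"
 shows "poly (poly r [:x:]) y = poly (poly s [:x:]) y"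
proof -
 have curve: "\<exists>g. \<forall>e. poly (poly q [:x + e:]) (y + e) = poly g e" for q :: "complex poly poly"
 proof (induction q)
  case (pCons b q)
  then obtain g where g: "\<And>e. poly (poly q [:x + e:]) (y + e) = poly g e" by blast
  show ?case by (rule exI[of _ "pcompose b [:y, 1:] + [:x, 1:] * g"]) (simp add: g poly_pcompose distrib_right)
 qed (auto intro: exI[of _ 0])
 obtain g1 where g1: "\<And>e. poly (poly r [:x + e:]) (y + e) = poly g1 e" using curve by blast
 obtain g2 where g2: "\<And>e. poly (poly s [:x + e:]) (y + e) = poly g2 e" using curve by blast
 have "g1 - g2 = 0"
 proof (rule ccontr)
  assume "g1 - g2 \<noteq> 0"
  then have "finite {e. poly (g1 - g2) e = 0}" by (rule poly_roots_finite)
  moreover have "- {- x, - y} \<subseteq> {e. poly (g1 - g2) e = 0}"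
  proof
   fix e assume "e \<in> - {- x, - y}"
   then have "x + e \<noteq> 0" "y + e \<noteq> 0" by (auto simp: add_eq_0_iff)
   then show "e \<in> {e. poly (g1 - g2) e = 0}" using assms[of "x + e" "y + e"] g1[of e] g2[of e] by simp
  qed
  ultimately have "finite (- {- x, - y})" by (rule rev_finite_subset)
  then show False using infinite_UNIV_char_0[where 'a=complex] by (simp add: finite_compl)
 qed
 then show ?thesis using g1[of 0] g2[of 0] by simp
qed

lemma wedge_pair:
 "wedge [u, v] is = (if length is = 2 then u $ (is ! 0) * v $ (is ! 1) - u $ (is ! 1) * v $ (is ! 0) else 0)"
proof -
 have "{..<Suc (Suc 0)} = {0, 1}" by auto
 then have perms: "{\<sigma>. \<sigma> permutes {..<Suc (Suc 0)}} = {id, Transposition.transpose 0 1}"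
  by (auto simp: permutes_doubleton_iff)
 have "id \<noteq> Transposition.transpose 0 (1::nat)" by (metis id_apply transpose_apply_first zero_neq_one)
 then show ?thesis unfolding wedge_def list.size add_0_right add_Suc_right perms
  by (simp add: sign_swap_id lessThan_Suc numeral_2_eq_2)
qed

lemma wedge_pair_scale: "wedge [c *s u, v] = tscale c (wedge [u, v])"
 by (simp add: fun_eq_iff wedge_pair tscale_def algebra_simps)

section \<open>Lagrangian planes\<close>

context pluecker_action
begin

lemma plane_cone:
 assumes n: "n = 2" and u: "u \<in> V" "v \<in> V" "br u v = 0" and ind: "\<And>a b. a *s u + b *s v = 0 ==> a = 0 \<and> b = 0"
 shows "wedge [u, v] \<in> cone"
proof -
 let ?f = "\<lambda>c :: complex^2. c $ 1 *s u + c $ 2 *s v"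
 let ?L = "range ?f"
 have lin: "Vector_Spaces.linear (*s) (*s) ?f"
  by (simp add: Vector_Spaces.linear_iff vec.vector_space_axioms vec.scale_left_distrib vec.scale_right_distrib)
 have inj: "inj ?f"
 proof (rule injI)
  fix x y assume "?f x = ?f y"
  then have "(x $ 1 - y $ 1) *s u + (x $ 2 - y $ 2) *s v = 0"
   by (simp add: vec.scale_left_diff_distrib algebra_simps)
  from ind[OF this] show "x = y" by (simp add: vec_eq_iff forall_2)
 qed
 have "vec.dim ?L = vec.dim (UNIV :: (complex^2) set)"
  by (rule vec.dim_image_eq[OF lin]) (use inj in simp)
 then have "vec.dim ?L = n" by (simp only: vec_dim_card n) simp
 moreover have "vec.subspace ?L" 
 proof (rule vec.subspaceI)
  show "0 \<in> ?L" by (rule range_eqI[of _ _ 0]) simp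
  fix x y c assume "x \<in> ?L" "y \<in> ?L"
  then obtain p q where pq: "x = ?f p" "y = ?f q" by blast
  show "x + y \<in> ?L" by (rule range_eqI[of _ _ "p + q"]) (simp add: pq vec.scale_left_distrib)
  show "c *s x \<in> ?L" by (rule range_eqI[of _ _ "c *s p"]) (simp add: pq vec.scale_right_distrib)
 qed
 moreover have "?L \<subseteq> V" using u V_subspace by (auto intro!: vec.subspace_add vec.subspace_scale)
 moreover have "br x y = 0" if "x \<in> ?L" "y \<in> ?L" for x y
  using that u(3) br_skew[of v u] by (auto simp: br_add_left br_add_right br_scale_left br_scale_right)
 ultimately have L: "?L \<in> LGr br V" by (simp add: LGr_def)
 have "u = ?f (vector [1, 0])" "v = ?f (vector [0, 1])" by (simp_all add: vector_2)
 then have "u \<in> ?L" "v \<in> ?L" by blast+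
 then have "wedge [u, v] \<in> ext_power n ?L" by (intro ext_power_wedge) (simp_all add: n)
 then show ?thesis unfolding cone_def using L by blast
qed

text \<open>The second exterior power of a plane is a line, and the scalar factor can be absorbed
  into the first vector.\<close>

lemma cone_plane:
 assumes n: "n = 2" and w: "w \<in> cone"
 obtains u v where "u \<in> V" "v \<in> V" "br u v = 0" "w = wedge [u, v]"
proof -
 obtain L where L: "L \<in> LGr br V" "w \<in> ext_power n L" using w unfolding cone_def by blast
 note LD = LGr_D[OF L(1)]
 obtain B where B: "B \<subseteq> L" "vec.independent B" "L \<subseteq> vec.span B" "card B = vec.dim L"
  using vec.basis_exists[of L] by blast
 have "card B = 2" using B(4) LD n by simp
 then obtain u v where uv: "B = {u, v}" by (auto simp: card_2_iff)
 have uvL: "u \<in> L" "v \<in> L" using B(1) uv by auto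
 have two: "{..<2} = {0, 1::nat}" by auto
 have "\<exists>c. w = tscale c (wedge [u, v])"
  using L(2)
 proof (induction rule: ext_power_induct)
  case zero
  have "(0 :: 'd tensor) = tscale 0 (wedge [u, v])" by (simp add: tscale_def fun_eq_iff fun_apply)
  then show ?case by blast
 next
  case (step c us t)
  have "\<exists>a. x = (\<Sum>l<2. a l *s [u, v] ! l)" if x: "x \<in> L" for x
  proof -
   have "x \<in> vec.span {u, v}" using x B(3) uv by blast
   then obtain a where "x - a *s u \<in> vec.span {v}" using vec.span_breakdown_eq[of x u "{v}"] by blast
   then obtain b where "x - a *s u = b *s v" by (auto simp: vec.span_singleton)
   then have "x = a *s u + b *s v" by (simp add: algebra_simps)
   then show ?thesis by (intro exI[of _ "\<lambda>l. if l = 0 then a else b"]) (simp add: two)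
  qed
  moreover have us: "us ! k \<in> L" if "k < 2" for k using that step(1,2) n by (metis nth_mem subsetD)
  ultimately have "\<forall>k. \<exists>a. k < 2 \<longrightarrow> us ! k = (\<Sum>l<2. a l *s [u, v] ! l)" by blast
  then obtain a where a: "\<And>k. k < 2 ==> us ! k = (\<Sum>l<2. a k l *s [u, v] ! l)"
   using choice[of "\<lambda>k a. k < 2 \<longrightarrow> us ! k = (\<Sum>l<2. a l *s [u, v] ! l)"] by blast
  have "wedge us = tscale (ldet 2 a) (wedge [u, v])"
   by (rule wedge_linear_combination) (use step(1) n a in auto)
  moreover obtain d where "t = tscale d (wedge [u, v])" using step.IH by blast
  ultimately have "tscale c (wedge us) + t = tscale (c * ldet 2 a + d) (wedge [u, v])"
   by (simp add: tscale_def fun_eq_iff fun_apply algebra_simps)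
  then show ?case by blast
 qed
 then obtain c where "w = wedge [c *s u, v]" unfolding wedge_pair_scale by blast
 moreover have "c *s u \<in> V" "v \<in> V" using uvL LD V_subspace by (auto intro: vec.subspace_scale)
 moreover have "br (c *s u) v = 0" using uvL LD by (simp add: br_scale_left)
 ultimately show ?thesis using that by blast
qed

lemma S_sub: "p \<in> carrier S ==> q \<in> carrier S ==> (\<lambda>w\<in>W. p w - q w) \<in> carrier S"
proof -
 assume p: "p \<in> carrier S" "q \<in> carrier S"
 have "(\<lambda>w\<in>W. p w - q w) = (\<lambda>w\<in>W. p w + (\<lambda>w\<in>W. (\<lambda>w\<in>W. - 1) w * q w) w)" by (rule restrict_ext) simp
 then show ?thesis using S_add[OF p(1) S_mult[OF S_const p(2)]] by simp
qed

lemma S_form: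
 assumes "\<And>x y. f (x + y) = f x + f y" "\<And>c x. f (tscale c x) = c * f x"
 shows "(\<lambda>w\<in>W. f w) \<in> carrier S"
 unfolding carrier_S by (rule poly_functions.form) (simp add: linear_forms_def assms W_add W_scale)

lemma S_det3:
 assumes "\<And>i j. (\<lambda>w\<in>W. B w $ i $ j) \<in> carrier S"
 shows "(\<lambda>w\<in>W. det (B w :: complex^3^3)) \<in> carrier S"
proof -
 let ?b = "\<lambda>i j. \<lambda>w\<in>W. B w $ i $ j"
 let ?m = "\<lambda>p q. \<lambda>w\<in>W. p w * q w" and ?a = "\<lambda>p q. \<lambda>w\<in>W. p w + q w" and ?s = "\<lambda>p q. \<lambda>w\<in>W. p w - q w"
 let ?t = "\<lambda>i j k. ?m (?m (?b 1 i) (?b 2 j)) (?b 3 k)"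
 have t: "?t i j k \<in> carrier S" for i j k by (intro S_mult assms)
 have "(\<lambda>w\<in>W. det (B w)) = ?s (?s (?s (?a (?a (?t 1 2 3) (?t 2 3 1)) (?t 3 1 2)) (?t 1 3 2)) (?t 2 1 3)) (?t 3 2 1)"
  by (rule restrict_ext) (simp add: det_3)
 then show ?thesis using t by (simp only: S_add S_sub)
qed

end

section \<open>Nilpotent exponentials on strings and under conjugation\<close>

context simple_lie
begin

lemma nexp_local:
 assumes "(br x ^^ m) v = 0" "m \<le> K" shows "nexp K x t *v v = (\<Sum>k<m. (t ^ k / fact k) *s (br x ^^ k) v)"
proof -
 have "(br x ^^ k) v = 0" if "k \<ge> m" for k
  using that assms(1) by (induction k rule: dec_induct) simp_all
 then show ?thesis unfolding nexp_vector
  using sum.mono_neutral_left[of "{..<K}" "{..<m}" "\<lambda>k. (t ^ k / fact k) *s (br x ^^ k) v"] assms(2) by force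
qed

lemma funpow_conj: assumes "A \<in> lie_aut br" shows "A *v (br x ^^ k) v = (br (A *v x) ^^ k) (A *v v)"
 by (induction k) (simp_all add: lie_autD(1)[OF assms])

lemma nexp_conj: assumes A: "A \<in> lie_aut br" shows "A ** nexp K x t ** matrix_inv A = nexp K (A *v x) t"
proof -
 have "(A ** nexp K x t ** matrix_inv A) *v v = nexp K (A *v x) t *v v" for v
  by (simp add: matrix_vector_mul_assoc[symmetric] nexp_vector vec.sum vec.scale funpow_conj[OF A]
    matrix_inv_vector lie_autD(2)[OF A])
 then show ?thesis by (simp add: matrix_eq)
qed

lemma funpow_scale: "(br (c *s x) ^^ k) v = c ^ k *s (br x ^^ k) v"
 by (induction k) (simp_all add: br_scale_left br_scale_right)

lemma nexp_scale: "nexp K (c *s x) t = nexp K x (c * t)"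
proof -
 have "nexp K (c *s x) t *v v = nexp K x (c * t) *v v" for v
  by (simp add: nexp_vector funpow_scale power_mult_distrib mult.commute)
 then show ?thesis by (simp add: matrix_eq)
qed

end

context levi_lie
begin

text \<open>A one-parameter unipotent group normalised by a torus acting nontrivially consists of commutators.\<close>
lemma nexp_derived:
 assumes x: "x \<in> \<W> \<alpha>" "x \<noteq> 0" and z: "z \<in> H" "\<alpha> z \<noteq> 0" and \<alpha>h: "\<alpha> h = 0"
 obtains K where "K \<ge> N" "\<And>t. nexp K x t \<in> derived GL G\<^sub>0"
proof -
 obtain K0 where K0: "K0 > 0" "\<And>v. (br x ^^ K0) v = 0" by (rule root_nilpotent[OF x(1) z]) blast
 define K where "K = max K0 N"
 have K: "K > 0" "K \<ge> N" and nil: "\<And>v. (br x ^^ K) v = 0"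
  using K0 funpow_zero_ge[of K0 x K] by (auto simp: K_def)
 have G: "nexp K x t \<in> G\<^sub>0" for t using nexp_CC[OF x(1) z \<alpha>h K(1) nil] G0_eq by simp
 define c where "c = ln 2 / \<alpha> z"
 have cz: "c *s z \<in> H" by (rule H_scale[OF z(1)])
 have "br (c *s z) x = (ln 2) *s x" using wtD[OF x(1) z(1)] z(2) by (simp add: br_scale_left c_def)
 then have "TT (c *s z) *v x = exp (ln 2) *s x" by (rule TT_eigen[OF cz])
 then have Tx: "TT (c *s z) *v x = 2 *s x" by simp
 have "nexp K x t \<in> derived GL G\<^sub>0" for t
 proof -
  have inv: "matrix_inv (nexp K x t) = nexp K x (- t)"
   by (rule matrix_inv_unique[OF nexp_inverse(2)[OF nil K(1)]]) (rule G0_invertible[OF G])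
  have "TT (c *s z) ** nexp K x t ** matrix_inv (TT (c *s z)) = nexp K x (2 * t)"
   unfolding nexp_conj[OF PP_aut[OF G0_PP[OF TT_G0[OF cz]]]] Tx nexp_scale ..
  then have "TT (c *s z) ** nexp K x t ** matrix_inv (TT (c *s z)) ** matrix_inv (nexp K x t) = nexp K x t"
   unfolding inv using nexp_add[OF nil] by simp
  then show ?thesis using pl.commutator_derived[OF TT_G0[OF cz] G, of t] by simp
 qed
 then show ?thesis using that K(2) by blast
qed

end

section \<open>Unipotent elements and Weyl elements acting on binary cubics\<close>

context g2_lie
begin

abbreviation "D \<equiv> derived GL G\<^sub>0"

lemma X_exists: obtains X where "X \<in> D" "X *v v0 = v0" "X *v v1 = v1 + (3 * t) *s v0"
 "X *v v2 = v2 + (2 * t) *s v1 + (3 * t\<^sup>2) *s v0" "X *v v3 = v3 + t *s v2 + t\<^sup>2 *s v1 + t ^ 3 *s v0"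
proof -
 have nz: "al ha \<noteq> 0" using ha(2) by simp
 obtain K where K: "K \<ge> 4" "\<And>t. nexp K xa t \<in> D"
  by (rule nexp_derived[OF triple_a(1,2) ha(1) nz al_h]) blast
 have "nexp K xa t *v v0 = v0" using nexp_local[of 1 xa v0 K t] K(1) by (simp add: xa_v0)
 moreover have "nexp K xa t *v v1 = v1 + (3 * t) *s v0"
  using nexp_local[of 2 xa v1 K t] K(1) by (simp add: eval_nat_numeral xa_v0 xa_v br_scale_right mult.commute)
 moreover have "nexp K xa t *v v2 = v2 + (2 * t) *s v1 + (3 * t\<^sup>2) *s v0"
  using nexp_local[of 3 xa v2 K t] K(1) by (simp add: eval_nat_numeral xa_v0 xa_v br_scale_right mult.commute)
 moreover have "nexp K xa t *v v3 = v3 + t *s v2 + t\<^sup>2 *s v1 + t ^ 3 *s v0"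
  using nexp_local[of 4 xa v3 K t] K(1) by (simp add: eval_nat_numeral xa_v0 xa_v br_scale_right mult.commute mult.left_commute)
 ultimately show ?thesis using that[OF K(2)[of t]] by blast
qed

lemma Y_exists: obtains Y where "Y \<in> D" "Y *v v3 = v3" "Y *v v2 = v2 + (3 * t) *s v3"
 "Y *v v1 = v1 + (2 * t) *s v2 + (3 * t\<^sup>2) *s v3" "Y *v v0 = v0 + t *s v1 + t\<^sup>2 *s v2 + t ^ 3 *s v3"
proof -
 have nz: "- al ha \<noteq> 0" using ha(2) by simp
 have nh: "- al h = 0" using al_h by simp
 obtain K where K: "K \<ge> 4" "\<And>t. nexp K ya t \<in> D"
  by (rule nexp_derived[OF triple_a(3,4) ha(1) nz nh]) blast
 have "nexp K ya t *v v3 = v3" using nexp_local[of 1 ya v3 K t] K(1) by (simp add: ya_v)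
 moreover have "nexp K ya t *v v2 = v2 + (3 * t) *s v3"
  using nexp_local[of 2 ya v2 K t] K(1) by (simp add: eval_nat_numeral ya_v br_scale_right mult.commute)
 moreover have "nexp K ya t *v v1 = v1 + (2 * t) *s v2 + (3 * t\<^sup>2) *s v3"
  using nexp_local[of 3 ya v1 K t] K(1) by (simp add: eval_nat_numeral ya_v br_scale_right mult.commute)
 moreover have "nexp K ya t *v v0 = v0 + t *s v1 + t\<^sup>2 *s v2 + t ^ 3 *s v3"
  using nexp_local[of 4 ya v0 K t] K(1) by (simp add: eval_nat_numeral ya_v br_scale_right mult.commute mult.left_commute)
 ultimately show ?thesis using that[OF K(2)[of t]] by blast
qed

text \<open>The usual factorisation in SL2 of an antidiagonal matrix into three unipotent ones, with
  parameters s, -1/s and s.\<close>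

lemma weyl_exists: assumes s: "s \<noteq> 0" obtains N where "N \<in> D" "N *v v0 = (- (1 / s ^ 3)) *s v3" "N *v v1 = (1 / s) *s v2"
 "N *v v2 = (- s) *s v1" "N *v v3 = s ^ 3 *s v0"
proof -
 obtain X where X: "X \<in> D" "X *v v0 = v0" "X *v v1 = v1 + (3 * s) *s v0"
  "X *v v2 = v2 + (2 * s) *s v1 + (3 * s\<^sup>2) *s v0" "X *v v3 = v3 + s *s v2 + s\<^sup>2 *s v1 + s ^ 3 *s v0"
  by (rule X_exists)
 obtain Y where Y: "Y \<in> D" "Y *v v3 = v3" "Y *v v2 = v2 + (3 * (- (1 / s))) *s v3"
  "Y *v v1 = v1 + (2 * (- (1 / s))) *s v2 + (3 * (- (1 / s))\<^sup>2) *s v3"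
  "Y *v v0 = v0 + (- (1 / s)) *s v1 + (- (1 / s))\<^sup>2 *s v2 + (- (1 / s)) ^ 3 *s v3"
  by (rule Y_exists)
 let ?N = "X ** Y ** X"
 note V = matrix_vector_mul_assoc[symmetric] vec.add vec.scale vec.diff vec.neg X(2-) Y(2-) vec_eq_iff
 have "?N *v v0 = (- (1 / s ^ 3)) *s v3" "?N *v v1 = (1 / s) *s v2" "?N *v v2 = (- s) *s v1" "?N *v v3 = s ^ 3 *s v0"
  using s by (simp_all add: V) (simp_all add: field_simps eval_nat_numeral)
 moreover have "?N \<in> D" using X(1) Y(1) by (intro pl.derived_mult)
 ultimately show ?thesis using that by blast
qed

end

section \<open>Normal forms and invariants of quartics on the cone\<close>

context g2_lie
begin

text \<open>The Pluecker space is the space of binary quartics; the basis is scaled so that the wedge products of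
 Lagrangian planes are the quartics with \<open>p0 p4 - p1 p3 + 3 p2\<^sup>2 = 0\<close>.\<close>
definition qt :: "complex \<Rightarrow> complex \<Rightarrow> complex \<Rightarrow> complex \<Rightarrow> complex \<Rightarrow> 'd tensor" where
 "qt p0 p1 p2 p3 p4 = tscale p0 (wedge [v0, v1]) + tscale p1 (wedge [v0, v2]) + tscale (3 * p2) (wedge [v0, v3]) +
   tscale p2 (wedge [v1, v2]) + tscale p3 (wedge [v1, v3]) + tscale p4 (wedge [v2, v3])"

lemma qt_ext_power: "qt p0 p1 p2 p3 p4 \<in> ext_power 2 UNIV"
 unfolding qt_def
 by (intro tensor.subspace_add[OF ext_power_subspace] tensor.subspace_scale[OF ext_power_subspace] ext_power_wedge) simp_all

lemma qt_X:
 assumes X: "X *v v0 = v0" "X *v v1 = v1 + (3 * t) *s v0"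
  "X *v v2 = v2 + (2 * t) *s v1 + (3 * t\<^sup>2) *s v0" "X *v v3 = v3 + t *s v2 + t\<^sup>2 *s v1 + t ^ 3 *s v0"
 shows "tensor_act X (qt p0 p1 p2 p3 p4) = qt (p0 + 2 * t * p1 + 6 * t\<^sup>2 * p2 + 2 * t ^ 3 * p3 + t ^ 4 * p4)
  (p1 + 6 * t * p2 + 3 * t\<^sup>2 * p3 + 2 * t ^ 3 * p4) (p2 + t * p3 + t\<^sup>2 * p4) (p3 + 2 * t * p4) p4"
proof
 fix js
 show "tensor_act X (qt p0 p1 p2 p3 p4) js = qt (p0 + 2 * t * p1 + 6 * t\<^sup>2 * p2 + 2 * t ^ 3 * p3 + t ^ 4 * p4)
  (p1 + 6 * t * p2 + 3 * t\<^sup>2 * p3 + 2 * t ^ 3 * p4) (p2 + t * p3 + t\<^sup>2 * p4) (p3 + 2 * t * p4) p4 js"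
  unfolding qt_def tensor_act_add tensor_act_scale tensor_act_wedge list.map X
  by (cases "length js = 2") (simp_all add: fun_apply tscale_def wedge_pair eval_nat_numeral algebra_simps)
qed

lemma qt_weyl:
 assumes s: "s \<noteq> 0" and N: "N *v v0 = (- (1 / s ^ 3)) *s v3" "N *v v1 = (1 / s) *s v2"
 "N *v v2 = (- s) *s v1" "N *v v3 = s ^ 3 *s v0"
 shows "tensor_act N (qt p0 p1 p2 p3 p4) = qt (s ^ 4 * p4) (- (s\<^sup>2 * p3)) p2 (- (p1 / s\<^sup>2)) (p0 / s ^ 4)"
proof
 fix js
 show "tensor_act N (qt p0 p1 p2 p3 p4) js = qt (s ^ 4 * p4) (- (s\<^sup>2 * p3)) p2 (- (p1 / s\<^sup>2)) (p0 / s ^ 4) js"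
  unfolding qt_def tensor_act_add tensor_act_scale tensor_act_wedge list.map N
  using s by (cases "length js = 2") (simp_all add: fun_apply tscale_def wedge_pair eval_nat_numeral field_simps)
qed

definition nf :: "'d tensor \<Rightarrow> bool" where "nf w \<longleftrightarrow> (\<exists>A\<in>D. \<exists>a d. tensor_act A w = qt a 0 0 d 0)"

lemma nf_base: "nf (qt a 0 0 d 0)"
 unfolding nf_def using tensor_act_one[OF qt_ext_power] pl.derived_one by blast

lemma nf_step: assumes "A \<in> D" "tensor_act A (qt p0 p1 p2 p3 p4) = w" "nf w" shows "nf (qt p0 p1 p2 p3 p4)"
proof -
 obtain B a d where B: "B \<in> D" "tensor_act B w = qt a 0 0 d 0" using assms(3) unfolding nf_def by blast
 have "tensor_act (B ** A) (qt p0 p1 p2 p3 p4) = qt a 0 0 d 0"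
  unfolding tensor_act_mult[OF qt_ext_power] assms(2) B(2) ..
 then show ?thesis unfolding nf_def using pl.derived_mult[OF B(1) assms(1)] by blast
qed

lemma nf_X:
 assumes "nf (qt (p0 + 2 * t * p1 + 6 * t\<^sup>2 * p2 + 2 * t ^ 3 * p3 + t ^ 4 * p4)
  (p1 + 6 * t * p2 + 3 * t\<^sup>2 * p3 + 2 * t ^ 3 * p4) (p2 + t * p3 + t\<^sup>2 * p4) (p3 + 2 * t * p4) p4)"
 shows "nf (qt p0 p1 p2 p3 p4)"
proof -
 obtain X where X: "X \<in> D" "X *v v0 = v0" "X *v v1 = v1 + (3 * t) *s v0"
  "X *v v2 = v2 + (2 * t) *s v1 + (3 * t\<^sup>2) *s v0" "X *v v3 = v3 + t *s v2 + t\<^sup>2 *s v1 + t ^ 3 *s v0"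
  by (rule X_exists)
 show ?thesis by (rule nf_step[OF X(1) qt_X[OF X(2-)] assms])
qed

lemma nf_weyl: assumes "nf (qt p4 (- p3) p2 (- p1) p0)" shows "nf (qt p0 p1 p2 p3 p4)"
proof -
 obtain N where N: "N \<in> D" "N *v v0 = (- (1 / 1 ^ 3)) *s v3" "N *v v1 = (1 / 1) *s v2"
  "N *v v2 = (- 1) *s v1" "N *v v3 = 1 ^ 3 *s v0" by (rule weyl_exists[of 1]) simp
 show ?thesis by (rule nf_step[OF N(1) qt_weyl[OF _ N(2-)]]) (use assms in simp_all)
qed

text \<open>If p3 is nonzero, the translation that kills p2 also kills p1, by the relation. If p3 =
  0, then p2 = 0, and a nonzero p1 allows p0 to be removed; the Weyl element turns the remaining
  term into the required one.\<close>

lemma nf_root_at_infinity: assumes "p1 * p3 = 3 * p2\<^sup>2" shows "nf (qt p0 p1 p2 p3 0)"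
proof (cases "p3 = 0")
 case False
 let ?t = "- (p2 / p3)"
 have "p1 = 3 * p2\<^sup>2 / p3" using assms False by (simp add: field_simps)
 then have "p1 + 6 * ?t * p2 + 3 * ?t\<^sup>2 * p3 + 2 * ?t ^ 3 * 0 = 0" "p2 + ?t * p3 + ?t\<^sup>2 * 0 = 0"
  using False by (simp_all add: field_simps power2_eq_square)
 then show ?thesis by (intro nf_X[of p0 ?t]) (simp add: nf_base del: mult_minus_left mult_minus_right)
next
 case True
 then have p2: "p2 = 0" using assms by simp
 show ?thesis
 proof (cases "p1 = 0")
  case False
  let ?t = "- (p0 / (2 * p1))"
  have "p0 + 2 * ?t * p1 = 0" using False by (simp add: field_simps)
  moreover have "nf (qt 0 p1 0 0 0)" by (rule nf_weyl) (simp add: nf_base)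
  ultimately show ?thesis unfolding True p2 by (intro nf_X[of p0 ?t]) (simp del: mult_minus_left mult_minus_right)
 qed (simp add: nf_base p2 True)
qed

text \<open>Translation by a root t makes p0 zero, and the Weyl element exchanges p0 and p4. The
  relation survives because it is invariant under translation. Without a nonconstant polynomial
  there is nothing to do, as only p0 is left.\<close>

lemma nf_quartic: assumes rel: "p0 * p4 - p1 * p3 + 3 * p2\<^sup>2 = 0" shows "nf (qt p0 p1 p2 p3 p4)"
proof (cases "constant (poly [:p0, 2 * p1, 6 * p2, 2 * p3, p4:])")
 case True
 then have "degree [:p0, 2 * p1, 6 * p2, 2 * p3, p4:] = 0" by (simp only: constant_degree)
 then have "p1 = 0 \<and> p2 = 0 \<and> p3 = 0 \<and> p4 = 0" by (simp split: if_splits)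
 then show ?thesis by (simp add: nf_base)
next
 case False
 then obtain t where t: "poly [:p0, 2 * p1, 6 * p2, 2 * p3, p4:] t = 0" using fundamental_theorem_of_algebra by blast
 let ?q0 = "p0 + 2 * t * p1 + 6 * t\<^sup>2 * p2 + 2 * t ^ 3 * p3 + t ^ 4 * p4"
  and ?q1 = "p1 + 6 * t * p2 + 3 * t\<^sup>2 * p3 + 2 * t ^ 3 * p4" and ?q2 = "p2 + t * p3 + t\<^sup>2 * p4" and ?q3 = "p3 + 2 * t * p4"
 have q0: "?q0 = 0" using t by (simp add: eval_nat_numeral algebra_simps)
 have "?q0 * p4 - ?q1 * ?q3 + 3 * ?q2\<^sup>2 = p0 * p4 - p1 * p3 + 3 * p2\<^sup>2"
  by (simp add: eval_nat_numeral algebra_simps)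
 then have "0 * p4 - ?q1 * ?q3 + 3 * ?q2\<^sup>2 = 0" by (simp only: q0 rel)
 moreover have aux: "b * a = c" if "0 * p4 - a * b + c = 0" for a b c using that by (simp add: mult.commute)
 ultimately have "?q3 * ?q1 = 3 * ?q2\<^sup>2" by (intro aux)
 then have "nf (qt p4 (- ?q3) ?q2 (- ?q1) 0)" by (intro nf_root_at_infinity) (simp only: minus_mult_minus)
 then have "nf (qt p4 (- ?q3) ?q2 (- ?q1) ?q0)" by (simp only: q0)
 from nf_weyl[OF this] show ?thesis by (rule nf_X[of p0 t])
qed

text \<open>Isotropy says that the coordinate at \<open>v0\<close>, \<open>v3\<close> is three times
  the one at \<open>v1\<close>, \<open>v2\<close>, which is the shape of \<open>qt\<close>. The
  Pluecker relation of the plane then becomes the relation of \<open>nf_quartic\<close>.\<close>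

lemma nf_cone: assumes w: "w \<in> pl.cone" shows "nf w"
proof -
 obtain u v where uv: "u \<in> gr (- 1)" "v \<in> gr (- 1)" "br u v = 0" "w = wedge [u, v]"
  by (rule pl.cone_plane[OF V_half_dim w])
 obtain a0 a1 a2 a3 where u: "u = a0 *s v0 + a1 *s v1 + a2 *s v2 + a3 *s v3" using V_span[OF uv(1)] by blast
 obtain b0 b1 b2 b3 where v: "v = b0 *s v0 + b1 *s v1 + b2 *s v2 + b3 *s v3" using V_span[OF uv(2)] by blast
 have "om * (a0 * b3 - a3 * b0 - 3 * (a1 * b2 - a2 * b1)) = 0"
  using uv(3) ff_nz unfolding u v br_coords by simp
 then have iso: "a0 * b3 - a3 * b0 = 3 * (a1 * b2 - a2 * b1)" using om(2) by simp
 have "w = tscale (a0 * b1 - a1 * b0) (wedge [v0, v1]) + tscale (a0 * b2 - a2 * b0) (wedge [v0, v2]) +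
   tscale (a0 * b3 - a3 * b0) (wedge [v0, v3]) + tscale (a1 * b2 - a2 * b1) (wedge [v1, v2]) +
   tscale (a1 * b3 - a3 * b1) (wedge [v1, v3]) + tscale (a2 * b3 - a3 * b2) (wedge [v2, v3])"
 proof
  fix js
  show "w js = (tscale (a0 * b1 - a1 * b0) (wedge [v0, v1]) + tscale (a0 * b2 - a2 * b0) (wedge [v0, v2]) +
   tscale (a0 * b3 - a3 * b0) (wedge [v0, v3]) + tscale (a1 * b2 - a2 * b1) (wedge [v1, v2]) +
   tscale (a1 * b3 - a3 * b1) (wedge [v1, v3]) + tscale (a2 * b3 - a3 * b2) (wedge [v2, v3])) js"
   unfolding uv(4) u v
   by (cases "length js = 2") (simp_all add: fun_apply tscale_def wedge_pair algebra_simps)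
 qed
 then have w': "w = qt (a0 * b1 - a1 * b0) (a0 * b2 - a2 * b0) (a1 * b2 - a2 * b1) (a1 * b3 - a3 * b1) (a2 * b3 - a3 * b2)"
  unfolding iso qt_def .
 have "(a0 * b1 - a1 * b0) * (a2 * b3 - a3 * b2) - (a0 * b2 - a2 * b0) * (a1 * b3 - a3 * b1) +
   (a0 * b3 - a3 * b0) * (a1 * b2 - a2 * b1) = 0" by (simp add: algebra_simps)
 then show ?thesis unfolding w' iso by (intro nf_quartic) (simp only: power2_eq_square mult.assoc)
qed

lemma qt_plane: "qt a 0 0 d 0 = wedge [v1, d *s v3 - a *s v0]"
proof
 show "qt a 0 0 d 0 js = wedge [v1, d *s v3 - a *s v0] js" for js
  by (cases "length js = 2") (simp_all add: qt_def fun_apply tscale_def wedge_pair algebra_simps)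
qed

lemma qt_cone: assumes "a \<noteq> 0 \<or> d \<noteq> 0" shows "qt a 0 0 d 0 \<in> pl.cone"
 unfolding qt_plane
proof (rule pl.plane_cone[OF V_half_dim v_gr(2)])
 show "d *s v3 - a *s v0 \<in> gr (- 1)"
  using v_gr gr_subspace by (intro vec.subspace_diff vec.subspace_scale)
 show "br v1 (d *s v3 - a *s v0) = 0" by (simp add: br_diff_right br_scale_right br_v br_v')
 fix x y assume "x *s v1 + y *s (d *s v3 - a *s v0) = 0"
 then have "(- y * a) *s v0 + x *s v1 + 0 *s v2 + (y * d) *s v3 = 0"
  by (simp add: vec.scale_right_diff_distrib algebra_simps)
 from v_independent[OF this] show "x = 0 \<and> y = 0" using assms by auto
qed

text \<open>The product of the Weyl elements with parameters s and 1 is diagonal.\<close>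

lemma qt_torus: assumes s: "s \<noteq> 0" obtains A where "A \<in> D" "tensor_act A (qt a 0 0 d 0) = qt (s ^ 4 * a) 0 0 (d / s\<^sup>2) 0"
proof -
 obtain N where N: "N \<in> D" "N *v v0 = (- (1 / 1 ^ 3)) *s v3" "N *v v1 = (1 / 1) *s v2"
  "N *v v2 = (- 1) *s v1" "N *v v3 = 1 ^ 3 *s v0" by (rule weyl_exists[of 1]) simp
 obtain M where M: "M \<in> D" "M *v v0 = (- (1 / s ^ 3)) *s v3" "M *v v1 = (1 / s) *s v2"
  "M *v v2 = (- s) *s v1" "M *v v3 = s ^ 3 *s v0" by (rule weyl_exists[OF s])
 have "tensor_act (M ** N) (qt a 0 0 d 0) = qt (s ^ 4 * a) 0 0 (d / s\<^sup>2) 0"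
  unfolding tensor_act_mult[OF qt_ext_power] using qt_weyl[OF _ N(2-), of a 0 0 d 0] qt_weyl[OF s M(2-), of 0 "- d" 0 0 a] by simp
 then show ?thesis using that pl.derived_mult[OF M(1) N(1)] by blast
qed

text \<open>For nonzero d the torus element with s a square root of d carries (a, d) to (a d^2, 1).
  Both sides are polynomials in a and d, so \<open>poly2_eqI\<close> adds the case d = 0.\<close>

lemma invariant_quartic:
 assumes p: "pl.invariant p" shows "\<exists>r. \<forall>a d. p (qt a 0 0 d 0) = poly r (a * d\<^sup>2)"
proof -
 have W: "qt 0 0 0 1 0 \<in> pl.W" "qt 1 0 0 0 0 \<in> pl.W" by (intro pl.cone_W qt_cone; simp)+
 have "p \<in> poly_functions tscale pl.W" using pl.invariant_S[OF p] by (simp only: pl.carrier_S)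
 from poly_functions_plane[OF this W pl.W_add pl.W_scale]
 obtain r0 where r0: "\<And>x y. p (tscale x (qt 0 0 0 1 0) + tscale y (qt 1 0 0 0 0)) = poly (poly r0 [:x:]) y"
  by metis
 have "tscale d (qt 0 0 0 1 0) + tscale a (qt 1 0 0 0 0) = qt a 0 0 d 0" for a d
  by (simp add: qt_def fun_eq_iff fun_apply tscale_def)
 then have r: "p (qt a 0 0 d 0) = poly (poly r0 [:d:]) a" for a d using r0[of d a] by simp
 define q where "q = poly r0 [:1:]"
 have nz: "p (qt a 0 0 d 0) = poly q (a * d\<^sup>2)" if d: "d \<noteq> 0" for a d
 proof -
  have s: "csqrt d \<noteq> 0" using d by simp
  obtain A where A: "A \<in> D" "tensor_act A (qt a 0 0 d 0) = qt (csqrt d ^ 4 * a) 0 0 (d / (csqrt d)\<^sup>2) 0"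
   by (rule qt_torus[OF s])
  have "csqrt d ^ 4 = ((csqrt d)\<^sup>2)\<^sup>2" by (simp only: power_mult[symmetric]) simp
  then have "csqrt d ^ 4 = d\<^sup>2" by simp
  then have "tensor_act A (qt a 0 0 d 0) = qt (a * d\<^sup>2) 0 0 1 0" using A(2) d by (simp add: mult.commute)
  moreover have "p (tensor_act A (qt a 0 0 d 0)) = p (qt a 0 0 d 0)"
   by (rule pl.invariantD[OF p A(1) qt_cone]) (simp add: d)
  ultimately show ?thesis using r[where d=1] by (simp add: q_def)
 qed
 \<comment> \<open>The polynomial q (a d^2) with d as outer and a as inner variable: [:0, 0,
   [:0, 1:]:] is d^2 times a.\<close>
 obtain q0 where q0: "\<And>d a. poly (poly q0 [:d:]) a = poly q (a * d\<^sup>2)"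
 proof
  show "poly (poly (pcompose (map_poly (\<lambda>c. [:c:]) q) [:0, 0, [:0, 1:]:]) [:d:]) a = poly q (a * d\<^sup>2)" for d a
   by (induction q) (simp_all add: map_poly_pCons pcompose_pCons power2_eq_square algebra_simps)
 qed
 have "poly (poly r0 [:d:]) a = poly (poly q0 [:d:]) a" for a d
  by (rule poly2_eqI) (simp add: q0 nz flip: r)
 then show ?thesis unfolding r q0 by blast
qed

text \<open>The catalecticant invariant of binary quartics.\<close>

definition kk :: 'd where "kk = (SOME k. ff $ k \<noteq> 0)"
text \<open>A linear form with value 1 on \<open>ff\<close>; it identifies the line of grade -2 with
  the complex numbers.\<close>

definition fc :: "complex^'d \<Rightarrow> complex" where "fc v = v $ kk / ff $ kk"

lemma fc_ff: "fc ff = 1"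
proof -
 have "\<exists>k. ff $ k \<noteq> 0" using ff_nz by (auto simp: vec_eq_iff)
 then have "ff $ kk \<noteq> 0" unfolding kk_def by (rule someI_ex)
 then show ?thesis by (simp add: fc_def)
qed

lemma fc_linear: "fc (u + v) = fc u + fc v" "fc (u - v) = fc u - fc v" "fc (- u) = - fc u" "fc (c *s u) = c * fc u" "fc 0 = 0"
 by (simp_all add: fc_def add_divide_distrib diff_divide_distrib)

text \<open>A tensor u \<and> v gives the expression of \<open>bf_wedge\<close>, which is symmetric
  in z and z'. On the three-dimensional \<open>ss\<close> it turns a quartic into a quadratic form
  with values in grade -2, and the determinant of that form is the catalecticant up to a
  factor.\<close>

definition bf :: "'d tensor \<Rightarrow> complex^'d \<Rightarrow> complex^'d \<Rightarrow> complex^'d" where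
 "bf w z z' = (\<Sum>i\<in>UNIV. \<Sum>j\<in>UNIV. w [i, j] *s br (br z (axis i 1)) (br z' (axis j 1)))"

lemma bf_add: "bf (x + y) z z' = bf x z z' + bf y z z'" and bf_scale: "bf (tscale c x) z z' = c *s bf x z z'"
 by (simp_all add: bf_def fun_apply tscale_def vec.scale_left_distrib sum.distrib vec.scale_sum_right)

lemma bf_wedge: "bf (wedge [u, v]) z z' = br (br z u) (br z' v) - br (br z v) (br z' u)"
proof -
 let ?b = "\<lambda>i j. br (br z (axis i 1)) (br z' (axis j 1))"
 have exp: "(\<Sum>i\<in>UNIV. \<Sum>j\<in>UNIV. (u $ i * v $ j) *s ?b i j) = br (br z u) (br z' v)" for u v
 proof -
  have "br (br z u) (br z' v) = br (br z (\<Sum>i\<in>UNIV. (u $ i) *s axis i 1)) (br z' (\<Sum>j\<in>UNIV. (v $ j) *s axis j 1))"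
   using vec_expand by metis
  then show ?thesis
   unfolding br_sum_right[of z] br_sum_right[of z'] br_scale_right br_sum_left br_scale_left
   by (simp only: br_sum_right br_scale_right vec.scale_sum_right vector_smult_assoc)
 qed
 have "bf (wedge [u, v]) z z' =
   (\<Sum>i\<in>UNIV. \<Sum>j\<in>UNIV. (u $ i * v $ j) *s ?b i j) - (\<Sum>i\<in>UNIV. \<Sum>j\<in>UNIV. (v $ i * u $ j) *s ?b i j)"
  unfolding bf_def wedge_pair by (simp add: vec.scale_left_diff_distrib sum_subtractf mult.commute)
 then show ?thesis by (simp only: exp)
qed

definition zz :: "3 \<Rightarrow> complex^'d" where "zz i = (if i = 1 then xa else if i = 2 then ha else ya)"

lemma zz [simp]: "zz 1 = xa" "zz 2 = ha" "zz 3 = ya" by (simp_all add: zz_def)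

definition Bm :: "'d tensor \<Rightarrow> complex^3^3" where "Bm w = (\<chi> i j. fc (bf w (zz i) (zz j)))"

definition J :: "'d tensor \<Rightarrow> complex" where "J = (\<lambda>w\<in>pl.W. det (Bm w))"

lemma J_carrier: "J \<in> carrier pl.S"
 unfolding J_def
 by (intro pl.S_det3) (simp add: Bm_def, rule pl.S_form, simp_all add: bf_add bf_scale fc_linear)

lemma J_scale: "w \<in> pl.W ==> J (tscale c w) = c ^ 3 * J w"
 by (simp add: J_def pl.W_scale det_3 Bm_def bf_scale fc_linear eval_nat_numeral algebra_simps)

text \<open>The nonzero entries of the matrix are -12 \<open>om\<close> d at \<open>xa\<close>,
  \<open>ha\<close> and symmetrically, and -12 \<open>om\<close> a at \<open>ya\<close>,
  \<open>ya\<close>. The constant is 12^3.\<close>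

lemma J_quartic: assumes "qt a 0 0 d 0 \<in> pl.W" shows "J (qt a 0 0 d 0) = 1728 * om ^ 3 * (a * d\<^sup>2)"
 using assms
 by (simp add: J_def det_3 Bm_def qt_plane bf_wedge br_diff_right br_diff_left br_scale_left br_scale_right xa_v xa_v0 ha_v ya_v
   br_minus_left br_minus_right br_v br_v' om fc_linear fc_ff) (simp add: fc_linear fc_ff eval_nat_numeral)

text \<open>The inverse of A acts on \<open>ss\<close> by a matrix n, and A acts on
  \<open>ff\<close> by a scalar x. So the matrix of the form changes to x n B n^T, and the
  determinant is multiplied by a number that does not depend on w.\<close>

lemma J_semi: assumes A: "A \<in> G\<^sub>0" shows "\<exists>c. \<forall>w\<in>pl.cone. J (tensor_act A w) = c * J w"
proof -
 let ?A' = "matrix_inv A"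
 note Aaut = lie_autD(1)[OF PP_aut[OF G0_PP[OF A]]]
 have "A *v ff \<in> gr (- 2)" by (rule G0_gr[OF A ff_gr])
 then obtain x where x: "A *v ff = x *s ff" using gr_minus_2 by auto
 \<comment> \<open>A preserves the grading and the line of \<open>ee\<close>, hence also
   \<open>ss\<close>, of which the \<open>zz i\<close> are a basis.\<close>
 have "\<exists>n. ?A' *v zz i = (\<Sum>k\<in>UNIV. n k *s zz k)" for i
 proof -
  have zi: "zz i \<in> ss" using ss_members by (simp add: zz_def)
  have A': "?A' \<in> G\<^sub>0" by (rule G0_inv[OF A])
  have "?A' *v ee \<in> gr 2" by (rule G0_gr[OF A' ee_gr])
  then obtain c where "?A' *v ee = c *s ee" using gr_2 by auto
  moreover have "ee = A *v (?A' *v ee)" using G0_invertible[OF A] by (simp add: matrix_inv_vector)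
  ultimately have e: "ee = c *s (A *v ee)" by (metis vec.scale)
  have "br (?A' *v zz i) (?A' *v (c *s (A *v ee))) = 0"
   using zi lie_autD(1)[OF PP_aut[OF G0_PP[OF A']], of "zz i" ee] unfolding e[symmetric] by (simp add: ss_def)
  then have "br (?A' *v zz i) (c *s ee) = 0" using G0_invertible[OF A] by (simp add: vec.scale matrix_inv_vector)
  then have "c *s br (?A' *v zz i) ee = 0" by (simp only: br_scale_right)
  moreover have "c \<noteq> 0" using e ee(1) by auto
  ultimately have "br (?A' *v zz i) ee = 0" using vec.scale_eq_0_iff by blast
  then have "?A' *v zz i \<in> ss" using zi G0_gr[OF A'] by (simp add: ss_def)
  then obtain a b c where "?A' *v zz i = a *s xa + b *s ha + c *s ya" using ss_span by blast
  then show ?thesis by (intro exI[of _ "\<lambda>k. if k = 1 then a else if k = 2 then b else c"]) (simp add: sum_3)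
 qed
 then obtain n where n: "\<And>i. ?A' *v zz i = (\<Sum>k\<in>UNIV. n i k *s zz k)" by metis
 let ?N = "\<chi> i k. n i k" and ?xN = "\<chi> i k. x * n i k"
 have "J (tensor_act A w) = (det ?xN * det ?N) * J w" if w: "w \<in> pl.cone" for w
 proof -
  obtain u v where uv: "u \<in> gr (- 1)" "v \<in> gr (- 1)" "br u v = 0" "w = wedge [u, v]"
   by (rule pl.cone_plane[OF V_half_dim w])
  have zi: "A *v (?A' *v zz i) = zz i" for i using G0_invertible[OF A] by (simp add: matrix_inv_vector)
  have b_ff: "bf w (zz k) (zz l) = fc (bf w (zz k) (zz l)) *s ff" for k l
  proof -
   have gr0: "zz i \<in> gr 0" for i using xa_gr0 by (simp add: zz_def)
   have "bf w (zz k) (zz l) \<in> gr (- 2)" unfolding uv(4) bf_wedge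
    using br_gr[OF br_gr[OF gr0[of k] uv(1)] br_gr[OF gr0[of l] uv(2)]]
     br_gr[OF br_gr[OF gr0[of k] uv(2)] br_gr[OF gr0[of l] uv(1)]]
    by (intro vec.subspace_diff[OF gr_subspace]) simp_all
   then show ?thesis using gr_minus_2 by (auto simp: fc_linear fc_ff)
  qed
  have expand: "br (br (?A' *v zz i) u) (br (?A' *v zz j) v) =
    (\<Sum>k\<in>UNIV. \<Sum>l\<in>UNIV. (n i k * n j l) *s br (br (zz k) u) (br (zz l) v))" for i j u v
   unfolding n br_sum_left br_scale_left
   by (simp only: br_sum_right br_scale_right vec.scale_sum_right vector_smult_assoc)
  have "bf (tensor_act A w) (zz i) (zz j) = A *v bf w (?A' *v zz i) (?A' *v zz j)" for i j
   unfolding uv(4) tensor_act_wedge list.map bf_wedge vec.diff Aaut zi ..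
  moreover have "bf w (?A' *v zz i) (?A' *v zz j) =
    (\<Sum>k\<in>UNIV. \<Sum>l\<in>UNIV. (n i k * n j l) *s bf w (zz k) (zz l))" for i j
   unfolding uv(4) bf_wedge expand by (simp add: sum_subtractf vec.scale_right_diff_distrib)
  moreover have "A *v bf w (zz k) (zz l) = (fc (bf w (zz k) (zz l)) * x) *s ff" for k l
   by (subst b_ff) (simp add: vec.scale x)
  ultimately have "bf (tensor_act A w) (zz i) (zz j) =
    (\<Sum>k\<in>UNIV. \<Sum>l\<in>UNIV. (n i k * n j l * (fc (bf w (zz k) (zz l)) * x)) *s ff)" for i j
   by (simp add: vec.sum vec.scale)
  then have "fc (bf (tensor_act A w) (zz i) (zz j)) =
    (\<Sum>k\<in>UNIV. \<Sum>l\<in>UNIV. n i k * n j l * (fc (bf w (zz k) (zz l)) * x))" for i j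
   by (simp add: sum_3 fc_linear fc_ff)
  then have "Bm (tensor_act A w) = ?xN ** Bm w ** transpose ?N"
   by (simp add: Bm_def vec_eq_iff matrix_matrix_mult_def transpose_def sum_3 algebra_simps)
  moreover have "w \<in> pl.W" "tensor_act A w \<in> pl.W" using pl.cone_W[OF w] pl.act_W[OF A] by blast+
  ultimately show ?thesis by (simp add: J_def det_mul det_transpose)
 qed
 then show ?thesis by blast
qed

lemma J_nz: "J (qt 1 0 0 1 0) \<noteq> 0"
 using J_quartic[of 1 1] pl.cone_W qt_cone[of 1 1] om(2) by simp

lemma J_invariant: "pl.invariant J"
 by (rule pl.semi_invariant[OF J_carrier J_semi qt_cone J_nz]) simp_all

theorem g2_invariants:
 "\<exists>f. invariant_of_degree br (gr (- 1)) G\<^sub>0 3 f \<and> generates_invariants br (gr (- 1)) G\<^sub>0 {f}"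
proof (intro exI conjI)
 show "invariant_of_degree br (gr (- 1)) G\<^sub>0 3 (pl.cls J)"
  by (rule pl.invariant_of_degreeI[OF J_invariant J_scale qt_cone J_nz]) simp_all
 show "generates_invariants br (gr (- 1)) G\<^sub>0 {pl.cls J}"
 proof (rule pl.generates_invariantsI)
  show "{pl.cls J} \<subseteq> {pl.cls p | p. pl.invariant p}" using J_invariant by blast
  fix p assume p: "pl.invariant p"
  obtain r where r: "\<And>a d. p (qt a 0 0 d 0) = poly r (a * d\<^sup>2)" using invariant_quartic[OF p] by blast
  \<comment> \<open>The substitution removes the factor between \<open>J\<close> and a d^2.\<close>
  let ?q = "pcompose r [:0, 1 / (1728 * om ^ 3):]"
  have q: "(\<lambda>w\<in>pl.W. poly ?q (J w)) \<in> carrier pl.S \<and> pl.cls (\<lambda>w\<in>pl.W. poly ?q (J w)) \<in> pl.gens {pl.cls J}"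
   by (rule pl.gens_poly[OF J_carrier pl.gens_base]) simp
  have "p w = (\<lambda>w\<in>pl.W. poly ?q (J w)) w" if w: "w \<in> pl.cone" for w
  proof -
   obtain A a d where A: "A \<in> D" "tensor_act A w = qt a 0 0 d 0" using nf_cone[OF w] unfolding nf_def by blast
   have "A \<in> G\<^sub>0" using pl.derived_subset A(1) by blast
   from pl.act_W[OF this pl.cone_W[OF w]] have "qt a 0 0 d 0 \<in> pl.W" by (simp only: A(2))
   then have "J w = 1728 * om ^ 3 * (a * d\<^sup>2)"
    using pl.invariantD[OF J_invariant A(1) w] J_quartic[of a d] unfolding A(2) by simp
   moreover have "p w = poly r (a * d\<^sup>2)" using pl.invariantD[OF p A(1) w] r unfolding A(2) by simp
   ultimately show ?thesis using om(2) pl.cone_W[OF w] by (simp add: poly_pcompose)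
  qed
  then have "pl.cls p = pl.cls (\<lambda>w\<in>pl.W. poly ?q (J w))"
   using pl.cls_eq_iff[OF pl.invariant_S[OF p]] q by blast
  then show "pl.cls p \<in> pl.gens {pl.cls J}" using q by simp
 qed
qed

end

section \<open>Type A\<close>

lemma dim_dual_family:
 fixes u :: "'i \<Rightarrow> complex^'d" and l :: "'i \<Rightarrow> complex^'d \<Rightarrow> complex"
 assumes I: "finite I" and lin: "\<And>i x y. l i (x + y) = l i x + l i y" "\<And>i c x. l i (c *s x) = c * l i x"
  and dual: "\<And>i j. i \<in> I ==> j \<in> I ==> l i (u j) = (if i = j then 1 else 0)"
  and S: "vec.subspace S" "u ` I \<subseteq> S" "\<And>x. x \<in> S ==> \<exists>c. x = (\<Sum>i\<in>I. c i *s u i)"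
 shows "vec.dim S = card I"
proof -
 have l0: "l i 0 = 0" for i using lin(2)[of i 0 0] by simp
 have l_sum: "l i (\<Sum>j\<in>J. c j *s u j) = (\<Sum>j\<in>J. c j * l i (u j))" for i J c
  by (induction J rule: infinite_finite_induct) (simp_all add: lin l0)
 have inj: "inj_on u I"
 proof (rule inj_onI)
  fix i j assume "i \<in> I" "j \<in> I" "u i = u j"
  then have "l i (u j) = 1" using dual[of i i] by simp
  then show "i = j" using dual[of i j] \<open>i \<in> I\<close> \<open>j \<in> I\<close> by (auto split: if_splits)
 qed
 have "vec.independent (u ` I)"
 proof
  assume "vec.dependent (u ` I)"
  then obtain c j where c: "j \<in> I" "c (u j) \<noteq> 0" "(\<Sum>v\<in>u ` I. c v *s v) = 0"
   using vec.dependent_finite[of "u ` I"] I by auto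
  have "(\<Sum>i\<in>I. c (u i) *s u i) = 0" using c(3) by (simp add: sum.reindex[OF inj])
  then have "(\<Sum>i\<in>I. c (u i) * l j (u i)) = 0" using l_sum[of j "\<lambda>i. c (u i)" I] l0 by simp
  moreover have "(\<Sum>i\<in>I. c (u i) * l j (u i)) = (\<Sum>i\<in>I. if i = j then c (u j) else 0)"
   by (rule sum.cong) (use dual c(1) in auto)
  ultimately show False using c(1,2) I by simp
 qed
 moreover have "S \<subseteq> vec.span (u ` I)"
 proof
  fix x assume "x \<in> S"
  then obtain c where c: "x = (\<Sum>i\<in>I. c i *s u i)" using S(3) by blast
  show "x \<in> vec.span (u ` I)" unfolding c by (intro vec.span_sum vec.span_scale vec.span_base imageI)
 qed
 ultimately have "vec.dim S = card (u ` I)" using S(2) vec.dim_unique[of "u ` I" S] by blast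
 then show ?thesis by (simp add: card_image[OF inj])
qed

lemma wedge_scale_slots:
 "wedge (map (\<lambda>i. c i *s v i) [0..<n]) = tscale (\<Prod>i<n. c i) (wedge (map v [0..<n]))"
proof -
 have "wedge (map (\<lambda>i. c i *s v i) [0..<n]) = tscale (ldet n (\<lambda>i j. if i = j then c i else 0)) (wedge (map v [0..<n]))"
 proof (rule wedge_linear_combination)
  fix k assume k: "k < n"
  have "(\<Sum>l<n. (if k = l then c k else 0) *s map v [0..<n] ! l) = (\<Sum>l<n. if k = l then c k *s v k else 0)"
   by (rule sum.cong) auto
  then show "map (\<lambda>i. c i *s v i) [0..<n] ! k = (\<Sum>l<n. (if k = l then c k else 0) *s map v [0..<n] ! l)"
   using k by simp
 qed simp_all
 then show ?thesis by (simp only: ldet_diagonal)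
qed

text \<open>What the study of Lagrangian subspaces needs from type A, free of matrices. X and Y are
  the coordinates on M and M* for the dual bases \<open>ez\<close> and \<open>fz\<close>. In
  \<open>transvection\<close> the vector x is annihilated by the covector \<eta>;
  \<open>scaling\<close> provides an element of the Levi subgroup that tells the two weights apart;
  \<open>X_G0\<close> and \<open>Y_G0\<close> say that M and M* are not mixed.\<close>

locale sl_model = levi_lie br H \<Delta> \<gamma> h G\<^sub>0 Pp
 for br :: "complex^'d \<Rightarrow> complex^'d \<Rightarrow> complex^'d" and H \<Delta> \<gamma> h G\<^sub>0 Pp +
 fixes N :: nat and ez fz :: "nat \<Rightarrow> complex^'d" and X Y :: "nat \<Rightarrow> complex^'d \<Rightarrow> complex"
 assumes N_pos: "N \<ge> 1"
  and X_add: "X i (u + v) = X i u + X i v" and X_scale: "X i (c *s u) = c * X i u"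
  and Y_add: "Y i (u + v) = Y i u + Y i v" and Y_scale: "Y i (c *s u) = c * Y i u"
  and ez_V: "i < N ==> ez i \<in> gr (- 1)" and fz_V: "i < N ==> fz i \<in> gr (- 1)"
  and X_ez: "i < N ==> j < N ==> X i (ez j) = (if i = j then 1 else 0)" and X_fz: "i < N ==> j < N ==> X i (fz j) = 0"
  and Y_fz: "i < N ==> j < N ==> Y i (fz j) = (if i = j then 1 else 0)" and Y_ez: "i < N ==> j < N ==> Y i (ez j) = 0"
  and V_expand: "z \<in> gr (- 1) ==> z = (\<Sum>i<N. X i z *s ez i + Y i z *s fz i)"
  and br_V: "z \<in> gr (- 1) ==> w \<in> gr (- 1) ==> br z w = (\<Sum>i<N. Y i z * X i w - X i z * Y i w) *s ff"
  and transvection: "(\<Sum>i<N. \<eta> i * x i) = 0 ==> \<exists>A\<in>derived GL G\<^sub>0. \<forall>z\<in>gr (- 1). \<forall>k<N.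
   X k (A *v z) = X k z + (\<Sum>i<N. \<eta> i * X i z) * x k \<and> Y k (A *v z) = Y k z - (\<Sum>i<N. Y i z * x i) * \<eta> k"
  and scaling: "\<exists>A\<in>G\<^sub>0. \<forall>z\<in>gr (- 1). \<forall>k<N.
   X k (A *v z) = (if k = 0 then 2 else 1) * X k z \<and> Y k (A *v z) = (if k = 0 then 1 / 2 else 1) * Y k z"
  and X_G0: "A \<in> G\<^sub>0 ==> \<exists>t. \<forall>z\<in>gr (- 1). \<forall>k<N. X k (A *v z) = (\<Sum>l<N. X l z * t l k)"
  and Y_G0: "A \<in> G\<^sub>0 ==> \<exists>t. \<forall>z\<in>gr (- 1). \<forall>k<N. Y k (A *v z) = (\<Sum>l<N. Y l z * t l k)"
begin

abbreviation "V \<equiv> gr (- 1)"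
abbreviation "D \<equiv> derived GL G\<^sub>0"

definition uu :: "nat \<Rightarrow> complex \<Rightarrow> complex \<Rightarrow> complex^'d" where "uu i a b = a *s ez i + b *s fz i"

lemma uu_V: "i < N ==> uu i a b \<in> V"
 unfolding uu_def using ez_V fz_V gr_subspace by (intro vec.subspace_add vec.subspace_scale) auto

lemma XY_uu: "i < N ==> k < N ==> X k (uu i a b) = (if k = i then a else 0)"
 "i < N ==> k < N ==> Y k (uu i a b) = (if k = i then b else 0)"
 by (simp_all add: uu_def X_add Y_add X_scale Y_scale X_ez X_fz Y_ez Y_fz)

lemma XY_0: "X i 0 = 0" "Y i 0 = 0" using X_scale[of i 0 0] Y_scale[of i 0 0] by simp_all

lemma XY_sum: "X i (sum f A) = (\<Sum>a\<in>A. X i (f a))" "Y i (sum f A) = (\<Sum>a\<in>A. Y i (f a))"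
 by (induction A rule: infinite_finite_induct) (simp_all add: XY_0 X_add Y_add)

lemma V_sum: "(\<And>i. i \<in> A ==> f i \<in> V) ==> sum f A \<in> V"
 by (rule vec.subspace_sum[OF gr_subspace])

lemma XY_diff: "X i (u - v) = X i u - X i v" "Y i (u - v) = Y i u - Y i v"
 using X_add[of i "u - v" v] Y_add[of i "u - v" v] by simp_all

lemma V_expand_uu: "z \<in> V ==> z = (\<Sum>i<N. uu i (X i z) (Y i z))"
 unfolding uu_def by (rule V_expand)

lemma V_eqI: assumes "z \<in> V" "w \<in> V" "\<And>k. k < N ==> X k z = X k w" "\<And>k. k < N ==> Y k z = Y k w" shows "z = w"
proof -
 have "(\<Sum>i<N. uu i (X i z) (Y i z)) = (\<Sum>i<N. uu i (X i w) (Y i w))" by (rule sum.cong) (simp_all add: assms)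
 then show ?thesis using V_expand_uu[OF assms(1)] V_expand_uu[OF assms(2)] by simp
qed

lemma XY_comb: assumes "k < N" "K \<subseteq> {..<N}"
 shows "X k (\<Sum>i\<in>K. uu i (a i) (b i)) = (if k \<in> K then a k else 0)" "Y k (\<Sum>i\<in>K. uu i (a i) (b i)) = (if k \<in> K then b k else 0)"
proof -
 have fin: "finite K" using assms(2) finite_subset by blast
 have "X k (\<Sum>i\<in>K. uu i (a i) (b i)) = (\<Sum>i\<in>K. if k = i then a i else 0)"
  unfolding XY_sum by (rule sum.cong) (use assms XY_uu in auto)
 then show "X k (\<Sum>i\<in>K. uu i (a i) (b i)) = (if k \<in> K then a k else 0)" using fin by simp
 have "Y k (\<Sum>i\<in>K. uu i (a i) (b i)) = (\<Sum>i\<in>K. if k = i then b i else 0)"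
  unfolding XY_sum by (rule sum.cong) (use assms XY_uu in auto)
 then show "Y k (\<Sum>i\<in>K. uu i (a i) (b i)) = (if k \<in> K then b k else 0)" using fin by simp
qed

lemma half_dim_V: "half_dim V = N"
proof -
 let ?I = "{..<N} \<times> (UNIV :: bool set)"
 let ?u = "\<lambda>(i, c). if c then ez i else fz i" and ?l = "\<lambda>(i, c). if c then X i else Y i"
 have "vec.dim V = card ?I"
 proof (rule dim_dual_family[where u="?u" and l="?l"])
  fix z assume "z \<in> V"
  have "(\<Sum>p\<in>?I. ?l p z *s ?u p) = (\<Sum>i<N. \<Sum>c\<in>UNIV. ?l (i, c) z *s ?u (i, c))"
   unfolding sum.cartesian_product by (rule sum.cong) auto
  also have "\<dots> = z" using V_expand[OF \<open>z \<in> V\<close>] by (simp add: UNIV_bool add.commute)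
  finally show "\<exists>c. z = (\<Sum>p\<in>?I. c p *s ?u p)" by (intro exI[of _ "\<lambda>p. ?l p z"]) (rule sym)
 qed (auto simp: X_add Y_add X_scale Y_scale X_ez X_fz Y_ez Y_fz ez_V fz_V gr_subspace split: if_splits)
 then show ?thesis by (simp add: half_dim_def card_cartesian_product)
qed

subsection \<open>Transvections\<close>

lemma D_G0: "A \<in> D ==> A \<in> G\<^sub>0" using pl.derived_subset by blast

lemma D_V: "A \<in> D ==> z \<in> V ==> A *v z \<in> V" by (rule G0_gr[OF D_G0])

text \<open>The split quadratic form given by the pairing of M with M*. Transvections preserve it
  besides the symplectic form, and it decides to which vectors a given one can be moved.\<close>

definition qq :: "complex^'d \<Rightarrow> complex" where "qq z = (\<Sum>i<N. X i z * Y i z)"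

text \<open>Products of transvections in the span of the coordinates from \<open>k\<close> on.\<close>
definition above :: "nat \<Rightarrow> complex^'d^'d \<Rightarrow> bool" where
 "above k A \<longleftrightarrow> A \<in> D \<and> (\<forall>z\<in>V. qq (A *v z) = qq z) \<and> (\<forall>z\<in>V. (\<forall>j<N. k \<le> j \<longrightarrow> X j z = 0 \<and> Y j z = 0) \<longrightarrow> A *v z = z) \<and>
   (\<forall>z\<in>V. (\<forall>j<k. X j z = 0 \<and> Y j z = 0) \<longrightarrow> (\<forall>j<k. X j (A *v z) = 0 \<and> Y j (A *v z) = 0))"

lemma above_D: "above k A ==> A \<in> D" by (simp add: above_def)

lemma above_qq: "above k A ==> z \<in> V ==> qq (A *v z) = qq z" by (simp add: above_def)

lemma above_one: "above k (mat 1)" by (simp add: above_def pl.derived_one)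

lemma above_mult: "above k A ==> above k B ==> above k (A ** B)"
 unfolding above_def using D_V by (simp add: pl.derived_mult matrix_vector_mul_assoc[symmetric])

lemma transvection_above:
 assumes orth: "(\<Sum>i<N. \<eta> i * x i) = 0" and low: "\<And>i. i < k ==> \<eta> i = 0 \<and> x i = 0" and k: "k \<le> N"
 obtains A where "above k A" "\<And>z j. z \<in> V ==> j < N ==> X j (A *v z) = X j z + (\<Sum>i<N. \<eta> i * X i z) * x j"
  "\<And>z j. z \<in> V ==> j < N ==> Y j (A *v z) = Y j z - (\<Sum>i<N. Y i z * x i) * \<eta> j"
proof -
 obtain A where A: "A \<in> D" and XA: "\<And>z j. z \<in> V ==> j < N ==> X j (A *v z) = X j z + (\<Sum>i<N. \<eta> i * X i z) * x j"
  and YA: "\<And>z j. z \<in> V ==> j < N ==> Y j (A *v z) = Y j z - (\<Sum>i<N. Y i z * x i) * \<eta> j"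
  using transvection[OF orth] by blast
 have "A *v z = z" if z: "z \<in> V" "\<forall>j<N. k \<le> j \<longrightarrow> X j z = 0 \<and> Y j z = 0" for z
 proof (rule V_eqI[OF D_V[OF A z(1)] z(1)])
  fix j assume j: "j < N"
  have "(\<Sum>i<N. \<eta> i * X i z) = 0" "(\<Sum>i<N. Y i z * x i) = 0"
   using z(2) low by (auto intro!: sum.neutral)
  then show "X j (A *v z) = X j z" "Y j (A *v z) = Y j z" using XA[OF z(1) j] YA[OF z(1) j] by simp_all
 qed
 moreover have "qq (A *v z) = qq z" if z: "z \<in> V" for z
 proof -
  let ?s = "\<Sum>i<N. \<eta> i * X i z" and ?t = "\<Sum>i<N. Y i z * x i"
  have "qq (A *v z) = (\<Sum>i<N. X i z * Y i z - ?t * (\<eta> i * X i z) + ?s * (Y i z * x i) - ?s * ?t * (\<eta> i * x i))"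
   unfolding qq_def by (rule sum.cong) (simp_all add: XA[OF z] YA[OF z] algebra_simps)
  also have "\<dots> = (\<Sum>i<N. X i z * Y i z) - ?t * ?s + ?s * ?t - ?s * ?t * (\<Sum>i<N. \<eta> i * x i)"
   by (simp only: sum.distrib sum_subtractf sum_distrib_left)
  finally show ?thesis by (simp add: qq_def orth)
 qed
 ultimately have "above k A" unfolding above_def using A XA YA low k by auto
 then show ?thesis using that XA YA by blast
qed

definition Vk :: "nat \<Rightarrow> (complex^'d) set" where "Vk k = {z \<in> V. \<forall>j<k. X j z = 0 \<and> Y j z = 0}"

lemma above_Vk: "above k A ==> z \<in> Vk k ==> A *v z \<in> Vk k"
 unfolding above_def Vk_def using D_V by blast

lemma sum_two: "i < N ==> j < N ==> i \<noteq> j ==> (\<Sum>k<N. (if k = i then a else if k = j then b else 0) * f k) = a * f i + b * (f j :: complex)"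
proof -
 assume ij: "i < N" "j < N" "i \<noteq> j"
 have "(\<Sum>k<N. (if k = i then a else if k = j then b else 0) * f k) = (\<Sum>k<N. (if k = i then a * f i else 0) + (if k = j then b * f j else 0))"
  by (rule sum.cong) (use ij in auto)
 then show ?thesis using ij by (simp add: sum.distrib)
qed

text \<open>One transvection carries the M-part of z to the k-th basis vector if some later
  coordinate is nonzero. Otherwise only the k-th coordinate is nonzero, and an elementary
  transvection first spreads it to position \<open>Suc k\<close>.\<close>

lemma move_X:
 assumes z: "z \<in> Vk k" and k: "Suc k < N" and nz: "j < N" "X j z \<noteq> 0"
 obtains A where "above k A" "\<And>i. i < N ==> X i (A *v z) = (if i = k then 1 else 0)"
  "(\<And>i. i < N ==> Y i z = 0) ==> (\<And>i. i < N ==> Y i (A *v z) = 0)"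
proof -
 have main: "\<exists>A. above k A \<and> (\<forall>i<N. X i (A *v z) = (if i = k then 1 else 0)) \<and>
   ((\<forall>i<N. Y i z = 0) \<longrightarrow> (\<forall>i<N. Y i (A *v z) = 0))"
  if z: "z \<in> Vk k" and j: "j < N" "k < j" "X j z \<noteq> 0" for z j
 proof -
  have zV: "z \<in> V" and low: "\<And>i. i < k ==> X i z = 0" using z by (auto simp: Vk_def)
  \<comment> \<open>The covector \<eta>, supported on k and j, is given the value 1 on the M-part of
    z. It also has the value 1 on the k-th basis vector, so it annihilates the difference x, and the
    transvection adds exactly x.\<close>
  let ?t = "(1 - X k z) / X j z"
  let ?\<eta> = "\<lambda>i. if i = k then 1 else if i = j then ?t else 0" and ?x = "\<lambda>i. (if i = k then 1 else 0) - X i z"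
  have two: "(\<Sum>i<N. ?\<eta> i * f i) = f k + ?t * f j" for f using sum_two[of k j 1 ?t f] k j by simp
  have "(\<Sum>i<N. ?\<eta> i * ?x i) = 0" unfolding two using j by (simp add: field_simps)
  moreover have "?\<eta> i = 0 \<and> ?x i = 0" if "i < k" for i using that low j by auto
  ultimately obtain A where A: "above k A"
   "\<And>z j. z \<in> V ==> j < N ==> X j (A *v z) = X j z + (\<Sum>i<N. ?\<eta> i * X i z) * ?x j"
   "\<And>z j. z \<in> V ==> j < N ==> Y j (A *v z) = Y j z - (\<Sum>i<N. Y i z * ?x i) * ?\<eta> j"
   by (rule transvection_above) (use k in auto)
  have one: "(\<Sum>i<N. ?\<eta> i * X i z) = 1" unfolding two using j by (simp add: field_simps)
  have "X i (A *v z) = (if i = k then 1 else 0)" if "i < N" for i using A(2)[OF zV that] unfolding one by simp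
  moreover have "Y i (A *v z) = 0" if "\<forall>i<N. Y i z = 0" "i < N" for i using A(3)[OF zV that(2)] that by simp
  ultimately show ?thesis using A(1) by blast
 qed
 show ?thesis
 proof (cases "\<exists>j<N. k < j \<and> X j z \<noteq> 0")
  case True
  then show ?thesis using main[OF z] that by blast
 next
  case False
  have zV: "z \<in> V" and low: "\<And>i. i < k ==> X i z = 0" using z by (auto simp: Vk_def)
  have "j = k" using False nz low by (meson linorder_neqE_nat)
  then have Xk: "X k z \<noteq> 0" using nz by simp
  let ?\<eta> = "\<lambda>i. if i = k then 1 else (0::complex)" and ?x = "\<lambda>i. if i = Suc k then 1 else (0::complex)"
  obtain B where B: "above k B"
   "\<And>z j. z \<in> V ==> j < N ==> X j (B *v z) = X j z + (\<Sum>i<N. ?\<eta> i * X i z) * ?x j"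
   "\<And>z j. z \<in> V ==> j < N ==> Y j (B *v z) = Y j z - (\<Sum>i<N. Y i z * ?x i) * ?\<eta> j"
   by (rule transvection_above[of ?\<eta> ?x k]) (use k in \<open>auto intro!: sum.neutral\<close>)
  have "(\<Sum>i<N. ?\<eta> i * X i z) = (\<Sum>i<N. if i = k then X k z else 0)" by (rule sum.cong) auto
  then have s: "(\<Sum>i<N. ?\<eta> i * X i z) = X k z" using k by simp
  have "X (Suc k) (B *v z) \<noteq> 0" using B(2)[OF zV k] False k Xk unfolding s by auto
  then obtain A where A: "above k A" "\<forall>i<N. X i (A *v (B *v z)) = (if i = k then 1 else 0)"
   "(\<forall>i<N. Y i (B *v z) = 0) \<longrightarrow> (\<forall>i<N. Y i (A *v (B *v z)) = 0)"
   using main[OF above_Vk[OF B(1) z] k] by auto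
  have "Y i (B *v z) = 0" if "\<And>i. i < N ==> Y i z = 0" "i < N" for i using B(3)[OF zV that(2)] that by simp
  then show ?thesis using that[OF above_mult[OF A(1) B(1)]] A by (simp add: matrix_vector_mul_assoc[symmetric])
 qed
qed

text \<open>The tori of the coordinate \<open>SL\<^sub>2\<close>'s, as products of transvections.\<close>
lemma weyl_pair:
 assumes ij: "i < N" "j < N" "i \<noteq> j" and s: "s \<noteq> 0"
 obtains A where "A \<in> D" "\<And>z k. z \<in> V ==> k < N ==> X k (A *v z) = (if k = i then s * X j z else if k = j then - X i z / s else X k z)"
  "\<And>z k. z \<in> V ==> k < N ==> Y k (A *v z) = (if k = i then Y j z / s else if k = j then - s * Y i z else Y k z)"
proof -
 have E: "\<exists>A\<in>D. \<forall>z\<in>V. \<forall>k<N. X k (A *v z) = (if k = i then X i z + s * X j z else X k z) \<and>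
   Y k (A *v z) = (if k = j then Y j z - s * Y i z else Y k z)" if ij: "i < N" "j < N" "i \<noteq> j" for i j s
 proof -
  let ?\<eta> = "\<lambda>k. if k = j then 1 else (0::complex)" and ?x = "\<lambda>k. if k = i then s else (0::complex)"
  have "(\<Sum>k<N. ?\<eta> k * ?x k) = 0" by (rule sum.neutral) (use ij in auto)
  from transvection[of ?\<eta> ?x, OF this]
  obtain A where A: "A \<in> D" "\<And>z k. z \<in> V ==> k < N ==> X k (A *v z) = X k z + (\<Sum>l<N. ?\<eta> l * X l z) * ?x k"
   "\<And>z k. z \<in> V ==> k < N ==> Y k (A *v z) = Y k z - (\<Sum>l<N. Y l z * ?x l) * ?\<eta> k"
   by blast
  have "(\<Sum>k<N. ?\<eta> k * f k) = (\<Sum>k<N. if k = j then f j else 0)" for f by (rule sum.cong) auto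
  then have 1: "(\<Sum>k<N. ?\<eta> k * f k) = f j" for f using ij by simp
  have "(\<Sum>k<N. f k * ?x k) = (\<Sum>k<N. if k = i then f i * s else 0)" for f by (rule sum.cong) auto
  then have 2: "(\<Sum>k<N. f k * ?x k) = f i * s" for f using ij by simp
  show ?thesis using A(1) A(2,3) unfolding 1 2 by (intro bexI[of _ A]) (auto simp: mult.commute)
 qed
 obtain P where P: "P \<in> D" "\<And>z k. z \<in> V ==> k < N ==> X k (P *v z) = (if k = i then X i z + s * X j z else X k z)"
   "\<And>z k. z \<in> V ==> k < N ==> Y k (P *v z) = (if k = j then Y j z - s * Y i z else Y k z)"
  using E[OF ij, of s] by blast
 obtain Q where Q: "Q \<in> D" "\<And>z k. z \<in> V ==> k < N ==> X k (Q *v z) = (if k = j then X j z + (- 1 / s) * X i z else X k z)"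
   "\<And>z k. z \<in> V ==> k < N ==> Y k (Q *v z) = (if k = i then Y i z - (- 1 / s) * Y j z else Y k z)"
  using E[OF ij(2,1) ij(3)[symmetric], of "- 1 / s"] by blast
 note V = matrix_vector_mul_assoc[symmetric] D_V[OF P(1)] D_V[OF Q(1)] P(2,3) Q(2,3)
 have "P ** Q ** P \<in> D" using P(1) Q(1) by (intro pl.derived_mult)
 moreover have "X k ((P ** Q ** P) *v z) = (if k = i then s * X j z else if k = j then - X i z / s else X k z)"
  "Y k ((P ** Q ** P) *v z) = (if k = i then Y j z / s else if k = j then - s * Y i z else Y k z)"
  if "z \<in> V" "k < N" for z k
  using that s ij by (simp_all add: V) (simp_all add: field_simps)
 ultimately show ?thesis using that by blast
qed

lemma torus_pair:
 assumes ij: "i < N" "j < N" "i \<noteq> j" and s: "s \<noteq> 0"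
 obtains A where "A \<in> D" "\<And>z k. z \<in> V ==> k < N ==> X k (A *v z) = (if k = i then s else if k = j then 1 / s else 1) * X k z"
  "\<And>z k. z \<in> V ==> k < N ==> Y k (A *v z) = (if k = i then 1 / s else if k = j then s else 1) * Y k z"
proof -
 obtain P where P: "P \<in> D" "\<And>z k. z \<in> V ==> k < N ==> X k (P *v z) = (if k = i then s * X j z else if k = j then - X i z / s else X k z)"
  "\<And>z k. z \<in> V ==> k < N ==> Y k (P *v z) = (if k = i then Y j z / s else if k = j then - s * Y i z else Y k z)"
  by (rule weyl_pair[OF ij s]) blast
 obtain Q where Q: "Q \<in> D" "\<And>z k. z \<in> V ==> k < N ==> X k (Q *v z) = (if k = i then - 1 * X j z else if k = j then - X i z / - 1 else X k z)"
  "\<And>z k. z \<in> V ==> k < N ==> Y k (Q *v z) = (if k = i then Y j z / - 1 else if k = j then - (- 1) * Y i z else Y k z)"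
  by (rule weyl_pair[OF ij, of "- 1"]) auto
 note V = matrix_vector_mul_assoc[symmetric] D_V[OF Q(1)] P(2,3) Q(2,3)
 have "P ** Q \<in> D" using P(1) Q(1) by (intro pl.derived_mult)
 moreover have "X k ((P ** Q) *v z) = (if k = i then s else if k = j then 1 / s else 1) * X k z"
  "Y k ((P ** Q) *v z) = (if k = i then 1 / s else if k = j then s else 1) * Y k z"
  if "z \<in> V" "k < N" for z k
  using that ij by (simp_all add: V)
 ultimately show ?thesis using that by blast
qed

end

context sl_model
begin

subsection \<open>Lagrangian subspaces\<close>

text \<open>A Lagrangian subspace, described as its own orthogonal complement in V instead of by its
  dimension; this is the form used in constructing vectors of it.\<close>

definition maxiso :: "(complex^'d) set \<Rightarrow> bool" where
 "maxiso L \<longleftrightarrow> vec.subspace L \<and> L \<subseteq> V \<and> (\<forall>x\<in>L. \<forall>y\<in>L. br x y = 0) \<and> (\<forall>y\<in>V. (\<forall>x\<in>L. br x y = 0) \<longrightarrow> y \<in> L)"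

text \<open>Among the isotropic subspaces containing L one of largest dimension is taken; a vector
  orthogonal to it but outside could be adjoined.\<close>

lemma maxiso_extends:
 assumes L: "vec.subspace L" "L \<subseteq> V" "\<And>x y. x \<in> L ==> y \<in> L ==> br x y = 0"
 obtains M where "maxiso M" "L \<subseteq> M"
proof -
 let ?P = "\<lambda>M. vec.subspace M \<and> L \<subseteq> M \<and> M \<subseteq> V \<and> (\<forall>x\<in>M. \<forall>y\<in>M. br x y = 0)"
 have bound: "\<forall>M. ?P M \<longrightarrow> vec.dim M < Suc (vec.dim (UNIV :: (complex^'d) set))"
  by (intro allI impI le_imp_less_Suc vec.dim_subset subset_UNIV)
 have "?P L" using L by blast
 from ex_has_greatest_nat[OF this bound]
 obtain M where M: "?P M" and max: "\<And>M'. ?P M' ==> vec.dim M' \<le> vec.dim M" by blast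
 have "y \<in> M" if y: "y \<in> V" "\<And>x. x \<in> M ==> br x y = 0" for y
 proof (rule ccontr)
  assume "y \<notin> M"
  let ?M = "vec.span (insert y M)"
  have sp: "vec.span M \<subseteq> M" using M by (intro vec.span_minimal) auto
  have yM: "\<exists>c. \<exists>x\<in>M. z = c *s y + x" if z: "z \<in> ?M" for z
  proof -
   obtain c where "z - c *s y \<in> vec.span M" using z vec.span_breakdown_eq[of z y M] by blast
   then have "z - c *s y \<in> M" using sp by blast
   then show ?thesis by (intro exI[of _ c] bexI[of _ "z - c *s y"]) simp_all
  qed
  have "br y x = 0" if "x \<in> M" for x using y(2)[OF that] br_skew[of y x] by simp
  then have "br z z' = 0" if zz: "z \<in> ?M" "z' \<in> ?M" for z z'
  proof -
   obtain c x c' x' where "x \<in> M" "x' \<in> M" "z = c *s y + x" "z' = c' *s y + x'" using yM[OF zz(1)] yM[OF zz(2)] by blast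
   then show ?thesis using M y(2) \<open>\<And>x. x \<in> M ==> br y x = 0\<close>
    by (simp add: br_add_left br_add_right br_scale_left br_scale_right)
  qed
  moreover have "?M \<subseteq> V" by (rule vec.span_minimal[OF _ gr_subspace]) (use y M in auto)
  moreover have "M \<subseteq> ?M" using vec.span_superset[of "insert y M"] by auto
  ultimately have "vec.dim ?M \<le> vec.dim M" using M by (intro max) auto
  moreover have "vec.dim ?M = vec.dim M + 1"
   using vec.dim_insert[of y M] \<open>y \<notin> M\<close> sp by (auto simp: vec.dim_span)
  ultimately show False by simp
 qed
 then have "maxiso M" using M unfolding maxiso_def by blast
 then show ?thesis using that M by blast
qed

lemma maxiso_image: assumes L: "maxiso L" and A: "A \<in> D" shows "maxiso ((*v) A ` L)"
proof -
 note inv = matrix_inv_vector[OF G0_invertible[OF D_G0[OF A]]]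
 have A': "matrix_inv A \<in> D" by (rule pl.derived_inv[OF A])
 note br = lie_autD(1)[OF PP_aut[OF G0_PP[OF D_G0]]]
 have sub: "vec.subspace ((*v) A ` L)" using L by (intro vec.subspace_image) (auto simp: maxiso_def)
 have V: "(*v) A ` L \<subseteq> V" using L D_V[OF A] by (auto simp: maxiso_def)
 have iso: "br (A *v x) (A *v y) = 0" if "x \<in> L" "y \<in> L" for x y
  using L that by (simp add: br[OF A, symmetric] maxiso_def)
 have "y \<in> (*v) A ` L" if y: "y \<in> V" "\<And>x. x \<in> L ==> br (A *v x) y = 0" for y
 proof -
  have "br x (matrix_inv A *v y) = 0" if "x \<in> L" for x
   using br[OF A', of "A *v x" y] y(2)[OF that] by (simp add: inv)
  then have "matrix_inv A *v y \<in> L" using L D_V[OF A' y(1)] by (simp add: maxiso_def)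
  then show ?thesis by (rule rev_image_eqI) (simp add: inv)
 qed
 then show ?thesis unfolding maxiso_def using sub V iso by blast
qed

text \<open>Orthogonality to a nonzero vector of the i-th coordinate plane, which is a
  two-dimensional symplectic space, forces the i-th coordinates of v to be proportional to that
  vector.\<close>

lemma L_components:
 assumes L: "maxiso L" and k: "k \<le> N" and u: "\<And>i. i < k ==> uu i (a i) (b i) \<in> L" "\<And>i. i < k ==> a i \<noteq> 0 \<or> b i \<noteq> 0"
  and v: "v \<in> L"
 obtains c where "v - (\<Sum>i<k. c i *s uu i (a i) (b i)) \<in> L \<inter> Vk k"
proof -
 have LV: "\<And>x. x \<in> L ==> x \<in> V" using L by (auto simp: maxiso_def)
 have "\<exists>c. X i v = c * a i \<and> Y i v = c * b i" if i: "i < k" for i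
 proof -
  have iN: "i < N" using i k by simp
  have "br v (uu i (a i) (b i)) = 0" using L v u(1)[OF i] by (auto simp: maxiso_def)
  then have "(\<Sum>j<N. Y j v * X j (uu i (a i) (b i)) - X j v * Y j (uu i (a i) (b i))) *s ff = 0"
   using br_V[OF LV[OF v] LV[OF u(1)[OF i]]] by simp
  then have "(\<Sum>j<N. Y j v * X j (uu i (a i) (b i)) - X j v * Y j (uu i (a i) (b i))) = 0" using ff_nz by simp
  moreover have "(\<Sum>j<N. Y j v * X j (uu i (a i) (b i)) - X j v * Y j (uu i (a i) (b i))) =
    (\<Sum>j<N. if j = i then Y i v * a i - X i v * b i else 0)"
   by (rule sum.cong) (use XY_uu[OF iN] in auto)
  ultimately have "Y i v * a i = X i v * b i" using iN by simp
  then show ?thesis using u(2)[OF i]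
   by (cases "a i = 0") (auto intro: exI[of _ "Y i v / b i"] exI[of _ "X i v / a i"] simp: field_simps)
 qed
 then obtain c where c: "\<And>i. i < k ==> X i v = c i * a i \<and> Y i v = c i * b i" by metis
 let ?s = "\<Sum>i<k. c i *s uu i (a i) (b i)"
 have s: "?s = (\<Sum>i<k. uu i (c i * a i) (c i * b i))" by (simp add: uu_def vec.scale_right_distrib)
 have "?s \<in> L" using L u(1) by (intro vec.subspace_sum vec.subspace_scale) (auto simp: maxiso_def)
 then have "v - ?s \<in> L" using L v by (auto simp: maxiso_def intro: vec.subspace_diff)
 moreover have "X i (v - ?s) = 0 \<and> Y i (v - ?s) = 0" if i: "i < k" for i
  using XY_comb[of i "{..<k}" "\<lambda>i. c i * a i" "\<lambda>i. c i * b i"] i k c[OF i] unfolding s XY_diff by auto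
 ultimately show ?thesis using that LV by (auto simp: Vk_def)
qed

text \<open>If the split quadratic form vanishes on the subspace, then the subspace is the sum of its projections to the two
 coordinate subspaces, so it contains either a vector of the first one or the whole second one.\<close>
lemma good_vector:
 assumes L: "maxiso L" and k: "k < N" and u: "\<And>i. i < k ==> uu i (a i) (b i) \<in> L" "\<And>i. i < k ==> a i \<noteq> 0 \<or> b i \<noteq> 0"
 obtains v where "v \<in> L \<inter> Vk k" "v \<noteq> 0" "qq v \<noteq> 0 \<or> v = fz k \<or> (\<forall>i<N. Y i v = 0)"
proof -
 have LV: "\<And>x. x \<in> L ==> x \<in> V" using L by (auto simp: maxiso_def)
 have kN: "k \<le> N" using k by simp
 \<comment> \<open>Maximality passes to the later coordinates: an element of L differs from one in
   \<open>Vk k\<close> by a combination of the first k vectors, to which y is orthogonal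
   anyway.\<close>
 have max: "y \<in> L" if y: "y \<in> Vk k" and z: "\<And>v. v \<in> L \<inter> Vk k ==> br v y = 0" for y
 proof -
  have yV: "y \<in> V" using y by (simp add: Vk_def)
  have "br v y = 0" if v: "v \<in> L" for v
  proof -
   obtain c where c: "v - (\<Sum>i<k. c i *s uu i (a i) (b i)) \<in> L \<inter> Vk k"
    by (rule L_components[OF L kN u v])
   have "br (uu i (a i) (b i)) y = 0" if i: "i < k" for i
   proof -
    have iN: "i < N" using i k by simp
    have "(\<Sum>j<N. Y j (uu i (a i) (b i)) * X j y - X j (uu i (a i) (b i)) * Y j y) = 0"
     by (rule sum.neutral) (use XY_uu[OF iN] y i in \<open>auto simp: Vk_def\<close>)
    then show ?thesis using br_V[OF uu_V[OF iN] yV] by simp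
   qed
   then have "br (\<Sum>i<k. c i *s uu i (a i) (b i)) y = 0" by (simp add: br_sum_left br_scale_left)
   then show ?thesis using z[OF c] by (simp add: br_diff_left)
  qed
  then show ?thesis using L yV by (auto simp: maxiso_def)
 qed
 have br_Vk: "br w (uu k x y) = (Y k w * x - X k w * y) *s ff" if "w \<in> L \<inter> Vk k" for w x y
 proof -
  have "(\<Sum>i<N. Y i w * X i (uu k x y) - X i w * Y i (uu k x y)) = (\<Sum>i<N. if i = k then Y k w * x - X k w * y else 0)"
   by (rule sum.cong) (use XY_uu[OF k] in auto)
  then show ?thesis using br_V[OF LV uu_V[OF k], of w x y] that k by simp
 qed
 have uk: "uu k x y \<in> Vk k" for x y using uu_V[OF k, of x y] XY_uu[OF k, of _ x y] k unfolding Vk_def by auto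
 have fz: "fz k = uu k 0 1" by (simp add: uu_def)
 show ?thesis
 proof (cases "\<exists>v\<in>L \<inter> Vk k. qq v \<noteq> 0")
  case True
  then obtain v' where "v' \<in> L \<inter> Vk k" "qq v' \<noteq> 0" by blast
  moreover then have "v' \<noteq> 0" by (auto simp: qq_def XY_0)
  ultimately show ?thesis using that by blast
 next
  case q0: False
  show ?thesis
  proof (cases "\<exists>v\<in>L \<inter> Vk k. \<exists>i<N. X i v \<noteq> 0")
   case False
   have "fz k \<in> L" unfolding fz by (rule max[OF uk]) (use br_Vk False k in simp)
   moreover have "fz k \<noteq> 0" using Y_fz[OF k k] XY_0 by auto
   ultimately show ?thesis using that[of "fz k"] uk fz by simp
  next
   case True
   then obtain v j where v: "v \<in> L \<inter> Vk k" "j < N" "X j v \<noteq> 0" by blast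
   let ?x = "\<Sum>i<N. uu i (X i v) 0"
   have xV: "?x \<in> V" using uu_V by (intro V_sum) simp
   have X: "X i ?x = X i v" "Y i ?x = 0" if "i < N" for i using XY_comb[OF that, of "{..<N}" "\<lambda>i. X i v" "\<lambda>i. 0"] that by simp_all
   have xk: "?x \<in> Vk k" using xV X v k by (auto simp: Vk_def)
   have "?x \<in> L"
   proof (rule max[OF xk])
    fix w assume w: "w \<in> L \<inter> Vk k"
    have vw: "v + w \<in> L \<inter> Vk k" using v w L gr_subspace
     by (auto simp: maxiso_def Vk_def X_add Y_add intro: vec.subspace_add)
    \<comment> \<open>As the quadratic form vanishes at v, w and v + w, so does its polar form.
      Together with the vanishing of the symplectic form this gives the vanishing of each of the two
      mixed sums.\<close>
    have "qq (v + w) = qq v + qq w + (\<Sum>i<N. X i v * Y i w + X i w * Y i v)"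
     by (simp add: qq_def X_add Y_add algebra_simps sum.distrib)
    then have 1: "(\<Sum>i<N. X i v * Y i w + X i w * Y i v) = 0" using q0 v w vw by auto
    have "br v w = 0" using v w L by (auto simp: maxiso_def)
    then have "(\<Sum>i<N. Y i v * X i w - X i v * Y i w) = 0"
     using br_V[of v w] LV v w ff_nz by auto
    then have 2: "(\<Sum>i<N. X i v * Y i w) = 0" using 1 by (simp add: sum.distrib sum_subtractf mult.commute)
    have "(\<Sum>i<N. Y i w * X i ?x - X i w * Y i ?x) = (\<Sum>i<N. X i v * Y i w)" by (rule sum.cong) (simp_all add: X)
    then show "br w ?x = 0" using br_V[OF _ xV, of w] LV w 2 by auto
   qed
   moreover have "?x \<noteq> 0" using X(1)[OF v(2)] v(3) XY_0 by auto
   ultimately show ?thesis using that[of ?x] xk X by blast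
  qed
 qed
qed

text \<open>First \<open>move_X\<close> brings the M-part to the k-th basis vector. If the M*-part
  is nonzero, the value of \<open>qq\<close> is its k-th coordinate and is nonzero, so a further
  transvection can clear the other coordinates of that part. For the last k the vector already lies
  in its coordinate plane.\<close>

lemma step:
 assumes v: "v \<in> Vk k" "v \<noteq> 0" and k: "k < N" and good: "qq v \<noteq> 0 \<or> v = fz k \<or> (\<forall>i<N. Y i v = 0)"
 obtains A \<alpha> \<beta> where "above k A" "A *v v = uu k \<alpha> \<beta>" "\<alpha> \<noteq> 0 \<or> \<beta> \<noteq> 0"
proof -
 have vV: "v \<in> V" using v by (simp add: Vk_def)
 have eq: "z = uu k (X k z) (Y k z)" if "z \<in> V" "\<And>i. i < N ==> i \<noteq> k ==> X i z = 0 \<and> Y i z = 0" for z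
  using that by (intro V_eqI[OF _ uu_V[OF k]]) (auto simp: XY_uu[OF k])
 have "\<exists>A. above k A \<and> (\<forall>i<N. i \<noteq> k \<longrightarrow> X i (A *v v) = 0 \<and> Y i (A *v v) = 0)"
 proof (cases "Suc k < N")
  case False
  then have "i < k" if "i < N" "i \<noteq> k" for i using that by simp
  then show ?thesis using v by (intro exI[of _ "mat 1"]) (auto simp: above_one Vk_def)
 next
  case True
  show ?thesis
  proof (cases "v = fz k")
   case True
   then have "v = uu k 0 1" by (simp add: uu_def)
   then show ?thesis by (intro exI[of _ "mat 1"]) (simp add: above_one XY_uu[OF k])
  next
   case False
   have "\<exists>j<N. X j v \<noteq> 0"
   proof (rule ccontr)
    assume X0: "\<not> ?thesis"
    then have "qq v = 0" by (auto simp: qq_def intro: sum.neutral)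
    then have "\<forall>i<N. Y i v = 0" using good False by blast
    then have "v = 0" using X0 by (intro V_eqI[OF vV vec.subspace_0[OF gr_subspace]]) (simp_all add: XY_0)
    then show False using v by blast
   qed
   then obtain j where j: "j < N" "X j v \<noteq> 0" by blast
   have "\<exists>A. above k A \<and> (\<forall>i<N. X i (A *v v) = (if i = k then 1 else 0)) \<and>
     ((\<forall>i<N. Y i v = 0) \<longrightarrow> (\<forall>i<N. Y i (A *v v) = 0))"
    by (rule move_X[OF v(1) True j]) blast
   then obtain A where A: "above k A" "\<And>i. i < N ==> X i (A *v v) = (if i = k then 1 else 0)"
    "(\<forall>i<N. Y i v = 0) \<longrightarrow> (\<forall>i<N. Y i (A *v v) = 0)" by blast
   let ?w = "A *v v"
   have w: "?w \<in> Vk k" by (rule above_Vk[OF A(1) v(1)])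
   then have wV: "?w \<in> V" by (simp add: Vk_def)
   show ?thesis
   proof (cases "\<forall>i<N. Y i v = 0")
    case True
    then show ?thesis using A by (intro exI[of _ A]) auto
   next
    case Y: False
    have "Y k ?w \<noteq> 0"
    proof
     assume z: "Y k ?w = 0"
     have "qq v \<noteq> 0" using good Y False by blast
     moreover have "qq ?w = (\<Sum>i<N. 0)" unfolding qq_def by (rule sum.cong) (use A(2) z in auto)
     ultimately show False using above_qq[OF A(1) vV] by simp
    qed
    \<comment> \<open>The covector is the M*-part of w divided by its k-th coordinate, with that
      coordinate left out. It vanishes on the k-th basis vector, which is the M-part of w, so that
      part does not change.\<close>
    let ?x = "\<lambda>i. if i = k then 1 else (0::complex)" and ?\<eta> = "\<lambda>i. if i = k then 0 else Y i ?w / Y k ?w"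
    have sx: "(\<Sum>i<N. f i * ?x i) = f k" for f
    proof -
     have "(\<Sum>i<N. f i * ?x i) = (\<Sum>i<N. if i = k then f k else 0)" by (rule sum.cong) auto
     then show ?thesis using k by simp
    qed
    have orth: "(\<Sum>i<N. ?\<eta> i * ?x i) = 0" unfolding sx by simp
    obtain B where B: "above k B"
     "\<And>z j. z \<in> V ==> j < N ==> X j (B *v z) = X j z + (\<Sum>i<N. ?\<eta> i * X i z) * ?x j"
     "\<And>z j. z \<in> V ==> j < N ==> Y j (B *v z) = Y j z - (\<Sum>i<N. Y i z * ?x i) * ?\<eta> j"
     by (rule transvection_above[OF orth, of k]) (use w k in \<open>auto simp: Vk_def\<close>)
    have "X i (B *v ?w) = 0 \<and> Y i (B *v ?w) = 0" if i: "i < N" "i \<noteq> k" for i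
     using B(2)[OF wV i(1)] B(3)[OF wV i(1)] A(2)[OF i(1)] i \<open>Y k ?w \<noteq> 0\<close> unfolding sx by simp
    then show ?thesis using above_mult[OF B(1) A(1)] by (intro exI[of _ "B ** A"]) (simp add: matrix_vector_mul_assoc[symmetric])
   qed
  qed
 qed
 then obtain A where A: "above k A" "\<And>i. i < N ==> i \<noteq> k ==> X i (A *v v) = 0 \<and> Y i (A *v v) = 0" by blast
 have AV: "A *v v \<in> V" by (rule D_V[OF above_D[OF A(1)] vV])
 have "A *v v \<noteq> 0" using invertible_eq_0[OF G0_invertible[OF D_G0[OF above_D[OF A(1)]]]] v(2) by blast
 then have "X k (A *v v) \<noteq> 0 \<or> Y k (A *v v) \<noteq> 0" using eq[OF AV A(2)] by (auto simp: uu_def)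
 then show ?thesis using that[OF A(1) eq[OF AV A(2)]] by blast
qed

text \<open>Each step uses transvections in the coordinates from k on, which fix the vectors found
  so far.\<close>

lemma diagonalise:
 assumes L: "maxiso L" and k: "k \<le> N"
 shows "\<exists>A\<in>D. \<exists>a b. \<forall>i<k. (a i \<noteq> 0 \<or> b i \<noteq> 0) \<and> uu i (a i) (b i) \<in> (*v) A ` L"
 using k
proof (induction k)
 case 0
 then show ?case using pl.derived_one by blast
next
 case (Suc k)
 have kN: "k < N" using Suc.prems by simp
 obtain A a b where "A \<in> D" "\<forall>i<k. (a i \<noteq> 0 \<or> b i \<noteq> 0) \<and> uu i (a i) (b i) \<in> (*v) A ` L"
  using Suc.IH kN by auto
 then have A: "A \<in> D" "\<And>i. i < k ==> a i \<noteq> 0 \<or> b i \<noteq> 0" "\<And>i. i < k ==> uu i (a i) (b i) \<in> (*v) A ` L"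
  by blast+
 obtain v where v: "v \<in> (*v) A ` L \<inter> Vk k" "v \<noteq> 0" "qq v \<noteq> 0 \<or> v = fz k \<or> (\<forall>i<N. Y i v = 0)"
  by (rule good_vector[OF maxiso_image[OF L A(1)] kN A(3,2)])
 obtain B \<alpha> \<beta> where B: "above k B" "B *v v = uu k \<alpha> \<beta>" "\<alpha> \<noteq> 0 \<or> \<beta> \<noteq> 0"
  by (rule step[OF _ v(2) kN v(3)]) (use v(1) in auto)
 have fix_B: "B *v uu i x y = uu i x y" if "i < k" for i x y
 proof -
  have iN: "i < N" using that kN by simp
  have "\<forall>j<N. k \<le> j \<longrightarrow> X j (uu i x y) = 0 \<and> Y j (uu i x y) = 0" using XY_uu[OF iN] that by auto
  then show ?thesis using B(1) uu_V[OF iN] unfolding above_def by blast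
 qed
 have BA: "(B ** A) *v z = B *v (A *v z)" for z by (simp add: matrix_vector_mul_assoc)
 show ?case
 proof (intro bexI[of _ "B ** A"] exI allI impI conjI)
  show "B ** A \<in> D" by (rule pl.derived_mult[OF above_D[OF B(1)] A(1)])
  fix i assume i: "i < Suc k"
  show "(a(k := \<alpha>)) i \<noteq> 0 \<or> (b(k := \<beta>)) i \<noteq> 0" using i A(2) B(3) by (auto simp: less_Suc_eq)
  show "uu i ((a(k := \<alpha>)) i) ((b(k := \<beta>)) i) \<in> (*v) (B ** A) ` L"
  proof (cases "i = k")
   case True
   obtain l where "l \<in> L" "v = A *v l" using v(1) by blast
   then show ?thesis using B(2) True by (intro image_eqI[of _ _ l]) (simp_all add: BA)
  next
   case False
   then have ik: "i < k" using i by simp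
   obtain l where l: "l \<in> L" "uu i (a i) (b i) = A *v l" using A(3)[OF ik] by blast
   have "(B ** A) *v l = uu i (a i) (b i)" unfolding BA l(2)[symmetric] by (rule fix_B[OF ik])
   then show ?thesis using False l(1) by (intro image_eqI[of _ _ l]) simp_all
  qed
 qed
qed

definition dw :: "(nat \<Rightarrow> complex) \<Rightarrow> (nat \<Rightarrow> complex) \<Rightarrow> 'd tensor" where
 "dw a b = wedge (map (\<lambda>i. uu i (a i) (b i)) [0..<N])"

text \<open>After diagonalisation the image of the subspace has the vectors in the coordinate planes
  as a basis, so its top exterior power is spanned by their wedge product; the scalar factor is put
  into slot 0.\<close>

lemma cone_diagonal: assumes w: "w \<in> pl.cone" shows "\<exists>A\<in>D. \<exists>a b. tensor_act A w = dw a b"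
proof -
 obtain L where L: "L \<in> LGr br V" "w \<in> ext_power N L" using w unfolding pl.cone_def half_dim_V by blast
 obtain M where M: "maxiso M" "L \<subseteq> M" by (rule maxiso_extends[of L]) (use pl.LGr_D[OF L(1)] in auto)
 obtain A a b where A: "A \<in> D" "\<And>i. i < N ==> a i \<noteq> 0 \<or> b i \<noteq> 0" "\<And>i. i < N ==> uu i (a i) (b i) \<in> (*v) A ` M"
  using diagonalise[OF M(1) order_refl] by blast
 have comb: "\<exists>c. v = (\<Sum>i<N. c i *s uu i (a i) (b i))" if v: "v \<in> (*v) A ` M" for v
 proof -
  obtain c where c: "v - (\<Sum>i<N. c i *s uu i (a i) (b i)) \<in> (*v) A ` M \<inter> Vk N"
   by (rule L_components[OF maxiso_image[OF M(1) A(1)] order_refl A(3,2) v])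
  have "v - (\<Sum>i<N. c i *s uu i (a i) (b i)) = 0"
   by (rule V_eqI[OF _ vec.subspace_0[OF gr_subspace]]) (use c in \<open>auto simp: Vk_def XY_0\<close>)
  then show ?thesis by auto
 qed
 have "tensor_act A w \<in> ext_power N ((*v) A ` M)" by (rule tensor_act_ext_power[OF L(2)]) (use M in auto)
 then have "\<exists>c. tensor_act A w = tscale c (dw a b)"
 proof (induction rule: ext_power_induct)
  case zero
  show ?case by (rule exI[of _ 0]) (simp add: tscale_def fun_eq_iff fun_apply)
 next
  case (step c us t)
  have "\<forall>k<N. \<exists>d. us ! k = (\<Sum>l<N. d l *s uu l (a l) (b l))"
   using comb step(1,2) by (metis nth_mem subsetD)
  then obtain d where d: "\<And>k. k < N ==> us ! k = (\<Sum>l<N. d k l *s uu l (a l) (b l))" by metis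
  have "wedge us = tscale (ldet N d) (dw a b)"
   unfolding dw_def by (rule wedge_linear_combination) (use step(1) d in auto)
  moreover obtain e where "t = tscale e (dw a b)" using step.IH by blast
  ultimately have "tscale c (wedge us) + t = tscale (c * ldet N d + e) (dw a b)"
   by (simp add: tscale_def fun_eq_iff fun_apply algebra_simps)
  then show ?case by blast
 qed
 then obtain c where c: "tensor_act A w = tscale c (dw a b)" by blast
 let ?c = "\<lambda>i. if i = 0 then c else 1"
 have "(\<Prod>i<N. ?c i) = c" using N_pos by (simp add: prod.delta)
 moreover have "(\<lambda>i. ?c i *s uu i (a i) (b i)) = (\<lambda>i. uu i (?c i * a i) (?c i * b i))"
  by (rule ext) (simp add: uu_def vec.scale_right_distrib)
 ultimately have "dw (\<lambda>i. ?c i * a i) (\<lambda>i. ?c i * b i) = tscale c (dw a b)"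
  unfolding dw_def using wedge_scale_slots[of ?c "\<lambda>i. uu i (a i) (b i)" N] by (simp only:)
 then have "tensor_act A w = dw (\<lambda>i. ?c i * a i) (\<lambda>i. ?c i * b i)" by (simp only: c)
 then show ?thesis using A(1) by blast
qed

end

lemma functional_vector:
 fixes l :: "complex^'d \<Rightarrow> complex"
 assumes lin: "\<And>x y. l (x + y) = l x + l y" "\<And>c x. l (c *s x) = c * l x"
 shows "dotp (\<chi> k. l (axis k 1)) v = l v"
proof -
 have l0: "l 0 = 0" using lin(2)[of 0 0] by simp
 have "l (\<Sum>k\<in>K. v $ k *s axis k 1) = (\<Sum>k\<in>K. l (axis k 1) * v $ k)" for K
  by (induction K rule: infinite_finite_induct) (simp_all add: lin l0 mult.commute)
 then show ?thesis using arg_cong[OF vec_expand[of v], of l] by (simp add: dotp_def)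
qed

lemma prod_two:
 fixes i j n :: nat
 shows "i < n ==> j < n ==> i \<noteq> j ==> (\<Prod>k<n. if k = i then a else if k = j then b else (1::complex)) = a * b"
proof -
 assume ij: "i < n" "j < n" "i \<noteq> j"
 have "(\<Prod>k<n. if k = i then a else if k = j then b else (1::complex)) = (\<Prod>k<n. (if k = i then a else 1) * (if k = j then b else 1))"
  by (rule prod.cong) (use ij in auto)
 also have "\<dots> = a * b" unfolding prod.distrib
  using ij by simp
 finally show ?thesis .
qed

section \<open>Invariants as functions of the diagonal Lagrangian subspaces\<close>

context sl_model
begin

lemma dw_cong: "(\<And>i. i < N ==> a i = a' i) ==> (\<And>i. i < N ==> b i = b' i) ==> dw a b = dw a' b'"
 unfolding dw_def by (rule arg_cong[where f=wedge]) simp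

lemma dw_slot:
 assumes i: "i < N"
 shows "dw (a(i := s * x)) (b(i := t * y)) = tscale s (dw (a(i := x)) (b(i := 0))) + tscale t (dw (a(i := 0)) (b(i := y)))"
proof -
 have upd: "dw (a(i := x)) (b(i := y)) = wedge ((map (\<lambda>k. uu k (a k) (b k)) [0..<N])[i := uu i x y])" for x y
  unfolding dw_def by (rule arg_cong[where f=wedge], rule nth_equalityI) (simp_all add: nth_list_update)
 have "uu i (s * x) (t * y) = s *s uu i x 0 + t *s uu i 0 y" by (simp add: uu_def)
 then show ?thesis unfolding upd using i by (simp add: wedge_linear_slot)
qed

lemma comb_scale: "(\<Sum>i<N. c i *s uu i (a i) (b i)) = (\<Sum>i<N. uu i (c i * a i) (c i * b i))"
 by (simp add: uu_def vec.scale_right_distrib)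

lemma XY_comb_scale: assumes "k < N"
 shows "X k (\<Sum>i<N. c i *s uu i (a i) (b i)) = c k * a k" "Y k (\<Sum>i<N. c i *s uu i (a i) (b i)) = c k * b k"
 unfolding comb_scale
 using XY_comb[OF assms, of "{..<N}" "\<lambda>i. c i * a i" "\<lambda>i. c i * b i"] assms by simp_all

lemma comb_V: "(\<Sum>i<N. c i *s uu i (a i) (b i)) \<in> V"
 unfolding comb_scale using uu_V by (intro V_sum) simp

lemma comb_isotropic: "br (\<Sum>i<N. c i *s uu i (a i) (b i)) (\<Sum>i<N. c' i *s uu i (a i) (b i)) = 0"
proof -
 have "(\<Sum>k<N. Y k (\<Sum>i<N. c i *s uu i (a i) (b i)) * X k (\<Sum>i<N. c' i *s uu i (a i) (b i)) -
   X k (\<Sum>i<N. c i *s uu i (a i) (b i)) * Y k (\<Sum>i<N. c' i *s uu i (a i) (b i))) = 0"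
  by (rule sum.neutral) (simp add: XY_comb_scale)
 then show ?thesis unfolding br_V[OF comb_V comb_V] by simp
qed

lemma dw_LGr: assumes nz: "\<And>i. i < N ==> a i \<noteq> 0 \<or> b i \<noteq> 0" shows "dw a b \<in> pl.cone"
proof -
 let ?f = "\<lambda>c. \<Sum>i<N. c i *s uu i (a i) (b i)"
 let ?L = "range ?f" and ?l = "\<lambda>i z. if a i \<noteq> 0 then X i z / a i else Y i z / b i"
 have sub: "vec.subspace ?L"
 proof (rule vec.subspaceI)
  show "0 \<in> ?L" by (rule range_eqI[of _ _ "\<lambda>i. 0"]) simp
  fix x y c assume "x \<in> ?L" "y \<in> ?L"
  then obtain p q where pq: "x = ?f p" "y = ?f q" by blast
  show "x + y \<in> ?L" unfolding pq
   by (rule range_eqI[of _ _ "\<lambda>i. p i + q i"]) (simp add: vec.scale_left_distrib sum.distrib)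
  show "c *s x \<in> ?L" unfolding pq
   by (rule range_eqI[of _ _ "\<lambda>i. c * p i"]) (simp add: vec.scale_sum_right)
 qed
 have u: "uu j (a j) (b j) \<in> ?L" if "j < N" for j
 proof (rule range_eqI[of _ _ "\<lambda>i. if i = j then 1 else 0"])
  have "?f (\<lambda>i. if i = j then 1 else 0) = (\<Sum>i<N. if i = j then uu j (a j) (b j) else 0)" by (rule sum.cong) auto
  then show "uu j (a j) (b j) = ?f (\<lambda>i. if i = j then 1 else 0)" using that by simp
 qed
 have "vec.dim ?L = card {..<N}"
  by (rule dim_dual_family[where u="\<lambda>i. uu i (a i) (b i)" and l="?l"])
   (use sub u nz in \<open>auto simp: X_add Y_add X_scale Y_scale XY_uu add_divide_distrib\<close>)
 then have "?L \<in> LGr br V" using sub comb_V comb_isotropic by (auto simp: LGr_def half_dim_V)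
 moreover have "dw a b \<in> ext_power N ?L" unfolding dw_def by (rule ext_power_wedge) (use u in auto)
 ultimately show ?thesis unfolding pl.cone_def half_dim_V by blast
qed

text \<open>If some vector is zero, the wedge product is zero, which belongs to every exterior power
  of every Lagrangian subspace.\<close>

lemma dw_cone: "dw a b \<in> pl.cone"
proof (cases "\<exists>i<N. a i = 0 \<and> b i = 0")
 case False
 then show ?thesis by (intro dw_LGr) auto
next
 case True
 then obtain i where i: "i < N" "a i = 0" "b i = 0" by blast
 have "dw a b = dw (a(i := 0 * 0)) (b(i := 0 * 0))" by (rule dw_cong) (use i in auto)
 also have "\<dots> = 0" unfolding dw_slot[OF i(1)] by (simp add: tscale_def fun_eq_iff fun_apply)
 finally have "dw a b = 0" .
 moreover obtain L where "L \<in> LGr br V" using dw_LGr[of "\<lambda>i. 1" "\<lambda>i. 1"] unfolding pl.cone_def by auto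
 ultimately show ?thesis unfolding pl.cone_def using tensor.subspace_0[OF ext_power_subspace] by auto
qed

lemma act_dw:
 assumes A: "A \<in> G\<^sub>0" and XA: "\<And>z k. z \<in> V ==> k < N ==> X k (A *v z) = c k * X k z"
  and YA: "\<And>z k. z \<in> V ==> k < N ==> Y k (A *v z) = d k * Y k z"
 shows "tensor_act A (dw a b) = dw (\<lambda>k. c k * a k) (\<lambda>k. d k * b k)"
proof -
 have "A *v uu k (a k) (b k) = uu k (c k * a k) (d k * b k)" if k: "k < N" for k
  by (rule V_eqI[OF G0_gr[OF A uu_V[OF k]] uu_V[OF k]]) (simp_all add: XA[OF uu_V[OF k]] YA[OF uu_V[OF k]] XY_uu[OF k])
 then show ?thesis unfolding dw_def tensor_act_wedge by (intro arg_cong[where f=wedge]) simp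
qed

text \<open>With s a square root of b_i / a_i the torus makes both coordinates in slot i equal to r
  = a_i s. This common factor leaves the wedge product, and slot N - 1 carries the factor 1 / r,
  which cancels it.\<close>

lemma invariant_torus:
 assumes p: "pl.invariant p" and i: "i < N" "i \<noteq> N - 1" and nz: "a i \<noteq> 0" "b i \<noteq> 0"
 shows "p (dw a b) = p (dw (a(i := 1, N - 1 := a i * a (N - 1))) (b(i := 1, N - 1 := b i * b (N - 1))))"
proof -
 let ?j = "N - 1" define s where "s = csqrt (b i / a i)"
 have s: "s \<noteq> 0" and ss: "s\<^sup>2 = b i / a i" using nz by (simp_all add: s_def)
 have j: "?j < N" using N_pos by simp
 obtain A where A: "A \<in> D" "\<And>z k. z \<in> V ==> k < N ==> X k (A *v z) = (if k = i then s else if k = ?j then 1 / s else 1) * X k z"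
  "\<And>z k. z \<in> V ==> k < N ==> Y k (A *v z) = (if k = i then 1 / s else if k = ?j then s else 1) * Y k z"
  by (rule torus_pair[OF i(1) j i(2) s]) blast
 let ?a = "a(i := 1, ?j := a i * a ?j)" and ?b = "b(i := 1, ?j := b i * b ?j)"
 let ?r = "a i * s" let ?c = "\<lambda>k. if k = i then ?r else if k = ?j then 1 / ?r else 1"
 have r: "b i / s = ?r" "b i / ?r = s" using ss s nz by (simp_all add: field_simps power2_eq_square)
 have "p (dw a b) = p (tensor_act A (dw a b))" by (rule pl.invariantD[OF p A(1) dw_cone, symmetric])
 also have "tensor_act A (dw a b) = dw (\<lambda>k. (if k = i then s else if k = ?j then 1 / s else 1) * a k)
   (\<lambda>k. (if k = i then 1 / s else if k = ?j then s else 1) * b k)" by (rule act_dw[OF D_G0[OF A(1)] A(2,3)])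
 also have "\<dots> = dw (\<lambda>k. ?c k * ?a k) (\<lambda>k. ?c k * ?b k)"
 proof (rule dw_cong)
  fix k assume "k < N"
  show "(if k = i then s else if k = ?j then 1 / s else 1) * a k = ?c k * ?a k" using nz s i by auto
  have "b i * b ?j / ?r = s * b ?j" by (subst r(2)[symmetric]) simp
  then show "(if k = i then 1 / s else if k = ?j then s else 1) * b k = ?c k * ?b k" using r(1) i by auto
 qed
 also have "\<dots> = wedge (map (\<lambda>k. ?c k *s uu k (?a k) (?b k)) [0..<N])"
  unfolding dw_def by (simp add: uu_def vec.scale_right_distrib)
 also have "\<dots> = tscale (?r * (1 / ?r)) (dw ?a ?b)" unfolding wedge_scale_slots prod_two[OF i(1) j i(2)] dw_def ..
 also have "\<dots> = dw ?a ?b" using nz s by (simp add: tscale_def)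
 finally show ?thesis .
qed

lemma dw_plane:
 assumes p: "pl.invariant p" and i: "i < N"
 shows "\<exists>r. \<forall>s t. p (dw (a(i := s * x)) (b(i := t * y))) = poly (poly r [:s:]) t"
proof -
 have "p \<in> poly_functions tscale pl.W" using pl.invariant_S[OF p] by (simp only: pl.carrier_S)
 from poly_functions_plane[OF this pl.cone_W[OF dw_cone] pl.cone_W[OF dw_cone] pl.W_add pl.W_scale]
 show ?thesis unfolding dw_slot[OF i] by blast
qed

text \<open>By \<open>dw_plane\<close> both sides are polynomials in the coordinates of slot i, and
  \<open>poly2_eqI\<close> extends \<open>invariant_torus\<close> to vanishing coordinates.\<close>

lemma invariant_step:
 assumes p: "pl.invariant p" and i: "i < N" "i \<noteq> N - 1"
 shows "p (dw a b) = p (dw (a(i := 1, N - 1 := a i * a (N - 1))) (b(i := 1, N - 1 := b i * b (N - 1))))"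
proof -
 let ?j = "N - 1"
 have j: "?j < N" using N_pos by simp
 obtain r where r: "\<And>s t. p (dw (a(i := s * 1)) (b(i := t * 1))) = poly (poly r [:s:]) t" using dw_plane[OF p i(1)] by blast
 obtain q where q: "\<And>s t. p (dw ((a(i := 1))(?j := s * a ?j)) ((b(i := 1))(?j := t * b ?j))) = poly (poly q [:s:]) t"
  using dw_plane[OF p j] by blast
 have "poly (poly r [:s:]) t = poly (poly q [:s:]) t" if "s \<noteq> 0" "t \<noteq> 0" for s t
  using invariant_torus[OF p i, of "a(i := s)" "b(i := t)"] that i i(2)[symmetric] r[of s t] q[of s t] by simp
 from poly2_eqI[OF this, of "a i" "b i"] show ?thesis using r[of "a i" "b i"] q[of "a i" "b i"] by simp
qed

lemma invariant_reduce:
 assumes p: "pl.invariant p"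
 shows "p (dw a b) = p (dw ((\<lambda>k. 1)(N - 1 := \<Prod>i<N. a i)) ((\<lambda>k. 1)(N - 1 := \<Prod>i<N. b i)))"
proof -
 \<comment> \<open>After j steps the first j entries are 1 and their product has been collected in
   the last entry.\<close>
 define g where "g j a k = (if k < j then 1 else if k = N - 1 then (\<Prod>i<j. a i) * a (N - 1) else a k)"
  for j k :: nat and a :: "nat \<Rightarrow> complex"
 have "j \<le> N - 1 ==> p (dw a b) = p (dw (g j a) (g j b))" for j
 proof (induction j)
  case 0
  have "g 0 a = a" "g 0 b = b" by (auto simp: g_def)
  then show ?case by simp
 next
  case (Suc j)
  have step: "(g j a)(j := 1, N - 1 := g j a j * g j a (N - 1)) = g (Suc j) a" for a
   using Suc.prems by (auto simp: g_def fun_eq_iff less_Suc_eq)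
  have "p (dw a b) = p (dw (g j a) (g j b))" using Suc by simp
  also have "\<dots> = p (dw (g (Suc j) a) (g (Suc j) b))"
   using invariant_step[OF p, of j "g j a" "g j b"] Suc.prems unfolding step by simp
  finally show ?case .
 qed
 from this[of "N - 1"] have "p (dw a b) = p (dw (g (N - 1) a) (g (N - 1) b))" by simp
 moreover have "N = Suc (N - 1)" using N_pos by simp
 then have "(\<Prod>i<N. a i) = (\<Prod>i<N - 1. a i) * a (N - 1)" for a :: "nat \<Rightarrow> complex"
  by (metis prod.lessThan_Suc)
 then have "dw (g (N - 1) a) (g (N - 1) b) = dw ((\<lambda>k. 1)(N - 1 := \<Prod>i<N. a i)) ((\<lambda>k. 1)(N - 1 := \<Prod>i<N. b i))"
  by (intro dw_cong) (auto simp: g_def)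
 ultimately show ?thesis by simp
qed

lemma invariant_polynomial:
 assumes p: "pl.invariant p"
 shows "\<exists>r. \<forall>a b. p (dw a b) = poly (poly r [:\<Prod>i<N. a i:]) (\<Prod>i<N. b i)"
proof -
 have "N - 1 < N" using N_pos by simp
 then obtain r where r: "\<And>s t. p (dw ((\<lambda>k. 1)(N - 1 := s * 1)) ((\<lambda>k. 1)(N - 1 := t * 1))) = poly (poly r [:s:]) t"
  using dw_plane[OF p] by blast
 have "p (dw a b) = poly (poly r [:\<Prod>i<N. a i:]) (\<Prod>i<N. b i)" for a b
  by (rule trans[OF invariant_reduce[OF p]]) (use r[of "\<Prod>i<N. a i" "\<Prod>i<N. b i"] in simp)
 then show ?thesis by blast
qed

subsection \<open>The two generators\<close>

definition Xv :: "nat \<Rightarrow> complex^'d" where "Xv i = (\<chi> k. X i (axis k 1))"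
definition Yv :: "nat \<Rightarrow> complex^'d" where "Yv i = (\<chi> k. Y i (axis k 1))"

lemma XYv: "dotp (Xv i) z = X i z" "dotp (Yv i) z = Y i z"
 unfolding Xv_def Yv_def by (rule functional_vector[OF X_add X_scale] functional_vector[OF Y_add Y_scale])+

lemma pairing_family:
 "length vs = N ==> pairing (map Z [0..<N]) (wedge vs) = ldet N (\<lambda>k j. dotp (Z j) (vs ! k))"
proof -
 assume "length vs = N"
 then have "pairing (map Z [0..<N]) (wedge vs) = ldet N (\<lambda>k j. dotp (map Z [0..<N] ! j) (vs ! k))"
  using pairing_wedge[of vs "map Z [0..<N]"] by simp
 also have "\<dots> = ldet N (\<lambda>k j. dotp (Z j) (vs ! k))" by (rule ldet_cong) simp
 finally show ?thesis .
qed

text \<open>If A mixes the linear forms Z only among themselves, the determinant of their values is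
  multiplied by the determinant of the mixing matrix t.\<close>

lemma pairing_semi_invariant:
 assumes A: "A \<in> G\<^sub>0" and t: "\<And>z k. z \<in> V ==> k < N ==> dotp (Z k) (A *v z) = (\<Sum>l<N. dotp (Z l) z * t l k)"
  and w: "w \<in> ext_power N V"
 shows "pairing (map Z [0..<N]) (tensor_act A w) = ldet N t * pairing (map Z [0..<N]) w"
 using w
proof (induction rule: ext_power_induct)
 case zero
 have "pairing (map Z [0..<N]) 0 = 0" by (simp add: pairing_def fun_apply)
 then show ?case by simp
next
 case (step c vs w)
 have "pairing (map Z [0..<N]) (wedge (map ((*v) A) vs)) = ldet N (\<lambda>k j. dotp (Z j) (map ((*v) A) vs ! k))"
  using step(1) by (intro pairing_family) simp
 also have "\<dots> = ldet N (\<lambda>k j. \<Sum>l<N. dotp (Z l) (vs ! k) * t l j)"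
 proof (rule ldet_cong)
  fix i j assume ij: "i < N" "j < N"
  then have "vs ! i \<in> V" using step(1,2) by (metis nth_mem subsetD)
  then show "dotp (Z j) (map ((*v) A) vs ! i) = (\<Sum>l<N. dotp (Z l) (vs ! i) * t l j)" using t ij step(1) by simp
 qed
 also have "\<dots> = pairing (map Z [0..<N]) (wedge vs) * ldet N t"
  unfolding ldet_mult pairing_family[OF step(1)] ..
 finally show ?case by (simp add: tensor_act_add tensor_act_scale tensor_act_wedge pairing_add pairing_scale step algebra_simps)
qed

text \<open>The Pluecker coordinate belonging to M: the determinant of the M-coordinates of the
  vectors. Likewise \<open>pF\<close> for M*.\<close>

definition pE :: "'d tensor \<Rightarrow> complex" where "pE = (\<lambda>w\<in>pl.W. pairing (map Xv [0..<N]) w)"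
definition pF :: "'d tensor \<Rightarrow> complex" where "pF = (\<lambda>w\<in>pl.W. pairing (map Yv [0..<N]) w)"

lemma pEF_carrier: "pE \<in> carrier pl.S" "pF \<in> carrier pl.S"
 unfolding pE_def pF_def by (rule pl.S_form[OF pairing_add pairing_scale])+

lemma pEF_scale: "w \<in> pl.W ==> pE (tscale c w) = c ^ 1 * pE w" "w \<in> pl.W ==> pF (tscale c w) = c ^ 1 * pF w"
 by (simp_all add: pE_def pF_def pl.W_scale pairing_scale)

lemma pEF_semi:
 assumes A: "A \<in> G\<^sub>0"
 shows "\<exists>c. \<forall>w\<in>pl.cone. pE (tensor_act A w) = c * pE w" "\<exists>c. \<forall>w\<in>pl.cone. pF (tensor_act A w) = c * pF w"
proof -
 have W: "w \<in> ext_power N V \<and> w \<in> pl.W \<and> tensor_act A w \<in> pl.W" if "w \<in> pl.cone" for w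
  using pl.cone_W[OF that] pl.act_W[OF A] pl.W_iff half_dim_V by auto
 obtain t where t: "\<And>z k. z \<in> V ==> k < N ==> dotp (Xv k) (A *v z) = (\<Sum>l<N. dotp (Xv l) z * t l k)"
  using X_G0[OF A] unfolding XYv by blast
 show "\<exists>c. \<forall>w\<in>pl.cone. pE (tensor_act A w) = c * pE w"
  by (rule exI[of _ "ldet N t"], rule ballI) (use W pairing_semi_invariant[where Z=Xv and t=t, OF A t] in \<open>simp add: pE_def\<close>)
 obtain t where t: "\<And>z k. z \<in> V ==> k < N ==> dotp (Yv k) (A *v z) = (\<Sum>l<N. dotp (Yv l) z * t l k)"
  using Y_G0[OF A] unfolding XYv by blast
 show "\<exists>c. \<forall>w\<in>pl.cone. pF (tensor_act A w) = c * pF w"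
  by (rule exI[of _ "ldet N t"], rule ballI) (use W pairing_semi_invariant[where Z=Yv and t=t, OF A t] in \<open>simp add: pF_def\<close>)
qed

lemma pEF_dw: "pE (dw a b) = (\<Prod>i<N. a i)" "pF (dw a b) = (\<Prod>i<N. b i)"
proof -
 have len: "length (map (\<lambda>i. uu i (a i) (b i)) [0..<N]) = N" by simp
 have "ldet N (\<lambda>k j. dotp (Xv j) (map (\<lambda>i. uu i (a i) (b i)) [0..<N] ! k)) = ldet N (\<lambda>k j. if k = j then a k else 0)"
  "ldet N (\<lambda>k j. dotp (Yv j) (map (\<lambda>i. uu i (a i) (b i)) [0..<N] ! k)) = ldet N (\<lambda>k j. if k = j then b k else 0)"
  by (rule ldet_cong; simp add: XYv XY_uu)+
 then show "pE (dw a b) = (\<Prod>i<N. a i)" "pF (dw a b) = (\<Prod>i<N. b i)"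
  using pl.cone_W[OF dw_cone, of a b] pairing_family[OF len, of Xv] pairing_family[OF len, of Yv]
  by (simp_all add: pE_def pF_def dw_def ldet_diagonal)
qed

lemma pEF_nz: "pE (dw (\<lambda>i. 1) (\<lambda>i. 1)) \<noteq> 0" "pF (dw (\<lambda>i. 1) (\<lambda>i. 1)) \<noteq> 0"
 by (simp_all add: pEF_dw)

lemma pEF_invariant: "pl.invariant pE" "pl.invariant pF"
 by (rule pl.semi_invariant[OF pEF_carrier(1) pEF_semi(1) dw_cone pEF_nz(1)], assumption)
  (rule pl.semi_invariant[OF pEF_carrier(2) pEF_semi(2) dw_cone pEF_nz(2)], assumption)

theorem sl_invariants:
 "\<exists>f\<^sub>1 f\<^sub>2 \<theta>\<^sub>1 \<theta>\<^sub>2.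
   invariant_of_degree br V G\<^sub>0 1 f\<^sub>1 \<and> invariant_of_degree br V G\<^sub>0 1 f\<^sub>2 \<and>
   has_weight br V G\<^sub>0 f\<^sub>1 \<theta>\<^sub>1 \<and> has_weight br V G\<^sub>0 f\<^sub>2 \<theta>\<^sub>2 \<and>
   (\<exists>t\<in>carrier (torus_quotient G\<^sub>0). \<theta>\<^sub>1 t \<noteq> \<theta>\<^sub>2 t) \<and> generates_invariants br V G\<^sub>0 {f\<^sub>1, f\<^sub>2}"
proof -
 let ?w = "dw (\<lambda>i. 1) (\<lambda>i. 1)"
 have "\<forall>A\<in>G\<^sub>0. \<exists>c. \<forall>w\<in>pl.cone. pE (tensor_act A w) = c * pE w" "\<forall>A\<in>G\<^sub>0. \<exists>c. \<forall>w\<in>pl.cone. pF (tensor_act A w) = c * pF w"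
  using pEF_semi by blast+
 from bchoice[OF this(1)] bchoice[OF this(2)]
 obtain \<kappa>\<^sub>1 \<kappa>\<^sub>2 where \<kappa>\<^sub>1: "\<And>A w. A \<in> G\<^sub>0 ==> w \<in> pl.cone ==> pE (tensor_act A w) = \<kappa>\<^sub>1 A * pE w"
  and \<kappa>\<^sub>2: "\<And>A w. A \<in> G\<^sub>0 ==> w \<in> pl.cone ==> pF (tensor_act A w) = \<kappa>\<^sub>2 A * pF w" by blast
 obtain \<theta>\<^sub>1 where \<theta>\<^sub>1: "has_weight br V G\<^sub>0 (pl.cls pE) \<theta>\<^sub>1"
  "\<And>A. A \<in> G\<^sub>0 ==> D #>\<^bsub>GL\<lparr>carrier := G\<^sub>0\<rparr>\<^esub> A \<in> carrier (torus_quotient G\<^sub>0)"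
  "\<And>A. A \<in> G\<^sub>0 ==> \<theta>\<^sub>1 (D #>\<^bsub>GL\<lparr>carrier := G\<^sub>0\<rparr>\<^esub> A) = \<kappa>\<^sub>1 (matrix_inv A)"
  using pl.weight_exists[OF pEF_carrier(1) \<kappa>\<^sub>1 dw_cone pEF_nz(1)] by blast
 obtain \<theta>\<^sub>2 where \<theta>\<^sub>2: "has_weight br V G\<^sub>0 (pl.cls pF) \<theta>\<^sub>2"
  "\<And>A. A \<in> G\<^sub>0 ==> \<theta>\<^sub>2 (D #>\<^bsub>GL\<lparr>carrier := G\<^sub>0\<rparr>\<^esub> A) = \<kappa>\<^sub>2 (matrix_inv A)"
  using pl.weight_exists[OF pEF_carrier(2) \<kappa>\<^sub>2 dw_cone pEF_nz(2)] by blast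
 \<comment> \<open>The scaling multiplies \<open>pE\<close> by 2 and \<open>pF\<close> by 1/2. The
   weights are compared at the coset of its inverse, where they take these values.\<close>
 obtain B where B: "B \<in> G\<^sub>0" "\<And>z k. z \<in> V ==> k < N ==> X k (B *v z) = (if k = 0 then 2 else 1) * X k z"
  "\<And>z k. z \<in> V ==> k < N ==> Y k (B *v z) = (if k = 0 then 1 / 2 else 1) * Y k z"
  using scaling by blast
 have "tensor_act B ?w = dw (\<lambda>k. (if k = 0 then 2 else 1) * 1) (\<lambda>k. (if k = 0 then 1 / 2 else 1) * 1)"
  by (rule act_dw[OF B])
 then have B_pEF: "pE (tensor_act B ?w) = 2" "pF (tensor_act B ?w) = 1 / 2"
  using N_pos by (simp_all add: pEF_dw prod.delta)
 have \<kappa>B: "\<kappa>\<^sub>1 B = 2" "\<kappa>\<^sub>2 B = 1 / 2"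
  using \<kappa>\<^sub>1[OF B(1) dw_cone, of "\<lambda>i. 1" "\<lambda>i. 1"] \<kappa>\<^sub>2[OF B(1) dw_cone, of "\<lambda>i. 1" "\<lambda>i. 1"] B_pEF
  by (simp_all add: pEF_dw)
 have B': "matrix_inv B \<in> G\<^sub>0" by (rule G0_inv[OF B(1)])
 have "matrix_inv (matrix_inv B) = B"
  by (rule matrix_inv_unique[OF matrix_inv_works(2)]) (use G0_invertible B(1) B' in auto)
 then have "\<theta>\<^sub>1 (D #>\<^bsub>GL\<lparr>carrier := G\<^sub>0\<rparr>\<^esub> matrix_inv B) \<noteq> \<theta>\<^sub>2 (D #>\<^bsub>GL\<lparr>carrier := G\<^sub>0\<rparr>\<^esub> matrix_inv B)"
  unfolding \<theta>\<^sub>1(3)[OF B'] \<theta>\<^sub>2(2)[OF B'] by (simp add: \<kappa>B)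
 then have weights: "\<exists>t\<in>carrier (torus_quotient G\<^sub>0). \<theta>\<^sub>1 t \<noteq> \<theta>\<^sub>2 t" using \<theta>\<^sub>1(2)[OF B'] by blast
 have degrees: "invariant_of_degree br V G\<^sub>0 1 (pl.cls pE)" "invariant_of_degree br V G\<^sub>0 1 (pl.cls pF)"
  by (rule pl.invariant_of_degreeI[OF pEF_invariant(1) pEF_scale(1) dw_cone pEF_nz(1)], assumption)
   (rule pl.invariant_of_degreeI[OF pEF_invariant(2) pEF_scale(2) dw_cone pEF_nz(2)], assumption)
 have "generates_invariants br V G\<^sub>0 {pl.cls pE, pl.cls pF}"
 proof (rule pl.generates_invariantsI)
  show "{pl.cls pE, pl.cls pF} \<subseteq> {pl.cls p | p. pl.invariant p}" using pEF_invariant by blast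
  fix p assume p: "pl.invariant p"
  obtain r where r: "\<And>a b. p (dw a b) = poly (poly r [:\<Prod>i<N. a i:]) (\<Prod>i<N. b i)" using invariant_polynomial[OF p] by blast
  let ?q = "\<lambda>w\<in>pl.W. poly (poly r [:pE w:]) (pF w)"
  have q: "?q \<in> carrier pl.S \<and> pl.cls ?q \<in> pl.gens {pl.cls pE, pl.cls pF}"
   by (rule pl.gens_poly2[OF pEF_carrier(1) pl.gens_base pEF_carrier(2) pl.gens_base]) simp_all
  have "p w = ?q w" if w: "w \<in> pl.cone" for w
  proof -
   obtain A a b where A: "A \<in> D" "tensor_act A w = dw a b" using cone_diagonal[OF w] by blast
   have "p w = p (dw a b)" "pE w = pE (dw a b)" "pF w = pF (dw a b)"
    using pl.invariantD[OF p A(1) w] pl.invariantD[OF pEF_invariant(1) A(1) w] pl.invariantD[OF pEF_invariant(2) A(1) w]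
    unfolding A(2) by simp_all
   then show ?thesis using pl.cone_W[OF w] by (simp add: r pEF_dw)
  qed
  then have "pl.cls p = pl.cls ?q" using pl.cls_eq_iff[OF pl.invariant_S[OF p]] q by blast
  then show "pl.cls p \<in> pl.gens {pl.cls pE, pl.cls pF}" using q by simp
 qed
 then show ?thesis using degrees \<theta>\<^sub>1(1) \<theta>\<^sub>2(1) weights by blast
qed

end

subsection \<open>Matrices of rank one\<close>

definition outer :: "complex^'m \<Rightarrow> complex^'m \<Rightarrow> complex^'m^'m" where "outer x y = (\<chi> i j. x $ i * y $ j)"

lemma outer_vec: "outer x y *v v = dotp y v *s x"
 by (simp add: outer_def vec_eq_iff matrix_vector_mult_def dotp_def sum_distrib_left mult_ac)

lemma mat_outer: "A ** outer x y = outer (A *v x) y"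
 by (simp add: outer_def vec_eq_iff matrix_matrix_mult_def matrix_vector_mult_def sum_distrib_right mult.assoc)

lemma outer_mat: "outer x y ** A = outer x (y v* A)"
 by (simp add: outer_def vec_eq_iff matrix_matrix_mult_def vector_matrix_mult_def sum_distrib_left mult_ac)

lemma outer_outer: "outer x y ** outer z w = mscale (dotp y z) (outer x w)"
 by (simp add: mat_outer outer_vec) (simp add: outer_def mscale_def vec_eq_iff)

lemma trace_outer: "trace (outer x y) = dotp y x"
 by (simp add: outer_def trace_def dotp_def mult.commute)

lemma outer_add: "outer (x + x') y = outer x y + outer x' y" "outer x (y + y') = outer x y + outer x y'"
 and outer_scale: "outer (c *s x) y = mscale c (outer x y)" "outer x (c *s y) = mscale c (outer x y)"
 and outer_0: "outer 0 y = 0" "outer x 0 = 0"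
 by (simp_all add: outer_def mscale_def vec_eq_iff algebra_simps)

lemma dotp_transpose: "dotp (y v* A) v = dotp y (A *v v)" for A :: "complex^'m^'m"
 by (simp add: dotp_def matrix_vector_mult_def vector_matrix_mult_def sum_distrib_left sum_distrib_right mult_ac)
  (rule sum.swap)

lemma dotp_axis: "dotp x (axis i 1) = x $ i"
 by (simp add: dotp_def axis_def if_distrib[of "\<lambda>z. _ * z"] cong: if_cong)

lemma dotp_eqI: "(\<And>v. dotp x v = dotp y v) ==> x = y"
 by (simp add: vec_eq_iff flip: dotp_axis)

lemma uminus_vector: "(- A) *v v = - (A *v v)" for A :: "complex^'m^'m"
 by (simp add: vec_eq_iff matrix_vector_mult_def sum_negf)

lemma mscale_simps: "mscale c (A + B) = mscale c A + mscale c B" "mscale c (A - B) = mscale c A - mscale c B"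
 "mscale c (mscale d A) = mscale (c * d) A" "mscale 1 A = A" "mscale 0 A = 0" "mscale c 0 = 0"
 "mscale (c + d) A = mscale c A + mscale d A"
 by (simp_all add: mscale_def vec_eq_iff algebra_simps)

lemma trace_simps: "trace (A + B) = trace A + trace B" "trace (A - B) = trace A - trace B" "trace (mscale c A) = c * trace A"
 for A B :: "complex^'m^'m"
 by (simp_all add: trace_def mscale_def sum.distrib sum_subtractf sum_distrib_left)

text \<open>A basis of the common kernel of b and b' completes a, a' to a basis; the f i are the
  coordinate functionals of the new vectors, written as vectors for \<open>dotp\<close>.\<close>

lemma dual_basis:
 fixes a a' b b' :: "complex^'m"
 assumes ab: "dotp b a = 0" "dotp b' a' = 0" "dotp b a' = 1" "dotp b' a = 1" and card: "CARD('m) = N + 2"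
 obtains e f :: "nat \<Rightarrow> complex^'m" where
  "\<And>i. i < N ==> dotp b (e i) = 0 \<and> dotp b' (e i) = 0 \<and> dotp (f i) a = 0 \<and> dotp (f i) a' = 0"
  "\<And>i j. i < N ==> j < N ==> dotp (f i) (e j) = (if i = j then 1 else 0)"
  "\<And>v. v = dotp b' v *s a + dotp b v *s a' + (\<Sum>i<N. dotp (f i) v *s e i)"
proof -
 let ?M = "{x. dotp b x = 0 \<and> dotp b' x = 0}"
 have M: "vec.subspace ?M" by (auto simp: vec.subspace_def dotp_add dotp_scale)
 obtain B where B: "B \<subseteq> ?M" "vec.independent B" "?M \<subseteq> vec.span B" "card B = vec.dim ?M"
  by (rule vec.basis_exists[of ?M])
 have spB: "vec.span B \<subseteq> ?M" by (rule vec.span_minimal[OF B(1) M])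
 have a'B: "a' \<notin> vec.span B" using spB ab by auto
 have M': "vec.subspace {x. dotp b' x = 0}" by (auto simp: vec.subspace_def dotp_add dotp_scale)
 have "vec.span (insert a' B) \<subseteq> {x. dotp b' x = 0}" by (rule vec.span_minimal[OF _ M']) (use B ab in auto)
 then have aB: "a \<notin> vec.span (insert a' B)" using ab by auto
 let ?B = "insert a (insert a' B)"
 have ind: "vec.independent ?B" by (intro vec.independent_insertI B(2) a'B aB)
 have fin: "finite ?B" by (rule vec_finite_independent[OF ind])
 have notin: "a \<notin> insert a' B" "a' \<notin> B" using aB a'B vec.span_base by blast+
 have sp: "v \<in> vec.span ?B" for v
 proof -
  have "v - dotp b' v *s a - dotp b v *s a' \<in> ?M" using ab by (simp add: dotp_diff dotp_scale)
  then have "v - dotp b' v *s a - dotp b v *s a' \<in> vec.span ?B"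
   using B(3) vec.span_mono[of B ?B] by blast
  moreover have "dotp b' v *s a + dotp b v *s a' \<in> vec.span ?B"
   by (intro vec.span_add vec.span_scale vec.span_base) simp_all
  ultimately have "(v - dotp b' v *s a - dotp b v *s a') + (dotp b' v *s a + dotp b v *s a') \<in> vec.span ?B"
   by (rule vec.span_add)
  then show ?thesis by simp
 qed
 have "vec.dim (UNIV :: (complex^'m) set) = card ?B"
  using vec.dim_unique[of ?B UNIV, OF _ _ ind refl] sp by auto
 then have "card ?B = N + 2" using card by (simp only: vec_dim_card)
 then have cardB: "card B = N" using fin notin by simp
 obtain e where e: "bij_betw e {0..<N} B" using ex_bij_betw_nat_finite[of B] fin cardB by auto
 have eB: "e i \<in> B" if "i < N" for i using e that by (auto simp: bij_betw_def)
 define f where "f i = (\<chi> k. vec.representation ?B (axis k 1) (e i))" for i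
 have f: "dotp (f i) v = vec.representation ?B v (e i)" for i v
  unfolding f_def by (rule functional_vector) (simp_all add: vec.representation_add[OF ind sp sp] vec.representation_scale[OF ind sp])
 have rep: "vec.representation ?B u v = (if v = u then 1 else 0)" if "u \<in> ?B" for u v
  using vec.representation_basis[OF ind that] by simp
 have 1: "dotp b (e i) = 0 \<and> dotp b' (e i) = 0 \<and> dotp (f i) a = 0 \<and> dotp (f i) a' = 0" if i: "i < N" for i
  using eB[OF i] B(1) notin rep[of a] rep[of a'] unfolding f by auto
 have inj: "inj_on e {0..<N}" using e by (simp add: bij_betw_def)
 have 2: "dotp (f i) (e j) = (if i = j then 1 else 0)" if "i < N" "j < N" for i j
  unfolding f using rep[of "e j" "e i"] eB[OF that(2)] inj_on_eq_iff[OF inj, of i j] that by auto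
 have 3: "v = dotp b' v *s a + dotp b v *s a' + (\<Sum>i<N. dotp (f i) v *s e i)" for v
 proof -
  let ?r = "vec.representation ?B v"
  have "v = (\<Sum>u\<in>?B. ?r u *s u)" using vec.sum_representation_eq[OF ind sp fin subset_refl, of v] by simp
  also have "\<dots> = ?r a *s a + (?r a' *s a' + (\<Sum>u\<in>B. ?r u *s u))" using fin notin by simp
  also have "(\<Sum>u\<in>B. ?r u *s u) = (\<Sum>i\<in>{0..<N}. ?r (e i) *s e i)"
   by (rule sum.reindex_bij_betw[OF e, symmetric])
  finally have v: "v = ?r a *s a + (?r a' *s a' + (\<Sum>i<N. dotp (f i) v *s e i))" by (simp add: f atLeast0LessThan)
  have "dotp b' (\<Sum>i<N. dotp (f i) v *s e i) = 0" "dotp b (\<Sum>i<N. dotp (f i) v *s e i) = 0"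
   by (auto simp: dotp_sum dotp_scale 1 intro!: sum.neutral)
  then have "dotp b' v = ?r a" "dotp b v = ?r a'"
   using arg_cong[OF v, of "dotp b'"] arg_cong[OF v, of "dotp b"] ab by (simp_all add: dotp_add dotp_scale)
  then show ?thesis using v by (simp add: add.assoc)
 qed
 show ?thesis by (rule that[OF 1 2 3])
qed

section \<open>Root vectors of sl as matrices of rank one\<close>

locale sl_lie = levi_lie br H \<Delta> \<gamma> h G\<^sub>0 Pp
 for br :: "complex^'d \<Rightarrow> complex^'d \<Rightarrow> complex^'d" and H \<Delta> \<gamma> h G\<^sub>0 Pp +
 fixes \<phi> :: "complex^'d \<Rightarrow> complex^'m^'m" and N :: nat
 assumes iso: "lie_iso_sl br \<phi>" and card: "CARD('m) = N + 2" and N_pos: "N \<ge> 1"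
begin

lemma \<phi>_add: "\<phi> (x + y) = \<phi> x + \<phi> y" and \<phi>_scale: "\<phi> (c *s x) = mscale c (\<phi> x)"
 and \<phi>_br: "\<phi> (br x y) = \<phi> x ** \<phi> y - \<phi> y ** \<phi> x" and \<phi>_bij: "bij_betw \<phi> UNIV {A. trace A = 0}"
 using iso by (auto simp: lie_iso_sl_def)

lemma \<phi>_trace: "trace (\<phi> x) = 0" using \<phi>_bij by (auto simp: bij_betw_def)

lemma \<phi>_eqD: "\<phi> x = \<phi> y ==> x = y" using \<phi>_bij by (auto simp: bij_betw_def inj_on_def)

lemma \<phi>_0: "\<phi> 0 = 0" using \<phi>_scale[of 0 0] by (simp add: mscale_simps)

lemma \<phi>_diff: "\<phi> (x - y) = \<phi> x - \<phi> y" using \<phi>_add[of "x - y" y] by simp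

lemma \<phi>_sum: "\<phi> (sum g A) = (\<Sum>i\<in>A. \<phi> (g i))"
 by (induction A rule: infinite_finite_induct) (simp_all add: \<phi>_0 \<phi>_add)

definition m :: complex where "m = of_nat CARD('m)"

lemma m: "m = of_nat N + 2" "m \<noteq> 0"
proof -
 show "m = of_nat N + 2" by (simp add: m_def card)
 show "m \<noteq> 0" unfolding m_def by simp
qed

lemma trace_one: "trace (mat 1 :: complex^'m^'m) = m" by (simp add: m_def trace_def mat_def)

text \<open>The inverse of \<phi>, extended to all matrices by removing the scalar part. Brackets do
  not see that part, which gives \<open>\<phi>_br_\<psi>\<close> for arbitrary A.\<close>

definition \<psi> :: "complex^'m^'m \<Rightarrow> complex^'d" where
 "\<psi> A = inv_into UNIV \<phi> (A - mscale (trace A / m) (mat 1))"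

lemma \<phi>_\<psi>: "\<phi> (\<psi> A) = A - mscale (trace A / m) (mat 1)"
proof -
 have "A - mscale (trace A / m) (mat 1) \<in> \<phi> ` UNIV"
  using \<phi>_bij m(2) by (simp add: bij_betw_def trace_simps trace_one)
 then show ?thesis unfolding \<psi>_def by (rule f_inv_into_f)
qed

lemma \<phi>_\<psi>0: "trace A = 0 ==> \<phi> (\<psi> A) = A" by (simp add: \<phi>_\<psi> mscale_simps)

lemma \<psi>_linear: "\<psi> (A + B) = \<psi> A + \<psi> B" "\<psi> (mscale c A) = c *s \<psi> A"
 by (rule \<phi>_eqD; simp add: \<phi>_\<psi> \<phi>_add \<phi>_scale trace_simps mscale_simps add_divide_distrib)+

lemma one_comm: "mscale c (mat 1) ** A = mscale c A" "A ** mscale c (mat 1) = mscale c A" for A :: "complex^'m^'m"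
 by (simp_all add: mscale_mult_left mscale_mult_right)

lemma \<phi>_br_\<psi>: "\<phi> (br (\<psi> A) z) = A ** \<phi> z - \<phi> z ** A"
 by (simp add: \<phi>_br \<phi>_\<psi> matrix_mult_diff_left matrix_mult_diff_right one_comm)

lemma gr_\<phi>: "z \<in> gr i \<longleftrightarrow> \<phi> h ** \<phi> z - \<phi> z ** \<phi> h = mscale (of_int i) (\<phi> z)"
 unfolding gr_iff \<phi>_br[symmetric] \<phi>_scale[symmetric] using \<phi>_eqD by auto

lemma \<psi>_gr: "\<phi> h ** A - A ** \<phi> h = mscale (of_int i) A ==> trace A = 0 ==> \<psi> A \<in> gr i"
 by (simp add: gr_\<phi> \<phi>_\<psi>0)

text \<open>The square is an eigenvector of the coroot matrix under commutators, with eigenvalue 2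
  i. A nonzero eigenvalue makes it traceless, so it comes from an element of grade 2 i, and that
  grade is empty.\<close>

lemma square_zero: assumes x: "x \<in> gr i" and i: "2 * i < - 2 \<or> 2 * i > 2" shows "\<phi> x ** \<phi> x = 0"
proof -
 let ?X = "\<phi> x" and ?H = "\<phi> h"
 have "?H ** (?X ** ?X) - (?X ** ?X) ** ?H = (?H ** ?X - ?X ** ?H) ** ?X + ?X ** (?H ** ?X - ?X ** ?H)"
  by (simp add: matrix_mult_diff_left matrix_mult_diff_right matrix_mul_assoc)
 also have "\<dots> = mscale (of_int (2 * i)) (?X ** ?X)"
  using x by (simp add: gr_\<phi> mscale_mult_left mscale_mult_right mscale_simps(7)[symmetric])
 finally have eq: "?H ** (?X ** ?X) - (?X ** ?X) ** ?H = mscale (of_int (2 * i)) (?X ** ?X)" .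
 have "of_int (2 * i) * trace (?X ** ?X) = trace (?H ** (?X ** ?X)) - trace ((?X ** ?X) ** ?H)"
  unfolding trace_simps[symmetric] eq ..
 then have "of_int (2 * i) * trace (?X ** ?X) = 0" using trace_mul_sym[of ?H "?X ** ?X"] by simp
 moreover have "complex_of_int (2 * i) \<noteq> 0" using i unfolding of_int_eq_0_iff by auto
 ultimately have tr: "trace (?X ** ?X) = 0" by (metis mult_eq_0_iff)
 have "\<psi> (?X ** ?X) \<in> gr (2 * i)" by (rule \<psi>_gr[OF eq tr])
 then have "\<psi> (?X ** ?X) = 0" using gr_outside[OF i] by simp
 then show ?thesis using \<phi>_\<psi>0[OF tr] \<phi>_0 by simp
qed

lemma EE0: "\<phi> ee ** \<phi> ee = 0" and FF0: "\<phi> ff ** \<phi> ff = 0"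
 by (rule square_zero[OF ee_gr]; simp) (rule square_zero[OF ff_gr]; simp)

lemma double_br: "\<phi> x ** \<phi> x = 0 ==> \<phi> (br x (br x z)) = mscale (- 2) (\<phi> x ** \<phi> z ** \<phi> x)"
proof -
 assume x: "\<phi> x ** \<phi> x = 0"
 have "\<phi> (br x (br x z)) = (\<phi> x ** \<phi> x) ** \<phi> z - \<phi> x ** \<phi> z ** \<phi> x - \<phi> x ** \<phi> z ** \<phi> x + \<phi> z ** (\<phi> x ** \<phi> x)"
  by (simp add: \<phi>_br matrix_mult_diff_left matrix_mult_diff_right matrix_mul_assoc algebra_simps)
 then show ?thesis by (simp add: x mscale_def vec_eq_iff)
qed

text \<open>Bracketing twice with \<open>ee\<close> leads into grade 2, which is a line; as the
  square of its matrix E is zero, the double bracket is -2 E Z E.\<close>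

lemma sandwich: "\<exists>c. \<phi> ee ** Z ** \<phi> ee = mscale c (\<phi> ee)"
proof -
 let ?z = "\<psi> Z"
 have "br ee (br ee ?z) \<in> gr 2"
 proof (rule comp_eq_self)
  fix k :: int assume k: "k \<noteq> 2"
  have eq: "comp k (br ee (br ee ?z)) = br ee (br ee (comp (k - 4) ?z))" by (simp add: comp_br_ee')
  show "comp k (br ee (br ee ?z)) = 0"
  proof (cases "k < 2")
   case True
   then have "comp (k - 4) ?z = 0" by (intro comp_outside) simp
   then show ?thesis unfolding eq by simp
  next
   case False
   have "br ee (br ee (comp (k - 4) ?z)) \<in> gr (2 + (2 + (k - 4)))" by (intro br_gr ee_gr comp_gr)
   then show ?thesis unfolding eq using gr_outside[of k] False k by simp
  qed
 qed
 then obtain c where "br ee (br ee ?z) = c *s ee" using gr_2 by auto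
 then have "mscale (- 2) (\<phi> ee ** \<phi> ?z ** \<phi> ee) = mscale c (\<phi> ee)"
  using double_br[OF EE0, of ?z] by (simp add: \<phi>_scale)
 then have "mscale (- (1 / 2)) (mscale (- 2) (\<phi> ee ** \<phi> ?z ** \<phi> ee)) = mscale (- (1 / 2)) (mscale c (\<phi> ee))" by simp
 then have "\<phi> ee ** \<phi> ?z ** \<phi> ee = mscale (- (1 / 2) * c) (\<phi> ee)" by (simp add: mscale_simps)
 moreover have "\<phi> ee ** \<phi> ?z ** \<phi> ee = \<phi> ee ** Z ** \<phi> ee"
  by (simp add: \<phi>_\<psi> matrix_mult_diff_left matrix_mult_diff_right one_comm mscale_mult_left EE0 mscale_simps)
 ultimately have "\<phi> ee ** Z ** \<phi> ee = mscale (- (1 / 2) * c) (\<phi> ee)" by (simp only:)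
 then show ?thesis by blast
qed

text \<open>By \<open>sandwich\<close> all E Z E are multiples of E. A suitable Z sends a fixed
  nonzero vector a of the image to any given w, so E w is always a multiple of a.\<close>

lemma rank_one: "\<exists>a b. \<phi> ee = outer a b"
proof -
 let ?E = "\<phi> ee"
 have "?E \<noteq> 0" using \<phi>_eqD[of ee 0] ee(1) by (auto simp: \<phi>_0)
 then obtain v where v: "?E *v v \<noteq> 0" by (metis matrix_eq matrix_vector_mult_0)
 define a where "a = ?E *v v"
 obtain i where i: "a $ i \<noteq> 0" using v by (auto simp: a_def vec_eq_iff)
 have mult: "\<exists>c. ?E *v w = c *s a" for w
 proof -
  \<comment> \<open>This Z sends a to w, since its covector picks the i-th coordinate and divides by
    that of a.\<close>
  let ?Z = "outer w (axis i (1 / a $ i))"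
  obtain c where c: "?E ** ?Z ** ?E = mscale c ?E" using sandwich by blast
  have "dotp (axis i (1 / a $ i)) a = 1"
   using i by (simp add: dotp_def axis_def if_distrib[of "\<lambda>z. z * _"] cong: if_cong)
  then have "?Z *v a = w" by (simp add: outer_vec)
  then have "?E *v w = (?E ** ?Z ** ?E) *v v" by (simp only: matrix_vector_mul_assoc[symmetric] a_def[symmetric])
  then show ?thesis unfolding c mscale_vector a_def[symmetric] by blast
 qed
 let ?b = "\<chi> j. ?E $ i $ j / a $ i"
 have "?E *v w = outer a ?b *v w" for w
 proof -
  obtain c where c: "?E *v w = c *s a" using mult by blast
  have "dotp ?b w = (?E *v w) $ i / a $ i"
   by (simp add: dotp_def matrix_vector_mult_def sum_divide_distrib)
  then have "dotp ?b w = c" using c i by simp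
  then show ?thesis using c by (simp add: outer_vec)
 qed
 then show ?thesis using matrix_eq by blast
qed

definition "va = (SOME p. \<phi> ee = outer (fst p) (snd p))"
definition a :: "complex^'m" where "a = fst va"
definition b :: "complex^'m" where "b = snd va"
text \<open>For E and F the matrices of \<open>ee\<close> and \<open>ff\<close>, the relation F E F
  = F shows that F is \<open>outer a' b'\<close>.\<close>

definition a' :: "complex^'m" where "a' = \<phi> ff *v a"
definition b' :: "complex^'m" where "b' = b v* \<phi> ff"

lemma E_outer: "\<phi> ee = outer a b"
proof -
 have "\<exists>p. \<phi> ee = outer (fst p) (snd p)" using rank_one by auto
 then show ?thesis unfolding a_def b_def va_def by (rule someI_ex)
qed

lemma E_nz: "\<phi> ee \<noteq> 0" using \<phi>_eqD[of ee 0] ee(1) by (auto simp: \<phi>_0)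

lemma mscale_cancel: "mscale c A = mscale d A ==> A \<noteq> 0 ==> c = d" for A :: "complex^'m^'m"
 by (auto simp: mscale_def vec_eq_iff)

lemma EFE: "\<phi> ee ** \<phi> ff ** \<phi> ee = \<phi> ee" and FEF: "\<phi> ff ** \<phi> ee ** \<phi> ff = \<phi> ff"
proof -
 have rel: "br ee ff = h" "br h ee = 2 *s ee" "br h ff = (- 2) *s ff" using sl2_h by (auto simp: sl2_def)
 have eq: "br ee (br ee ff) = (- 2) *s ee" using br_skew[of ee h] by (simp add: rel)
 have "mscale (- 2) (\<phi> ee ** \<phi> ff ** \<phi> ee) = mscale (- 2) (\<phi> ee)"
  using double_br[OF EE0, of ff] unfolding eq \<phi>_scale by (rule sym)
 then show "\<phi> ee ** \<phi> ff ** \<phi> ee = \<phi> ee" by (simp add: mscale_def vec_eq_iff)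
 have eq': "br ff (br ff ee) = (- 2) *s ff" using br_skew[of ff ee] br_skew[of ff h] by (simp add: rel br_minus_right)
 have "mscale (- 2) (\<phi> ff ** \<phi> ee ** \<phi> ff) = mscale (- 2) (\<phi> ff)"
  using double_br[OF FF0, of ee] unfolding eq' \<phi>_scale by (rule sym)
 then show "\<phi> ff ** \<phi> ee ** \<phi> ff = \<phi> ff" by (simp add: mscale_def vec_eq_iff)
qed

lemma F_outer: "\<phi> ff = outer a' b'"
 using FEF by (simp add: E_outer mat_outer outer_mat a'_def b'_def)

lemma ab: "dotp b a = 0" "dotp b' a' = 0" "dotp b a' = 1" "dotp b' a = 1"
proof -
 have "mscale (dotp b a) (\<phi> ee) = mscale 0 (\<phi> ee)" using EE0 by (simp add: E_outer outer_outer mscale_simps)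
 then show "dotp b a = 0" using E_nz by (rule mscale_cancel)
 have "\<phi> ff *v a' = 0" using FF0 by (simp add: a'_def matrix_vector_mul_assoc)
 then show "dotp b' a' = 0" unfolding b'_def dotp_transpose by simp
 have "mscale (dotp b a') (\<phi> ee) = mscale 1 (\<phi> ee)"
  using EFE by (simp add: E_outer mat_outer outer_vec outer_scale mscale_simps outer_mat a'_def dotp_transpose)
 then show "dotp b a' = 1" using E_nz by (rule mscale_cancel)
 then show "dotp b' a = 1" unfolding b'_def dotp_transpose by (simp add: a'_def)
qed

lemma h_outer: "\<phi> h = outer a b' - outer a' b"
proof -
 have "\<phi> h = \<phi> ee ** \<phi> ff - \<phi> ff ** \<phi> ee" using \<phi>_br[of ee ff] by (simp add: ee_ff)
 then show ?thesis by (simp add: E_outer F_outer outer_outer ab mscale_simps)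
qed

lemma h_vec: "\<phi> h *v v = dotp b' v *s a - dotp b v *s a'"
 by (simp add: h_outer matrix_vector_mult_diff_rdistrib outer_vec)

text \<open>The blocks are found by evaluating the eigenvalue equation at a and a' and pairing it
  with b and b'. Here x lies in M, the common kernel of b and b', and \<xi> in its dual, the
  annihilator of a and a'.\<close>

lemma V_form:
 assumes z: "z \<in> gr (- 1)"
 obtains x \<xi> where "\<phi> z = outer x b' + outer a' \<xi>" "dotp b x = 0" "dotp b' x = 0" "dotp \<xi> a = 0" "dotp \<xi> a' = 0"
proof -
 let ?Z = "\<phi> z"
 have "\<phi> h ** ?Z - ?Z ** \<phi> h = mscale (- 1) ?Z" using z gr_\<phi>[of z "- 1"] by simp
 then have "(\<phi> h ** ?Z - ?Z ** \<phi> h) *v v = mscale (- 1) ?Z *v v" for v by simp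
 then have star: "dotp b' (?Z *v v) *s a - dotp b (?Z *v v) *s a' - (dotp b' v *s (?Z *v a) - dotp b v *s (?Z *v a')) = - (?Z *v v)" for v
  by (simp add: matrix_vector_mult_diff_rdistrib matrix_vector_mul_assoc[symmetric] h_vec vec.diff vec.scale mscale_vector uminus_vector)
 note d = dotp_diff dotp_scale dotp_add ab
 have 1: "dotp b (?Z *v a) = 0" "dotp b' (?Z *v a) = 0"
  using arg_cong[OF star[of a], of "\<lambda>v. dotp b v + dotp b (?Z *v a)"] arg_cong[OF star[of a], of "\<lambda>v. dotp b' v + dotp b' (?Z *v a)"]
  by (simp_all add: d flip: dotp_add(1))
 have neg: "dotp c (- v) = - dotp c v" for c v :: "complex^'m" using dotp_scale(1)[of c "- 1" v] by simp
 have 2: "dotp b (?Z *v a') = 0" "dotp b' (?Z *v a') = 0"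
  using arg_cong[OF star[of a'], of "dotp b"] arg_cong[OF star[of a'], of "dotp b'"] by (simp_all add: d neg)
 have 3: "?Z *v a' = 0" using star[of a'] 2 ab by (simp add: vec_eq_iff)
 have 4: "dotp b' (?Z *v v) = 0" for v
  using arg_cong[OF star[of v], of "dotp b'"] 1 3 by (simp add: d neg)
 let ?\<xi> = "b v* ?Z"
 have "?Z *v v = (outer (?Z *v a) b' + outer a' ?\<xi>) *v v" for v
 proof -
  have "?Z *v v = dotp b' v *s (?Z *v a) + dotp b (?Z *v v) *s a'"
   using star[of v] 3 4[of v] by (simp add: algebra_simps)
  then show ?thesis by (simp add: matrix_vector_mult_add_rdistrib outer_vec dotp_transpose)
 qed
 then have "?Z = outer (?Z *v a) b' + outer a' ?\<xi>" using matrix_eq by blast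
 then show ?thesis using that 1 2 by (simp add: dotp_transpose)
qed

end

section \<open>The Levi subgroup of type A in dual coordinates\<close>

locale sl_basis = sl_lie br H \<Delta> \<gamma> h G\<^sub>0 Pp \<phi> N
 for br :: "complex^'d \<Rightarrow> complex^'d \<Rightarrow> complex^'d" and H \<Delta> \<gamma> h G\<^sub>0 Pp and \<phi> :: "complex^'d \<Rightarrow> complex^'m^'m" and N :: nat +
 fixes e f :: "nat \<Rightarrow> complex^'m"
 assumes ef_orth: "i < N ==> dotp b (e i) = 0 \<and> dotp b' (e i) = 0 \<and> dotp (f i) a = 0 \<and> dotp (f i) a' = 0"
  and ef_dual: "i < N ==> j < N ==> dotp (f i) (e j) = (if i = j then 1 else 0)"
  and ef_expand: "v = dotp b' v *s a + dotp b v *s a' + (\<Sum>i<N. dotp (f i) v *s e i)"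
begin

definition ez :: "nat \<Rightarrow> complex^'d" where "ez i = \<psi> (outer (e i) b')"
definition fz :: "nat \<Rightarrow> complex^'d" where "fz i = \<psi> (outer a' (f i))"
definition X :: "nat \<Rightarrow> complex^'d \<Rightarrow> complex" where "X i z = dotp (f i) (\<phi> z *v a)"
definition Y :: "nat \<Rightarrow> complex^'d \<Rightarrow> complex" where "Y i z = dotp b (\<phi> z *v e i)"

lemma \<phi>_ez: "i < N ==> \<phi> (ez i) = outer (e i) b'" and \<phi>_fz: "i < N ==> \<phi> (fz i) = outer a' (f i)"
 unfolding ez_def fz_def by (rule \<phi>_\<psi>0; simp add: trace_outer ef_orth)+

lemma e_sum: "k < N ==> dotp (f k) (\<Sum>i<N. c i *s e i) = c k"
 "dotp b (\<Sum>i<N. c i *s e i) = 0" "dotp b' (\<Sum>i<N. c i *s e i) = 0"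
proof -
 have "dotp (f k) (\<Sum>i<N. c i *s e i) = (\<Sum>i<N. if k = i then c k else 0)" if "k < N"
  unfolding dotp_sum dotp_scale by (rule sum.cong) (use ef_dual that in auto)
 then show "k < N ==> dotp (f k) (\<Sum>i<N. c i *s e i) = c k" by simp
 show "dotp b (\<Sum>i<N. c i *s e i) = 0" "dotp b' (\<Sum>i<N. c i *s e i) = 0"
  unfolding dotp_sum dotp_scale by (rule sum.neutral, simp add: ef_orth)+
qed

lemma f_sum: "k < N ==> dotp (\<Sum>i<N. c i *s f i) (e k) = c k"
 "dotp (\<Sum>i<N. c i *s f i) a = 0" "dotp (\<Sum>i<N. c i *s f i) a' = 0"
proof -
 have "dotp (\<Sum>i<N. c i *s f i) (e k) = (\<Sum>i<N. if k = i then c k else 0)" if "k < N"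
  unfolding dotp_sum dotp_scale by (rule sum.cong) (use ef_dual that in auto)
 then show "k < N ==> dotp (\<Sum>i<N. c i *s f i) (e k) = c k" by simp
 show "dotp (\<Sum>i<N. c i *s f i) a = 0" "dotp (\<Sum>i<N. c i *s f i) a' = 0"
  unfolding dotp_sum dotp_scale by (rule sum.neutral, simp add: ef_orth)+
qed

lemma sum_outer: "(\<Sum>i<n::nat. outer (g i) y) = outer (\<Sum>i<n. g i) y" "(\<Sum>i<n. outer y (g i)) = outer y (\<Sum>i<n. g i)"
 by (induction n) (simp_all add: outer_0 outer_add)

lemma V_coords:
 assumes z: "z \<in> gr (- 1)"
 shows "\<phi> z = outer (\<Sum>i<N. X i z *s e i) b' + outer a' (\<Sum>i<N. Y i z *s f i)"
proof -
 obtain x \<xi> where x: "\<phi> z = outer x b' + outer a' \<xi>" "dotp b x = 0" "dotp b' x = 0" "dotp \<xi> a = 0" "dotp \<xi> a' = 0"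
  by (rule V_form[OF z])
 have X: "X i z = dotp (f i) x" if "i < N" for i
  by (simp add: X_def x(1) matrix_vector_mult_add_rdistrib outer_vec x(4) ab)
 have Y: "Y i z = dotp \<xi> (e i)" if "i < N" for i
  using ef_orth[OF that] by (simp add: Y_def x(1) matrix_vector_mult_add_rdistrib outer_vec dotp_scale ab)
 have "x = (\<Sum>i<N. dotp (f i) x *s e i)" using ef_expand[of x] by (simp add: x(2,3))
 then have x': "x = (\<Sum>i<N. X i z *s e i)" by (simp add: X)
 have "\<xi> = (\<Sum>i<N. Y i z *s f i)"
 proof (rule dotp_eqI)
  fix v
  have "dotp \<xi> v = (\<Sum>i<N. dotp (f i) v * dotp \<xi> (e i))"
   using arg_cong[OF ef_expand[of v], of "dotp \<xi>"] by (simp add: dotp_add dotp_scale dotp_sum x(4,5))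
  also have "\<dots> = dotp (\<Sum>i<N. Y i z *s f i) v"
   unfolding dotp_sum dotp_scale by (rule sum.cong) (simp_all add: Y mult.commute)
  finally show "dotp \<xi> v = dotp (\<Sum>i<N. Y i z *s f i) v" .
 qed
 then show ?thesis using x(1) x' by simp
qed

lemma V_expand: assumes z: "z \<in> gr (- 1)" shows "z = (\<Sum>i<N. X i z *s ez i + Y i z *s fz i)"
proof (rule \<phi>_eqD)
 have "\<phi> (\<Sum>i<N. X i z *s ez i + Y i z *s fz i) = (\<Sum>i<N. outer (X i z *s e i) b' + outer a' (Y i z *s f i))"
  unfolding \<phi>_sum by (rule sum.cong) (simp_all add: \<phi>_add \<phi>_scale \<phi>_ez \<phi>_fz outer_scale)
 then show "\<phi> z = \<phi> (\<Sum>i<N. X i z *s ez i + Y i z *s fz i)"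
  unfolding V_coords[OF z] by (simp add: sum.distrib sum_outer)
qed

lemma br_V:
 assumes z: "z \<in> gr (- 1)" and w: "w \<in> gr (- 1)"
 shows "br z w = (\<Sum>i<N. Y i z * X i w - X i z * Y i w) *s ff"
proof (rule \<phi>_eqD)
 let ?x = "\<Sum>i<N. X i z *s e i" and ?\<xi> = "\<Sum>i<N. Y i z *s f i" and ?y = "\<Sum>i<N. X i w *s e i" and ?\<eta> = "\<Sum>i<N. Y i w *s f i"
 have d: "dotp (\<Sum>i<N. c i *s f i) (\<Sum>i<N. d i *s e i) = (\<Sum>i<N. c i * d i)" for c d
  unfolding dotp_sum(2) dotp_scale by (rule sum.cong) (use e_sum(1) in simp_all)
 have "\<phi> (br z w) = mscale (dotp ?\<xi> ?y) (outer a' b') - mscale (dotp ?\<eta> ?x) (outer a' b')"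
  unfolding \<phi>_br V_coords[OF z] V_coords[OF w]
  by (simp add: matrix_mult_add_left matrix_mult_add_right outer_outer e_sum f_sum ab mscale_simps)
 also have "\<dots> = mscale (\<Sum>i<N. Y i z * X i w - X i z * Y i w) (outer a' b')"
  unfolding d by (simp add: sum_subtractf mscale_def vec_eq_iff algebra_simps)
 finally show "\<phi> (br z w) = \<phi> ((\<Sum>i<N. Y i z * X i w - X i z * Y i w) *s ff)" by (simp add: \<phi>_scale F_outer)
qed

definition acts :: "complex^'d^'d \<Rightarrow> complex^'m^'m \<Rightarrow> complex^'m^'m \<Rightarrow> bool" where
 "acts A P Q \<longleftrightarrow> P ** Q = mat 1 \<and> Q ** P = mat 1 \<and> (\<forall>z. \<phi> (A *v z) = P ** \<phi> z ** Q)"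

lemma acts_mult: "acts A P Q ==> acts B P' Q' ==> acts (A ** B) (P ** P') (Q' ** Q)"
proof -
 assume A: "acts A P Q" "acts B P' Q'"
 have "P ** P' ** (Q' ** Q) = P ** (P' ** Q') ** Q" "Q' ** Q ** (P ** P') = Q' ** (Q ** P) ** P'"
  by (simp_all add: matrix_mul_assoc)
 then show ?thesis using A by (simp add: acts_def matrix_vector_mul_assoc[symmetric]) (simp add: matrix_mul_assoc)
qed

lemma acts_inv: assumes A: "acts A P Q" "invertible A" shows "acts (matrix_inv A) Q P"
proof -
 have "\<phi> (matrix_inv A *v z) = Q ** \<phi> z ** P" for z
 proof -
  have "\<phi> (A *v (matrix_inv A *v z)) = P ** \<phi> (matrix_inv A *v z) ** Q" using A(1) unfolding acts_def by blast
  then have "\<phi> z = P ** \<phi> (matrix_inv A *v z) ** Q" by (simp only: matrix_inv_vector(2)[OF A(2)])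
  then have "Q ** \<phi> z ** P = (Q ** P) ** \<phi> (matrix_inv A *v z) ** (Q ** P)" by (simp add: matrix_mul_assoc)
  then show ?thesis using A by (simp add: acts_def)
 qed
 then show ?thesis using A by (simp add: acts_def)
qed

definition AdM :: "complex^'m^'m \<Rightarrow> complex^'m^'m \<Rightarrow> complex^'d^'d" where
 "AdM P Q = matrix (\<lambda>z. \<psi> (P ** \<phi> z ** Q))"

lemma AdM_vector: "AdM P Q *v z = \<psi> (P ** \<phi> z ** Q)"
 unfolding AdM_def
 by (rule matrix_works_vec)
  (simp add: Vector_Spaces.linear_iff vec.vector_space_axioms \<phi>_add \<phi>_scale matrix_mult_add_left matrix_mult_add_right
   mscale_mult_left mscale_mult_right \<psi>_linear)

lemma acts_AdM: assumes PQ: "P ** Q = mat 1" "Q ** P = mat 1" shows "acts (AdM P Q) P Q"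
proof -
 have "trace (P ** \<phi> z ** Q) = 0" for z
  using trace_mul_sym[of "P ** \<phi> z" Q] by (simp add: matrix_mul_assoc PQ \<phi>_trace)
 then show ?thesis using PQ by (simp add: acts_def AdM_vector \<phi>_\<psi>0)
qed

lemma acts_one: "acts A (mat 1) (mat 1) ==> A = mat 1"
 using \<phi>_eqD by (simp add: acts_def matrix_eq)

lemma acts_aut: assumes A: "acts A P Q" shows "A \<in> lie_aut br"
proof -
 have PQ: "P ** Q = mat 1" "Q ** P = mat 1" using A by (auto simp: acts_def)
 have B: "acts (AdM Q P) Q P" by (rule acts_AdM[OF PQ(2,1)])
 have "A ** AdM Q P = mat 1" "AdM Q P ** A = mat 1"
  using acts_mult[OF A B] acts_mult[OF B A] by (simp_all add: PQ acts_one)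
 then have "invertible A" unfolding invertible_def by blast
 moreover have "A *v br x y = br (A *v x) (A *v y)" for x y
 proof (rule \<phi>_eqD)
  have *: "P ** S ** Q ** (P ** T ** Q) = P ** (S ** T) ** Q" for S T
  proof -
   have "P ** S ** Q ** (P ** T ** Q) = P ** S ** (Q ** P) ** T ** Q" by (simp add: matrix_mul_assoc)
   then show ?thesis by (simp add: PQ matrix_mul_assoc)
  qed
  show "\<phi> (A *v br x y) = \<phi> (br (A *v x) (A *v y))"
   using A by (simp add: acts_def \<phi>_br * matrix_mult_diff_left matrix_mult_diff_right)
 qed
 ultimately show ?thesis by (simp add: lie_aut_def)
qed

text \<open>Conjugation by an elementary matrix lies in the Levi subgroup: join the matrix to \<open>1\<close> by a segment of
 elementary matrices.\<close>
lemma elem_G0: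
 assumes x: "dotp b x = 0" "dotp b' x = 0" and \<eta>: "dotp \<eta> a = 0" "dotp \<eta> a' = 0"
  and nz: "\<And>s::real. 0 \<le> s ==> s \<le> 1 ==> 1 + of_real s * t * dotp \<eta> x \<noteq> 0"
 obtains A where "A \<in> G\<^sub>0" "acts A (mat 1 + mscale t (outer x \<eta>)) (mat 1 - mscale (t / (1 + t * dotp \<eta> x)) (outer x \<eta>))"
proof -
 let ?X = "outer x \<eta>" and ?q = "dotp \<eta> x"
 let ?c = "\<lambda>s::real. of_real s * t" and ?d = "\<lambda>s::real. of_real s * t / (1 + of_real s * t * ?q)"
 let ?P = "\<lambda>s. mat 1 + mscale (?c s) ?X" and ?Q = "\<lambda>s. mat 1 - mscale (?d s) ?X"
 have PQ: "?P s ** ?Q s = mat 1" "?Q s ** ?P s = mat 1" if s: "0 \<le> s" "s \<le> 1" for s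
 proof -
  \<comment> \<open>For a rank one matrix X with X X = q X, the inverse of 1 + c X is 1 - d X
    exactly when c - d - c d q = 0; \<open>nz\<close> keeps the denominator of d away from zero
    along the segment.\<close>
  have zero: "?c s - ?d s - ?c s * ?d s * ?q = 0" using nz[OF s] by (simp add: field_simps)
  have "?P s ** ?Q s = mat 1 + mscale (?c s - ?d s - ?c s * ?d s * ?q) ?X"
   "?Q s ** ?P s = mat 1 + mscale (?c s - ?d s - ?c s * ?d s * ?q) ?X"
   by (simp_all add: matrix_mult_add_left matrix_mult_add_right matrix_mult_diff_left matrix_mult_diff_right
     mscale_mult_left mscale_mult_right outer_outer) (simp_all add: mscale_def vec_eq_iff algebra_simps)
  then show "?P s ** ?Q s = mat 1" "?Q s ** ?P s = mat 1" unfolding zero by (simp_all add: mscale_simps)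
 qed
 let ?g = "\<lambda>s. AdM (?P s) (?Q s)"
 have act: "acts (?g s) (?P s) (?Q s)" if "0 \<le> s" "s \<le> 1" for s by (rule acts_AdM[OF PQ[OF that]])
 have split: "?g s *v z = \<psi> (\<phi> z) + ?c s *s \<psi> (?X ** \<phi> z) + (- ?d s) *s \<psi> (\<phi> z ** ?X) + (- (?c s * ?d s)) *s \<psi> (?X ** \<phi> z ** ?X)" for s z
 proof -
  have "?P s ** \<phi> z ** ?Q s = \<phi> z + mscale (?c s) (?X ** \<phi> z) + mscale (- ?d s) (\<phi> z ** ?X) + mscale (- (?c s * ?d s)) (?X ** \<phi> z ** ?X)"
   by (simp add: matrix_mult_add_left matrix_mult_diff_right mscale_mult_left mscale_mult_right)
    (simp add: mscale_def vec_eq_iff algebra_simps)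
  then show ?thesis by (simp only: AdM_vector \<psi>_linear)
 qed
 have d: "continuous_on {0..1} ?d" by (intro continuous_intros) (use nz in auto)
 have "continuous_on {0..1} ?g"
  unfolding continuous_on_def
 proof (intro ballI matrix_tendsto_basis[of UNIV])
  fix s :: real and v assume s: "s \<in> {0..1}"
  have "(?d \<longlongrightarrow> ?d s) (at s within {0..1})" using d s unfolding continuous_on_def by blast
  moreover have "(?c \<longlongrightarrow> ?c s) (at s within {0..1})" by (intro tendsto_intros)
  ultimately show "((\<lambda>s. ?g s *v v) \<longlongrightarrow> ?g s *v v) (at s within {0..1})"
   unfolding split by (intro tendsto_add tendsto_vector_smult tendsto_const tendsto_minus tendsto_mult
     tendsto_of_real tendsto_ident_at)
 qed simp
 then have "connected (?g ` {0..1})" by (rule connected_continuous_image) simp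
 moreover have "mat 1 \<in> ?g ` {0..1}"
  using acts_one[of "?g 0"] act[of 0] by (intro image_eqI[of _ _ 0]) (simp_all add: mscale_simps)
 moreover have "?g 1 \<in> ?g ` {0..1}" by (rule imageI) simp
 moreover have "?g ` {0..1} \<subseteq> lie_aut br" using acts_aut[OF act] by auto
 ultimately have aut: "?g 1 \<in> lie_aut0 br" unfolding lie_aut0_def connected_component_def
  by (intro CollectI exI[of _ "?g ` {0..1}"] conjI)
 have act1: "acts (?g 1) (?P 1) (?Q 1)" by (rule act) simp_all
 \<comment> \<open>A conjugation fixing a, a', b and b' fixes the matrices of \<open>ee\<close> and
   h, which are built from them.\<close>
 have fixed: "?P 1 *v a = a" "?P 1 *v a' = a'" "b v* ?Q 1 = b" "b' v* ?Q 1 = b'"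
  by (simp_all add: matrix_vector_mult_add_rdistrib mscale_vector outer_vec \<eta>)
   (rule dotp_eqI, simp add: dotp_transpose matrix_vector_mult_diff_rdistrib mscale_vector outer_vec dotp_diff dotp_scale x)+
 have conj1: "\<phi> (?g 1 *v z) = ?P 1 ** \<phi> z ** ?Q 1" for z using act1 unfolding acts_def by blast
 have dist: "R ** (S - T) ** U = R ** S ** U - R ** T ** U" for R S T U :: "complex^'m^'m"
  by (simp add: matrix_mult_diff_left matrix_mult_diff_right)
 have "?g 1 *v ee = ee"
  by (rule \<phi>_eqD) (simp only: conj1 E_outer mat_outer outer_mat fixed)
 then have "(*v) (?g 1) ` gr 2 = gr 2" unfolding gr_2 image_image vec.scale by (simp only:)
 moreover have "?g 1 *v h = h"
  by (rule \<phi>_eqD) (simp only: conj1 h_outer dist mat_outer outer_mat fixed)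
 ultimately have "?g 1 \<in> G\<^sub>0" using aut unfolding G0_eq CC_def PP_iff by blast
 then show ?thesis using that[of "?g 1"] act1 by simp
qed

lemma elem_coords:
 assumes A: "acts A (mat 1 + mscale t (outer (\<Sum>i<N. x i *s e i) (\<Sum>i<N. \<eta> i *s f i)))
   (mat 1 - mscale c (outer (\<Sum>i<N. x i *s e i) (\<Sum>i<N. \<eta> i *s f i)))" and k: "k < N"
 shows "X k (A *v z) = X k z + t * (\<Sum>i<N. \<eta> i * X i z) * x k" "Y k (A *v z) = Y k z - c * (\<Sum>i<N. Y i z * x i) * \<eta> k"
proof -
 let ?x = "\<Sum>i<N. x i *s e i" and ?\<eta> = "\<Sum>i<N. \<eta> i *s f i"
 let ?P = "mat 1 + mscale t (outer ?x ?\<eta>)" and ?Q = "mat 1 - mscale c (outer ?x ?\<eta>)"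
 have Az: "\<phi> (A *v z) = ?P ** \<phi> z ** ?Q" using A by (simp add: acts_def)
 have Qa: "?Q *v a = a" by (simp add: matrix_vector_mult_diff_rdistrib mscale_vector outer_vec f_sum)
 have "X k (A *v z) = dotp (f k) (?P *v (\<phi> z *v a))"
  unfolding X_def Az matrix_vector_mul_assoc[symmetric] Qa ..
 also have "\<dots> = X k z + t * dotp ?\<eta> (\<phi> z *v a) * x k"
  using k e_sum(1)[OF k, of x] by (simp add: matrix_vector_mult_add_rdistrib mscale_vector outer_vec dotp_add dotp_scale X_def)
 also have "dotp ?\<eta> (\<phi> z *v a) = (\<Sum>i<N. \<eta> i * X i z)" unfolding dotp_sum dotp_scale X_def ..
 finally show "X k (A *v z) = X k z + t * (\<Sum>i<N. \<eta> i * X i z) * x k" .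
 have bP: "dotp b (?P *v v) = dotp b v" for v
  by (simp add: matrix_vector_mult_add_rdistrib mscale_vector outer_vec dotp_add dotp_scale e_sum)
 have Qe: "?Q *v e k = e k - (c * \<eta> k) *s ?x"
  using k by (simp add: matrix_vector_mult_diff_rdistrib mscale_vector outer_vec f_sum)
 have "Y k (A *v z) = dotp b (\<phi> z *v (?Q *v e k))"
  unfolding Y_def Az matrix_vector_mul_assoc[symmetric] bP ..
 also have "\<dots> = Y k z - (c * \<eta> k) * dotp b (\<phi> z *v ?x)"
  unfolding Qe by (simp add: vec.diff vec.scale dotp_diff dotp_scale Y_def)
 also have "dotp b (\<phi> z *v ?x) = (\<Sum>i<N. Y i z * x i)"
  by (simp add: vec.sum vec.scale dotp_sum dotp_scale Y_def mult.commute)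
 finally show "Y k (A *v z) = Y k z - c * (\<Sum>i<N. Y i z * x i) * \<eta> k" by (simp add: mult_ac)
qed

text \<open>A transvection \<open>1 + x \<eta>\<^sup>T\<close> is its commutator with the dilation by \<open>2\<close> in the direction \<open>x\<close>.\<close>
lemma transvection:
 assumes orth: "(\<Sum>i<N. \<eta> i * x i) = 0"
 shows "\<exists>A\<in>derived GL G\<^sub>0. \<forall>z\<in>gr (- 1). \<forall>k<N.
   X k (A *v z) = X k z + (\<Sum>i<N. \<eta> i * X i z) * x k \<and> Y k (A *v z) = Y k z - (\<Sum>i<N. Y i z * x i) * \<eta> k"
proof (cases "\<exists>j<N. x j \<noteq> 0")
 case False
 then show ?thesis by (intro bexI[of _ "mat 1"] pl.derived_one) simp
next
 case True
 then obtain j where j: "j < N" "x j \<noteq> 0" by blast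
 let ?x = "\<Sum>i<N. x i *s e i" and ?\<eta> = "\<Sum>i<N. \<eta> i *s f i"
 \<comment> \<open>A covector with value 1 on x, taken from a nonzero coordinate of x; it defines
   the dilation 1 + Z.\<close>
 define \<zeta> where "\<zeta> = (1 / x j) *s f j"
 let ?X = "outer ?x ?\<eta>" and ?Z = "outer ?x \<zeta>"
 have \<zeta>: "dotp \<zeta> a = 0" "dotp \<zeta> a' = 0" "dotp \<zeta> ?x = 1"
  using j ef_orth[OF j(1)] e_sum(1)[OF j(1), of x] by (simp_all add: \<zeta>_def dotp_scale)
 have "dotp ?\<eta> ?x = (\<Sum>i<N. \<eta> i * x i)"
  unfolding dotp_sum(2) dotp_scale by (rule sum.cong) (use e_sum(1) in simp_all)
 then have \<eta>x: "dotp ?\<eta> ?x = 0" using orth by simp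
 have "1 + complex_of_real s \<noteq> 0" if "0 \<le> s" for s
 proof -
  have "1 + complex_of_real s = complex_of_real (1 + s)" by simp
  then show ?thesis using that by (simp only: of_real_eq_0_iff)
 qed
 then obtain d where d: "d \<in> G\<^sub>0" "acts d (mat 1 + mscale 1 ?Z) (mat 1 - mscale (1 / (1 + 1 * dotp \<zeta> ?x)) ?Z)"
  using elem_G0[OF e_sum(2,3) \<zeta>(1,2), of 1 x] \<zeta>(3) by auto
 obtain \<tau> where \<tau>: "\<tau> \<in> G\<^sub>0" "acts \<tau> (mat 1 + mscale 1 ?X) (mat 1 - mscale (1 / (1 + 1 * dotp ?\<eta> ?x)) ?X)"
  by (rule elem_G0[OF e_sum(2,3) f_sum(2,3), of 1 \<eta> x]) (simp add: \<eta>x)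
 have d': "acts d (mat 1 + ?Z) (mat 1 - mscale (1 / 2) ?Z)" using d(2) by (simp add: \<zeta>(3) mscale_simps)
 have \<tau>': "acts \<tau> (mat 1 + ?X) (mat 1 - ?X)" using \<tau>(2) by (simp add: \<eta>x mscale_simps)
 let ?C = "d ** \<tau> ** matrix_inv d ** matrix_inv \<tau>"
 have C: "?C \<in> derived GL G\<^sub>0" by (rule pl.commutator_derived[OF d(1) \<tau>(1)])
 obtain R where R: "acts ?C ((mat 1 + ?Z) ** (mat 1 + ?X) ** (mat 1 - mscale (1 / 2) ?Z) ** (mat 1 - ?X)) R"
  using acts_mult[OF acts_mult[OF acts_mult[OF d' \<tau>'] acts_inv[OF d' G0_invertible[OF d(1)]]] acts_inv[OF \<tau>' G0_invertible[OF \<tau>(1)]]]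
  by blast
 \<comment> \<open>By these relations conjugation with the dilation doubles X, and multiplication by
   1 - X leaves 1 + X.\<close>
 have prods: "?Z ** ?X = ?X" "?Z ** ?Z = ?Z" "?X ** ?Z = 0" "?X ** ?X = 0"
  by (simp_all add: outer_outer \<zeta> \<eta>x mscale_simps)
 have "(mat 1 + ?Z) ** (mat 1 + ?X) = mat 1 + ?Z + mscale 2 ?X"
  by (simp add: matrix_mult_add_left matrix_mult_add_right prods) (simp add: mscale_def vec_eq_iff)
 moreover have "(mat 1 + ?Z + mscale 2 ?X) ** (mat 1 - mscale (1 / 2) ?Z) = mat 1 + mscale 2 ?X"
  by (simp add: matrix_mult_add_left matrix_mult_diff_right mscale_mult_left mscale_mult_right prods mscale_simps)
   (simp add: mscale_def vec_eq_iff)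
 moreover have "(mat 1 + mscale 2 ?X) ** (mat 1 - ?X) = mat 1 + ?X"
  by (simp add: matrix_mult_add_left matrix_mult_diff_right mscale_mult_left prods mscale_simps)
   (simp add: mscale_def vec_eq_iff)
 ultimately have R': "acts ?C (mat 1 + ?X) R" using R by simp
 have "(mat 1 - ?X) ** (mat 1 + ?X) = mat 1" using \<tau>' by (simp add: acts_def)
 then have "R = (mat 1 - ?X) ** ((mat 1 + ?X) ** R)" by (simp add: matrix_mul_assoc)
 then have "R = mat 1 - ?X" using R' by (simp add: acts_def)
 then have "acts ?C (mat 1 + mscale 1 ?X) (mat 1 - mscale 1 ?X)" using R' by (simp add: mscale_simps)
 from elem_coords[OF this] show ?thesis using C by (intro bexI[OF _ C]) simp
qed

lemma scaling: "\<exists>A\<in>G\<^sub>0. \<forall>z\<in>gr (- 1). \<forall>k<N.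
   X k (A *v z) = (if k = 0 then 2 else 1) * X k z \<and> Y k (A *v z) = (if k = 0 then 1 / 2 else 1) * Y k z"
proof -
 let ?u = "\<lambda>i. if i = 0 then 1 else (0::complex)"
 have N0: "0 < N" using N_pos by simp
 have delta: "(\<Sum>i<N. ?u i *s (g i :: complex^'m)) = g 0" "(\<Sum>i<N. ?u i * r i) = r 0" "(\<Sum>i<N. r i * ?u i) = r 0" for g r
 proof -
  have "(\<Sum>i<N. ?u i *s g i) = (\<Sum>i<N. if i = 0 then g 0 else 0)" "(\<Sum>i<N. ?u i * r i) = (\<Sum>i<N. if i = 0 then r 0 else 0)"
   "(\<Sum>i<N. r i * ?u i) = (\<Sum>i<N. if i = 0 then r 0 else 0)" by (rule sum.cong; auto)+
  then show "(\<Sum>i<N. ?u i *s g i) = g 0" "(\<Sum>i<N. ?u i * r i) = r 0" "(\<Sum>i<N. r i * ?u i) = r 0" using N0 by simp_all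
 qed
 have nz: "1 + complex_of_real s \<noteq> 0" if "0 \<le> s" for s
 proof -
  have "1 + complex_of_real s = complex_of_real (1 + s)" by simp
  then show ?thesis using that by (simp only: of_real_eq_0_iff)
 qed
 have d: "dotp (f 0) (e 0) = 1" using ef_dual[OF N0 N0] by simp
 have o: "dotp b (e 0) = 0" "dotp b' (e 0) = 0" "dotp (f 0) a = 0" "dotp (f 0) a' = 0" using ef_orth[OF N0] by auto
 obtain A where A: "A \<in> G\<^sub>0" "acts A (mat 1 + mscale 1 (outer (e 0) (f 0))) (mat 1 - mscale (1 / (1 + 1 * dotp (f 0) (e 0))) (outer (e 0) (f 0)))"
  by (rule elem_G0[OF o, of 1]) (simp add: d nz)
 have "acts A (mat 1 + mscale 1 (outer (\<Sum>i<N. ?u i *s e i) (\<Sum>i<N. ?u i *s f i)))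
   (mat 1 - mscale (1 / 2) (outer (\<Sum>i<N. ?u i *s e i) (\<Sum>i<N. ?u i *s f i)))" unfolding delta using A(2) by (simp add: d)
 note co = elem_coords[OF this, unfolded delta]
 show ?thesis by (intro bexI[OF _ A(1)] ballI allI impI conjI) (simp_all add: co)
qed

text \<open>The Levi subgroup fixes a generator of the centre of the centraliser of the \<open>sl\<^sub>2\<close>-triple of \<open>\<gamma>\<close>, whose
 eigenspaces are the two coordinate subspaces.\<close>

definition P0 :: "complex^'m^'m" where "P0 = outer a b' + outer a' b"
definition c0 :: "complex^'d" where "c0 = \<psi> P0"
text \<open>The centraliser of h and \<open>ee\<close>, that is, of the sl2-triple of the highest
  root. The Levi subgroup preserves it, because it fixes h and the line of
  \<open>ee\<close>.\<close>

definition SS :: "(complex^'d) set" where "SS = {y \<in> gr 0. br y ee = 0}"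

lemma P0_vec: "P0 *v v = dotp b' v *s a + dotp b v *s a'"
 by (simp add: P0_def matrix_vector_mult_add_rdistrib outer_vec)

lemma c0_XY: "k < N ==> X k (br c0 z) = - X k z" "k < N ==> Y k (br c0 z) = Y k z"
 using ef_orth[of k]
 by (simp_all add: X_def Y_def c0_def \<phi>_br_\<psi> matrix_vector_mult_diff_rdistrib matrix_vector_mul_assoc[symmetric] P0_vec ab
   dotp_diff dotp_add dotp_scale vec.add vec.scale)

lemma gr0I: "br y h = 0 ==> y \<in> gr 0" using br_skew[of h y] by (simp add: gr_iff)

lemma SS_I: assumes "A ** \<phi> h = \<phi> h ** A" "A ** \<phi> ee = \<phi> ee ** A" shows "\<psi> A \<in> SS"
proof -
 have "br (\<psi> A) h = 0" "br (\<psi> A) ee = 0" by (rule \<phi>_eqD; simp add: \<phi>_br_\<psi> assms \<phi>_0)+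
 then show ?thesis using gr0I by (simp add: SS_def)
qed

lemma c0_SS: "c0 \<in> SS"
 unfolding c0_def
 by (rule SS_I)
  (simp_all add: P0_def h_outer E_outer matrix_mult_add_left matrix_mult_add_right matrix_mult_diff_left matrix_mult_diff_right
   outer_outer ab mscale_simps)

text \<open>Commuting with the matrices of \<open>ee\<close> and h forces a scalar action on the
  plane of a and a', with the same scalar on the dual plane of b and b'.\<close>

lemma SS_scalar:
 assumes y: "y \<in> SS"
 obtains l where "\<phi> y *v a = l *s a" "\<phi> y *v a' = l *s a'" "\<And>v. dotp b (\<phi> y *v v) = l * dotp b v" "\<And>v. dotp b' (\<phi> y *v v) = l * dotp b' v"
proof -
 let ?Z = "\<phi> y"
 define l where "l = dotp b (\<phi> y *v a')"
 have "br y ee = 0" using y by (simp add: SS_def)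
 then have "?Z ** \<phi> ee = \<phi> ee ** ?Z" using \<phi>_br[of y ee] by (simp add: \<phi>_0)
 then have "(?Z ** \<phi> ee) *v v = (\<phi> ee ** ?Z) *v v" for v by simp
 then have E: "dotp b v *s (?Z *v a) = dotp b (?Z *v v) *s a" for v
  by (simp add: matrix_vector_mul_assoc[symmetric] E_outer outer_vec vec.scale)
 have 1: "?Z *v a = l *s a" using E[of a'] by (simp add: ab l_def)
 have 2: "dotp b (?Z *v v) = l * dotp b v" for v
  using arg_cong[OF E[of v], of "dotp b'"] unfolding 1 by (simp add: dotp_scale ab mult.commute)
 have "br h y = 0" using y by (simp add: SS_def gr_iff)
 then have "\<phi> h ** ?Z = ?Z ** \<phi> h" using \<phi>_br[of h y] by (simp add: \<phi>_0)
 then have "(\<phi> h ** ?Z) *v v = (?Z ** \<phi> h) *v v" for v by simp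
 then have Hc: "dotp b' (?Z *v v) *s a - dotp b (?Z *v v) *s a' = dotp b' v *s (?Z *v a) - dotp b v *s (?Z *v a')" for v
  by (simp add: matrix_vector_mul_assoc[symmetric] h_vec vec.diff vec.scale)
 have s: "dotp b' (?Z *v a') *s a - l *s a' = - (?Z *v a')" using Hc[of a'] by (simp add: ab l_def)
 have neg: "dotp c (- v) = - dotp c v" for c v :: "complex^'m" using dotp_scale(1)[of c "- 1" v] by simp
 have "dotp b' (?Z *v a') = - dotp b' (?Z *v a')"
  using arg_cong[OF s, of "dotp b'"] by (simp add: dotp_diff dotp_scale ab neg)
 then have "dotp b' (?Z *v a') = 0" by simp
 then have 3: "?Z *v a' = l *s a'" using Hc[of a'] by (simp add: ab l_def)
 have 4: "dotp b' (?Z *v v) = l * dotp b' v" for v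
  using arg_cong[OF Hc[of v], of "dotp b'"] unfolding 1 3 by (simp add: dotp_diff dotp_scale ab mult.commute)
 show ?thesis by (rule that[OF 1 3 2 4])
qed

lemma c0_central: assumes y: "y \<in> SS" shows "br c0 y = 0"
proof (rule \<phi>_eqD)
 obtain l where l: "\<phi> y *v a = l *s a" "\<phi> y *v a' = l *s a'" "\<And>v. dotp b (\<phi> y *v v) = l * dotp b v" "\<And>v. dotp b' (\<phi> y *v v) = l * dotp b' v"
  by (rule SS_scalar[OF y]) blast
 have "(P0 ** \<phi> y) *v v = (\<phi> y ** P0) *v v" for v
  by (simp add: matrix_vector_mul_assoc[symmetric] P0_vec vec.add vec.scale l mult.commute)
 then have "P0 ** \<phi> y = \<phi> y ** P0" using matrix_eq by blast
 then show "\<phi> (br c0 y) = \<phi> 0" by (simp add: c0_def \<phi>_br_\<psi> \<phi>_0)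
qed

text \<open>A central element is a scalar l on the plane of a, a' and a scalar \<mu> on M; vanishing
  of the trace leaves one free parameter.\<close>

lemma centre:
 assumes z: "z \<in> SS" and comm: "\<And>y. y \<in> SS ==> br z y = 0"
 shows "\<exists>\<kappa>. z = \<kappa> *s c0"
proof -
 let ?Z = "\<phi> z"
 have N0: "0 < N" using N_pos by simp
 obtain l where l: "?Z *v a = l *s a" "?Z *v a' = l *s a'" "\<And>v. dotp b (?Z *v v) = l * dotp b v" "\<And>v. dotp b' (?Z *v v) = l * dotp b' v"
  by (rule SS_scalar[OF z]) blast
 define \<mu> where "\<mu> = dotp (f 0) (?Z *v e 0)"
 have e: "?Z *v e i = \<mu> *s e i" if i: "i < N" for i
 proof -
  \<comment> \<open>This matrix unit of M belongs to \<open>SS\<close>; commuting with it transfers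
    the eigenvalue at \<open>e 0\<close> to \<open>e i\<close>.\<close>
  let ?X = "outer (e i) (f 0)"
  have "\<psi> ?X \<in> SS"
   by (rule SS_I) (simp_all add: h_outer E_outer matrix_mult_diff_left matrix_mult_diff_right outer_outer ef_orth[OF i] ef_orth[OF N0] mscale_simps)
  then have "br (\<psi> ?X) z = 0" using comm[of "\<psi> ?X"] br_skew[of "\<psi> ?X" z] by simp
  then have "?X ** ?Z = ?Z ** ?X" using \<phi>_br_\<psi>[of ?X z] by (simp add: \<phi>_0)
  then have "(?X ** ?Z) *v e 0 = (?Z ** ?X) *v e 0" by simp
  then show ?thesis using ef_dual[OF N0 N0] by (simp add: matrix_vector_mul_assoc[symmetric] outer_vec \<mu>_def)
 qed
 have "?Z *v v = (mscale (l - \<mu>) P0 + mscale \<mu> (mat 1)) *v v" for v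
 proof -
  let ?s = "\<Sum>i<N. dotp (f i) v *s e i"
  have s: "?s = v - P0 *v v" using ef_expand[of v] by (simp add: P0_vec algebra_simps)
  have "?Z *v v = ?Z *v (dotp b' v *s a + dotp b v *s a' + ?s)" using ef_expand[of v] by simp
  also have "\<dots> = l *s (P0 *v v) + (\<Sum>i<N. dotp (f i) v *s (?Z *v e i))"
   by (simp add: vec.add vec.scale vec.sum l P0_vec vec.scale_right_distrib mult.commute)
  also have "(\<Sum>i<N. dotp (f i) v *s (?Z *v e i)) = \<mu> *s ?s"
   unfolding vec.scale_sum_right by (rule sum.cong) (simp_all add: e mult.commute)
  finally show ?thesis unfolding s
   by (simp add: matrix_vector_mult_add_rdistrib mscale_vector vec.scale_left_diff_distrib vec.scale_right_diff_distrib algebra_simps)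
 qed
 then have Z: "?Z = mscale (l - \<mu>) P0 + mscale \<mu> (mat 1)" using matrix_eq by blast
 have tP: "trace P0 = 2" by (simp add: P0_def trace_simps trace_outer ab)
 \<comment> \<open>The trace gives 2 (l - \<mu>) + m \<mu> = 0, so \<mu> is the scalar needed to
   make (l - \<mu>) \<open>P0\<close> traceless.\<close>
 have "trace ?Z = 0" by (rule \<phi>_trace)
 then have "(l - \<mu>) * 2 + \<mu> * m = 0" unfolding Z by (simp add: trace_simps tP trace_one)
 then have "\<mu> = (l - \<mu>) * (- (2 / m))" using m(2) by (simp add: field_simps)
 then have "mscale \<mu> (mat 1) = mscale (l - \<mu>) (mscale (- (2 / m)) (mat 1 :: complex^'m^'m))" by (simp only: mscale_simps)
 then have "\<phi> z = \<phi> ((l - \<mu>) *s c0)"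
  unfolding Z \<phi>_scale c0_def \<phi>_\<psi> tP by (simp add: mscale_def vec_eq_iff algebra_simps)
 then show ?thesis using \<phi>_eqD by blast
qed

lemma br_c0_ez: "i < N ==> br c0 (ez i) = - ez i" and br_c0_fz: "i < N ==> br c0 (fz i) = fz i"
proof -
 assume i: "i < N"
 have "\<phi> (br c0 (ez i)) = \<phi> ((- 1) *s ez i)"
  unfolding c0_def \<phi>_br_\<psi> \<phi>_scale \<phi>_ez[OF i] P0_def
  by (simp add: matrix_mult_add_left matrix_mult_add_right outer_outer ab ef_orth[OF i] mscale_simps)
 from \<phi>_eqD[OF this] show "br c0 (ez i) = - ez i" by simp
 have "\<phi> (br c0 (fz i)) = \<phi> (fz i)"
  unfolding c0_def \<phi>_br_\<psi> \<phi>_fz[OF i] P0_def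
  by (simp add: matrix_mult_add_left matrix_mult_add_right outer_outer ab ef_orth[OF i] mscale_simps)
 then show "br c0 (fz i) = fz i" by (rule \<phi>_eqD)
qed

lemma ez_V: "i < N ==> ez i \<in> gr (- 1)" and fz_V: "i < N ==> fz i \<in> gr (- 1)"
proof -
 assume i: "i < N"
 show "ez i \<in> gr (- 1)" "fz i \<in> gr (- 1)"
  unfolding gr_\<phi> \<phi>_ez[OF i] \<phi>_fz[OF i] h_outer
  by (simp_all add: matrix_mult_diff_left matrix_mult_diff_right outer_outer ab ef_orth[OF i] mscale_simps)
qed

lemma XY_ef: assumes "i < N" "j < N"
 shows "X i (ez j) = (if i = j then 1 else 0)" "X i (fz j) = 0" "Y i (fz j) = (if i = j then 1 else 0)" "Y i (ez j) = 0"
 using assms ef_orth[OF assms(1)] ef_orth[OF assms(2)] ef_dual[OF assms] ef_dual[OF assms(2,1)]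
 by (simp_all add: X_def Y_def \<phi>_ez \<phi>_fz outer_vec dotp_scale ab)

lemma G0_SS: assumes A: "A \<in> G\<^sub>0" and y: "y \<in> SS" shows "A *v y \<in> SS"
proof -
 have A': "matrix_inv A \<in> G\<^sub>0" by (rule G0_inv[OF A])
 have "matrix_inv A *v ee \<in> gr 2" by (rule G0_gr[OF A' ee_gr])
 then obtain c where c: "matrix_inv A *v ee = c *s ee" using gr_2 by auto
 have "br (A *v y) ee = br (A *v y) (A *v (matrix_inv A *v ee))" using G0_invertible[OF A] by (simp add: matrix_inv_vector)
 also have "\<dots> = A *v br y (c *s ee)" using lie_autD(1)[OF PP_aut[OF G0_PP[OF A]]] c by simp
 also have "\<dots> = 0" using y by (simp add: SS_def br_scale_right)
 finally show ?thesis using G0_gr[OF A] y by (simp add: SS_def)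
qed

lemma XY_linear: "X i (u + v) = X i u + X i v" "X i (c *s u) = c * X i u" "Y i (u + v) = Y i u + Y i v" "Y i (c *s u) = c * Y i u"
 by (simp_all add: X_def Y_def \<phi>_add \<phi>_scale matrix_vector_mult_add_rdistrib mscale_vector dotp_add dotp_scale)

lemma XY_minus: "X i (- u) = - X i u" "Y i (- u) = - Y i u"
 using XY_linear(2)[of i "- 1" u] XY_linear(4)[of i "- 1" u] by simp_all

text \<open>The image of \<open>c0\<close> is again central in \<open>SS\<close>, so it is a
  multiple \<kappa> of \<open>c0\<close>. The eigenvalues of \<open>c0\<close> on V are 1 and -1,
  hence \<kappa> is a sign; the sign -1 would mean that M and M* are exchanged.\<close>

lemma G0_c0_sign: assumes A: "A \<in> G\<^sub>0" shows "A *v c0 = c0 \<or> A *v c0 = - c0"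
proof -
 have A': "matrix_inv A \<in> G\<^sub>0" by (rule G0_inv[OF A])
 note aut = lie_autD(1)[OF PP_aut[OF G0_PP[OF A]]]
 have "br (A *v c0) y = 0" if "y \<in> SS" for y
 proof -
  have "br (A *v c0) y = A *v br c0 (matrix_inv A *v y)" using G0_invertible[OF A] by (simp add: aut matrix_inv_vector)
  then show ?thesis using c0_central[OF G0_SS[OF A' that]] by simp
 qed
 from centre[OF G0_SS[OF A c0_SS] this] obtain \<kappa> where \<kappa>: "A *v c0 = \<kappa> *s c0" by blast
 have N0: "0 < N" using N_pos by simp
 let ?w = "A *v ez 0"
 have "br (A *v c0) ?w = - ?w" using aut[of c0 "ez 0"] br_c0_ez[OF N0] by (simp add: vec.neg)
 then have w: "\<kappa> *s br c0 ?w = - ?w" by (simp add: \<kappa> br_scale_left)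
 have XY: "\<kappa> * X k ?w = X k ?w \<and> \<kappa> * Y k ?w = - Y k ?w" if k: "k < N" for k
  using arg_cong[OF w, of "X k"] arg_cong[OF w, of "Y k"] by (simp add: XY_linear XY_minus c0_XY[OF k])
 have "\<exists>k<N. X k ?w \<noteq> 0 \<or> Y k ?w \<noteq> 0"
 proof (rule ccontr)
  assume "\<not> ?thesis"
  then have "?w = 0" using V_expand[OF G0_gr[OF A ez_V[OF N0]]] by simp
  then have "ez 0 = 0" using invertible_eq_0[OF G0_invertible[OF A]] by blast
  then have "X 0 (ez 0) = 0" by (simp add: X_def \<phi>_0)
  then show False using XY_ef(1)[OF N0 N0] by simp
 qed
 then obtain k where k: "k < N" "X k ?w \<noteq> 0 \<or> Y k ?w \<noteq> 0" by blast
 have "(\<kappa> - 1) * X k ?w = 0" "(\<kappa> + 1) * Y k ?w = 0" using XY[OF k(1)] by (simp_all add: algebra_simps)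
 then have "\<kappa> - 1 = 0 \<or> \<kappa> + 1 = 0" using k(2) unfolding mult_eq_0_iff by blast
 then have "\<kappa> = 1 \<or> \<kappa> = - 1" by (simp add: eq_neg_iff_add_eq_0)
 then show ?thesis using \<kappa> by auto
qed

text \<open>The sign is a continuous function on the connected Levi subgroup with values in a finite
  set, so it is constant, and it is 1 at the identity.\<close>

lemma G0_c0: assumes A: "A \<in> G\<^sub>0" shows "A *v c0 = c0"
proof -
 have N0: "0 < N" using N_pos by simp
 have "c0 \<noteq> 0"
 proof
  assume "c0 = 0"
  then have "ez 0 = 0" using br_c0_ez[OF N0] by simp
  then have "X 0 (ez 0) = 0" by (simp add: X_def \<phi>_0)
  then show False using XY_ef(1)[OF N0 N0] by simp
 qed
 then have "\<exists>i. c0 $ i \<noteq> 0" by (simp add: vec_eq_iff)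
 then obtain i where i: "c0 $ i \<noteq> 0" by blast
 let ?f = "\<lambda>A. (A *v c0) $ i / c0 $ i"
 have vals: "?f A \<in> {1, - 1}" if "A \<in> G\<^sub>0" for A using G0_c0_sign[OF that] by (rule disjE) (simp_all add: i)
 have "continuous_on G\<^sub>0 ?f"
  unfolding divide_inverse
  by (intro continuous_on_mult continuous_on_const continuous_on_component continuous_on_matrix_vector_mult continuous_on_id)
 then have "connected (?f ` G\<^sub>0)" using levi_facts(3) by (rule connected_continuous_image)
 moreover have "finite (?f ` G\<^sub>0)"
 proof (rule finite_subset)
  show "?f ` G\<^sub>0 \<subseteq> {1, - 1}" by (rule image_subsetI) (rule vals)
 qed simp
 ultimately have "?f ` G\<^sub>0 = {} \<or> (\<exists>r. ?f ` G\<^sub>0 = {r})" by (simp only: connected_finite_iff_sing)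
 moreover have "?f ` G\<^sub>0 \<noteq> {}" using imageI[OF A, of ?f] by (metis empty_iff)
 ultimately obtain r where r: "?f ` G\<^sub>0 = {r}" by meson
 have "?f A = ?f (mat 1)" using imageI[OF A, of ?f] imageI[OF G0_one, of ?f] unfolding r by simp
 then have eq: "(A *v c0) $ i = c0 $ i" using i by simp
 show ?thesis
 proof (rule ccontr)
  assume "A *v c0 \<noteq> c0"
  then have "A *v c0 = - c0" using G0_c0_sign[OF A] by blast
  then show False using eq i by simp
 qed
qed

lemma G0_mixed: assumes A: "A \<in> G\<^sub>0" and i: "i < N" "k < N" shows "Y k (A *v ez i) = 0" "X k (A *v fz i) = 0"
proof -
 have "br c0 (A *v z) = A *v br c0 z" for z using lie_autD(1)[OF PP_aut[OF G0_PP[OF A]], of c0 z] by (simp add: G0_c0[OF A])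
 then have "br c0 (A *v ez i) = - (A *v ez i)" "br c0 (A *v fz i) = A *v fz i"
  by (simp_all add: br_c0_ez[OF i(1)] br_c0_fz[OF i(1)] vec.neg)
 then have "Y k (A *v ez i) = - Y k (A *v ez i)" "- X k (A *v fz i) = X k (A *v fz i)"
  using c0_XY[OF i(2), of "A *v ez i"] c0_XY[OF i(2), of "A *v fz i"] by (simp_all add: XY_minus)
 then show "Y k (A *v ez i) = 0" "X k (A *v fz i) = 0" by simp_all
qed

lemma XY_sum: "X i (sum g K) = (\<Sum>k\<in>K. X i (g k))" "Y i (sum g K) = (\<Sum>k\<in>K. Y i (g k))"
 using XY_linear(2,4)[of i 0 0] by (induction K rule: infinite_finite_induct) (simp_all add: XY_linear)

lemma G0_blocks: assumes A: "A \<in> G\<^sub>0" and z: "z \<in> gr (- 1)" and k: "k < N"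
 shows "X k (A *v z) = (\<Sum>l<N. X l z * X k (A *v ez l))" "Y k (A *v z) = (\<Sum>l<N. Y l z * Y k (A *v fz l))"
proof -
 have "A *v z = (\<Sum>l<N. X l z *s (A *v ez l) + Y l z *s (A *v fz l))"
  using arg_cong[OF V_expand[OF z], of "(*v) A"] by (simp add: vec.sum vec.add vec.scale)
 then show "X k (A *v z) = (\<Sum>l<N. X l z * X k (A *v ez l))" "Y k (A *v z) = (\<Sum>l<N. Y l z * Y k (A *v fz l))"
  by (simp_all add: XY_sum XY_linear G0_mixed[OF A _ k])
qed

lemma sl_model: "sl_model br H \<Delta> \<gamma> h G\<^sub>0 Pp N ez fz X Y"
proof (unfold_locales)
 fix A assume A: "A \<in> G\<^sub>0"
 show "\<exists>t. \<forall>z\<in>gr (- 1). \<forall>k<N. X k (A *v z) = (\<Sum>l<N. X l z * t l k)"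
  using G0_blocks(1)[OF A] by (intro exI[of _ "\<lambda>l k. X k (A *v ez l)"]) blast
 show "\<exists>t. \<forall>z\<in>gr (- 1). \<forall>k<N. Y k (A *v z) = (\<Sum>l<N. Y l z * t l k)"
  using G0_blocks(2)[OF A] by (intro exI[of _ "\<lambda>l k. Y k (A *v fz l)"]) blast
qed (rule N_pos XY_linear XY_ef ez_V fz_V V_expand br_V transvection scaling; assumption)+

end

section \<open>The invariants of the Lagrangian Grassmannian\<close>

theorem proposition2:
  fixes br :: "complex^'d \<Rightarrow> complex^'d \<Rightarrow> complex^'d"
    and X :: "(complex^'d) set set" and l H :: "(complex^'d) set"
    and G\<^sub>0 Pp :: "(complex^'d^'d) set"
    and \<Delta> :: "(complex^'d \<Rightarrow> complex) set" and \<gamma> :: "complex^'d \<Rightarrow> complex"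
    and \<gamma>v :: "complex^'d"
  assumes "simple_lie_algebra br"
    and "closed_orbit (lie_aut0 br) X" and "l \<in> X"
    and "levi_decomposition (line_stabilizer (lie_aut0 br) l) G\<^sub>0 Pp"
    and "cartan_subalgebra br H"
    and "(\<lambda>h. matrix (br h)) ` H \<subseteq> lie_algebra_of G\<^sub>0"
    and "root_base br H \<Delta>"
    and "highest_root br H \<Delta> \<gamma>"
    and "l = root_space br H \<gamma>"
    and "is_coroot br H \<gamma> \<gamma>v"
  shows
    "(\<forall>n (\<phi> :: complex^'d \<Rightarrow> complex^'m^'m).
        n \<ge> 1 \<and> CARD('m) = n + 2 \<and> lie_iso_sl br \<phi> \<longrightarrow>
        (\<exists>f\<^sub>1 f\<^sub>2 \<theta>\<^sub>1 \<theta>\<^sub>2.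
           invariant_of_degree br (grade br \<gamma>v (-1)) G\<^sub>0 1 f\<^sub>1 \<and>
           invariant_of_degree br (grade br \<gamma>v (-1)) G\<^sub>0 1 f\<^sub>2 \<and>
           has_weight br (grade br \<gamma>v (-1)) G\<^sub>0 f\<^sub>1 \<theta>\<^sub>1 \<and>
           has_weight br (grade br \<gamma>v (-1)) G\<^sub>0 f\<^sub>2 \<theta>\<^sub>2 \<and>
           (\<exists>t\<in>carrier (torus_quotient G\<^sub>0). \<theta>\<^sub>1 t \<noteq> \<theta>\<^sub>2 t) \<and>
           generates_invariants br (grade br \<gamma>v (-1)) G\<^sub>0 {f\<^sub>1, f\<^sub>2})) \<and>
     (type_G2 br H \<Delta> \<longrightarrow>
        (\<exists>f. invariant_of_degree br (grade br \<gamma>v (-1)) G\<^sub>0 3 f \<and>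
             generates_invariants br (grade br \<gamma>v (-1)) G\<^sub>0 {f}))"
proof -
 \<comment> \<open>The orbit consists of images of a line under invertible maps, so the highest root
   space has dimension 1.\<close>
 obtain l0 where l0: "vec.dim l0 = 1" "X = (\<lambda>A. (*v) A ` l0) ` lie_aut0 br" using assms(2) unfolding closed_orbit_def by blast
 then obtain A where A: "A \<in> lie_aut0 br" "l = (*v) A ` l0" using assms(3) by blast
 have "invertible A"
  using A(1) connected_component_subset[of "lie_aut br" "mat 1"] by (auto simp: lie_aut0_def lie_aut_def)
 then have inj: "inj ((*v) A)" by (intro inj_on_inverseI[of _ "(*v) (matrix_inv A)"]) (simp add: matrix_inv_vector)
 have "vec.dim ((*v) A ` l0) = vec.dim l0" by (rule vec.dim_image_eq) (use inj in \<open>auto intro: inj_on_subset\<close>)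
 then have dim: "vec.dim (root_space br H \<gamma>) = 1" using l0(1) A(2) assms(9) by simp
 have levi: "levi_decomposition (line_stabilizer (lie_aut0 br) (root_space br H \<gamma>)) G\<^sub>0 Pp" using assms(4) unfolding assms(9) .
 interpret levi_lie br H \<Delta> \<gamma> \<gamma>v G\<^sub>0 Pp
  by unfold_locales (fact assms dim levi)+
 show ?thesis
 proof (intro conjI allI impI)
  fix n and \<phi> :: "complex^'d \<Rightarrow> complex^'m^'m"
  assume n: "n \<ge> 1 \<and> CARD('m) = n + 2 \<and> lie_iso_sl br \<phi>"
  interpret sl_lie br H \<Delta> \<gamma> \<gamma>v G\<^sub>0 Pp \<phi> n by unfold_locales (use n in blast)+
  obtain e f :: "nat \<Rightarrow> complex^'m" where
   ef: "\<And>i. i < n ==> dotp b (e i) = 0 \<and> dotp b' (e i) = 0 \<and> dotp (f i) a = 0 \<and> dotp (f i) a' = 0"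
   "\<And>i j. i < n ==> j < n ==> dotp (f i) (e j) = (if i = j then 1 else 0)"
   "\<And>v. v = dotp b' v *s a + dotp b v *s a' + (\<Sum>i<n. dotp (f i) v *s e i)"
   by (rule dual_basis[OF ab card]) blast
  interpret sl_basis br H \<Delta> \<gamma> \<gamma>v G\<^sub>0 Pp \<phi> n e f by unfold_locales (fact ef)+
  show "\<exists>f\<^sub>1 f\<^sub>2 \<theta>\<^sub>1 \<theta>\<^sub>2.
      invariant_of_degree br (grade br \<gamma>v (-1)) G\<^sub>0 1 f\<^sub>1 \<and>
      invariant_of_degree br (grade br \<gamma>v (-1)) G\<^sub>0 1 f\<^sub>2 \<and>
      has_weight br (grade br \<gamma>v (-1)) G\<^sub>0 f\<^sub>1 \<theta>\<^sub>1 \<and>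
      has_weight br (grade br \<gamma>v (-1)) G\<^sub>0 f\<^sub>2 \<theta>\<^sub>2 \<and>
      (\<exists>t\<in>carrier (torus_quotient G\<^sub>0). \<theta>\<^sub>1 t \<noteq> \<theta>\<^sub>2 t) \<and>
      generates_invariants br (grade br \<gamma>v (-1)) G\<^sub>0 {f\<^sub>1, f\<^sub>2}"
   by (rule sl_model.sl_invariants[OF sl_model])
 next
  assume "type_G2 br H \<Delta>"
  then obtain al be ha hb where g2: "\<Delta> = {al, be}" "al \<noteq> be" "is_coroot br H al ha" "is_coroot br H be hb"
   "al hb = - 1" "be ha = - 3" unfolding type_G2_def by blast
  interpret g2_lie br H \<Delta> \<gamma> \<gamma>v G\<^sub>0 Pp al be ha hb by unfold_locales (fact g2)+
  show "\<exists>f. invariant_of_degree br (grade br \<gamma>v (-1)) G\<^sub>0 3 f \<and>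
       generates_invariants br (grade br \<gamma>v (-1)) G\<^sub>0 {f}" by (rule g2_invariants)
 qed
qed

end
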